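(* Let $\mathscr{C}$ be a bicategory and $\mathbf{W}$ a class of morphisms of $\mathscr{C}$ such that $(\mathscr{C},\mathbf{W})$ satisfies axioms (BF1)--(BF5), and choose any bicategory of fractions $\mathscr{C}[\mathbf{W}^{-1}]$ associated to $(\mathscr{C},\mathbf{W})$. Let $f^1:B^1\rightarrow A$ and $f^2:B^2\rightarrow A$ be morphisms of $\mathscr{C}$, and suppose that there are an object $C$, morphisms $p^m:C\rightarrow B^m$ ($m=1,2$) and an invertible $2$-morphism $\omega:f^1\circ p^1\Rightarrow f^2\circ p^2$ such that the square $(C,p^1,p^2,\omega)$ is a weak fiber product of $(f^1,f^2)$ in $\mathscr{C}$. Then for each object $D$ of $\mathscr{C}$ the following conditions are satisfied: (a) given any pair of morphisms $q^m:D\rightarrow B^m$ for $m=1,2$ and any invertible $2$-morphism $\lambda:f^1\circ q^1\Rightarrow f^2\circ q^2$ in $\mathscr{C}$, there are an object $E$, a morphism $\mathrm{v}:E\rightarrow D$ in $\mathbf{W}$, a morphism $q:E\rightarrow C$ and a pair of invertible $2$-morphisms $\lambda^m:q^m\circ\mathrm{v}\Rightarrow p^m\circ q$ for $m=1,2$, such that $$\theta^{-1}_{f^2,p^2,q}\odot(\omega\ast i_q)\odot\theta_{f^1,p^1,q}\odot(i_{f^1}\ast\lambda^1)=(i_{f^2}\ast\lambda^2)\odot\theta^{-1}_{f^2,q^2,\mathrm{v}}\odot(\lambda\ast i_{\mathrm{v}})\odot\theta_{f^1,q^1,\mathrm{v}};$$ (b) given any pair of morphisms $t,t':D\rightarrow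 C$ and any pair of invertible $2$-morphisms $\gamma^m:p^m\circ t\Rightarrow p^m\circ t'$ for $m=1,2$ such that $$\theta^{-1}_{f^2,p^2,t'}\odot(\omega\ast i_{t'})\odot\theta_{f^1,p^1,t'}\odot(i_{f^1}\ast\gamma^1)=(i_{f^2}\ast\gamma^2)\odot\theta^{-1}_{f^2,p^2,t}\odot(\omega\ast i_t)\odot\theta_{f^1,p^1,t},$$ there are an object $F$, a morphism $\mathrm{u}:F\rightarrow D$ in $\mathbf{W}$ and an invertible $2$-morphism $\gamma:t\circ\mathrm{u}\Rightarrow t'\circ\mathrm{u}$, such that $\theta_{p^m,t',\mathrm{u}}\odot(i_{p^m}\ast\gamma)=(\gamma^m\ast i_{\mathrm{u}})\odot\theta_{p^m,t,\mathrm{u}}$ for $m=1,2$; (c) given any set of data $(t,t',\gamma^1,\gamma^2,F,\mathrm{u},\gamma)$ as in (b), if there is another choice of data $\widetilde{F}$, $\widetilde{\mathrm{u}}:\widetilde{F}\rightarrow D$ in $\mathbf{W}$ and $\widetilde{\gamma}:t\circ\widetilde{\mathrm{u}}\Rightarrow t'\circ\widetilde{\mathrm{u}}$ invertible, such that $\theta_{p^m,t',\widetilde{\mathrm{u}}}\odot(i_{p^m}\ast\widetilde{\gamma})=(\gamma^m\ast i_{\widetilde{\mathrm{u}}})\odot\theta_{p^m,t,\widetilde{\mathrm{u}}}$ for $m=1,2$, then there are an object $G$, a morphism $\mathrm{z}:G\rightarrow F$ in $\mathbf{W}$, a morphism $\widetilde{\mathrm{z}}:G\rightarrow\widetilde{F}$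 and an invertible $2$-morphism $\mu:\mathrm{u}\circ\mathrm{z}\Rightarrow\widetilde{\mathrm{u}}\circ\widetilde{\mathrm{z}}$, such that $$\theta_{t',\widetilde{\mathrm{u}},\widetilde{\mathrm{z}}}\odot(i_{t'}\ast\mu)\odot\theta^{-1}_{t',\mathrm{u},\mathrm{z}}\odot(\gamma\ast i_{\mathrm{z}})=(\widetilde{\gamma}\ast i_{\widetilde{\mathrm{z}}})\odot\theta_{t,\widetilde{\mathrm{u}},\widetilde{\mathrm{z}}}\odot(i_t\ast\mu)\odot\theta^{-1}_{t,\mathrm{u},\mathrm{z}}.$$ Therefore, for each pair of morphisms $\mathrm{w}^1:B^1\rightarrow\overline{B}^1$ and $\mathrm{w}^2:B^2\rightarrow\overline{B}^2$ in $\mathbf{W}$, there is a weak fiber product in $\mathscr{C}[\mathbf{W}^{-1}]$ for the pair of morphisms $(B^1,\mathrm{w}^1,f^1):\overline{B}^1\to A$ and $(B^2,\mathrm{w}^2,f^2):\overline{B}^2\to A$. In particular, if $\mathscr{C}$ is closed under weak fiber products (i.e. every pair of morphisms of $\mathscr{C}$ with common target has a weak fiber product in $\mathscr{C}$), then $\mathscr{C}[\mathbf{W}^{-1}]$ is also closed under weak fiber products.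
   Context: The axiom of choice is assumed. Bicategory notation. $\odot$ is vertical and $\ast$ horizontal composition of $2$-morphisms; $i_f$ is the identity $2$-morphism of $f$. In a bicategory $\mathscr{C}$ the associators are $\theta_{h,g,f}:h\circ(g\circ f)\Rightarrow(h\circ g)\circ f$, the right and left unitors of $f:A\to B$ are $\pi_f:f\circ\mathrm{id}_A\Rightarrow f$ and $\upsilon_f:\mathrm{id}_B\circ f\Rightarrow f$. In another bicategory $\mathscr{D}$ (in particular in $\mathscr{C}[\mathbf{W}^{-1}]$) associators are denoted by $\Theta$. Weak fiber products. In a bicategory $\mathscr{D}$ let $g^m:B^m\to A$ ($m=1,2$) be morphisms, $r^m:C\to B^m$ ($m=1,2$) morphisms and $\Omega:g^1\circ r^1\Rightarrow g^2\circ r^2$ an invertible $2$-morphism. The square $(C,r^1,r^2,\Omega)$ is a weak fiber product of $(g^1,g^2)$ if for every object $D$ the following hold. A1$(D)$: for all $s^m:D\to B^m$ ($m=1,2$) and every invertible $\Lambda:g^1\circ s^1\Rightarrow g^2\circ s^2$ there are $s:D\to C$ and invertible $\Lambda^m:s^m\Rightarrow r^m\circ s$ ($m=1,2$) with $(\Omega\ast i_s)\odot\Theta_{g^1,r^1,s}\odot(i_{g^1}\ast\Lambda^1)=\Theta_{g^2,r^2,s}\odot(i_{g^2}\ast\Lambda^2)\odot\Lambda$. A2$(D)$: for all $t,t':D\to C$ and all invertible $\Gamma^m:r^m\circ t\Rightarrow r^m\circ t'$ ($m=1,2$) with $\Theta^{-1}_{g^2,r^2,t'}\odot(\Omega\ast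 i_{t'})\odot\Theta_{g^1,r^1,t'}\odot(i_{g^1}\ast\Gamma^1)=(i_{g^2}\ast\Gamma^2)\odot\Theta^{-1}_{g^2,r^2,t}\odot(\Omega\ast i_t)\odot\Theta_{g^1,r^1,t}$ there is a unique invertible $\Gamma:t\Rightarrow t'$ with $i_{r^m}\ast\Gamma=\Gamma^m$ for $m=1,2$. Axioms (BF) for $(\mathscr{C},\mathbf{W})$. (BF1) all identities $\mathrm{id}_A$ are in $\mathbf{W}$. (BF2) $\mathbf{W}$ is closed under composition. (BF3) for every $\mathrm{w}:A\to B$ in $\mathbf{W}$ and every $f:C\to B$ there are an object $D$, $\mathrm{w}':D\to C$ in $\mathbf{W}$, $f':D\to A$ and an invertible $\alpha:f\circ\mathrm{w}'\Rightarrow\mathrm{w}\circ f'$. (BF4a) for every $\mathrm{w}:B\to A$ in $\mathbf{W}$, all $f^1,f^2:C\to B$ and every $\alpha:\mathrm{w}\circ f^1\Rightarrow\mathrm{w}\circ f^2$ there are an object $D$, $\mathrm{v}:D\to C$ in $\mathbf{W}$ and $\beta:f^1\circ\mathrm{v}\Rightarrow f^2\circ\mathrm{v}$ with $\alpha\ast i_{\mathrm{v}}=\theta_{\mathrm{w},f^2,\mathrm{v}}\odot(i_{\mathrm{w}}\ast\beta)\odot\theta^{-1}_{\mathrm{w},f^1,\mathrm{v}}$. (BF4b) if $\alpha$ in (BF4a) is invertible, so is $\beta$. (BF4c) if $(D',\mathrm{v}',\beta')$ is another triple with the properties of $(D,\mathrm{v},\beta)$ in (BF4a), there are an object $E$,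 $\mathrm{u}:E\to D$, $\mathrm{u}':E\to D'$ and an invertible $\zeta:\mathrm{v}\circ\mathrm{u}\Rightarrow\mathrm{v}'\circ\mathrm{u}'$ such that $\mathrm{v}\circ\mathrm{u}\in\mathbf{W}$ and $\theta^{-1}_{f^2,\mathrm{v}',\mathrm{u}'}\odot(\beta'\ast i_{\mathrm{u}'})\odot\theta_{f^1,\mathrm{v}',\mathrm{u}'}\odot(i_{f^1}\ast\zeta)=(i_{f^2}\ast\zeta)\odot\theta^{-1}_{f^2,\mathrm{v},\mathrm{u}}\odot(\beta\ast i_{\mathrm{u}})\odot\theta_{f^1,\mathrm{v},\mathrm{u}}$. (BF5) if $\mathrm{w}:A\to B$ is in $\mathbf{W}$ and there is an invertible $2$-morphism $\mathrm{v}\Rightarrow\mathrm{w}$, then $\mathrm{v}\in\mathbf{W}$. Bicategory of fractions (Pronk). Fix a set of choices $C(\mathbf{W})$: for every $f:A'\to B$ and every $\mathrm{v}:B'\to B$ in $\mathbf{W}$, an object $A''$, $\mathrm{v}':A''\to A'$ in $\mathbf{W}$, $f':A''\to B'$ and an invertible $\rho:f\circ\mathrm{v}'\Rightarrow\mathrm{v}\circ f'$, such that: (C1) if $A'=B$ and $f=\mathrm{id}_B$, the choice is $A''=B'$, $f'=\mathrm{id}_{B'}$, $\mathrm{v}'=\mathrm{v}$, $\rho=\pi_{\mathrm{v}}^{-1}\odot\upsilon_{\mathrm{v}}$; (C2) if $B'=B$ and $\mathrm{v}=\mathrm{id}_B$, the choice is $A''=A'$, $f'=f$, $\mathrm{v}'=\mathrm{id}_{A'}$,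 $\rho=\upsilon_f^{-1}\odot\pi_f$. Each set of choices gives a bicategory $\mathscr{C}[\mathbf{W}^{-1}]$ ("a bicategory of fractions for $(\mathscr{C},\mathbf{W})$"): - objects are those of $\mathscr{C}$; a morphism $A\to B$ is a triple $(A',\mathrm{w},f)$ with $\mathrm{w}:A'\to A$ in $\mathbf{W}$ and $f:A'\to B$; the identity of $A$ is $(A,\mathrm{id}_A,\mathrm{id}_A)$; $(B',\mathrm{v},g)\circ(A',\mathrm{w},f):=(A'',\mathrm{w}\circ\mathrm{v}',g\circ f')$, with $(A'',\mathrm{v}',f')$ the choice for $(f,\mathrm{v})$; - a $2$-morphism $(A^1,\mathrm{w}^1,f^1)\Rightarrow(A^2,\mathrm{w}^2,f^2)$ is a class $[A^3,\mathrm{v}^1,\mathrm{v}^2,\alpha,\beta]$ of data with $\mathrm{v}^m:A^3\to A^m$, $\mathrm{w}^1\circ\mathrm{v}^1\in\mathbf{W}$, $\alpha:\mathrm{w}^1\circ\mathrm{v}^1\Rightarrow\mathrm{w}^2\circ\mathrm{v}^2$ invertible, $\beta:f^1\circ\mathrm{v}^1\Rightarrow f^2\circ\mathrm{v}^2$; data $(A'^3,\mathrm{v}'^1,\mathrm{v}'^2,\alpha',\beta')$ are equivalent to it iff there are an object $A^4$, $\mathrm{z}:A^4\to A^3$, $\mathrm{z}':A^4\to A'^3$ and invertible $\sigma^1:\mathrm{v}'^1\circ\mathrm{z}'\Rightarrow\mathrm{v}^1\circ\mathrm{z}$, $\sigma^2:\mathrm{v}^2\circ\mathrm{z}\Rightarrow\mathrm{v}'^2\circ\mathrm{z}'$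 with $(\mathrm{w}^1\circ\mathrm{v}^1)\circ\mathrm{z}\in\mathbf{W}$ and, up to associators, $(i_{\mathrm{w}^2}\ast\sigma^2)\odot(\alpha\ast i_{\mathrm{z}})\odot(i_{\mathrm{w}^1}\ast\sigma^1)=\alpha'\ast i_{\mathrm{z}'}$ and $(i_{f^2}\ast\sigma^2)\odot(\beta\ast i_{\mathrm{z}})\odot(i_{f^1}\ast\sigma^1)=\beta'\ast i_{\mathrm{z}'}$. The remaining structure is as follows (associators of $\mathscr{C}$ are inserted where needed; the auxiliary data always exist and the resulting classes do not depend on them). The identity of $(A',\mathrm{w},f)$ is $[A',\mathrm{id}_{A'},\mathrm{id}_{A'},i,i]$. - Vertical composition: for $[E^1,\mathrm{v}^1,\mathrm{v}^2,\alpha,\beta]:(A^1,\mathrm{w}^1,f^1)\Rightarrow(A^2,\mathrm{w}^2,f^2)$ and $[E^2,\mathrm{u}^1,\mathrm{u}^2,\gamma,\delta]:(A^2,\mathrm{w}^2,f^2)\Rightarrow(A^3,\mathrm{w}^3,f^3)$ take $\mathrm{t}^m:E\to E^m$ and an invertible $\rho:\mathrm{v}^2\circ\mathrm{t}^1\Rightarrow\mathrm{u}^1\circ\mathrm{t}^2$ with $(\mathrm{w}^1\circ\mathrm{v}^1)\circ\mathrm{t}^1\in\mathbf{W}$; the composite is $[E,\mathrm{v}^1\circ\mathrm{t}^1,\mathrm{u}^2\circ\mathrm{t}^2,(\gamma\ast i_{\mathrm{t}^2})\odot(i_{\mathrm{w}^2}\ast\rho)\odot(\alpha\ast i_{\mathrm{t}^1}),(\delta\ast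 i_{\mathrm{t}^2})\odot(i_{f^2}\ast\rho)\odot(\beta\ast i_{\mathrm{t}^1})]$. - $[B^3,\mathrm{u}^1,\mathrm{u}^2,\alpha,\beta]\ast i_{(A',\mathrm{w},f)}$, for a $2$-morphism $(B^1,\mathrm{v}^1,g^1)\Rightarrow(B^2,\mathrm{v}^2,g^2)$ and $(A',\mathrm{w},f):A\to B$: let $(A^m,\mathrm{v}'^m,f^m,\rho^m)$ be the choice for $(f,\mathrm{v}^m)$; take $a^m:E\to A^m$, $h:E\to B^3$, invertible $\varepsilon:\mathrm{v}'^1\circ a^1\Rightarrow\mathrm{v}'^2\circ a^2$ and $\sigma^m:f^m\circ a^m\Rightarrow\mathrm{u}^m\circ h$ with $(\mathrm{w}\circ\mathrm{v}'^1)\circ a^1\in\mathbf{W}$ and $(\alpha\ast i_h)\odot(i_{\mathrm{v}^1}\ast\sigma^1)\odot(\rho^1\ast i_{a^1})=(i_{\mathrm{v}^2}\ast\sigma^2)\odot(\rho^2\ast i_{a^2})\odot(i_f\ast\varepsilon)$; the result is $[E,a^1,a^2,i_{\mathrm{w}}\ast\varepsilon,(i_{g^2}\ast(\sigma^2)^{-1})\odot(\beta\ast i_h)\odot(i_{g^1}\ast\sigma^1)]$. - $i_{(B',\mathrm{v},g)}\ast[A^3,\mathrm{u}^1,\mathrm{u}^2,\alpha,\beta]$, for a $2$-morphism $(A^1,\mathrm{w}^1,f^1)\Rightarrow(A^2,\mathrm{w}^2,f^2)$ and $(B',\mathrm{v},g):B\to C$: let $(A''^m,\mathrm{v}'^m,f'^m,\rho^m)$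 be the choice for $(f^m,\mathrm{v})$; take $a^m:E\to A''^m$, $a:E\to A^3$, invertible $\tau^m:\mathrm{v}'^m\circ a^m\Rightarrow\mathrm{u}^m\circ a$ with $(\mathrm{w}^1\circ\mathrm{v}'^1)\circ a^1\in\mathbf{W}$ and $\varphi:f'^1\circ a^1\Rightarrow f'^2\circ a^2$ with $i_{\mathrm{v}}\ast\varphi=(\rho^2\ast i_{a^2})\odot(i_{f^2}\ast(\tau^2)^{-1})\odot(\beta\ast i_a)\odot(i_{f^1}\ast\tau^1)\odot((\rho^1)^{-1}\ast i_{a^1})$; the result is $[E,a^1,a^2,(i_{\mathrm{w}^2}\ast(\tau^2)^{-1})\odot(\alpha\ast i_a)\odot(i_{\mathrm{w}^1}\ast\tau^1),i_g\ast\varphi]$. - Associator for $\underline f=(A',\mathrm{u},f)$, $\underline g=(B',\mathrm{v},g)$, $\underline h=(C',\mathrm{w},h)$: let $(A^1,\mathrm{v}^1,f^1,\delta)$, $(A^2,\mathrm{w}^1,g^1,\sigma)$, $(B^2,\mathrm{w}^2,g^2,\xi)$, $(A^3,\mathrm{y},f^3,\eta)$ be the choices for $(f,\mathrm{v})$, $(g\circ f^1,\mathrm{w})$, $(g,\mathrm{w})$, $(f,\mathrm{v}\circ\mathrm{w}^2)$; take $a:E\to A^2$, $b:E\to A^3$ and invertible $\gamma:(\mathrm{v}^1\circ\mathrm{w}^1)\circ a\Rightarrow\mathrm{y}\circ b$, $\omega:f^1\circ(\mathrm{w}^1\circ a)\Rightarrow\mathrm{w}^2\circ(f^3\circ b)$,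 $\rho:g^1\circ a\Rightarrow g^2\circ(f^3\circ b)$ with $((\mathrm{u}\circ\mathrm{v}^1)\circ\mathrm{w}^1)\circ a\in\mathbf{W}$, $i_{\mathrm{v}}\ast\omega=(\eta\ast i_b)\odot(i_f\ast\gamma)\odot(\delta^{-1}\ast i_{\mathrm{w}^1\circ a})$, $i_{\mathrm{w}}\ast\rho=(\xi\ast i_{f^3\circ b})\odot(i_g\ast\omega)\odot(\sigma^{-1}\ast i_a)$; then $\Theta_{\underline h,\underline g,\underline f}=[E,a,b,i_{\mathrm{u}}\ast\gamma,i_h\ast\rho]:\underline h\circ(\underline g\circ\underline f)\Rightarrow(\underline h\circ\underline g)\circ\underline f$. - Unitors of $(A',\mathrm{w},f)$: right $[A',\mathrm{id}_{A'},\mathrm{id}_{A'},\upsilon_{\mathrm{w}}\ast i,\pi_f\ast i]$, left $[A',\mathrm{id}_{A'},\mathrm{id}_{A'},\pi_{\mathrm{w}}\ast i,\upsilon_f\ast i]$. *)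

theory Defs
  imports Main
begin

section \<open>Bicategories\<close>

text \<open>
  Sources and targets of morphisms and of 2-morphisms are given by functions, so that a morphism
  determines its source and target object.  As for the structures of the algebra library,
  operations are meaningful on the carriers only.
  Both compositions are written in the usual (applicative) order: \<open>g \<cdot> f\<close> is
  ``\<open>g\<close> after \<open>f\<close>'' and \<open>\<beta> \<odot> \<alpha>\<close> is ``\<open>\<beta>\<close> after \<open>\<alpha>\<close>''.
\<close>

record ('o, 'm, 'c) bicat =
  Ob :: "'o set"
  Mor :: "'m set"
  Cell :: "'c set"
  src :: "'m \<Rightarrow> 'o"
  tgt :: "'m \<Rightarrow> 'o"
  dm :: "'c \<Rightarrow> 'm"
  cd :: "'c \<Rightarrow> 'm"
  idm :: "'o \<Rightarrow> 'm" ("\<one>\<index>")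
  cmp :: "'m \<Rightarrow> 'm \<Rightarrow> 'm" (infixr "\<cdot>\<index>" 75)
  idc :: "'m \<Rightarrow> 'c" ("\<iota>\<index>")
  vcomp :: "'c \<Rightarrow> 'c \<Rightarrow> 'c" (infixr "\<odot>\<index>" 65)
  hcomp :: "'c \<Rightarrow> 'c \<Rightarrow> 'c" (infixr "\<star>\<index>" 70)
  associator :: "'m \<Rightarrow> 'm \<Rightarrow> 'm \<Rightarrow> 'c" ("\<theta>\<index>")
  right_unitor :: "'m \<Rightarrow> 'c" ("\<pi>\<index>")
  left_unitor :: "'m \<Rightarrow> 'c" ("\<upsilon>\<index>")

definition hom :: "('o, 'm, 'c) bicat \<Rightarrow> 'o \<Rightarrow> 'o \<Rightarrow> 'm set" where
  "hom D A B = {f \<in> Mor D. src D f = A \<and> tgt D f = B}"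

definition cells :: "('o, 'm, 'c) bicat \<Rightarrow> 'm \<Rightarrow> 'm \<Rightarrow> 'c set" where
  "cells D f g = {\<alpha> \<in> Cell D. dm D \<alpha> = f \<and> cd D \<alpha> = g}"

context
  fixes D :: "('o, 'm, 'c) bicat" (structure)
begin

definition inverse_cells :: "'c \<Rightarrow> 'c \<Rightarrow> bool" where
  "inverse_cells \<alpha> \<beta> \<longleftrightarrow> \<beta> \<in> cells D (cd D \<alpha>) (dm D \<alpha>)
     \<and> \<beta> \<odot> \<alpha> = \<iota> (dm D \<alpha>) \<and> \<alpha> \<odot> \<beta> = \<iota> (cd D \<alpha>)"

definition inv_cells :: "'m \<Rightarrow> 'm \<Rightarrow> 'c set" where
  "inv_cells f g = {\<alpha> \<in> cells D f g. \<exists>\<beta>. inverse_cells \<alpha> \<beta>}"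

definition vinv :: "'c \<Rightarrow> 'c" where
  "vinv \<alpha> = (THE \<beta>. inverse_cells \<alpha> \<beta>)"

end

locale bicategory =
  fixes C :: "('o, 'm, 'c) bicat" (structure)
  assumes src_Ob: "f \<in> Mor C \<Longrightarrow> src C f \<in> Ob C"
    and tgt_Ob: "f \<in> Mor C \<Longrightarrow> tgt C f \<in> Ob C"
    and dm_Mor: "\<alpha> \<in> Cell C \<Longrightarrow> dm C \<alpha> \<in> Mor C"
    and cd_Mor: "\<alpha> \<in> Cell C \<Longrightarrow> cd C \<alpha> \<in> Mor C"
    and cell_src: "\<alpha> \<in> Cell C \<Longrightarrow> src C (dm C \<alpha>) = src C (cd C \<alpha>)"
    and cell_tgt: "\<alpha> \<in> Cell C \<Longrightarrow> tgt C (dm C \<alpha>) = tgt C (cd C \<alpha>)"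
    and idm_hom: "X \<in> Ob C \<Longrightarrow> \<one> X \<in> hom C X X"
    and cmp_hom: "f \<in> hom C X Y \<Longrightarrow> g \<in> hom C Y Z \<Longrightarrow> g \<cdot> f \<in> hom C X Z"
    \<comment> \<open>the hom-categories\<close>
    and idc_cells: "f \<in> Mor C \<Longrightarrow> \<iota> f \<in> cells C f f"
    and vcomp_cells: "\<alpha> \<in> cells C f g \<Longrightarrow> \<beta> \<in> cells C g h \<Longrightarrow> \<beta> \<odot> \<alpha> \<in> cells C f h"
    and vcomp_assoc: "\<alpha> \<in> cells C f g \<Longrightarrow> \<beta> \<in> cells C g h \<Longrightarrow> \<gamma> \<in> cells C h k
      \<Longrightarrow> (\<gamma> \<odot> \<beta>) \<odot> \<alpha> = \<gamma> \<odot> (\<beta> \<odot> \<alpha>)"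
    and vcomp_idc_left: "\<alpha> \<in> cells C f g \<Longrightarrow> \<iota> g \<odot> \<alpha> = \<alpha>"
    and vcomp_idc_right: "\<alpha> \<in> cells C f g \<Longrightarrow> \<alpha> \<odot> \<iota> f = \<alpha>"
    \<comment> \<open>functoriality of horizontal composition\<close>
    and hcomp_cells: "f \<in> hom C X Y \<Longrightarrow> g \<in> hom C Y Z \<Longrightarrow> \<alpha> \<in> cells C f f' \<Longrightarrow> \<beta> \<in> cells C g g'
      \<Longrightarrow> \<beta> \<star> \<alpha> \<in> cells C (g \<cdot> f) (g' \<cdot> f')"
    and hcomp_idc: "f \<in> hom C X Y \<Longrightarrow> g \<in> hom C Y Z \<Longrightarrow> \<iota> g \<star> \<iota> f = \<iota> (g \<cdot> f)"
    and interchange: "f \<in> hom C X Y \<Longrightarrow> g \<in> hom C Y Z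
      \<Longrightarrow> \<alpha> \<in> cells C f f' \<Longrightarrow> \<alpha>' \<in> cells C f' f'' \<Longrightarrow> \<beta> \<in> cells C g g' \<Longrightarrow> \<beta>' \<in> cells C g' g''
      \<Longrightarrow> (\<beta>' \<odot> \<beta>) \<star> (\<alpha>' \<odot> \<alpha>) = (\<beta>' \<star> \<alpha>') \<odot> (\<beta> \<star> \<alpha>)"
    \<comment> \<open>associators and unitors: invertible, natural and coherent\<close>
    and associator_cells: "f \<in> hom C X Y \<Longrightarrow> g \<in> hom C Y Z \<Longrightarrow> h \<in> hom C Z T
      \<Longrightarrow> \<theta> h g f \<in> inv_cells C (h \<cdot> (g \<cdot> f)) ((h \<cdot> g) \<cdot> f)"
    and right_unitor_cells: "f \<in> hom C X Y \<Longrightarrow> \<pi> f \<in> inv_cells C (f \<cdot> \<one> X) f"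
    and left_unitor_cells: "f \<in> hom C X Y \<Longrightarrow> \<upsilon> f \<in> inv_cells C (\<one> Y \<cdot> f) f"
    and associator_natural: "f \<in> hom C X Y \<Longrightarrow> g \<in> hom C Y Z \<Longrightarrow> h \<in> hom C Z T
      \<Longrightarrow> \<alpha> \<in> cells C f f' \<Longrightarrow> \<beta> \<in> cells C g g' \<Longrightarrow> \<gamma> \<in> cells C h h'
      \<Longrightarrow> \<theta> h' g' f' \<odot> (\<gamma> \<star> (\<beta> \<star> \<alpha>)) = ((\<gamma> \<star> \<beta>) \<star> \<alpha>) \<odot> \<theta> h g f"
    and right_unitor_natural: "f \<in> hom C X Y \<Longrightarrow> \<alpha> \<in> cells C f f'
      \<Longrightarrow> \<pi> f' \<odot> (\<alpha> \<star> \<iota> (\<one> X)) = \<alpha> \<odot> \<pi> f"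
    and left_unitor_natural: "f \<in> hom C X Y \<Longrightarrow> \<alpha> \<in> cells C f f'
      \<Longrightarrow> \<upsilon> f' \<odot> (\<iota> (\<one> Y) \<star> \<alpha>) = \<alpha> \<odot> \<upsilon> f"
    and pentagon: "f \<in> hom C X Y \<Longrightarrow> g \<in> hom C Y Z \<Longrightarrow> h \<in> hom C Z T \<Longrightarrow> k \<in> hom C T U
      \<Longrightarrow> \<theta> (k \<cdot> h) g f \<odot> \<theta> k h (g \<cdot> f)
        = (\<theta> k h g \<star> \<iota> f) \<odot> \<theta> k (h \<cdot> g) f \<odot> (\<iota> k \<star> \<theta> h g f)"
    and triangle: "f \<in> hom C X Y \<Longrightarrow> g \<in> hom C Y Z
      \<Longrightarrow> (\<pi> g \<star> \<iota> f) \<odot> \<theta> g (\<one> Y) f = \<iota> g \<star> \<upsilon> f"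

section \<open>Weak fiber products\<close>

context
  fixes D :: "('o, 'm, 'c) bicat" (structure)
begin

definition weak_fiber_product :: "'m \<Rightarrow> 'm \<Rightarrow> 'o \<Rightarrow> 'm \<Rightarrow> 'm \<Rightarrow> 'c \<Rightarrow> bool" where
  "weak_fiber_product g1 g2 C r1 r2 \<Omega> \<longleftrightarrow>
     g1 \<in> Mor D \<and> g2 \<in> Mor D \<and> tgt D g1 = tgt D g2 \<and> C \<in> Ob D
     \<and> r1 \<in> hom D C (src D g1) \<and> r2 \<in> hom D C (src D g2) \<and> \<Omega> \<in> inv_cells D (g1 \<cdot> r1) (g2 \<cdot> r2)
     \<and> (\<forall>X \<in> Ob D.
          (\<forall>s1 \<in> hom D X (src D g1). \<forall>s2 \<in> hom D X (src D g2).
             \<forall>\<Lambda> \<in> inv_cells D (g1 \<cdot> s1) (g2 \<cdot> s2).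
             \<exists>s \<in> hom D X C. \<exists>\<Lambda>1 \<in> inv_cells D s1 (r1 \<cdot> s). \<exists>\<Lambda>2 \<in> inv_cells D s2 (r2 \<cdot> s).
               (\<Omega> \<star> \<iota> s) \<odot> \<theta> g1 r1 s \<odot> (\<iota> g1 \<star> \<Lambda>1) = \<theta> g2 r2 s \<odot> (\<iota> g2 \<star> \<Lambda>2) \<odot> \<Lambda>)
        \<and> (\<forall>t \<in> hom D X C. \<forall>t' \<in> hom D X C.
             \<forall>\<Gamma>1 \<in> inv_cells D (r1 \<cdot> t) (r1 \<cdot> t'). \<forall>\<Gamma>2 \<in> inv_cells D (r2 \<cdot> t) (r2 \<cdot> t').
               vinv D (\<theta> g2 r2 t') \<odot> (\<Omega> \<star> \<iota> t') \<odot> \<theta> g1 r1 t' \<odot> (\<iota> g1 \<star> \<Gamma>1)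
                 = (\<iota> g2 \<star> \<Gamma>2) \<odot> vinv D (\<theta> g2 r2 t) \<odot> (\<Omega> \<star> \<iota> t) \<odot> \<theta> g1 r1 t
               \<longrightarrow> (\<exists>!\<Gamma>. \<Gamma> \<in> inv_cells D t t' \<and> \<iota> r1 \<star> \<Gamma> = \<Gamma>1 \<and> \<iota> r2 \<star> \<Gamma> = \<Gamma>2)))"

definition closed_under_weak_fiber_products :: bool where
  "closed_under_weak_fiber_products \<longleftrightarrow>
     (\<forall>g1 \<in> Mor D. \<forall>g2 \<in> Mor D. tgt D g1 = tgt D g2 \<longrightarrow>
        (\<exists>C r1 r2 \<Omega>. weak_fiber_product g1 g2 C r1 r2 \<Omega>))"

end

section \<open>The axioms (BF)\<close>

text \<open>The triples \<open>(D, v, \<beta>)\<close> whose existence is required by (BF4a).\<close>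

definition lifts :: "('o, 'm, 'c) bicat \<Rightarrow> 'm set \<Rightarrow> 'm \<Rightarrow> 'm \<Rightarrow> 'm \<Rightarrow> 'c \<Rightarrow> 'o \<Rightarrow> 'm \<Rightarrow> 'c \<Rightarrow> bool" where
  "lifts C W w f1 f2 \<alpha> D v \<beta> \<longleftrightarrow>
     v \<in> W \<and> v \<in> hom C D (src C f1) \<and> \<beta> \<in> cells C (f1 \<cdot>\<^bsub>C\<^esub> v) (f2 \<cdot>\<^bsub>C\<^esub> v)
     \<and> \<alpha> \<star>\<^bsub>C\<^esub> \<iota>\<^bsub>C\<^esub> v = \<theta>\<^bsub>C\<^esub> w f2 v \<odot>\<^bsub>C\<^esub> (\<iota>\<^bsub>C\<^esub> w \<star>\<^bsub>C\<^esub> \<beta>) \<odot>\<^bsub>C\<^esub> vinv C (\<theta>\<^bsub>C\<^esub> w f1 v)"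

text \<open>
  (BF4b) is read as in Pronk's formulation: for invertible \<open>\<alpha>\<close> the \<open>\<beta>\<close> of (BF4a) can be found
  invertible.  Requiring every \<open>\<beta>\<close> solving (BF4a) to be invertible would be a
  stronger hypothesis.
\<close>

locale BF = bicategory C for C :: "('o, 'm, 'c) bicat" (structure) +
  fixes W :: "'m set"
  assumes W_Mor: "W \<subseteq> Mor C"
    and BF1: "A \<in> Ob C \<Longrightarrow> \<one> A \<in> W"
    and BF2: "v \<in> W \<Longrightarrow> w \<in> W \<Longrightarrow> tgt C v = src C w \<Longrightarrow> w \<cdot> v \<in> W"
    and BF3: "w \<in> W \<Longrightarrow> w \<in> hom C A B \<Longrightarrow> f \<in> hom C X B \<Longrightarrow>
      \<exists>D \<in> Ob C. \<exists>w' \<in> hom C D X. \<exists>f' \<in> hom C D A. w' \<in> W \<and> inv_cells C (f \<cdot> w') (w \<cdot> f') \<noteq> {}"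
    and BF4a: "w \<in> W \<Longrightarrow> w \<in> hom C B A \<Longrightarrow> f1 \<in> hom C X B \<Longrightarrow> f2 \<in> hom C X B \<Longrightarrow>
      \<alpha> \<in> cells C (w \<cdot> f1) (w \<cdot> f2) \<Longrightarrow> \<exists>D v \<beta>. lifts C W w f1 f2 \<alpha> D v \<beta>"
    and BF4b: "w \<in> W \<Longrightarrow> w \<in> hom C B A \<Longrightarrow> f1 \<in> hom C X B \<Longrightarrow> f2 \<in> hom C X B \<Longrightarrow>
      \<alpha> \<in> inv_cells C (w \<cdot> f1) (w \<cdot> f2) \<Longrightarrow>
      \<exists>D v \<beta>. lifts C W w f1 f2 \<alpha> D v \<beta> \<and> \<beta> \<in> inv_cells C (f1 \<cdot> v) (f2 \<cdot> v)"
    and BF4c: "w \<in> W \<Longrightarrow> w \<in> hom C B A \<Longrightarrow> f1 \<in> hom C X B \<Longrightarrow> f2 \<in> hom C X B \<Longrightarrow>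
      \<alpha> \<in> cells C (w \<cdot> f1) (w \<cdot> f2) \<Longrightarrow>
      lifts C W w f1 f2 \<alpha> D v \<beta> \<Longrightarrow> lifts C W w f1 f2 \<alpha> D' v' \<beta>' \<Longrightarrow>
      \<exists>E \<in> Ob C. \<exists>u \<in> hom C E D. \<exists>u' \<in> hom C E D'. \<exists>\<zeta> \<in> inv_cells C (v \<cdot> u) (v' \<cdot> u').
        v \<cdot> u \<in> W
        \<and> vinv C (\<theta> f2 v' u') \<odot> (\<beta>' \<star> \<iota> u') \<odot> \<theta> f1 v' u' \<odot> (\<iota> f1 \<star> \<zeta>)
          = (\<iota> f2 \<star> \<zeta>) \<odot> vinv C (\<theta> f2 v u) \<odot> (\<beta> \<star> \<iota> u) \<odot> \<theta> f1 v u"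
    and BF5: "w \<in> W \<Longrightarrow> \<alpha> \<in> inv_cells C v w \<Longrightarrow> v \<in> W"

section \<open>The bicategory of fractions\<close>

type_synonym ('o, 'm, 'c) choices = "'m \<Rightarrow> 'm \<Rightarrow> 'o \<times> 'm \<times> 'm \<times> 'c"

type_synonym ('o, 'm) fmor = "'o \<times> 'm \<times> 'm"

type_synonym ('o, 'm, 'c) fdatum = "'o \<times> 'm \<times> 'm \<times> 'c \<times> 'c"

text \<open>
  A 2-morphism of the bicategory of fractions is an equivalence class of data, tagged with its
  source and target, which the data alone do not determine.
\<close>

type_synonym ('o, 'm, 'c) fcell =
  "('o, 'm) fmor \<times> ('o, 'm) fmor \<times> ('o, 'm, 'c) fdatum set"

context
  fixes C :: "('o, 'm, 'c) bicat" (structure) and W :: "'m set"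
begin

definition set_of_choices :: "('o, 'm, 'c) choices \<Rightarrow> bool" where
  "set_of_choices ch \<longleftrightarrow>
     (\<forall>f \<in> Mor C. \<forall>v \<in> W. tgt C f = tgt C v \<longrightarrow>
        (case ch f v of (A'', v', f', \<rho>) \<Rightarrow>
           A'' \<in> Ob C \<and> v' \<in> W \<and> v' \<in> hom C A'' (src C f) \<and> f' \<in> hom C A'' (src C v)
           \<and> \<rho> \<in> inv_cells C (f \<cdot> v') (v \<cdot> f')))
     \<and> (\<forall>v \<in> W. ch (\<one> (tgt C v)) v = (src C v, v, \<one> (src C v), vinv C (\<pi> v) \<odot> \<upsilon> v))
     \<and> (\<forall>f \<in> Mor C. ch f (\<one> (tgt C f)) = (src C f, \<one> (src C f), f, vinv C (\<upsilon> f) \<odot> \<pi> f))"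

text \<open>
  The two recurring ways of inserting associators: \<open>pull g x g' x' \<alpha> z\<close> is
  \<open>\<alpha> \<star> \<iota> z\<close>, for \<open>\<alpha> : g x \<Rightarrow> g' x'\<close>, regarded as a 2-morphism \<open>g (x z) \<Rightarrow> g' (x' z)\<close>, and
  \<open>push g x z g' x' z' \<alpha>\<close> is \<open>\<alpha> : g (x z) \<Rightarrow> g' (x' z')\<close> regarded as a 2-morphism
  \<open>(g x) z \<Rightarrow> (g' x') z'\<close>.
\<close>

definition pull :: "'m \<Rightarrow> 'm \<Rightarrow> 'm \<Rightarrow> 'm \<Rightarrow> 'c \<Rightarrow> 'm \<Rightarrow> 'c" where
  "pull g x g' x' \<alpha> z = vinv C (\<theta> g' x' z) \<odot> (\<alpha> \<star> \<iota> z) \<odot> \<theta> g x z"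

definition push :: "'m \<Rightarrow> 'm \<Rightarrow> 'm \<Rightarrow> 'm \<Rightarrow> 'm \<Rightarrow> 'm \<Rightarrow> 'c \<Rightarrow> 'c" where
  "push g x z g' x' z' \<alpha> = \<theta> g' x' z' \<odot> \<alpha> \<odot> vinv C (\<theta> g x z)"

definition frac_Mor :: "('o, 'm) fmor set" where
  "frac_Mor = {(A', w, f). w \<in> W \<and> f \<in> Mor C \<and> src C w = A' \<and> src C f = A'}"

definition frac_data :: "('o, 'm) fmor \<Rightarrow> ('o, 'm) fmor \<Rightarrow> ('o, 'm, 'c) fdatum set" where
  "frac_data = (\<lambda>(A1, w1, f1) (A2, w2, f2). {(A3, v1, v2, \<alpha>, \<beta>).
     A3 \<in> Ob C \<and> v1 \<in> hom C A3 A1 \<and> v2 \<in> hom C A3 A2 \<and> w1 \<cdot> v1 \<in> W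
     \<and> \<alpha> \<in> inv_cells C (w1 \<cdot> v1) (w2 \<cdot> v2) \<and> \<beta> \<in> cells C (f1 \<cdot> v1) (f2 \<cdot> v2)})"

definition frac_rel ::
    "('o, 'm) fmor \<Rightarrow> ('o, 'm) fmor \<Rightarrow> (('o, 'm, 'c) fdatum \<times> ('o, 'm, 'c) fdatum) set" where
  "frac_rel = (\<lambda>(A1, w1, f1) (A2, w2, f2).
     {((A3, v1, v2, \<alpha>, \<beta>), (A3', v1', v2', \<alpha>', \<beta>')).
        (A3, v1, v2, \<alpha>, \<beta>) \<in> frac_data (A1, w1, f1) (A2, w2, f2)
        \<and> (A3', v1', v2', \<alpha>', \<beta>') \<in> frac_data (A1, w1, f1) (A2, w2, f2)
        \<and> (\<exists>A4 \<in> Ob C. \<exists>z \<in> hom C A4 A3. \<exists>z' \<in> hom C A4 A3'.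
             \<exists>\<sigma>1 \<in> inv_cells C (v1' \<cdot> z') (v1 \<cdot> z). \<exists>\<sigma>2 \<in> inv_cells C (v2 \<cdot> z) (v2' \<cdot> z').
               (w1 \<cdot> v1) \<cdot> z \<in> W
               \<and> (\<iota> w2 \<star> \<sigma>2) \<odot> pull w1 v1 w2 v2 \<alpha> z \<odot> (\<iota> w1 \<star> \<sigma>1) = pull w1 v1' w2 v2' \<alpha>' z'
               \<and> (\<iota> f2 \<star> \<sigma>2) \<odot> pull f1 v1 f2 v2 \<beta> z \<odot> (\<iota> f1 \<star> \<sigma>1) = pull f1 v1' f2 v2' \<beta>' z')})"

definition frac_class ::
    "('o, 'm) fmor \<Rightarrow> ('o, 'm) fmor \<Rightarrow> ('o, 'm, 'c) fdatum \<Rightarrow> ('o, 'm, 'c) fcell" where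
  "frac_class F1 F2 d = (F1, F2, frac_rel F1 F2 `` {d})"

definition frac_src :: "('o, 'm) fmor \<Rightarrow> 'o" where
  "frac_src = (\<lambda>(A', w, f). tgt C w)"

definition frac_tgt :: "('o, 'm) fmor \<Rightarrow> 'o" where
  "frac_tgt = (\<lambda>(A', w, f). tgt C f)"

definition frac_Cell :: "('o, 'm, 'c) fcell set" where
  "frac_Cell = {(F1, F2, X). F1 \<in> frac_Mor \<and> F2 \<in> frac_Mor \<and> frac_src F1 = frac_src F2
     \<and> frac_tgt F1 = frac_tgt F2 \<and> X \<in> frac_data F1 F2 // frac_rel F1 F2}"

definition frac_idm :: "'o \<Rightarrow> ('o, 'm) fmor" where
  "frac_idm A = (A, \<one> A, \<one> A)"

definition frac_idc :: "('o, 'm) fmor \<Rightarrow> ('o, 'm, 'c) fcell" where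
  "frac_idc = (\<lambda>(A', w, f). frac_class (A', w, f) (A', w, f)
     (A', \<one> A', \<one> A', \<iota> (w \<cdot> \<one> A'), \<iota> (f \<cdot> \<one> A')))"

text \<open>
  The operations below are given by a construction from auxiliary data (and from representatives
  of the classes involved) on which the result does not depend; \<open>SOME\<close> picks the result of the
  construction for an arbitrary choice of these.
\<close>

definition frac_vcomp :: "('o, 'm, 'c) fcell \<Rightarrow> ('o, 'm, 'c) fcell \<Rightarrow> ('o, 'm, 'c) fcell" where
  "frac_vcomp = (\<lambda>(_, (A3, w3, f3), Y) ((A1, w1, f1), (A2, w2, f2), X). SOME R.
     \<exists>E1 v1 v2 \<alpha> \<beta> E2 u1 u2 \<gamma> \<delta> E t1 t2 \<rho>.
       (E1, v1, v2, \<alpha>, \<beta>) \<in> X \<and> (E2, u1, u2, \<gamma>, \<delta>) \<in> Y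
       \<and> E \<in> Ob C \<and> t1 \<in> hom C E E1 \<and> t2 \<in> hom C E E2 \<and> \<rho> \<in> inv_cells C (v2 \<cdot> t1) (u1 \<cdot> t2)
       \<and> (w1 \<cdot> v1) \<cdot> t1 \<in> W
       \<and> R = frac_class (A1, w1, f1) (A3, w3, f3)
           (E, v1 \<cdot> t1, u2 \<cdot> t2,
            pull w2 u1 w3 u2 \<gamma> t2 \<odot> (\<iota> w2 \<star> \<rho>) \<odot> pull w1 v1 w2 v2 \<alpha> t1,
            pull f2 u1 f3 u2 \<delta> t2 \<odot> (\<iota> f2 \<star> \<rho>) \<odot> pull f1 v1 f2 v2 \<beta> t1))"

context
  fixes ch :: "('o, 'm, 'c) choices"
begin

definition frac_cmp :: "('o, 'm) fmor \<Rightarrow> ('o, 'm) fmor \<Rightarrow> ('o, 'm) fmor" where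
  "frac_cmp = (\<lambda>(B', v, g) (A', w, f). case ch f v of (A'', v', f', \<rho>) \<Rightarrow> (A'', w \<cdot> v', g \<cdot> f'))"

text \<open>\<open>frac_rwhisk \<Gamma> F\<close> is \<open>\<Gamma> \<star> \<iota> F\<close> and \<open>frac_lwhisk G \<Gamma>\<close> is \<open>\<iota> G \<star> \<Gamma>\<close>.\<close>

definition frac_rwhisk :: "('o, 'm, 'c) fcell \<Rightarrow> ('o, 'm) fmor \<Rightarrow> ('o, 'm, 'c) fcell" where
  "frac_rwhisk = (\<lambda>((B1, v1, g1), (B2, v2, g2), X) (A', w, f).
     case ch f v1 of (A1, v1', f1, \<rho>1) \<Rightarrow> case ch f v2 of (A2, v2', f2, \<rho>2) \<Rightarrow> SOME R.
     \<exists>B3 u1 u2 \<alpha> \<beta> E a1 a2 h \<epsilon> \<sigma>1 \<sigma>2.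
       (B3, u1, u2, \<alpha>, \<beta>) \<in> X
       \<and> E \<in> Ob C \<and> a1 \<in> hom C E A1 \<and> a2 \<in> hom C E A2 \<and> h \<in> hom C E B3
       \<and> \<epsilon> \<in> inv_cells C (v1' \<cdot> a1) (v2' \<cdot> a2)
       \<and> \<sigma>1 \<in> inv_cells C (f1 \<cdot> a1) (u1 \<cdot> h) \<and> \<sigma>2 \<in> inv_cells C (f2 \<cdot> a2) (u2 \<cdot> h)
       \<and> (w \<cdot> v1') \<cdot> a1 \<in> W
       \<and> pull v1 u1 v2 u2 \<alpha> h \<odot> (\<iota> v1 \<star> \<sigma>1) \<odot> pull f v1' v1 f1 \<rho>1 a1
         = (\<iota> v2 \<star> \<sigma>2) \<odot> pull f v2' v2 f2 \<rho>2 a2 \<odot> (\<iota> f \<star> \<epsilon>)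
       \<and> R = frac_class (frac_cmp (B1, v1, g1) (A', w, f)) (frac_cmp (B2, v2, g2) (A', w, f))
           (E, a1, a2,
            push w v1' a1 w v2' a2 (\<iota> w \<star> \<epsilon>),
            push g1 f1 a1 g2 f2 a2
              ((\<iota> g2 \<star> vinv C \<sigma>2) \<odot> pull g1 u1 g2 u2 \<beta> h \<odot> (\<iota> g1 \<star> \<sigma>1))))"

definition frac_lwhisk :: "('o, 'm) fmor \<Rightarrow> ('o, 'm, 'c) fcell \<Rightarrow> ('o, 'm, 'c) fcell" where
  "frac_lwhisk = (\<lambda>(B', v, g) ((A1, w1, f1), (A2, w2, f2), X).
     case ch f1 v of (A1'', v1', f1', \<rho>1) \<Rightarrow> case ch f2 v of (A2'', v2', f2', \<rho>2) \<Rightarrow> SOME R.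
     \<exists>A3 u1 u2 \<alpha> \<beta> E a1 a2 a \<tau>1 \<tau>2 \<phi>.
       (A3, u1, u2, \<alpha>, \<beta>) \<in> X
       \<and> E \<in> Ob C \<and> a1 \<in> hom C E A1'' \<and> a2 \<in> hom C E A2'' \<and> a \<in> hom C E A3
       \<and> \<tau>1 \<in> inv_cells C (v1' \<cdot> a1) (u1 \<cdot> a) \<and> \<tau>2 \<in> inv_cells C (v2' \<cdot> a2) (u2 \<cdot> a)
       \<and> (w1 \<cdot> v1') \<cdot> a1 \<in> W
       \<and> \<phi> \<in> cells C (f1' \<cdot> a1) (f2' \<cdot> a2)
       \<and> \<iota> v \<star> \<phi>
         = pull f2 v2' v f2' \<rho>2 a2 \<odot> (\<iota> f2 \<star> vinv C \<tau>2) \<odot> pull f1 u1 f2 u2 \<beta> a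
             \<odot> (\<iota> f1 \<star> \<tau>1) \<odot> pull v f1' f1 v1' (vinv C \<rho>1) a1
       \<and> R = frac_class (frac_cmp (B', v, g) (A1, w1, f1)) (frac_cmp (B', v, g) (A2, w2, f2))
           (E, a1, a2,
            push w1 v1' a1 w2 v2' a2
              ((\<iota> w2 \<star> vinv C \<tau>2) \<odot> pull w1 u1 w2 u2 \<alpha> a \<odot> (\<iota> w1 \<star> \<tau>1)),
            push g f1' a1 g f2' a2 (\<iota> g \<star> \<phi>)))"

text \<open>
  Horizontal composition is determined by the two whiskerings:
  \<open>\<Delta> \<star> \<Gamma> = (\<Delta> \<star> \<iota> (cd \<Gamma>)) \<odot> (\<iota> (dm \<Delta>) \<star> \<Gamma>)\<close>.
\<close>

definition frac_hcomp :: "('o, 'm, 'c) fcell \<Rightarrow> ('o, 'm, 'c) fcell \<Rightarrow> ('o, 'm, 'c) fcell" where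
  "frac_hcomp = (\<lambda>(G1, G2, Y) (F1, F2, X).
     frac_vcomp (frac_rwhisk (G1, G2, Y) F2) (frac_lwhisk G1 (F1, F2, X)))"

definition frac_associator ::
    "('o, 'm) fmor \<Rightarrow> ('o, 'm) fmor \<Rightarrow> ('o, 'm) fmor \<Rightarrow> ('o, 'm, 'c) fcell" where
  "frac_associator = (\<lambda>(C', w, h) (B', v, g) (A', u, f).
     case ch f v of (A1, v1, f1, \<delta>) \<Rightarrow>
     case ch (g \<cdot> f1) w of (A2, w1, g1, \<sigma>) \<Rightarrow>
     case ch g w of (B2, w2, g2, \<xi>) \<Rightarrow>
     case ch f (v \<cdot> w2) of (A3, y, f3, \<eta>) \<Rightarrow> SOME R.
     \<exists>E a b \<gamma> \<omega> \<rho>.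
       E \<in> Ob C \<and> a \<in> hom C E A2 \<and> b \<in> hom C E A3
       \<and> \<gamma> \<in> inv_cells C ((v1 \<cdot> w1) \<cdot> a) (y \<cdot> b)
       \<and> \<omega> \<in> inv_cells C (f1 \<cdot> (w1 \<cdot> a)) (w2 \<cdot> (f3 \<cdot> b))
       \<and> \<rho> \<in> inv_cells C (g1 \<cdot> a) (g2 \<cdot> (f3 \<cdot> b))
       \<and> ((u \<cdot> v1) \<cdot> w1) \<cdot> a \<in> W
       \<and> \<iota> v \<star> \<omega>
         = vinv C (\<theta> v w2 (f3 \<cdot> b)) \<odot> pull f y (v \<cdot> w2) f3 \<eta> b \<odot> (\<iota> f \<star> \<gamma>)
             \<odot> (\<iota> f \<star> \<theta> v1 w1 a) \<odot> pull v f1 f v1 (vinv C \<delta>) (w1 \<cdot> a)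
       \<and> \<iota> w \<star> \<rho>
         = pull g w2 w g2 \<xi> (f3 \<cdot> b) \<odot> (\<iota> g \<star> \<omega>) \<odot> vinv C (\<theta> g f1 (w1 \<cdot> a))
             \<odot> pull w g1 (g \<cdot> f1) w1 (vinv C \<sigma>) a
       \<and> R = frac_class
           (frac_cmp (C', w, h) (frac_cmp (B', v, g) (A', u, f)))
           (frac_cmp (frac_cmp (C', w, h) (B', v, g)) (A', u, f))
           (E, a, b,
            \<theta> u y b \<odot> (\<iota> u \<star> \<gamma>) \<odot> vinv C (\<theta> u (v1 \<cdot> w1) a) \<odot> (vinv C (\<theta> u v1 w1) \<star> \<iota> a),
            \<theta> (h \<cdot> g2) f3 b \<odot> \<theta> h g2 (f3 \<cdot> b) \<odot> (\<iota> h \<star> \<rho>) \<odot> vinv C (\<theta> h g1 a)))"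

text \<open>
  By the two normalisation conditions on choices, \<open>(A', w, f)\<close> composed with an identity is
  \<open>(A', \<one> \<cdot> w, f \<cdot> \<one>)\<close> respectively \<open>(A', w \<cdot> \<one>, \<one> \<cdot> f)\<close>.
\<close>

definition frac_right_unitor :: "('o, 'm) fmor \<Rightarrow> ('o, 'm, 'c) fcell" where
  "frac_right_unitor = (\<lambda>(A', w, f).
     frac_class (frac_cmp (A', w, f) (frac_idm (tgt C w))) (A', w, f)
       (A', \<one> A', \<one> A', \<upsilon> w \<star> \<iota> (\<one> A'), \<pi> f \<star> \<iota> (\<one> A')))"

definition frac_left_unitor :: "('o, 'm) fmor \<Rightarrow> ('o, 'm, 'c) fcell" where
  "frac_left_unitor = (\<lambda>(A', w, f).
     frac_class (frac_cmp (frac_idm (tgt C f)) (A', w, f)) (A', w, f)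
       (A', \<one> A', \<one> A', \<pi> w \<star> \<iota> (\<one> A'), \<upsilon> f \<star> \<iota> (\<one> A')))"

definition fractions :: "('o, ('o, 'm) fmor, ('o, 'm, 'c) fcell) bicat" where
  "fractions = \<lparr>
     Ob = Ob C, Mor = frac_Mor, Cell = frac_Cell,
     src = frac_src, tgt = frac_tgt, dm = fst, cd = fst \<circ> snd,
     idm = frac_idm, cmp = frac_cmp, idc = frac_idc,
     vcomp = frac_vcomp, hcomp = frac_hcomp,
     associator = frac_associator,
     right_unitor = frac_right_unitor, left_unitor = frac_left_unitor \<rparr>"

end

end

end

theory Submission
  imports Defs
begin

text \<open>
  Associators are removed once and for all by passing to the strict 2-category of paths of morphisms, whose
  2-cells are the 2-morphisms between composites.  A 2-morphism \<open>\<Gamma>\<close> of \<open>\<C>[W\<^sup>-\<^sup>1]\<close> from \<open>(A\<^sup>1, w\<^sup>1, f\<^sup>1)\<close>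
  to \<open>(A\<^sup>2, w\<^sup>2, f\<^sup>2)\<close> is then described by its values: to \<open>x\<^sup>m\<close> with common source and an invertible
  \<open>\<alpha> : w\<^sup>1 x\<^sup>1 \<Rightarrow> w\<^sup>2 x\<^sup>2\<close> it assigns, after restriction along a morphism of \<open>W\<close>, some \<open>\<beta> : f\<^sup>1 x\<^sup>1 \<Rightarrow> f\<^sup>2 x\<^sup>2\<close>,
  unique up to further restriction, and one value with \<open>w\<^sup>1 x\<^sup>1 \<in> W\<close> determines \<open>\<Gamma>\<close>.  All operations of
  \<open>\<C>[W\<^sup>-\<^sup>1]\<close> are computed on values.

  The weak fiber product of \<open>(B\<^sup>m, w\<^sup>m, f\<^sup>m)\<close> has the same vertex \<open>C\<close>, projections \<open>(C, id, w\<^sup>m p\<^sup>m)\<close> and the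
  2-morphism whose value is \<open>\<omega>\<close>.  For A1, an invertible value of \<open>\<Lambda>\<close> is a square over \<open>f\<^sup>1, f\<^sup>2\<close> in \<open>\<C>\<close>, to
  which A1 of \<open>\<C>\<close> applies.  For A2, the values of \<open>\<Gamma>\<^sup>m\<close> lift through \<open>w\<^sup>m\<close> to 2-morphisms of \<open>\<C>\<close> compatible with
  \<open>\<omega>\<close> after restriction along \<open>W\<close>, so that A2 of \<open>\<C>\<close> gives a value of \<open>\<Gamma>\<close>.  In (a) and (b) the identity of
  \<open>D\<close> serves as \<open>v\<close> and \<open>u\<close>.
\<close>

section \<open>Vertical composition and inverses\<close>

text \<open>The operations of \<open>fractions\<close> pick by \<open>SOME\<close> a class built
  from auxiliary data, so a result cannot be read off from a preferred representative. Instead, a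
  set of data that is stable under restriction and change of test, and in which denominators
  determine numerators up to restriction, is shown to contain every possible outcome; all its
  members are then values of the class picked. Values are compared as germs, because lifts through
  members of \<open>W\<close> exist and are unique only after restriction along \<open>W\<close>.
  Also, \<open>W\<close> need not have the two-out-of-three property, so membership is tracked for
  whole composites. The square meets a further obstacle. A projection has numerator
  \<open>w p\<close>, so composing it with the given fraction passes through the chosen square of
  \<open>w p\<close> against \<open>w\<close>, and \<open>p\<close> reappears only up to an
  isomorphism obtained by cancelling \<open>w\<close> locally; the two bracketings with a test
  morphism \<open>T\<close> use different chosen squares besides. Everything is therefore evaluated
  in common coordinates, the denominator of \<open>T\<close> and \<open>f p\<close> after its
  numerator, where associators become identities and the 2-morphism of the square becomes
  \<omega>.\<close>

context bicategory
begin

lemma cells_I: "\<alpha> \<in> Cell C \<Longrightarrow> dm C \<alpha> = f \<Longrightarrow> cd C \<alpha> = g \<Longrightarrow> \<alpha> \<in> cells C f g"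
  by (simp add: cells_def)

lemma hom_I: "f \<in> Mor C \<Longrightarrow> src C f = A \<Longrightarrow> tgt C f = B \<Longrightarrow> f \<in> hom C A B"
  by (simp add: hom_def)

lemma cmp_raw [simp]:
  assumes "f \<in> Mor C" "g \<in> Mor C" "src C g = tgt C f"
  shows "g \<cdot> f \<in> Mor C" "src C (g \<cdot> f) = src C f" "tgt C (g \<cdot> f) = tgt C g"
  using cmp_hom[of f "src C f" "tgt C f" g "tgt C g"] assms by (auto simp: hom_def)

lemma idm_raw [simp]:
  assumes "X \<in> Ob C" shows "\<one> X \<in> Mor C" "src C (\<one> X) = X" "tgt C (\<one> X) = X"
  using idm_hom[OF assms] by (auto simp: hom_def)

lemma idc_raw [simp]:
  assumes "f \<in> Mor C" shows "\<iota> f \<in> Cell C" "dm C (\<iota> f) = f" "cd C (\<iota> f) = f"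
  using idc_cells[OF assms] by (auto simp: cells_def)

lemma vcomp_raw [simp]:
  assumes "\<alpha> \<in> Cell C" "\<beta> \<in> Cell C" "dm C \<beta> = cd C \<alpha>"
  shows "\<beta> \<odot> \<alpha> \<in> Cell C" "dm C (\<beta> \<odot> \<alpha>) = dm C \<alpha>" "cd C (\<beta> \<odot> \<alpha>) = cd C \<beta>"
  using vcomp_cells[of \<alpha> "dm C \<alpha>" "cd C \<alpha>" \<beta> "cd C \<beta>"] assms by (auto simp: cells_def)

lemma dmcd_Mor [simp]: "\<alpha> \<in> Cell C \<Longrightarrow> dm C \<alpha> \<in> Mor C" "\<alpha> \<in> Cell C \<Longrightarrow> cd C \<alpha> \<in> Mor C"
  by (auto intro: dm_Mor cd_Mor)

lemma hcomp_raw [simp]: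
  assumes "\<alpha> \<in> Cell C" "\<beta> \<in> Cell C" "src C (dm C \<beta>) = tgt C (dm C \<alpha>)"
  shows "\<beta> \<star> \<alpha> \<in> Cell C" "dm C (\<beta> \<star> \<alpha>) = dm C \<beta> \<cdot> dm C \<alpha>" "cd C (\<beta> \<star> \<alpha>) = cd C \<beta> \<cdot> cd C \<alpha>"
  using hcomp_cells[of "dm C \<alpha>" _ _ "dm C \<beta>" _ \<alpha> "cd C \<alpha>" \<beta> "cd C \<beta>"] assms
  by (auto simp: cells_def hom_def dm_Mor)

lemma vassoc [simp]:
  assumes "\<alpha> \<in> Cell C" "\<beta> \<in> Cell C" "\<gamma> \<in> Cell C" "dm C \<beta> = cd C \<alpha>" "dm C \<gamma> = cd C \<beta>"
  shows "(\<gamma> \<odot> \<beta>) \<odot> \<alpha> = \<gamma> \<odot> (\<beta> \<odot> \<alpha>)"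
  by (rule vcomp_assoc[OF cells_I cells_I cells_I]) (use assms in auto)

lemma vid [simp]:
  assumes "\<alpha> \<in> Cell C"
  shows "cd C \<alpha> = g \<Longrightarrow> \<iota> g \<odot> \<alpha> = \<alpha>" "dm C \<alpha> = f \<Longrightarrow> \<alpha> \<odot> \<iota> f = \<alpha>"
  using vcomp_idc_left[of \<alpha> f g] vcomp_idc_left[of \<alpha> "dm C \<alpha>" g]
    vcomp_idc_right[of \<alpha> f "cd C \<alpha>"] assms by (auto simp: cells_def)

lemma hid [simp]:
  assumes "f \<in> Mor C" "g \<in> Mor C" "src C g = tgt C f"
  shows "\<iota> g \<star> \<iota> f = \<iota> (g \<cdot> f)"
  by (rule hcomp_idc[OF hom_I hom_I]) (use assms in auto)

lemma hinter:
  assumes "\<alpha> \<in> Cell C" "\<alpha>' \<in> Cell C" "\<beta> \<in> Cell C" "\<beta>' \<in> Cell C"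
    "dm C \<alpha>' = cd C \<alpha>" "dm C \<beta>' = cd C \<beta>" "src C (dm C \<beta>) = tgt C (dm C \<alpha>)"
  shows "(\<beta>' \<star> \<alpha>') \<odot> (\<beta> \<star> \<alpha>) = (\<beta>' \<odot> \<beta>) \<star> (\<alpha>' \<odot> \<alpha>)"
  by (rule interchange[OF hom_I hom_I cells_I cells_I cells_I cells_I, symmetric])
    (use assms in auto)

text \<open>The boundary is dropped, so that invertibility can be a side condition of simp
  rules.\<close>

definition isoc :: "'c \<Rightarrow> bool" where
  "isoc \<alpha> \<longleftrightarrow> \<alpha> \<in> Cell C \<and> (\<exists>\<beta>. inverse_cells C \<alpha> \<beta>)"

lemma inv_cells_iff: "\<alpha> \<in> inv_cells C f g \<longleftrightarrow> isoc \<alpha> \<and> dm C \<alpha> = f \<and> cd C \<alpha> = g"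
  by (auto simp: inv_cells_def isoc_def cells_def)

lemma inverse_cells_unique:
  assumes "\<alpha> \<in> Cell C" "inverse_cells C \<alpha> \<beta>" "inverse_cells C \<alpha> \<beta>'"
  shows "\<beta> = \<beta>'"
proof -
  have a: "\<beta> \<odot> (\<alpha> \<odot> \<beta>') = (\<beta> \<odot> \<alpha>) \<odot> \<beta>'"
    by (rule vassoc[symmetric]) (use assms in \<open>auto simp: inverse_cells_def cells_def\<close>)
  have "\<beta> \<odot> \<alpha> = \<iota> (dm C \<alpha>)" "\<alpha> \<odot> \<beta>' = \<iota> (cd C \<alpha>)"
    using assms by (auto simp: inverse_cells_def)
  with a show ?thesis using assms by (auto simp: inverse_cells_def cells_def)
qed

lemma vinv_eq: "\<alpha> \<in> Cell C \<Longrightarrow> inverse_cells C \<alpha> \<beta> \<Longrightarrow> vinv C \<alpha> = \<beta>"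
  unfolding vinv_def using inverse_cells_unique by blast

lemma isoc_cell [simp]: "isoc \<alpha> \<Longrightarrow> \<alpha> \<in> Cell C"
  by (simp add: isoc_def)

lemma vinv_raw [simp]:
  assumes "isoc \<alpha>"
  shows "vinv C \<alpha> \<in> Cell C" "dm C (vinv C \<alpha>) = cd C \<alpha>" "cd C (vinv C \<alpha>) = dm C \<alpha>"
    "vinv C \<alpha> \<odot> \<alpha> = \<iota> (dm C \<alpha>)" "\<alpha> \<odot> vinv C \<alpha> = \<iota> (cd C \<alpha>)"
    and isoc_vinv [simp]: "isoc (vinv C \<alpha>)" and vinv_vinv [simp]: "vinv C (vinv C \<alpha>) = \<alpha>"
proof -
  obtain \<beta> where b: "inverse_cells C \<alpha> \<beta>" and a: "\<alpha> \<in> Cell C" using assms isoc_def by blast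
  have v: "vinv C \<alpha> = \<beta>" using vinv_eq[OF a b] .
  show "vinv C \<alpha> \<in> Cell C" "dm C (vinv C \<alpha>) = cd C \<alpha>" "cd C (vinv C \<alpha>) = dm C \<alpha>"
    "vinv C \<alpha> \<odot> \<alpha> = \<iota> (dm C \<alpha>)" "\<alpha> \<odot> vinv C \<alpha> = \<iota> (cd C \<alpha>)"
    using b a unfolding v by (auto simp: inverse_cells_def cells_def)
  then have c: "inverse_cells C (vinv C \<alpha>) \<alpha>" using a by (simp add: inverse_cells_def cells_def)
  show "isoc (vinv C \<alpha>)" unfolding isoc_def using c \<open>vinv C \<alpha> \<in> Cell C\<close> by blast
  show "vinv C (vinv C \<alpha>) = \<alpha>" using vinv_eq[OF _ c] \<open>vinv C \<alpha> \<in> Cell C\<close> by blast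
qed

lemma vinv_tail [simp]:
  assumes "isoc \<alpha>" "\<beta> \<in> Cell C"
  shows "cd C \<beta> = dm C \<alpha> \<Longrightarrow> vinv C \<alpha> \<odot> (\<alpha> \<odot> \<beta>) = \<beta>"
    "cd C \<beta> = cd C \<alpha> \<Longrightarrow> \<alpha> \<odot> (vinv C \<alpha> \<odot> \<beta>) = \<beta>"
  using assms by (simp_all flip: vassoc)

lemma isocI:
  assumes "\<alpha> \<in> Cell C" "\<beta> \<in> Cell C" "dm C \<beta> = cd C \<alpha>" "cd C \<beta> = dm C \<alpha>"
    "\<beta> \<odot> \<alpha> = \<iota> (dm C \<alpha>)" "\<alpha> \<odot> \<beta> = \<iota> (cd C \<alpha>)"
  shows "isoc \<alpha>" "vinv C \<alpha> = \<beta>"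
proof -
  have "inverse_cells C \<alpha> \<beta>" using assms by (simp add: inverse_cells_def cells_def)
  then show "isoc \<alpha>" "vinv C \<alpha> = \<beta>" using assms vinv_eq by (auto simp: isoc_def)
qed

lemma isoc_idc [simp]:
  assumes "f \<in> Mor C" shows "isoc (\<iota> f)" "vinv C (\<iota> f) = \<iota> f"
  by (rule isocI[of _ "\<iota> f"]; use assms in simp)+

lemma isoc_vcomp [simp]:
  assumes "isoc \<alpha>" "isoc \<beta>" "dm C \<beta> = cd C \<alpha>"
  shows "isoc (\<beta> \<odot> \<alpha>)" "vinv C (\<beta> \<odot> \<alpha>) = vinv C \<alpha> \<odot> vinv C \<beta>"
  by (rule isocI[of _ "vinv C \<alpha> \<odot> vinv C \<beta>"]; use assms in simp)+

lemma isoc_hcomp [simp]: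
  assumes "isoc \<alpha>" "isoc \<beta>" "src C (dm C \<beta>) = tgt C (dm C \<alpha>)"
  shows "isoc (\<beta> \<star> \<alpha>)" "vinv C (\<beta> \<star> \<alpha>) = vinv C \<beta> \<star> vinv C \<alpha>"
proof -
  have "src C (cd C \<beta>) = tgt C (cd C \<alpha>)" using assms cell_src[of \<beta>] cell_tgt[of \<alpha>] by simp
  then show "isoc (\<beta> \<star> \<alpha>)" "vinv C (\<beta> \<star> \<alpha>) = vinv C \<beta> \<star> vinv C \<alpha>"
    using isocI[of "\<beta> \<star> \<alpha>" "vinv C \<beta> \<star> vinv C \<alpha>"] assms by (simp_all add: hinter)
qed

lemma assoc_raw [simp]:
  assumes "f \<in> Mor C" "g \<in> Mor C" "h \<in> Mor C" "src C g = tgt C f" "src C h = tgt C g"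
  shows "isoc (\<theta> h g f)" "dm C (\<theta> h g f) = h \<cdot> (g \<cdot> f)" "cd C (\<theta> h g f) = (h \<cdot> g) \<cdot> f"
  using associator_cells[of f "src C f" "tgt C f" g "tgt C g" h "tgt C h"] assms
  by (simp_all add: hom_def inv_cells_iff)

lemma assoc_nat:
  assumes "\<alpha> \<in> Cell C" "\<beta> \<in> Cell C" "\<gamma> \<in> Cell C"
    "src C (dm C \<beta>) = tgt C (dm C \<alpha>)" "src C (dm C \<gamma>) = tgt C (dm C \<beta>)"
  shows "\<theta> (cd C \<gamma>) (cd C \<beta>) (cd C \<alpha>) \<odot> (\<gamma> \<star> (\<beta> \<star> \<alpha>))
    = ((\<gamma> \<star> \<beta>) \<star> \<alpha>) \<odot> \<theta> (dm C \<gamma>) (dm C \<beta>) (dm C \<alpha>)"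
  by (rule associator_natural[OF hom_I hom_I hom_I cells_I cells_I cells_I]) (use assms in auto)

lemma unitor_raw [simp]:
  assumes "f \<in> Mor C"
  shows "isoc (\<pi> f)" "dm C (\<pi> f) = f \<cdot> \<one> (src C f)" "cd C (\<pi> f) = f"
    "isoc (\<upsilon> f)" "dm C (\<upsilon> f) = \<one> (tgt C f) \<cdot> f" "cd C (\<upsilon> f) = f"
  using right_unitor_cells[of f "src C f" "tgt C f"] left_unitor_cells[of f "src C f" "tgt C f"] assms
  by (simp_all add: hom_def inv_cells_iff)

lemma vinv_eqI:
  assumes "isoc \<alpha>" "\<beta> \<in> Cell C" "\<gamma> \<in> Cell C" "cd C \<gamma> = cd C \<alpha>" "cd C \<beta> = dm C \<alpha>"
  shows "\<beta> = vinv C \<alpha> \<odot> \<gamma> \<longleftrightarrow> \<alpha> \<odot> \<beta> = \<gamma>"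
  using assms by auto

lemma cellST [simp]:
  assumes "\<alpha> \<in> Cell C" shows "src C (cd C \<alpha>) = src C (dm C \<alpha>)" "tgt C (cd C \<alpha>) = tgt C (dm C \<alpha>)"
  using assms cell_src cell_tgt by auto

lemma assoc_nat_inv:
  assumes "\<alpha> \<in> Cell C" "\<beta> \<in> Cell C" "\<gamma> \<in> Cell C"
    "src C (dm C \<beta>) = tgt C (dm C \<alpha>)" "src C (dm C \<gamma>) = tgt C (dm C \<beta>)"
  shows "vinv C (\<theta> (cd C \<gamma>) (cd C \<beta>) (cd C \<alpha>)) \<odot> ((\<gamma> \<star> \<beta>) \<star> \<alpha>)
    = (\<gamma> \<star> (\<beta> \<star> \<alpha>)) \<odot> vinv C (\<theta> (dm C \<gamma>) (dm C \<beta>) (dm C \<alpha>))" (is "?l \<odot> ?x = ?y \<odot> ?r")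
proof -
  have "?l \<odot> (?x \<odot> \<theta> (dm C \<gamma>) (dm C \<beta>) (dm C \<alpha>)) \<odot> ?r = ?y \<odot> ?r"
    unfolding assoc_nat[OF assms, symmetric] using assms by simp
  then show ?thesis using assms by simp
qed

section \<open>Paths\<close>

text \<open>A path is listed in composition order: its head is applied last.\<close>

fun pth :: "'m list \<Rightarrow> bool" where
  "pth [] = False"
| "pth [f] = (f \<in> Mor C)"
| "pth (f # g # p) = (f \<in> Mor C \<and> src C f = tgt C g \<and> pth (g # p))"

definition sr :: "'m list \<Rightarrow> 'o" where "sr p = src C (last p)"
definition tg :: "'m list \<Rightarrow> 'o" where "tg p = tgt C (hd p)"

lemma sr_simps [simp]: "sr [f] = src C f" "p \<noteq> [] \<Longrightarrow> sr (f # p) = sr p"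
  "q \<noteq> [] \<Longrightarrow> sr (p @ q) = sr q"
  by (auto simp: sr_def)

lemma tg_simps [simp]: "tg (f # p) = tgt C f" "p \<noteq> [] \<Longrightarrow> tg (p @ q) = tg p"
  by (auto simp: tg_def)

lemma pth_nonempty [simp]: "pth p \<Longrightarrow> p \<noteq> []" by auto

lemma pth_Cons [simp]: "p \<noteq> [] \<Longrightarrow> pth (f # p) \<longleftrightarrow> f \<in> Mor C \<and> src C f = tg p \<and> pth p"
  by (cases p) (auto simp: tg_def)

declare pth.simps(3) [simp del]

lemma pth_append [simp]: "p \<noteq> [] \<Longrightarrow> q \<noteq> [] \<Longrightarrow> pth (p @ q) \<longleftrightarrow> pth p \<and> sr p = tg q \<and> pth q"
proof (induction p)
  case (Cons a p)
  then show ?case by (cases "p = []") (auto simp: sr_def)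
qed simp

fun ev :: "'m list \<Rightarrow> 'm" where
  "ev [] = undefined"
| "ev [f] = f"
| "ev (f # g # p) = f \<cdot> ev (g # p)"

lemma ev_Cons [simp]: "p \<noteq> [] \<Longrightarrow> ev (f # p) = f \<cdot> ev p"
  by (cases p) auto

declare ev.simps(3) [simp del]

lemma ev_raw [simp]: "pth p \<Longrightarrow> ev p \<in> Mor C \<and> src C (ev p) = sr p \<and> tgt C (ev p) = tg p"
proof (induction p)
  case (Cons a p)
  then show ?case by (cases "p = []") auto
qed simp

text \<open>The rebracketing 2-morphism from \<open>ev p \<cdot> ev q\<close> to
  \<open>ev (p @ q)\<close>, made of inverse associators. For a single \<open>f\<close> it is an
  identity because \<open>ev\<close> brackets to the right.\<close>

fun coh :: "'m list \<Rightarrow> 'm list \<Rightarrow> 'c" where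
  "coh [] q = undefined"
| "coh [f] q = \<iota> (f \<cdot> ev q)"
| "coh (f # g # p) q = (\<iota> f \<star> coh (g # p) q) \<odot> vinv C (\<theta> f (ev (g # p)) (ev q))"

lemma coh_Cons [simp]:
  "p \<noteq> [] \<Longrightarrow> coh (f # p) q = (\<iota> f \<star> coh p q) \<odot> vinv C (\<theta> f (ev p) (ev q))"
  by (cases p) auto

declare coh.simps(3) [simp del]

lemma coh_raw [simp]:
  assumes "pth p" "pth q" "sr p = tg q"
  shows "isoc (coh p q) \<and> dm C (coh p q) = ev p \<cdot> ev q \<and> cd C (coh p q) = ev (p @ q)"
  using assms
proof (induction p)
  case (Cons a p)
  then show ?case by (cases "p = []") auto
qed simp

lemma pentagon_raw:
  assumes "f \<in> Mor C" "g \<in> Mor C" "h \<in> Mor C" "k \<in> Mor C"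
    "src C g = tgt C f" "src C h = tgt C g" "src C k = tgt C h"
  shows "(\<theta> k h g \<star> \<iota> f) \<odot> \<theta> k (h \<cdot> g) f \<odot> (\<iota> k \<star> \<theta> h g f)
    = \<theta> (k \<cdot> h) g f \<odot> \<theta> k h (g \<cdot> f)"
  by (rule pentagon[OF hom_I hom_I hom_I hom_I, symmetric]) (use assms in auto)

text \<open>The pentagon in the form in which inverse associators, as they occur in
  \<open>coh\<close>, produce it.\<close>

lemma pentagon_inv:
  assumes "f \<in> Mor C" "g \<in> Mor C" "h \<in> Mor C" "k \<in> Mor C"
    "src C g = tgt C f" "src C h = tgt C g" "src C k = tgt C h"
  shows "vinv C (\<theta> k (h \<cdot> g) f) \<odot> (vinv C (\<theta> k h g) \<star> \<iota> f) \<odot> \<theta> (k \<cdot> h) g f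
    = (\<iota> k \<star> \<theta> h g f) \<odot> vinv C (\<theta> k h (g \<cdot> f))"
proof -
  have "\<theta> (k \<cdot> h) g f = ((\<theta> k h g \<star> \<iota> f) \<odot> \<theta> k (h \<cdot> g) f \<odot> (\<iota> k \<star> \<theta> h g f)) \<odot> vinv C (\<theta> k h (g \<cdot> f))"
    unfolding pentagon_raw[OF assms] using assms by simp
  moreover have "(vinv C (\<theta> k h g) \<star> \<iota> f) \<odot> (\<theta> k h g \<star> \<iota> f) \<odot> x = x"
    if "x \<in> Cell C" "cd C x = (k \<cdot> (h \<cdot> g)) \<cdot> f" for x
  proof -
    have "(vinv C (\<theta> k h g) \<star> \<iota> f) \<odot> (\<theta> k h g \<star> \<iota> f) \<odot> x
      = ((vinv C (\<theta> k h g) \<star> \<iota> f) \<odot> (\<theta> k h g \<star> \<iota> f)) \<odot> x" using assms that by simp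
    then show ?thesis using assms that by (simp add: hinter)
  qed
  ultimately show ?thesis using assms by simp
qed

text \<open>Induction on \<open>p\<close>: naturality moves the inverse associators of the head
  \<open>f\<close> past the whiskered coherence cells, the induction hypothesis is whiskered by
  \<open>f\<close>, and the pentagon accounts for the associators that remain. The equation is what
  associativity of \<open>hc\<close> amounts to on a boundary.\<close>

lemma coh_assoc:
  assumes "pth p" "pth q" "pth r" "sr p = tg q" "sr q = tg r"
  shows "coh p (q @ r) \<odot> (\<iota> (ev p) \<star> coh q r)
    = coh (p @ q) r \<odot> (coh p q \<star> \<iota> (ev r)) \<odot> \<theta> (ev p) (ev q) (ev r)"
  using assms
proof (induction p)
  case Nil then show ?case by simp
next
  case (Cons f p)
  show ?case
  proof (cases "p = []")
    case True
    with Cons.prems show ?thesis by simp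
  next
    case False
    with Cons have p: "f \<in> Mor C" "src C f = tg p" "pth p" "sr p = tg q" by simp_all
    note q = Cons.prems(2,3,5)
    let ?F = "\<iota> f" and ?P = "ev p" and ?Q = "ev q" and ?R = "ev r"
    have ih: "coh p (q @ r) \<odot> (\<iota> ?P \<star> coh q r)
        = coh (p @ q) r \<odot> (coh p q \<star> \<iota> ?R) \<odot> \<theta> ?P ?Q ?R"
      using Cons.IH p q by simp
    have n1: "vinv C (\<theta> f ?P (ev (q @ r))) \<odot> (\<iota> (f \<cdot> ?P) \<star> coh q r)
        = (?F \<star> (\<iota> ?P \<star> coh q r)) \<odot> vinv C (\<theta> f ?P (?Q \<cdot> ?R))"
      using assoc_nat_inv[of "coh q r" "\<iota> ?P" "\<iota> f"] p q by simp
    have "coh (f # p) (q @ r) \<odot> (\<iota> (ev (f # p)) \<star> coh q r)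
        = (?F \<star> coh p (q @ r)) \<odot> vinv C (\<theta> f ?P (ev (q @ r))) \<odot> (\<iota> (f \<cdot> ?P) \<star> coh q r)"
      using p q False by simp
    also have "\<dots> = ((?F \<star> coh p (q @ r)) \<odot> (?F \<star> (\<iota> ?P \<star> coh q r))) \<odot> vinv C (\<theta> f ?P (?Q \<cdot> ?R))"
      unfolding n1 using p q by simp
    also have "(?F \<star> coh p (q @ r)) \<odot> (?F \<star> (\<iota> ?P \<star> coh q r))
        = ?F \<star> (coh (p @ q) r \<odot> (coh p q \<star> \<iota> ?R) \<odot> \<theta> ?P ?Q ?R)"
      using p q by (simp add: hinter flip: ih)
    also have "\<dots> = (?F \<star> coh (p @ q) r) \<odot> (?F \<star> (coh p q \<star> \<iota> ?R)) \<odot> (?F \<star> \<theta> ?P ?Q ?R)"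
      using p q by (simp add: hinter)
    finally have l: "coh (f # p) (q @ r) \<odot> (\<iota> (ev (f # p)) \<star> coh q r)
        = (?F \<star> coh (p @ q) r) \<odot> (?F \<star> (coh p q \<star> \<iota> ?R)) \<odot> (?F \<star> \<theta> ?P ?Q ?R)
          \<odot> vinv C (\<theta> f ?P (?Q \<cdot> ?R))"
      using p q by simp
    have n2: "vinv C (\<theta> f (ev (p @ q)) ?R) \<odot> ((?F \<star> coh p q) \<star> \<iota> ?R)
        = (?F \<star> (coh p q \<star> \<iota> ?R)) \<odot> vinv C (\<theta> f (?P \<cdot> ?Q) ?R)"
      using assoc_nat_inv[of "\<iota> ?R" "coh p q" "\<iota> f"] p q by simp
    have i: "((?F \<star> coh p q) \<odot> vinv C (\<theta> f ?P ?Q)) \<star> \<iota> ?R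
       = ((?F \<star> coh p q) \<star> \<iota> ?R) \<odot> (vinv C (\<theta> f ?P ?Q) \<star> \<iota> ?R)"
      using p q by (simp add: hinter)
    have "coh ((f # p) @ q) r \<odot> (coh (f # p) q \<star> \<iota> ?R) \<odot> \<theta> (ev (f # p)) ?Q ?R
        = (?F \<star> coh (p @ q) r) \<odot> (vinv C (\<theta> f (ev (p @ q)) ?R) \<odot> ((?F \<star> coh p q) \<star> \<iota> ?R))
          \<odot> (vinv C (\<theta> f ?P ?Q) \<star> \<iota> ?R) \<odot> \<theta> (f \<cdot> ?P) ?Q ?R"
      using p q False by (simp add: i)
    also have "\<dots> = (?F \<star> coh (p @ q) r) \<odot> (?F \<star> (coh p q \<star> \<iota> ?R))
          \<odot> (vinv C (\<theta> f (?P \<cdot> ?Q) ?R) \<odot> (vinv C (\<theta> f ?P ?Q) \<star> \<iota> ?R) \<odot> \<theta> (f \<cdot> ?P) ?Q ?R)"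
      unfolding n2 using p q by simp
    also have "\<dots> = (?F \<star> coh (p @ q) r) \<odot> (?F \<star> (coh p q \<star> \<iota> ?R))
          \<odot> (?F \<star> \<theta> ?P ?Q ?R) \<odot> vinv C (\<theta> f ?P (?Q \<cdot> ?R))"
      using pentagon_inv[of ?R ?Q ?P f] p q by simp
    finally show ?thesis using l by simp
  qed
qed

end

section \<open>The strict 2-category of paths\<close>

text \<open>A 2-cell between paths is a 2-morphism between their composites, bracketed to the right.\<close>

type_synonym ('m, 'c) scell = "'m list \<times> 'c \<times> 'm list"

definition dom :: "('m, 'c) scell \<Rightarrow> 'm list" where "dom s = fst s"
definition raw :: "('m, 'c) scell \<Rightarrow> 'c" where "raw s = fst (snd s)"
definition cod :: "('m, 'c) scell \<Rightarrow> 'm list" where "cod s = snd (snd s)"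

lemma scell_simps [simp]: "dom (p, a, q) = p" "raw (p, a, q) = a" "cod (p, a, q) = q"
  by (simp_all add: dom_def raw_def cod_def)

lemma scell_eqI: "dom s = dom t \<Longrightarrow> raw s = raw t \<Longrightarrow> cod s = cod t \<Longrightarrow> s = t"
  by (cases s; cases t) auto

context bicategory
begin

text \<open>The invalid 2-cell \<open>bad\<close> makes both compositions total and their associativity unconditional.\<close>

definition valid :: "('m, 'c) scell \<Rightarrow> bool" where
  "valid s \<longleftrightarrow> pth (dom s) \<and> pth (cod s) \<and> raw s \<in> Cell C
     \<and> dm C (raw s) = ev (dom s) \<and> cd C (raw s) = ev (cod s)"

definition bad :: "('m, 'c) scell" where "bad = ([], undefined, [])"

definition sid :: "'m list \<Rightarrow> ('m, 'c) scell" where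
  "sid p = (if pth p then (p, \<iota> (ev p), p) else bad)"

definition vc :: "('m, 'c) scell \<Rightarrow> ('m, 'c) scell \<Rightarrow> ('m, 'c) scell" (infixr "\<bullet>" 65) where
  "t \<bullet> s = (if valid s \<and> valid t \<and> dom t = cod s then (dom s, raw t \<odot> raw s, cod t) else bad)"

definition hc :: "('m, 'c) scell \<Rightarrow> ('m, 'c) scell \<Rightarrow> ('m, 'c) scell" where
  "hc t s = (if valid s \<and> valid t \<and> sr (dom t) = tg (dom s)
     then (dom t @ dom s, coh (cod t) (cod s) \<odot> (raw t \<star> raw s) \<odot> vinv C (coh (dom t) (dom s)),
           cod t @ cod s) else bad)"

definition lw :: "'m list \<Rightarrow> ('m, 'c) scell \<Rightarrow> ('m, 'c) scell" (infixr "\<rhd>" 71) where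
  "x \<rhd> s = (if x = [] then s else hc (sid x) s)"

definition rw :: "('m, 'c) scell \<Rightarrow> 'm list \<Rightarrow> ('m, 'c) scell" (infixl "\<lhd>" 72) where
  "s \<lhd> z = (if z = [] then s else hc s (sid z))"

definition iso :: "('m, 'c) scell \<Rightarrow> bool" where
  "iso s \<longleftrightarrow> valid s \<and> isoc (raw s)"

definition sinv :: "('m, 'c) scell \<Rightarrow> ('m, 'c) scell" where
  "sinv s = (cod s, vinv C (raw s), dom s)"

lemma valid_D:
  assumes "valid s"
  shows "pth (dom s)" "pth (cod s)" "raw s \<in> Cell C" "dm C (raw s) = ev (dom s)" "cd C (raw s) = ev (cod s)"
    "dom s \<noteq> []" "cod s \<noteq> []" "sr (cod s) = sr (dom s)" "tg (cod s) = tg (dom s)"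
proof -
  show a: "pth (dom s)" "pth (cod s)" "raw s \<in> Cell C" "dm C (raw s) = ev (dom s)" "cd C (raw s) = ev (cod s)"
    using assms by (auto simp: valid_def)
  show "dom s \<noteq> []" "cod s \<noteq> []" using a by auto
  show "sr (cod s) = sr (dom s)" "tg (cod s) = tg (dom s)"
    using cellST[of "raw s"] a by auto
qed

lemma bad_simps [simp]: "dom bad = []" "cod bad = []" "\<not> valid bad"
  by (auto simp: bad_def valid_def)

lemma sid_simps [simp]:
  "valid (sid p) \<longleftrightarrow> pth p" "pth p \<Longrightarrow> dom (sid p) = p" "pth p \<Longrightarrow> cod (sid p) = p"
  "pth p \<Longrightarrow> raw (sid p) = \<iota> (ev p)"
  by (auto simp: sid_def bad_def valid_def)

lemma valid_triple: "valid (p, a, q) \<longleftrightarrow> pth p \<and> pth q \<and> a \<in> Cell C \<and> dm C a = ev p \<and> cd C a = ev q"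
  by (simp add: valid_def)

lemma valid_vc [simp]: "valid (t \<bullet> s) \<longleftrightarrow> valid s \<and> valid t \<and> dom t = cod s"
proof (cases "valid s \<and> valid t \<and> dom t = cod s")
  case True
  then show ?thesis using valid_D(1-5)[of s] valid_D(1-5)[of t] by (simp add: vc_def valid_triple)
qed (auto simp: vc_def)

lemma vc_simps [simp]:
  assumes "valid s" "valid t" "dom t = cod s"
  shows "dom (t \<bullet> s) = dom s" "cod (t \<bullet> s) = cod t" "raw (t \<bullet> s) = raw t \<odot> raw s"
  using assms by (auto simp: vc_def)

lemma valid_hc [simp]: "valid (hc t s) \<longleftrightarrow> valid s \<and> valid t \<and> sr (dom t) = tg (dom s)"
proof (cases "valid s \<and> valid t \<and> sr (dom t) = tg (dom s)")
  case True
  then show ?thesis using valid_D[of s] valid_D[of t] by (simp add: hc_def valid_triple)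
qed (auto simp: hc_def)

lemma hc_simps [simp]:
  assumes "valid s" "valid t" "sr (dom t) = tg (dom s)"
  shows "dom (hc t s) = dom t @ dom s" "cod (hc t s) = cod t @ cod s"
    "raw (hc t s) = coh (cod t) (cod s) \<odot> (raw t \<star> raw s) \<odot> vinv C (coh (dom t) (dom s))"
  using assms by (auto simp: hc_def)

lemma vc_bad: "\<not> valid (t \<bullet> s) \<Longrightarrow> t \<bullet> s = bad" and hc_bad: "\<not> valid (hc t s) \<Longrightarrow> hc t s = bad"
  unfolding valid_vc valid_hc by (auto simp: vc_def hc_def)

lemma vc_assoc [simp]: "(u \<bullet> t) \<bullet> s = u \<bullet> (t \<bullet> s)"
proof (cases "valid ((u \<bullet> t) \<bullet> s)")
  case True
  then have v: "valid u" "valid t" "valid s" "dom u = cod t" "dom t = cod s" by auto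
  show ?thesis by (rule scell_eqI) (use v valid_D[OF v(1)] valid_D[OF v(2)] valid_D[OF v(3)] in simp_all)
next
  case False
  moreover from False have "\<not> valid (u \<bullet> (t \<bullet> s))" by auto
  ultimately show ?thesis by (metis vc_bad)
qed

lemma sid_left [simp]: "valid s \<Longrightarrow> cod s = p \<Longrightarrow> sid p \<bullet> s = s"
  using valid_D[of s] by (auto intro!: scell_eqI)

lemma sid_right [simp]: "valid s \<Longrightarrow> dom s = p \<Longrightarrow> s \<bullet> sid p = s"
  using valid_D[of s] by (auto intro!: scell_eqI)

lemma hinter3:
  assumes "\<alpha> \<in> Cell C" "\<alpha>' \<in> Cell C" "\<beta> \<in> Cell C" "\<beta>' \<in> Cell C" "\<gamma> \<in> Cell C"
    "dm C \<alpha>' = cd C \<alpha>" "dm C \<beta>' = cd C \<beta>" "src C (dm C \<beta>) = tgt C (dm C \<alpha>)"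
    "cd C \<gamma> = dm C \<beta> \<cdot> dm C \<alpha>"
  shows "(\<beta>' \<star> \<alpha>') \<odot> (\<beta> \<star> \<alpha>) \<odot> \<gamma> = ((\<beta>' \<odot> \<beta>) \<star> (\<alpha>' \<odot> \<alpha>)) \<odot> \<gamma>"
proof -
  have "src C (dm C \<beta>') = tgt C (dm C \<alpha>')" using assms by simp
  then have "(\<beta>' \<star> \<alpha>') \<odot> (\<beta> \<star> \<alpha>) \<odot> \<gamma> = ((\<beta>' \<star> \<alpha>') \<odot> (\<beta> \<star> \<alpha>)) \<odot> \<gamma>"
    using assms by simp
  then show ?thesis using hinter[of \<alpha> \<alpha>' \<beta> \<beta>'] assms by simp
qed

lemma hc_vc:
  assumes "valid s" "valid s'" "valid t" "valid t'" "dom s' = cod s" "dom t' = cod t" "sr (dom t) = tg (dom s)"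
  shows "hc t' s' \<bullet> hc t s = hc (t' \<bullet> t) (s' \<bullet> s)"
proof (rule scell_eqI)
  note v = valid_D[OF assms(1)] valid_D[OF assms(2)] valid_D[OF assms(3)] valid_D[OF assms(4)]
  show "raw (hc t' s' \<bullet> hc t s) = raw (hc (t' \<bullet> t) (s' \<bullet> s))"
    using assms v by (simp add: hinter3)
qed (use assms valid_D[OF assms(1)] valid_D[OF assms(3)] in auto)

text \<open>The two sides differ in the coherence cells on their boundaries.
  \<open>coh_assoc\<close> exchanges these at the cost of one associator on each boundary, and
  naturality lets the two associators cancel. If one side is invalid, so is the other, and both are
  \<open>bad\<close>.\<close>

lemma hc_assoc: "hc (hc u t) s = hc u (hc t s)"
proof (cases "valid (hc (hc u t) s)")
  case True
  then have v: "valid u" "valid t" "valid s" "sr (dom u) = tg (dom t)" "sr (dom t) = tg (dom s)"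
    using valid_D[of u] valid_D[of t] by auto
  note d = valid_D[OF v(1)] valid_D[OF v(2)] valid_D[OF v(3)]
  have pc: "sr (cod u) = tg (cod t)" "sr (cod t) = tg (cod s)" using v d by simp_all
  let ?U = "raw u" and ?T = "raw t" and ?S = "raw s"
  let ?u = "dom u" and ?t = "dom t" and ?s = "dom s" and ?u' = "cod u" and ?t' = "cod t" and ?s' = "cod s"
  \<comment> \<open>\<open>coh_assoc\<close> solved for the left-bracketed coherence;
    \<open>B\<close> is its inverse, for the other boundary.\<close>
  have A: "coh (p @ q) r \<odot> (coh p q \<star> \<iota> (ev r)) = coh p (q @ r) \<odot> (\<iota> (ev p) \<star> coh q r) \<odot> vinv C (\<theta> (ev p) (ev q) (ev r))"
    if "pth p" "pth q" "pth r" "sr p = tg q" "sr q = tg r" for p q r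
  proof -
    have "coh (p @ q) r \<odot> (coh p q \<star> \<iota> (ev r)) =
      (coh (p @ q) r \<odot> (coh p q \<star> \<iota> (ev r)) \<odot> \<theta> (ev p) (ev q) (ev r)) \<odot> vinv C (\<theta> (ev p) (ev q) (ev r))"
      using that by simp
    also have "\<dots> = coh p (q @ r) \<odot> (\<iota> (ev p) \<star> coh q r) \<odot> vinv C (\<theta> (ev p) (ev q) (ev r))"
      unfolding coh_assoc[OF that, symmetric] using that by simp
    finally show ?thesis .
  qed
  have B: "(vinv C (coh p q) \<star> \<iota> (ev r)) \<odot> vinv C (coh (p @ q) r)
     = \<theta> (ev p) (ev q) (ev r) \<odot> (\<iota> (ev p) \<star> vinv C (coh q r)) \<odot> vinv C (coh p (q @ r))"
    if "pth p" "pth q" "pth r" "sr p = tg q" "sr q = tg r" for p q r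
    using arg_cong[OF A[OF that], of "vinv C"] that by simp
  have "raw (hc (hc u t) s) = coh (?u' @ ?t') ?s' \<odot>
      ((coh ?u' ?t' \<odot> (?U \<star> ?T) \<odot> vinv C (coh ?u ?t)) \<star> ?S) \<odot> vinv C (coh (?u @ ?t) ?s)"
    using v d by simp
  also have "(coh ?u' ?t' \<odot> (?U \<star> ?T) \<odot> vinv C (coh ?u ?t)) \<star> ?S
      = (coh ?u' ?t' \<star> \<iota> (ev ?s')) \<odot> ((?U \<star> ?T) \<star> ?S) \<odot> (vinv C (coh ?u ?t) \<star> \<iota> (ev ?s))"
    using v d by (simp add: hinter)
  finally have "raw (hc (hc u t) s) = (coh (?u' @ ?t') ?s' \<odot> (coh ?u' ?t' \<star> \<iota> (ev ?s'))) \<odot> ((?U \<star> ?T) \<star> ?S)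
     \<odot> ((vinv C (coh ?u ?t) \<star> \<iota> (ev ?s)) \<odot> vinv C (coh (?u @ ?t) ?s))"
    using v d by simp
  also have "\<dots> = coh ?u' (?t' @ ?s') \<odot> (\<iota> (ev ?u') \<star> coh ?t' ?s')
     \<odot> (vinv C (\<theta> (ev ?u') (ev ?t') (ev ?s')) \<odot> ((?U \<star> ?T) \<star> ?S))
     \<odot> \<theta> (ev ?u) (ev ?t) (ev ?s) \<odot> (\<iota> (ev ?u) \<star> vinv C (coh ?t ?s)) \<odot> vinv C (coh ?u (?t @ ?s))"
    unfolding A[OF d(2) d(11) d(20) pc] B[OF d(1) d(10) d(19) v(4,5)] using v d pc by simp
  also have "vinv C (\<theta> (ev ?u') (ev ?t') (ev ?s')) \<odot> ((?U \<star> ?T) \<star> ?S)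
     = (?U \<star> (?T \<star> ?S)) \<odot> vinv C (\<theta> (ev ?u) (ev ?t) (ev ?s))"
    using assoc_nat_inv[of ?S ?T ?U] v d by simp
  also have "coh ?u' (?t' @ ?s') \<odot> (\<iota> (ev ?u') \<star> coh ?t' ?s')
     \<odot> ((?U \<star> (?T \<star> ?S)) \<odot> vinv C (\<theta> (ev ?u) (ev ?t) (ev ?s)))
     \<odot> \<theta> (ev ?u) (ev ?t) (ev ?s) \<odot> (\<iota> (ev ?u) \<star> vinv C (coh ?t ?s)) \<odot> vinv C (coh ?u (?t @ ?s))
     = coh ?u' (?t' @ ?s') \<odot> ((\<iota> (ev ?u') \<star> coh ?t' ?s')
     \<odot> (?U \<star> (?T \<star> ?S)) \<odot> (\<iota> (ev ?u) \<star> vinv C (coh ?t ?s))) \<odot> vinv C (coh ?u (?t @ ?s))"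
    using v d by simp
  also have "(\<iota> (ev ?u') \<star> coh ?t' ?s') \<odot> (?U \<star> (?T \<star> ?S)) \<odot> (\<iota> (ev ?u) \<star> vinv C (coh ?t ?s))
     = ?U \<star> (coh ?t' ?s' \<odot> (?T \<star> ?S) \<odot> vinv C (coh ?t ?s))"
    using v d by (simp add: hinter)
  finally have "raw (hc (hc u t) s) = raw (hc u (hc t s))" using v d by simp
  then show ?thesis by (intro scell_eqI) (use v d in auto)
next
  case False
  moreover from False have "\<not> valid (hc u (hc t s))" using valid_D[of u] valid_D[of t] by auto
  ultimately show ?thesis by (metis hc_bad)
qed

lemma sid_notpth: "\<not> pth p \<Longrightarrow> sid p = bad" by (simp add: sid_def)

lemma hc_sid: "p \<noteq> [] \<Longrightarrow> q \<noteq> [] \<Longrightarrow> hc (sid p) (sid q) = sid (p @ q)"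
proof (cases "pth p \<and> pth q \<and> sr p = tg q")
  case True
  then show ?thesis by (intro scell_eqI) auto
next
  case False
  assume ne: "p \<noteq> []" "q \<noteq> []"
  have "\<not> valid (hc (sid p) (sid q))" using False by (auto simp: valid_hc)
  moreover have "\<not> pth (p @ q)" using False ne by auto
  ultimately show ?thesis by (metis hc_bad sid_notpth)
qed

lemma lw_Nil [simp]: "[] \<rhd> s = s" and rw_Nil [simp]: "s \<lhd> [] = s"
  by (auto simp: lw_def rw_def)

lemma lw_lw [simp]: "x \<rhd> y \<rhd> s = (x @ y) \<rhd> s"
  by (auto simp: lw_def hc_sid simp flip: hc_assoc)

lemma rw_rw [simp]: "s \<lhd> y \<lhd> z = s \<lhd> (y @ z)"
  by (auto simp: rw_def hc_sid hc_assoc)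

lemma rw_lw [simp]: "(x \<rhd> s) \<lhd> z = x \<rhd> s \<lhd> z"
  by (auto simp: rw_def lw_def hc_assoc)

lemma valid_lw [simp]: "x \<noteq> [] \<Longrightarrow> valid (x \<rhd> s) \<longleftrightarrow> valid s \<and> pth x \<and> sr x = tg (dom s)"
  by (auto simp: lw_def)

lemma valid_rw [simp]: "z \<noteq> [] \<Longrightarrow> valid (s \<lhd> z) \<longleftrightarrow> valid s \<and> pth z \<and> sr (dom s) = tg z"
  by (auto simp: rw_def)

lemma lw_simps [simp]:
  assumes "valid s" "pth x" "sr x = tg (dom s)"
  shows "dom (x \<rhd> s) = x @ dom s" "cod (x \<rhd> s) = x @ cod s"
  using assms by (auto simp: lw_def)

lemma rw_simps [simp]:
  assumes "valid s" "pth z" "sr (dom s) = tg z"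
  shows "dom (s \<lhd> z) = dom s @ z" "cod (s \<lhd> z) = cod s @ z"
  using assms by (auto simp: rw_def)

lemma lw_bad: "\<not> valid (x \<rhd> s) \<Longrightarrow> x \<noteq> [] \<Longrightarrow> x \<rhd> s = bad"
  by (metis hc_bad lw_def)

lemma rw_bad: "\<not> valid (s \<lhd> x) \<Longrightarrow> x \<noteq> [] \<Longrightarrow> s \<lhd> x = bad"
  by (metis hc_bad rw_def)

text \<open>Both sides are valid or invalid together, so no side condition remains and simp always
  reaches the normal form, a right-bracketed composite of whiskered cells.\<close>

lemma lw_vc [simp]: "x \<rhd> (t \<bullet> s) = (x \<rhd> t) \<bullet> (x \<rhd> s)"
proof (cases "x = [] \<or> valid (x \<rhd> (t \<bullet> s))")
  case True
  then show ?thesis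
  proof
    assume a: "valid (x \<rhd> (t \<bullet> s))"
    show ?thesis
    proof (cases "x = []")
      case False
      with a have v: "valid t" "valid s" "dom t = cod s" "pth x" "sr x = tg (dom s)" by auto
      show ?thesis using hc_vc[of s t "sid x" "sid x"] v False by (simp add: lw_def)
    qed simp
  qed simp
next
  case False
  then have n: "x \<noteq> []" "\<not> valid (x \<rhd> (t \<bullet> s))" by auto
  have "\<not> valid ((x \<rhd> t) \<bullet> (x \<rhd> s))"
  proof
    assume a: "valid ((x \<rhd> t) \<bullet> (x \<rhd> s))"
    then have "valid t" "valid s" "pth x" "sr x = tg (dom s)" "sr x = tg (dom t)" using n by auto
    with a n show False by auto
  qed
  then show ?thesis using n by (metis vc_bad lw_bad)
qed

lemma rw_vc [simp]: "(t \<bullet> s) \<lhd> x = (t \<lhd> x) \<bullet> (s \<lhd> x)"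
proof (cases "x = [] \<or> valid ((t \<bullet> s) \<lhd> x)")
  case True
  then show ?thesis
  proof
    assume a: "valid ((t \<bullet> s) \<lhd> x)"
    show ?thesis
    proof (cases "x = []")
      case False
      with a have v: "valid t" "valid s" "dom t = cod s" "pth x" "sr (dom s) = tg x" by auto
      show ?thesis using hc_vc[of "sid x" "sid x" s t] v False by (simp add: rw_def)
    qed simp
  qed simp
next
  case False
  then have n: "x \<noteq> []" "\<not> valid ((t \<bullet> s) \<lhd> x)" by auto
  have "\<not> valid ((t \<lhd> x) \<bullet> (s \<lhd> x))"
  proof
    assume a: "valid ((t \<lhd> x) \<bullet> (s \<lhd> x))"
    then have "valid t" "valid s" "pth x" "sr (dom s) = tg x" "sr (dom t) = tg x" using n by auto
    with a n show False by auto
  qed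
  then show ?thesis using n by (metis vc_bad rw_bad)
qed

lemma hc_whisk:
  assumes "valid s" "valid t" "sr (dom t) = tg (dom s)"
  shows "t \<lhd> cod s \<bullet> dom t \<rhd> s = hc t s" "cod t \<rhd> s \<bullet> t \<lhd> dom s = hc t s"
  using assms valid_D[OF assms(1)] valid_D[OF assms(2)]
    hc_vc[of s "sid (cod s)" "sid (dom t)" t] hc_vc[of "sid (dom s)" s t "sid (cod t)"]
  by (simp_all add: lw_def rw_def)

text \<open>
  Oriented interchange: the factor acting further to the left is moved to the outside.
\<close>

lemma slide0:
  assumes "valid s" "valid t" "Z = u @ dom t" "X = cod s @ u" "valid (X \<rhd> t)" "valid (s \<lhd> Z)"
  shows "(X \<rhd> t) \<bullet> (s \<lhd> Z) = (s \<lhd> (u @ cod t)) \<bullet> ((dom s @ u) \<rhd> t)"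
proof -
  note d = valid_D[OF assms(1)] valid_D[OF assms(2)]
  have t: "valid (u \<rhd> t)" "sr (dom s) = tg (dom (u \<rhd> t))" "dom (u \<rhd> t) = u @ dom t" "cod (u \<rhd> t) = u @ cod t"
    using assms(3-) d by (cases "u = []"; auto simp: assms(1,2))+
  have "(cod s \<rhd> (u \<rhd> t)) \<bullet> (s \<lhd> dom (u \<rhd> t)) = (s \<lhd> cod (u \<rhd> t)) \<bullet> (dom s \<rhd> (u \<rhd> t))"
    using hc_whisk[of "u \<rhd> t" s] assms(1) t by simp
  then show ?thesis using t assms(3,4) by simp
qed

text \<open>The length condition is a test, decided by simp, that \<open>t\<close> acts strictly to
  the right of \<open>s\<close>. It fails for the rewritten composite, so the rule does not
  loop.\<close>

lemma slide:
  assumes "valid ((X \<rhd> t \<lhd> z) \<bullet> (x \<rhd> s \<lhd> Z))" "valid s" "valid t" "length x + length (cod s) \<le> length X"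
  shows "(X \<rhd> t \<lhd> z) \<bullet> (x \<rhd> s \<lhd> Z)
    = (x \<rhd> s \<lhd> (drop (length x + length (cod s)) X @ cod t @ z))
      \<bullet> ((x @ dom s @ drop (length x + length (cod s)) X) \<rhd> t \<lhd> z)"
proof -
  \<comment> \<open>The segment of the path between the places where \<open>s\<close> and
    \<open>t\<close> act.\<close>
  define u where "u = drop (length x + length (cod s)) X"
  note d = valid_D[OF assms(2)] valid_D[OF assms(3)]
  have v: "valid (X \<rhd> t \<lhd> z)" "valid (x \<rhd> s \<lhd> Z)" "dom (X \<rhd> t \<lhd> z) = cod (x \<rhd> s \<lhd> Z)"
    using assms(1) by auto
  have Xn: "X \<noteq> []" using assms(4) d by auto
  have vt: "valid (t \<lhd> z)" "pth X" "sr X = tg (dom (t \<lhd> z))" "dom (t \<lhd> z) = dom t @ z"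
    using v(1) Xn assms(3) by (cases "z = []"; auto)+
  have dX: "dom (X \<rhd> t \<lhd> z) = X @ dom t @ z" using vt by simp
  have cd: "cod (x \<rhd> s \<lhd> Z) = x @ cod s @ Z"
    using v(2) assms(2) by (cases "x = []"; cases "Z = []") auto
  have e: "X @ dom t @ z = x @ cod s @ Z" using v(3) dX cd by simp
  then have X: "X = x @ cod s @ u"
  proof -
    have "take (length x + length (cod s)) (X @ dom t @ z) = x @ cod s" unfolding e by simp
    then have "take (length x + length (cod s)) X = x @ cod s" using assms(4) by simp
    then show ?thesis unfolding u_def using append_take_drop_id[of "length x + length (cod s)" X] by simp
  qed
  then have Z: "Z = u @ dom t @ z" using e by simp
  have Zn: "Z \<noteq> []" using Z d by auto
  have sZ: "valid (s \<lhd> Z)" using v(2) by (cases "x = []") auto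
  have sX: "valid ((cod s @ u) \<rhd> t \<lhd> z)"
    using v(1) X d vt by (cases "x = []") (auto simp: assms)
  have ct: "cod (t \<lhd> z) = cod t @ z" using vt(1) assms(3) by (cases "z = []") auto
  have "(cod s @ u) \<rhd> (t \<lhd> z) \<bullet> s \<lhd> Z = s \<lhd> (u @ cod t @ z) \<bullet> (dom s @ u) \<rhd> t \<lhd> z"
    using slide0[of s "t \<lhd> z" Z u "cod s @ u"] assms vt Z sZ sX ct by simp
  then have "x \<rhd> ((cod s @ u) \<rhd> (t \<lhd> z) \<bullet> s \<lhd> Z) = x \<rhd> (s \<lhd> (u @ cod t @ z) \<bullet> (dom s @ u) \<rhd> t \<lhd> z)"
    by simp
  then show ?thesis using X unfolding u_def[symmetric] by simp
qed

lemma slide_tail: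
  assumes "valid ((X \<rhd> t \<lhd> z) \<bullet> (x \<rhd> s \<lhd> Z))" "valid s" "valid t" "length x + length (cod s) \<le> length X"
  shows "(X \<rhd> t \<lhd> z) \<bullet> (x \<rhd> s \<lhd> Z) \<bullet> y
    = (x \<rhd> s \<lhd> (drop (length x + length (cod s)) X @ cod t @ z))
      \<bullet> ((x @ dom s @ drop (length x + length (cod s)) X) \<rhd> t \<lhd> z) \<bullet> y"
  by (simp only: vc_assoc[symmetric] slide[OF assms])

text \<open>Empty whiskers simplify away, so the patterns with an empty \<open>x\<close> or
  \<open>z\<close> have to be supplied separately; the tail versions apply inside a longer
  composite, which is bracketed to the right.\<close>

lemmas slides =
  slide slide[where x="[]", simplified] slide[where z="[]", simplified]
  slide[where x="[]" and z="[]", simplified]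
  slide_tail slide_tail[where x="[]", simplified] slide_tail[where z="[]", simplified]
  slide_tail[where x="[]" and z="[]", simplified]

lemma iso_valid [simp]: "iso s \<Longrightarrow> valid s" by (simp add: iso_def)

lemma sinv_simps [simp]:
  assumes "iso s"
  shows "iso (sinv s)" "valid (sinv s)" "dom (sinv s) = cod s" "cod (sinv s) = dom s"
    "sinv (sinv s) = s" "sinv s \<bullet> s = sid (dom s)" "s \<bullet> sinv s = sid (cod s)"
proof -
  have v: "valid s" "isoc (raw s)" using assms by (auto simp: iso_def)
  note d = valid_D[OF v(1)]
  show a: "dom (sinv s) = cod s" "cod (sinv s) = dom s" "valid (sinv s)"
    using v d by (auto simp: sinv_def valid_def)
  then show "iso (sinv s)" using v by (auto simp: sinv_def iso_def)
  show "sinv (sinv s) = s" using v by (simp add: sinv_def dom_def cod_def raw_def)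
  show "sinv s \<bullet> s = sid (dom s)" "s \<bullet> sinv s = sid (cod s)"
    by (intro scell_eqI; use v d a in \<open>simp add: sinv_def\<close>)+
qed

lemma sinv_tail [simp]:
  assumes "iso s" "valid y"
  shows "cod y = dom s \<Longrightarrow> sinv s \<bullet> s \<bullet> y = y" "cod y = cod s \<Longrightarrow> s \<bullet> sinv s \<bullet> y = y"
  using assms by (simp_all flip: vc_assoc)

lemma isoI:
  assumes "valid s" "valid t" "dom t = cod s" "cod t = dom s" "t \<bullet> s = sid (dom s)" "s \<bullet> t = sid (cod s)"
  shows "iso s" "sinv s = t"
proof -
  note d = valid_D[OF assms(1)] valid_D[OF assms(2)]
  have "raw t \<odot> raw s = \<iota> (ev (dom s))" "raw s \<odot> raw t = \<iota> (ev (cod s))"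
    using arg_cong[OF assms(5), of raw] arg_cong[OF assms(6), of raw] assms(1-4) d by simp_all
  then have "isoc (raw s)" "vinv C (raw s) = raw t"
    using isocI[of "raw s" "raw t"] d assms(1-4) by simp_all
  then show "iso s" "sinv s = t" using assms by (auto simp: iso_def sinv_def intro!: scell_eqI)
qed

lemma iso_vc [simp]:
  assumes "iso s" "iso t" "dom t = cod s"
  shows "iso (t \<bullet> s)" "sinv (t \<bullet> s) = sinv s \<bullet> sinv t"
  by (rule isoI[of _ "sinv s \<bullet> sinv t"]; use assms in simp)+

lemma lw_sid: "p \<noteq> [] \<Longrightarrow> x \<rhd> sid p = sid (x @ p)"
  by (auto simp: lw_def hc_sid)

lemma rw_sid: "p \<noteq> [] \<Longrightarrow> sid p \<lhd> x = sid (p @ x)"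
  by (auto simp: rw_def hc_sid)

lemma iso_sid [simp]: "pth p \<Longrightarrow> iso (sid p)" "pth p \<Longrightarrow> sinv (sid p) = sid p"
  by (rule isoI[of _ "sid p"]; simp)+

lemma iso_lw:
  assumes "iso s" "valid (x \<rhd> s)"
  shows "iso (x \<rhd> s) \<and> sinv (x \<rhd> s) = x \<rhd> sinv s"
proof (cases "x = []")
  case False
  have d: "valid s" "pth x" "sr x = tg (dom s)" using assms False by auto
  note e = valid_D[OF d(1)]
  show ?thesis using isoI[of "x \<rhd> s" "x \<rhd> sinv s"] d e assms
    by (simp add: lw_sid False flip: lw_vc)
qed (use assms in simp)

lemma iso_rw:
  assumes "iso s" "valid (s \<lhd> x)"
  shows "iso (s \<lhd> x) \<and> sinv (s \<lhd> x) = sinv s \<lhd> x"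
proof (cases "x = []")
  case False
  have d: "valid s" "pth x" "sr (dom s) = tg x" using assms False by auto
  note e = valid_D[OF d(1)]
  show ?thesis using isoI[of "s \<lhd> x" "sinv s \<lhd> x"] d e assms
    by (simp add: rw_sid False flip: rw_vc)
qed (use assms in simp)

lemma iso_whisk [simp]:
  "iso s \<Longrightarrow> pth x \<Longrightarrow> sr x = tg (dom s) \<Longrightarrow> iso (x \<rhd> s)"
  "iso s \<Longrightarrow> pth x \<Longrightarrow> sr x = tg (dom s) \<Longrightarrow> sinv (x \<rhd> s) = x \<rhd> sinv s"
  "iso s \<Longrightarrow> pth z \<Longrightarrow> sr (dom s) = tg z \<Longrightarrow> iso (s \<lhd> z)"
  "iso s \<Longrightarrow> pth z \<Longrightarrow> sr (dom s) = tg z \<Longrightarrow> sinv (s \<lhd> z) = sinv s \<lhd> z"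
  using iso_lw[of s x] iso_rw[of s z] by auto

lemma cancel_lr:
  assumes "iso s" "valid (x \<rhd> s \<lhd> z)"
  shows "x \<rhd> sinv s \<lhd> z \<bullet> x \<rhd> s \<lhd> z = sid (x @ dom s @ z)"
    "x \<rhd> s \<lhd> z \<bullet> x \<rhd> sinv s \<lhd> z = sid (x @ cod s @ z)"
  using assms valid_D[OF iso_valid[OF assms(1)]]
  by (simp_all add: lw_sid rw_sid flip: lw_vc rw_vc)

lemma cancel_lr_tail:
  assumes "iso s" "valid (x \<rhd> s \<lhd> z \<bullet> y)"
  shows "x \<rhd> sinv s \<lhd> z \<bullet> x \<rhd> s \<lhd> z \<bullet> y = y"
proof -
  have v: "valid s" "valid (s \<lhd> z)" "valid (x \<rhd> s \<lhd> z)" "valid y" "dom (x \<rhd> s \<lhd> z) = cod y"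
    using assms by (auto; cases "x = []"; auto)+
  have "dom (s \<lhd> z) = dom s @ z" using v by (cases "z = []") auto
  then have "dom (x \<rhd> s \<lhd> z) = x @ dom s @ z" using v(2,3) by (cases "x = []") auto
  then have c: "cod y = x @ dom s @ z" using v by simp
  have "x \<rhd> sinv s \<lhd> z \<bullet> x \<rhd> s \<lhd> z \<bullet> y = (x \<rhd> sinv s \<lhd> z \<bullet> x \<rhd> s \<lhd> z) \<bullet> y" by simp
  also have "\<dots> = y" unfolding cancel_lr(1)[OF assms(1) v(3)] using v c by simp
  finally show ?thesis .
qed

lemma cancel_lr_tail':
  assumes "iso s" "valid (x \<rhd> sinv s \<lhd> z \<bullet> y)"
  shows "x \<rhd> s \<lhd> z \<bullet> x \<rhd> sinv s \<lhd> z \<bullet> y = y"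
  using cancel_lr_tail[of "sinv s" x z y] assms by simp

lemmas cancels =
  cancel_lr cancel_lr[where x="[]", simplified] cancel_lr[where z="[]", simplified]
  cancel_lr_tail cancel_lr_tail[where x="[]", unfolded lw_Nil] cancel_lr_tail[where z="[]", unfolded rw_Nil]
  cancel_lr_tail' cancel_lr_tail'[where x="[]", unfolded lw_Nil] cancel_lr_tail'[where z="[]", unfolded rw_Nil]

end

section \<open>Passage between paths and their composites\<close>

context bicategory
begin

text \<open>The underlying 2-morphism is an identity, but the path changes. For a path of two
  morphisms, whiskering on the right makes it an associator of \<open>C\<close>; the rebracketings
  in the definitions of the operations are expressed through it.\<close>

definition kap :: "'m list \<Rightarrow> ('m, 'c) scell" where
  "kap p = (p, \<iota> (ev p), [ev p])"

lemma kap_simps [simp]: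
  "dom (kap p) = p" "cod (kap p) = [ev p]" "valid (kap p) \<longleftrightarrow> pth p" "pth p \<Longrightarrow> iso (kap p)"
  "raw (kap p) = \<iota> (ev p)" "pth p \<Longrightarrow> raw (sinv (kap p)) = \<iota> (ev p)"
  by (auto simp: kap_def valid_triple iso_def sinv_def)

lemma coh_ev: "pth p \<Longrightarrow> coh p [ev q] = coh p q"
proof (induction p)
  case (Cons a p)
  then show ?case by (cases "p = []") auto
qed simp

lemma raw_lw: "valid s \<Longrightarrow> pth x \<Longrightarrow> sr x = tg (dom s) \<Longrightarrow>
   raw (x \<rhd> s) = coh x (cod s) \<odot> (\<iota> (ev x) \<star> raw s) \<odot> vinv C (coh x (dom s))"
  by (simp add: lw_def)

lemma raw_rw: "valid s \<Longrightarrow> pth z \<Longrightarrow> sr (dom s) = tg z \<Longrightarrow>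
   raw (s \<lhd> z) = coh (cod s) z \<odot> (raw s \<star> \<iota> (ev z)) \<odot> vinv C (coh (dom s) z)"
  by (simp add: rw_def)

lemma raw_lw_kap:
  assumes "pth x" "pth p" "sr x = tg p"
  shows "raw (x \<rhd> kap p) = \<iota> (ev (x @ p))" "raw (x \<rhd> sinv (kap p)) = \<iota> (ev (x @ p))"
  using assms by (simp_all add: raw_lw coh_ev)

lemma raw_lw1:
  assumes "valid s" "f \<in> Mor C" "src C f = tg (dom s)"
  shows "raw ([f] \<rhd> s) = \<iota> f \<star> raw s"
  using assms valid_D[OF assms(1)] by (simp add: raw_lw)

lemma lw_triple:
  assumes "valid (p, a, q)" "f \<in> Mor C" "src C f = tg p"
  shows "[f] \<rhd> (p, a, q) = (f # p, \<iota> f \<star> a, f # q)"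
  using assms by (intro scell_eqI) (simp_all add: raw_lw1)

text \<open>Replacing the tail of a path by its composite does not change the right-bracketed
  composite, so both 2-cells have the same underlying 2-morphism. This turns 2-cells found on long
  paths into data made of single morphisms.\<close>

lemma collapse_right:
  assumes "valid s" "dom s = x @ p" "cod s = y @ q" "x \<noteq> []" "y \<noteq> []" "p \<noteq> []" "q \<noteq> []"
  shows "(x @ [ev p], raw s, y @ [ev q]) = y \<rhd> kap q \<bullet> s \<bullet> x \<rhd> sinv (kap p)"
proof -
  have d: "pth x" "pth p" "pth y" "pth q" "sr x = tg p" "sr y = tg q" "raw s \<in> Cell C"
     "dm C (raw s) = ev (x @ p)" "cd C (raw s) = ev (y @ q)"
    using valid_D[OF assms(1)] assms by auto
  show ?thesis using d assms by (intro scell_eqI) (simp_all add: raw_lw_kap)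
qed

lemma collapse:
  assumes "valid s"
  shows "([ev (dom s)], raw s, [ev (cod s)]) = kap (cod s) \<bullet> s \<bullet> sinv (kap (dom s))"
  using assms valid_D[OF assms] by (intro scell_eqI) simp_all

lemma valid_collapse: "valid s \<Longrightarrow> valid ([ev (dom s)], raw s, [ev (cod s)])"
  using valid_D[of s] by (simp add: valid_triple)

text \<open>Paths absorb associators but not identity morphisms, so unitors survive as 2-cells. The
  left one is taken for whole paths, as its naturality in \<open>lu_natural\<close>
  requires.\<close>

definition ru :: "'m \<Rightarrow> ('m, 'c) scell" where "ru f = ([f, \<one> (src C f)], \<pi> f, [f])"
definition lu :: "'m list \<Rightarrow> ('m, 'c) scell" where "lu p = (\<one> (tg p) # p, \<upsilon> (ev p), p)"

lemma tg_Ob [simp]: "pth p \<Longrightarrow> tg p \<in> Ob C" and sr_Ob [simp]: "pth p \<Longrightarrow> sr p \<in> Ob C"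
  using tgt_Ob[of "ev p"] src_Ob[of "ev p"] by auto

lemma srctgt_Ob [simp]: "f \<in> Mor C \<Longrightarrow> tgt C f \<in> Ob C" "f \<in> Mor C \<Longrightarrow> src C f \<in> Ob C"
  using tgt_Ob src_Ob by auto

lemma ru_simps [simp]: "dom (ru f) = [f, \<one> (src C f)]" "cod (ru f) = [f]" "f \<in> Mor C \<Longrightarrow> iso (ru f)"
  by (auto simp: ru_def iso_def valid_triple)

lemma lu_simps [simp]: "dom (lu p) = \<one> (tg p) # p" "cod (lu p) = p" "pth p \<Longrightarrow> iso (lu p)"
  by (auto simp: lu_def iso_def valid_triple)

lemma lu_natural:
  assumes "valid s" shows "lu (cod s) \<bullet> [\<one> (tg (dom s))] \<rhd> s = s \<bullet> lu (dom s)"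
proof -
  note d = valid_D[OF assms]
  show ?thesis
  proof (rule scell_eqI)
    have "\<upsilon> (ev (cod s)) \<odot> (\<iota> (\<one> (tg (dom s))) \<star> raw s) = raw s \<odot> \<upsilon> (ev (dom s))"
      by (rule left_unitor_natural[OF hom_I cells_I]) (use d in auto)
    then show "raw (lu (cod s) \<bullet> [\<one> (tg (dom s))] \<rhd> s) = raw (s \<bullet> lu (dom s))"
      using d assms by (simp add: raw_lw1) (simp add: lu_def)
  qed (use d assms in auto)
qed

lemma triangle_scell:
  assumes "pth p" "f \<in> Mor C" "src C f = tg p"
  shows "ru f \<lhd> p = [f] \<rhd> lu p"
proof (rule scell_eqI)
  have "(\<pi> f \<star> \<iota> (ev p)) \<odot> \<theta> f (\<one> (tgt C (ev p))) (ev p) = \<iota> f \<star> \<upsilon> (ev p)"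
    by (rule triangle[OF hom_I hom_I]) (use assms in auto)
  then show "raw (ru f \<lhd> p) = raw ([f] \<rhd> lu p)"
    using assms by (simp add: raw_lw1 raw_rw) (simp add: ru_def lu_def)
qed (use assms in auto)

text \<open>On paths the associators inserted by \<open>pull\<close> disappear and plain whiskering
  is left; \<open>push\<close> becomes conjugation by the cells \<open>kap\<close> that form
  composites.\<close>

lemma pull_triple:
  assumes "valid ([g, x], a, [g', x'])" "z \<in> Mor C" "src C x = tgt C z"
  shows "([g, x, z], pull C g x g' x' a z, [g', x', z]) = ([g, x], a, [g', x']) \<lhd> [z]"
proof -
  note d = valid_D[OF assms(1), simplified]
  show ?thesis by (rule scell_eqI) (use d assms in \<open>simp_all add: raw_rw pull_def\<close>)
qed

lemma push_triple:
  assumes "valid ([g, x, z], a, [g', x', z'])"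
  shows "([g \<cdot> x, z], push C g x z g' x' z' a, [g' \<cdot> x', z'])
     = kap [g', x'] \<lhd> [z'] \<bullet> ([g, x, z], a, [g', x', z']) \<bullet> sinv (kap [g, x]) \<lhd> [z]"
proof -
  note d = valid_D[OF assms(1), simplified]
  show ?thesis by (rule scell_eqI) (use d assms in \<open>simp_all add: raw_rw push_def\<close>)
qed

lemma raw_sinv: "raw (sinv s) = vinv C (raw s)"
  by (simp add: sinv_def)

lemma sinv_triple: "sinv (p, a, q) = (q, vinv C a, p)"
  by (simp add: sinv_def)

lemma triple_eta: "(dom s, raw s, cod s) = s"
  by (simp add: dom_def raw_def cod_def)

end

section \<open>The axioms (BF) for paths\<close>

context BF
begin

lemma inv_cell_iso: "a \<in> inv_cells C (ev p) (ev q) \<Longrightarrow> pth p \<Longrightarrow> pth q \<Longrightarrow> iso (p, a, q)"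
  by (simp add: inv_cells_iff iso_def valid_triple)

lemma iso_inv_cell: "iso s \<Longrightarrow> raw s \<in> inv_cells C (ev (dom s)) (ev (cod s))"
  using valid_D[of s] by (simp add: inv_cells_iff iso_def)

definition WP :: "'m list \<Rightarrow> bool" where "WP p \<longleftrightarrow> pth p \<and> ev p \<in> W"

lemma WP_pth [simp]: "WP p \<Longrightarrow> pth p" by (simp add: WP_def)

lemma WP_iso: assumes "iso s" shows "WP (cod s) \<longleftrightarrow> WP (dom s)"
proof -
  note d = valid_D[OF iso_valid[OF assms]]
  have "raw s \<in> inv_cells C (ev (dom s)) (ev (cod s))" using iso_inv_cell[OF assms] .
  moreover have "vinv C (raw s) \<in> inv_cells C (ev (cod s)) (ev (dom s))"
    using iso_inv_cell[OF sinv_simps(1)[OF assms]] assms by (simp add: raw_sinv)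
  ultimately show ?thesis unfolding WP_def using d BF5 by blast
qed

lemma WP_single [simp]: "WP [f] \<longleftrightarrow> f \<in> W"
  using W_Mor by (auto simp: WP_def)

lemma WP_id [simp]: "A \<in> Ob C \<Longrightarrow> \<one> A \<in> W" by (rule BF1)

lemma WP_append: assumes "WP p" "WP q" "sr p = tg q" shows "WP (p @ q)"
proof -
  have "ev p \<cdot> ev q \<in> W" using BF2[of "ev q" "ev p"] assms by (auto simp: WP_def)
  moreover have "coh p q \<in> inv_cells C (ev p \<cdot> ev q) (ev (p @ q))"
    using coh_raw[of p q] assms by (simp add: inv_cells_iff)
  then have "vinv C (coh p q) \<in> inv_cells C (ev (p @ q)) (ev p \<cdot> ev q)"
    by (simp add: inv_cells_iff)
  ultimately show ?thesis using BF5 assms by (auto simp: WP_def)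
qed

lemma bf3:
  assumes "WP w" "pth p" "tg p = tg w"
  obtains z x s where "WP z" "tg z = sr p" "iso s" "dom s = p @ z" "cod s = w @ x" "pth x" "tg x = sr w" "sr x = sr z"
proof -
  have w: "ev w \<in> W" "ev w \<in> hom C (sr w) (tg w)" "ev p \<in> hom C (sr p) (tg w)"
    using assms by (auto simp: WP_def hom_def)
  from BF3[OF w] obtain D z x where z: "z \<in> hom C D (sr p)" "x \<in> hom C D (sr w)" "z \<in> W"
    "inv_cells C (ev p \<cdot> z) (ev w \<cdot> x) \<noteq> {}" by blast
  then obtain r where r: "r \<in> inv_cells C (ev p \<cdot> z) (ev w \<cdot> x)" by blast
  define s where "s = sinv (kap w) \<lhd> [x] \<bullet> ([ev p, z], r, [ev w, x]) \<bullet> kap p \<lhd> [z]"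
  have rs: "iso ([ev p, z], r, [ev w, x])"
    by (rule inv_cell_iso) (use r z assms in \<open>auto simp: hom_def\<close>)
  show ?thesis
    by (rule that[of "[z]" s "[x]"]) (use rs z assms in \<open>auto simp: hom_def s_def\<close>)
qed

lemma lift_aux:
  assumes w: "w \<in> W" and p: "pth p1" "pth p2" "src C w = tg p1" "tg p2 = tg p1" "sr p2 = sr p1"
    and L: "lifts C W w (ev p1) (ev p2) a D v \<beta>"
    and s: "valid s" "dom s = w # p1" "cod s = w # p2" "raw s = a"
  defines "t \<equiv> sinv (kap p2) \<lhd> [v] \<bullet> ([ev p1, v], \<beta>, [ev p2, v]) \<bullet> kap p1 \<lhd> [v]"
  shows "WP [v]" "valid t" "dom t = p1 @ [v]" "cod t = p2 @ [v]" "s \<lhd> [v] = [w] \<rhd> t" "tgt C v = sr p1"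
    "\<beta> \<in> inv_cells C (ev p1 \<cdot> v) (ev p2 \<cdot> v) \<Longrightarrow> iso t"
proof -
  have l: "v \<in> W" "v \<in> Mor C" "tgt C v = sr p1" "\<beta> \<in> Cell C" "dm C \<beta> = ev p1 \<cdot> v" "cd C \<beta> = ev p2 \<cdot> v"
    "a \<star> \<iota> v = \<theta> w (ev p2) v \<odot> (\<iota> w \<star> \<beta>) \<odot> vinv C (\<theta> w (ev p1) v)"
    using L p by (auto simp: lifts_def hom_def cells_def)
  have wM: "w \<in> Mor C" using w W_Mor by auto
  let ?b = "([ev p1, v], \<beta>, [ev p2, v])"
  have b: "valid ?b" using l p by (simp add: valid_triple)
  show "WP [v]" "tgt C v = sr p1" using l by auto
  show "valid t" "dom t = p1 @ [v]" "cod t = p2 @ [v]" using b l p by (auto simp: t_def)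
  let ?a = "([w, ev p1], a, [w, ev p2])"
  have a: "?a = [w] \<rhd> kap p2 \<bullet> s \<bullet> [w] \<rhd> sinv (kap p1)"
    using collapse_right[OF s(1), of "[w]" p1 "[w]" p2] s p by auto
  have va: "valid ?a" unfolding a using s p wM by simp
  have e: "([w, ev p1] @ [v], pull C w (ev p1) w (ev p2) a v, [w, ev p2] @ [v]) = ?a \<lhd> [v]"
    using pull_triple[OF va, of v] l p by simp
  have "pull C w (ev p1) w (ev p2) a v = \<iota> w \<star> \<beta>"
    unfolding pull_def l(7) using l p wM by simp
  then have "?a \<lhd> [v] = [w] \<rhd> ?b" using e lw_triple[OF b, of w] wM p by simp
  then have *: "([w] \<rhd> kap p2 \<bullet> s \<bullet> [w] \<rhd> sinv (kap p1)) \<lhd> [v] = [w] \<rhd> ?b" unfolding a .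
  have "s \<lhd> [v] = [w] \<rhd> sinv (kap p2) \<lhd> [v] \<bullet> (([w] \<rhd> kap p2 \<bullet> s \<bullet> [w] \<rhd> sinv (kap p1)) \<lhd> [v]) \<bullet> [w] \<rhd> kap p1 \<lhd> [v]"
    using s p wM l by (simp add: cancels)
  then show "s \<lhd> [v] = [w] \<rhd> t" unfolding * t_def by simp
  show "iso t" if "\<beta> \<in> inv_cells C (ev p1 \<cdot> v) (ev p2 \<cdot> v)"
  proof -
    have "iso ?b" by (rule inv_cell_iso) (use that l p in auto)
    then show ?thesis unfolding t_def using p l by simp
  qed
qed

lemma unkap_right:
  assumes "pth w" "valid s" "dom s = w @ p1" "cod s = w @ p2" "pth p1" "pth p2"
    "kap w \<lhd> p2 \<bullet> s \<bullet> sinv (kap w) \<lhd> p1 = [ev w] \<rhd> t" "valid t" "dom t = p1" "cod t = p2"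
  shows "s = w \<rhd> t"
proof -
  have j: "sr w = tg p1" "sr w = tg p2" using valid_D[OF assms(2)] assms by auto
  have "s = sinv (kap w) \<lhd> p2 \<bullet> (kap w \<lhd> p2 \<bullet> s \<bullet> sinv (kap w) \<lhd> p1) \<bullet> kap w \<lhd> p1"
    using assms(1-6) j by (simp add: cancels)
  also have "\<dots> = w \<rhd> t" unfolding assms(7) using assms j by (simp add: slides cancels)
  finally show ?thesis .
qed

lemma lift:
  assumes w: "WP w" and p: "pth p1" "pth p2" and s: "valid s" "dom s = w @ p1" "cod s = w @ p2"
  obtains z t where "WP z" "tg z = sr p1" "valid t" "dom t = p1 @ z" "cod t = p2 @ z" "s \<lhd> z = w \<rhd> t" "iso s \<Longrightarrow> iso t"
proof -
  have j: "sr w = tg p1" "sr w = tg p2" "pth w" "ev w \<in> W" "sr p2 = sr p1" "tg p2 = tg p1"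
    using valid_D[OF s(1)] s w p by (auto simp: WP_def)
  let ?s = "kap w \<lhd> p2 \<bullet> s \<bullet> sinv (kap w) \<lhd> p1"
  have s': "valid ?s" "dom ?s = ev w # p1" "cod ?s = ev w # p2" using s j p by auto
  have h: "ev w \<in> hom C (tg p1) (tg w)" "ev p1 \<in> hom C (sr p1) (tg p1)" "ev p2 \<in> hom C (sr p1) (tg p1)"
    using j p by (auto simp: hom_def)
  have hs: "raw ?s \<in> cells C (ev w \<cdot> ev p1) (ev w \<cdot> ev p2)"
    using valid_D[OF s'(1)] s' p by (auto simp: cells_def)
  \<comment> \<open>One lift serves both purposes: for invertible \<open>s\<close> it is taken from
    (BF4b), because a lift given by (BF4a) need not be the invertible one.\<close>
  have "\<exists>D v \<beta>. lifts C W (ev w) (ev p1) (ev p2) (raw ?s) D v \<beta> \<and> (iso s \<longrightarrow> \<beta> \<in> inv_cells C (ev p1 \<cdot> v) (ev p2 \<cdot> v))"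
  proof (cases "iso s")
    case True
    then have "iso ?s" using s j p by simp
    then have "raw ?s \<in> inv_cells C (ev w \<cdot> ev p1) (ev w \<cdot> ev p2)"
      using iso_inv_cell[of ?s] s' p by simp
    then show ?thesis using BF4b[OF j(4) h] by blast
  next
    case False
    then show ?thesis using BF4a[OF j(4) h hs] by blast
  qed
  then obtain D v \<beta> where L: "lifts C W (ev w) (ev p1) (ev p2) (raw ?s) D v \<beta>"
     and i: "iso s \<Longrightarrow> \<beta> \<in> inv_cells C (ev p1 \<cdot> v) (ev p2 \<cdot> v)" by blast
  define t where "t = sinv (kap p2) \<lhd> [v] \<bullet> ([ev p1, v], \<beta>, [ev p2, v]) \<bullet> kap p1 \<lhd> [v]"
  have e: "src C (ev w) = tg p1" using j by simp
  note A = lift_aux[OF j(4) p(1,2) e j(6) j(5) L s'(1-3) refl, folded t_def]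
  have v: "v \<in> Mor C" "tgt C v = sr p1" using A(1,6) WP_pth[OF A(1)] by auto
  have e7: "kap w \<lhd> (p2 @ [v]) \<bullet> s \<lhd> [v] \<bullet> sinv (kap w) \<lhd> (p1 @ [v]) = [ev w] \<rhd> t"
    using A(5) by simp
  have "s \<lhd> [v] = w \<rhd> t"
    by (rule unkap_right[OF j(3) _ _ _ _ _ e7 A(2,3,4)]) (use v s p j in simp_all)
  then show ?thesis
    using that[of "[v]" t] A i v by auto
qed

text \<open>(BF4c) read as left cancellation: restricted along the identity of their source,
  \<open>a\<close> and \<open>b\<close> are two lifts of the same 2-morphism. Hence they agree up to
  some \<zeta>, which interchange moves across so that it can be cancelled.\<close>

lemma cancel_aux:
  assumes w: "w \<in> W" "src C w = tgt C f" and s: "valid ([f], a, [g])" "valid ([f], b, [g])"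
    and e: "\<iota> w \<star> a = \<iota> w \<star> b"
  obtains z where "WP z" "tg z = src C f" "([f], a, [g]) \<lhd> z = ([f], b, [g]) \<lhd> z"
proof -
  have wM: "w \<in> Mor C" using w W_Mor by auto
  let ?E = "src C f" and ?a = "([f], a, [g])" and ?b = "([f], b, [g])"
  note d = valid_D[OF s(1), simplified] valid_D[OF s(2), simplified]
  have la: "lifts C W w f g (\<iota> w \<star> c) ?E (\<one> ?E) (c \<star> \<iota> (\<one> ?E))"
    if "valid ([f], c, [g])" for c
  proof -
    note d' = valid_D[OF that, simplified]
    have "\<theta> w g (\<one> ?E) \<odot> (\<iota> w \<star> (c \<star> \<iota> (\<one> ?E))) \<odot> vinv C (\<theta> w f (\<one> ?E))
       = (\<theta> w g (\<one> ?E) \<odot> (\<iota> w \<star> (c \<star> \<iota> (\<one> ?E)))) \<odot> vinv C (\<theta> w f (\<one> ?E))"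
      using d' wM w by simp
    also have "\<theta> w g (\<one> ?E) \<odot> (\<iota> w \<star> (c \<star> \<iota> (\<one> ?E))) = ((\<iota> w \<star> c) \<star> \<iota> (\<one> ?E)) \<odot> \<theta> w f (\<one> ?E)"
      using assoc_nat[of "\<iota> (\<one> ?E)" c "\<iota> w"] d' wM w by simp
    finally show ?thesis using d' wM w by (simp add: lifts_def hom_def cells_def)
  qed
  have h: "w \<in> hom C (tgt C f) (tgt C w)" "f \<in> hom C ?E (tgt C f)" "g \<in> hom C ?E (tgt C f)"
    "\<iota> w \<star> a \<in> cells C (w \<cdot> f) (w \<cdot> g)"
    using d w wM by (auto simp: hom_def cells_def)
  obtain E u u' \<zeta> where u: "u \<in> hom C E ?E" "u' \<in> hom C E ?E" "\<zeta> \<in> inv_cells C (\<one> ?E \<cdot> u) (\<one> ?E \<cdot> u')"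
    "\<one> ?E \<cdot> u \<in> W"
    "vinv C (\<theta> g (\<one> ?E) u') \<odot> ((b \<star> \<iota> (\<one> ?E)) \<star> \<iota> u') \<odot> \<theta> f (\<one> ?E) u' \<odot> (\<iota> f \<star> \<zeta>)
          = (\<iota> g \<star> \<zeta>) \<odot> vinv C (\<theta> g (\<one> ?E) u) \<odot> ((a \<star> \<iota> (\<one> ?E)) \<star> \<iota> u) \<odot> \<theta> f (\<one> ?E) u"
    using BF4c[OF w(1) h la[OF s(1)] la[OF s(2), folded e]] by blast
  have um: "u \<in> Mor C" "u' \<in> Mor C" "tgt C u = ?E" "tgt C u' = ?E" "src C u = E" "src C u' = E"
    using u by (auto simp: hom_def)
  let ?z = "([\<one> ?E, u], \<zeta>, [\<one> ?E, u'])"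
  have z: "iso ?z" by (rule inv_cell_iso) (use u um d in auto)
  have rz: "raw (([f], c, [g]) \<lhd> [\<one> ?E, x]) = vinv C (\<theta> g (\<one> ?E) x) \<odot> ((c \<star> \<iota> (\<one> ?E)) \<star> \<iota> x) \<odot> \<theta> f (\<one> ?E) x"
    if "valid ([f], c, [g])" "x \<in> Mor C" "tgt C x = ?E" for c x
  proof -
    note d' = valid_D[OF that(1), simplified]
    have "([f], c, [g]) \<lhd> [\<one> ?E, x] = ([f], c, [g]) \<lhd> [\<one> ?E] \<lhd> [x]" by simp
    also have "raw \<dots> = vinv C (\<theta> g (\<one> ?E) x) \<odot> ((c \<star> \<iota> (\<one> ?E)) \<star> \<iota> x) \<odot> \<theta> f (\<one> ?E) x"
      using that d' by (simp add: raw_rw del: rw_rw)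
    finally show ?thesis .
  qed
  have "?b \<lhd> [\<one> ?E, u'] \<bullet> [f] \<rhd> ?z = [g] \<rhd> ?z \<bullet> ?a \<lhd> [\<one> ?E, u]"
    by (rule scell_eqI) (use u(5) s d um z valid_D[OF iso_valid[OF z], simplified] in \<open>simp_all add: rz raw_lw1\<close>)
  also have "\<dots> = ?a \<lhd> [\<one> ?E, u'] \<bullet> [f] \<rhd> ?z"
    using s z d um by (simp add: slides)
  finally have "(?b \<lhd> [\<one> ?E, u'] \<bullet> [f] \<rhd> ?z) \<bullet> sinv ([f] \<rhd> ?z) = (?a \<lhd> [\<one> ?E, u'] \<bullet> [f] \<rhd> ?z) \<bullet> sinv ([f] \<rhd> ?z)"
    by simp
  then have "?b \<lhd> [\<one> ?E, u'] = ?a \<lhd> [\<one> ?E, u']"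
    using s z d um by (simp add: cancels)
  \<comment> \<open>(BF4c) puts the path through \<open>u\<close> into \<open>W\<close>; \<zeta>
    carries this over to the path through \<open>u'\<close>, along which the two cells now
    agree.\<close>
  moreover have "WP [\<one> ?E, u]" using u um d by (simp add: WP_def)
  then have "WP [\<one> ?E, u']" using WP_iso[OF z] by simp
  ultimately show ?thesis using that[of "[\<one> ?E, u']"] d by auto
qed

lemma cancel:
  assumes w: "WP w" "sr w = tg (dom s)" and s: "valid s" "valid t" "dom t = dom s" "cod t = cod s"
    and e: "w \<rhd> s = w \<rhd> t"
  obtains z where "WP z" "tg z = sr (dom s)" "s \<lhd> z = t \<lhd> z"
proof -
  note d = valid_D[OF s(1)]
  let ?f = "ev (dom s)" and ?g = "ev (cod s)"
  have wM: "ev w \<in> Mor C" "src C (ev w) = tg (dom s)" using w by auto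
  have 1: "[ev w] \<rhd> r = kap w \<lhd> cod r \<bullet> (w \<rhd> r) \<bullet> sinv (kap w) \<lhd> dom r" if "valid r" "dom r = dom s" for r
    using that w valid_D[OF that(1)] by (simp add: slides cancels)
  have "[ev w] \<rhd> s = [ev w] \<rhd> t" using 1[of s] 1[of t] s e by simp
  then have "\<iota> (ev w) \<star> raw s = \<iota> (ev w) \<star> raw t"
    using raw_lw1[of s "ev w"] raw_lw1[of t "ev w"] s wM by simp
  then obtain z where z: "WP z" "tg z = src C ?f" "([?f], raw s, [?g]) \<lhd> z = ([?f], raw t, [?g]) \<lhd> z"
    using cancel_aux[of "ev w" ?f "raw s" ?g "raw t"] w wM s d valid_collapse[OF s(1)] valid_collapse[OF s(2)]
    by (auto simp: WP_def)
  have "r \<lhd> z = sinv (kap (cod r)) \<lhd> z \<bullet> (([ev (dom r)], raw r, [ev (cod r)]) \<lhd> z) \<bullet> kap (dom r) \<lhd> z"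
    if "valid r" "dom r = dom s" for r
    unfolding collapse[OF that(1)] using z that valid_D[OF that(1)] by (simp add: cancels)
  then have "s \<lhd> z = t \<lhd> z" using z s by simp
  then show ?thesis using that z d by simp
qed

section \<open>Germs\<close>

text \<open>Lifts through members of \<open>W\<close> are unique only after a further restriction;
  this relation is the resulting substitute for equality.\<close>

definition germ :: "('m, 'c) scell \<Rightarrow> ('m, 'c) scell \<Rightarrow> bool" (infix "\<approx>" 50) where
  "s \<approx> t \<longleftrightarrow> valid s \<and> valid t \<and> dom t = dom s \<and> cod t = cod s
     \<and> (\<exists>z. WP z \<and> tg z = sr (dom s) \<and> s \<lhd> z = t \<lhd> z)"

lemma germ_D: "s \<approx> t \<Longrightarrow> valid s" "s \<approx> t \<Longrightarrow> valid t" "s \<approx> t \<Longrightarrow> dom t = dom s" "s \<approx> t \<Longrightarrow> cod t = cod s"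
  by (auto simp: germ_def)

lemma germ_refl [simp]: "s \<approx> s \<longleftrightarrow> valid s"
proof -
  \<comment> \<open>An identity serves as the trivial restriction, as the empty list is not a
    path.\<close>
  have "valid s \<Longrightarrow> WP [\<one> (sr (dom s))] \<and> tg [\<one> (sr (dom s))] = sr (dom s)" using valid_D[of s] by auto
  then show ?thesis unfolding germ_def by blast
qed

lemma germ_sym: "s \<approx> t \<Longrightarrow> t \<approx> s" by (auto simp: germ_def)

text \<open>By interchange, restricting along an isomorphic path conjugates the restriction by
  whiskerings of \<zeta>.\<close>

lemma restrict_iso:
  assumes "valid s" "valid t" "dom t = dom s" "cod t = cod s" "pth x" "tg x = sr (dom s)"
    "s \<lhd> x = t \<lhd> x" "iso \<zeta>" "dom \<zeta> = x" "cod \<zeta> = y"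
  shows "s \<lhd> y = t \<lhd> y"
proof -
  note d = valid_D[OF assms(1)] valid_D[OF assms(2)] valid_D[OF iso_valid[OF assms(8)]]
  have 1: "r \<lhd> y = cod r \<rhd> \<zeta> \<bullet> (r \<lhd> x) \<bullet> dom r \<rhd> sinv \<zeta>" if "valid r" "dom r = dom s" for r
    using that assms d valid_D[OF that(1)] by (simp add: slides cancels)
  show ?thesis using 1[of s] 1[of t] assms by simp
qed

lemma restrict_iso':
  assumes "valid s" "valid t" "dom t = dom s" "cod t = cod s" "pth y" "tg y = sr (dom s)"
    "s \<lhd> y = t \<lhd> y" "iso \<zeta>" "dom \<zeta> = x" "cod \<zeta> = y"
  shows "s \<lhd> x = t \<lhd> x"
  by (rule restrict_iso[of s t y "sinv \<zeta>" x]) (use assms in auto)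

lemma germ_E:
  assumes "s \<approx> t"
  obtains z where "WP z" "tg z = sr (dom s)" "s \<lhd> z = t \<lhd> z"
  using assms by (auto simp: germ_def)

lemma germ_I:
  "valid s \<Longrightarrow> valid t \<Longrightarrow> dom t = dom s \<Longrightarrow> cod t = cod s \<Longrightarrow> WP z \<Longrightarrow> tg z = sr (dom s) \<Longrightarrow> s \<lhd> z = t \<lhd> z \<Longrightarrow> s \<approx> t"
  by (auto simp: germ_def)

text \<open>An Ore argument: (BF3) completes \<open>h\<close> and the witness \<open>z\<close> to a
  square whose side over \<open>h\<close> lies in \<open>W\<close>, and agreement along
  \<open>z @ x\<close> passes to the isomorphic path \<open>h @ y\<close>. Transitivity of germs and
  their restriction rest on it.\<close>

lemma germ_restrict_along:
  assumes "s \<approx> t" "pth h" "tg h = sr (dom s)"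
  obtains y where "WP y" "tg y = sr h" "s \<lhd> (h @ y) = t \<lhd> (h @ y)"
proof -
  obtain z where z: "WP z" "tg z = sr (dom s)" "s \<lhd> z = t \<lhd> z" using germ_E[OF assms(1)] .
  obtain y x \<zeta> where y: "WP y" "tg y = sr h" "iso \<zeta>" "dom \<zeta> = h @ y" "cod \<zeta> = z @ x" "pth x" "tg x = sr z" "sr x = sr y"
    by (rule bf3[of z h]) (use z assms in auto)
  have "s \<lhd> (z @ x) = t \<lhd> (z @ x)" using z(3) by (simp flip: rw_rw)
  then have "s \<lhd> (h @ y) = t \<lhd> (h @ y)"
    using restrict_iso'[of s t "z @ x" \<zeta> "h @ y"] germ_D[OF assms(1)] y z by auto
  then show ?thesis using that y by blast
qed

lemma germ_rw:
  assumes "s \<approx> t" "pth h" "tg h = sr (dom s)" shows "s \<lhd> h \<approx> t \<lhd> h"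
proof -
  note d = germ_D[OF assms(1)]
  obtain y where "WP y" "tg y = sr h" "s \<lhd> (h @ y) = t \<lhd> (h @ y)" using germ_restrict_along[OF assms] .
  then show ?thesis using d assms by (intro germ_I[of _ _ y]) auto
qed

lemma germ_lw:
  assumes "s \<approx> t" "pth x" "sr x = tg (dom s)" shows "x \<rhd> s \<approx> x \<rhd> t"
proof -
  note d = germ_D[OF assms(1)] valid_D[OF germ_D(1)[OF assms(1)]]
  obtain z where z: "WP z" "tg z = sr (dom s)" "s \<lhd> z = t \<lhd> z" using germ_E[OF assms(1)] .
  show ?thesis by (rule germ_I[of _ _ z]) (use d assms z in auto)
qed

lemma germ_trans [trans]:
  assumes "s \<approx> t" "t \<approx> u" shows "s \<approx> u"
proof -
  note d = germ_D[OF assms(1)] germ_D[OF assms(2)]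
  obtain z where z: "WP z" "tg z = sr (dom s)" "s \<lhd> z = t \<lhd> z" using germ_E[OF assms(1)] .
  obtain y where y: "WP y" "tg y = sr z" "t \<lhd> (z @ y) = u \<lhd> (z @ y)"
    by (rule germ_restrict_along[OF assms(2), of z]) (use z d in auto)
  have "s \<lhd> (z @ y) = t \<lhd> (z @ y)" using z(3) by (simp flip: rw_rw)
  then show ?thesis using y z d by (intro germ_I[of _ _ "z @ y"]) (auto intro: WP_append)
qed

lemma germ_vc_right:
  assumes "s \<approx> t" "valid u" "dom u = cod s" shows "u \<bullet> s \<approx> u \<bullet> t"
proof -
  note d = germ_D[OF assms(1)]
  obtain z where z: "WP z" "tg z = sr (dom s)" "s \<lhd> z = t \<lhd> z" using germ_E[OF assms(1)] .
  show ?thesis by (rule germ_I[of _ _ z]) (use d assms z in auto)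
qed

lemma germ_vc_left:
  assumes "s \<approx> t" "valid u" "cod u = dom s" shows "s \<bullet> u \<approx> t \<bullet> u"
proof -
  note d = germ_D[OF assms(1)] valid_D[OF assms(2)]
  obtain z where z: "WP z" "tg z = sr (dom s)" "s \<lhd> z = t \<lhd> z" using germ_E[OF assms(1)] .
  show ?thesis by (rule germ_I[of _ _ z]) (use d assms z in auto)
qed

lemma germ_vc:
  assumes "s \<approx> t" "s' \<approx> t'" "dom s' = cod s" shows "s' \<bullet> s \<approx> t' \<bullet> t"
  using germ_trans[OF germ_vc_right[OF assms(1) germ_D(1)[OF assms(2)] assms(3)] germ_vc_left[OF assms(2) germ_D(2)[OF assms(1)]]]
    germ_D[OF assms(1)] assms(3) by simp

lemma germ_eq [trans]: "s = t \<Longrightarrow> t \<approx> u \<Longrightarrow> s \<approx> u" "s \<approx> t \<Longrightarrow> t = u \<Longrightarrow> s \<approx> u" by auto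

lemma germ_descend:
  assumes "valid s" "valid t" "dom t = dom s" "cod t = cod s" "WP z" "tg z = sr (dom s)" "s \<lhd> z \<approx> t \<lhd> z"
  shows "s \<approx> t"
proof -
  obtain y where y: "WP y" "tg y = sr (dom (s \<lhd> z))" "s \<lhd> z \<lhd> y = t \<lhd> z \<lhd> y" using germ_E[OF assms(7)] .
  then show ?thesis using assms by (intro germ_I[of _ _ "z @ y"]) (auto intro: WP_append)
qed

text \<open>In terms of germs the restriction in the conclusion of \<open>cancel\<close> is
  absorbed.\<close>

lemma germ_cancel_lw:
  assumes "w \<rhd> s \<approx> w \<rhd> t" "WP w" "valid s" "valid t" "dom t = dom s" "cod t = cod s"
  shows "s \<approx> t"
proof -
  have w: "sr w = tg (dom s)" using germ_D(1)[OF assms(1)] WP_pth[OF assms(2)] by (metis pth_nonempty valid_lw)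
  note d = valid_D[OF assms(3)]
  obtain z where z: "WP z" "tg z = sr (dom (w \<rhd> s))" "(w \<rhd> s) \<lhd> z = (w \<rhd> t) \<lhd> z" using germ_E[OF assms(1)] .
  then have tz: "tg z = sr (dom s)" using w assms d by simp
  obtain y where y: "WP y" "tg y = sr (dom (s \<lhd> z))" "s \<lhd> z \<lhd> y = t \<lhd> z \<lhd> y"
    by (rule cancel[of w "s \<lhd> z" "t \<lhd> z"]) (use assms w z tz d in auto)
  then show ?thesis using assms tz z by (intro germ_I[of _ _ "z @ y"]) (auto intro: WP_append)
qed

lemma germ_cancel_vc:
  assumes "u \<bullet> s \<approx> u \<bullet> t" "iso u" "cod s = dom u" "cod t = dom u"
  shows "s \<approx> t"
proof -
  note d = germ_D[OF assms(1)]
  have "sinv u \<bullet> u \<bullet> s \<approx> sinv u \<bullet> u \<bullet> t" by (rule germ_vc_right) (use assms d in auto)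
  then show ?thesis using assms d by auto
qed

lemma germ_cancel_vc':
  assumes "s \<bullet> u \<approx> t \<bullet> u" "iso u" "dom s = cod u" "dom t = cod u"
  shows "s \<approx> t"
proof -
  note d = germ_D[OF assms(1)]
  have "(s \<bullet> u) \<bullet> sinv u \<approx> (t \<bullet> u) \<bullet> sinv u" by (rule germ_vc_left) (use assms d in auto)
  then show ?thesis using assms d by auto
qed

lemma germ_sandwich:
  assumes "X \<approx> Y" "valid A" "valid B" "dom A = cod X" "cod B = dom X"
  shows "A \<bullet> X \<bullet> B \<approx> A \<bullet> Y \<bullet> B"
  using germ_vc_right[OF germ_vc_left[OF assms(1,3,5)] assms(2)] germ_D[OF assms(1)] assms by simp

lemma germ_unsandwich:
  assumes e: "A \<bullet> X \<bullet> B \<approx> A \<bullet> Y \<bullet> B" and A: "iso A" "iso B" "dom A = cod X" "cod B = dom X" and Y: "dom Y = dom X" "cod Y = cod X"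
  shows "X \<approx> Y"
proof -
  have v: "valid X" "valid Y" using germ_D[OF e] by auto
  have "X \<bullet> B \<approx> Y \<bullet> B" by (rule germ_cancel_vc[OF e A(1)]) (use v A Y in simp_all)
  then show ?thesis by (rule germ_cancel_vc'[OF _ A(2)]) (use A Y in simp_all)
qed

end

section \<open>Representatives of 2-morphisms\<close>

type_synonym ('m, 'c) sdatum = "'m list \<times> 'm list \<times> ('m, 'c) scell \<times> ('m, 'c) scell"

definition den :: "('o, 'm) fmor \<Rightarrow> 'm" where "den F = fst (snd F)"
definition num :: "('o, 'm) fmor \<Rightarrow> 'm" where "num F = snd (snd F)"

lemma den_num [simp]: "den (A, w, f) = w" "num (A, w, f) = f"
  by (simp_all add: den_def num_def)

context BF
begin

lemma sq_sym:
  assumes "v \<bullet> a \<approx> b \<bullet> u" "iso u" "iso v"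
  shows "sinv v \<bullet> b \<approx> a \<bullet> sinv u"
proof -
  have d: "valid a" "valid b" "dom v = cod a" "dom b = cod u" "cod b = cod v" "dom u = dom a"
    using germ_D[OF assms(1)] assms by auto
  have "sinv v \<bullet> (b \<bullet> u) \<bullet> sinv u \<approx> sinv v \<bullet> (v \<bullet> a) \<bullet> sinv u"
    by (intro germ_vc germ_sym[OF assms(1)]) (use d assms in auto)
  then show ?thesis using d assms by simp
qed

lemma sq_trans:
  assumes "v \<bullet> a \<approx> b \<bullet> u" "v' \<bullet> b \<approx> c \<bullet> u'"
  shows "(v' \<bullet> v) \<bullet> a \<approx> c \<bullet> (u' \<bullet> u)"
proof -
  have d: "valid a" "valid b" "valid c" "valid u" "valid v" "valid u'" "valid v'" "dom v = cod a" "dom b = cod u" "cod b = cod v"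
    "dom u = dom a" "dom v' = cod b" "dom c = cod u'" "cod c = cod v'" "dom u' = dom b"
    using germ_D[OF assms(1)] germ_D[OF assms(2)] by auto
  have "v' \<bullet> v \<bullet> a \<approx> v' \<bullet> b \<bullet> u" by (rule germ_vc_right[OF assms(1)]) (use d in auto)
  also have "(v' \<bullet> b) \<bullet> u \<approx> (c \<bullet> u') \<bullet> u" by (rule germ_vc_left[OF assms(2)]) (use d in auto)
  then have "v' \<bullet> b \<bullet> u \<approx> c \<bullet> u' \<bullet> u" by simp
  finally show ?thesis by simp
qed

definition ty :: "'m \<Rightarrow> 'm \<Rightarrow> 'm list \<Rightarrow> 'm list \<Rightarrow> ('m, 'c) scell \<Rightarrow> bool" where
  "ty g1 g2 x1 x2 a \<longleftrightarrow> valid a \<and> dom a = g1 # x1 \<and> cod a = g2 # x2 \<and> x1 \<noteq> [] \<and> x2 \<noteq> []"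

text \<open>Two pairs of morphisms are identified after restriction along \<open>h\<close> and
  \<open>h'\<close>; \<open>lk\<close> then says that the identification matches one component, of
  denominators or of numerators, as germs. \<open>frac_rel\<close> has its first cell in the
  opposite direction; with both pointing forward, inverses and composites of comparisons are formed
  componentwise.\<close>

definition tp :: "'m list \<Rightarrow> 'm list \<Rightarrow> ('m, 'c) scell \<Rightarrow> ('m, 'c) scell
    \<Rightarrow> 'm list \<Rightarrow> 'm list \<Rightarrow> 'm list \<Rightarrow> 'm list \<Rightarrow> bool" where
  "tp h h' s1 s2 x1 x2 x1' x2' \<longleftrightarrow> pth h \<and> pth h' \<and> x1 \<noteq> [] \<and> x2 \<noteq> [] \<and> x1' \<noteq> [] \<and> x2' \<noteq> []
     \<and> iso s1 \<and> dom s1 = x1 @ h \<and> cod s1 = x1' @ h'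
     \<and> iso s2 \<and> dom s2 = x2 @ h \<and> cod s2 = x2' @ h'"

definition lk :: "'m \<Rightarrow> 'm \<Rightarrow> 'm list \<Rightarrow> 'm list \<Rightarrow> ('m, 'c) scell \<Rightarrow> ('m, 'c) scell
    \<Rightarrow> ('m, 'c) scell \<Rightarrow> ('m, 'c) scell \<Rightarrow> bool" where
  "lk g1 g2 h h' s1 s2 a a' \<longleftrightarrow> [g2] \<rhd> s2 \<bullet> a \<lhd> h \<approx> a' \<lhd> h' \<bullet> [g1] \<rhd> s1"

lemma ty_D:
  assumes "ty g1 g2 x1 x2 a"
  shows "valid a" "dom a = g1 # x1" "cod a = g2 # x2" "pth x1" "pth x2" "g1 \<in> Mor C" "g2 \<in> Mor C"
    "src C g1 = tg x1" "src C g2 = tg x2" "tgt C g2 = tgt C g1" "sr x2 = sr x1"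
  using assms valid_D[of a] by (auto simp: ty_def)

lemma tp_D:
  assumes "tp h h' s1 s2 x1 x2 x1' x2'"
  shows "pth h" "pth h'" "iso s1" "dom s1 = x1 @ h" "cod s1 = x1' @ h'" "iso s2" "dom s2 = x2 @ h" "cod s2 = x2' @ h'"
     "pth x1" "pth x2" "pth x1'" "pth x2'" "tg h = sr x1" "tg h' = sr x1'" "sr x2 = sr x1" "sr x2' = sr x1'" "sr h' = sr h"
     "tg x1' = tg x1" "tg x2' = tg x2"
  using assms valid_D[of s1] valid_D[of s2] by (auto simp: tp_def)

lemma tp_sym: "tp h h' s1 s2 x1 x2 x1' x2' \<Longrightarrow> tp h' h (sinv s1) (sinv s2) x1' x2' x1 x2"
  by (auto simp: tp_def)

lemma tp_trans: "tp h h' s1 s2 x1 x2 x1' x2' \<Longrightarrow> tp h' h'' t1 t2 x1' x2' x1'' x2''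
    \<Longrightarrow> tp h h'' (t1 \<bullet> s1) (t2 \<bullet> s2) x1 x2 x1'' x2''"
  by (auto simp: tp_def)

lemma tp_res:
  assumes "tp h h' s1 s2 x1 x2 x1' x2'" "pth k" "tg k = sr h"
  shows "tp (h @ k) (h' @ k) (s1 \<lhd> k) (s2 \<lhd> k) x1 x2 x1' x2'"
  using tp_D[OF assms(1)] assms(2,3) by (auto simp: tp_def)

lemma tp_adj: "iso t \<Longrightarrow> pth x1 \<Longrightarrow> pth x2 \<Longrightarrow> sr x1 = tg (dom t) \<Longrightarrow> sr x2 = tg (dom t) \<Longrightarrow>
    tp (dom t) (cod t) (x1 \<rhd> t) (x2 \<rhd> t) x1 x2 x1 x2"
  using valid_D[of t] by (auto simp: tp_def)

lemma lk_sym: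
  assumes "tp h h' s1 s2 x1 x2 x1' x2'" "ty g1 g2 x1 x2 a" "ty g1 g2 x1' x2' a'" "lk g1 g2 h h' s1 s2 a a'"
  shows "lk g1 g2 h' h (sinv s1) (sinv s2) a' a"
  using sq_sym[OF assms(4)[unfolded lk_def]] tp_D[OF assms(1)] ty_D[OF assms(2)] ty_D[OF assms(3)] by (simp add: lk_def)

lemma lk_trans:
  assumes "lk g1 g2 h h' s1 s2 a a'" "lk g1 g2 h' h'' t1 t2 a' a''"
  shows "lk g1 g2 h h'' (t1 \<bullet> s1) (t2 \<bullet> s2) a a''"
  using sq_trans[OF assms[unfolded lk_def]] by (simp add: lk_def)

lemma lk_res:
  assumes "tp h h' s1 s2 x1 x2 x1' x2'" "ty g1 g2 x1 x2 a" "lk g1 g2 h h' s1 s2 a a'" "pth k" "tg k = sr h"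
  shows "lk g1 g2 (h @ k) (h' @ k) (s1 \<lhd> k) (s2 \<lhd> k) a a'"
  using germ_rw[OF assms(3)[unfolded lk_def], of k] assms(4,5) tp_D[OF assms(1)] ty_D[OF assms(2)]
  by (simp add: lk_def)

lemma lk_adj:
  assumes "ty g1 g2 x1 x2 a" "iso t" "tg (dom t) = sr x1"
  shows "lk g1 g2 (dom t) (cod t) (x1 \<rhd> t) (x2 \<rhd> t) a a"
  using ty_D[OF assms(1)] assms valid_D[of t] by (simp add: lk_def slides)

text \<open>Membership in \<open>W\<close> is left to \<open>wdat\<close>, since values are also
  taken at tests that do not lie over a member of \<open>W\<close>.\<close>

definition dat :: "('o, 'm) fmor \<Rightarrow> ('o, 'm) fmor \<Rightarrow> ('m, 'c) sdatum \<Rightarrow> bool" where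
  "dat F1 F2 = (\<lambda>(x1, x2, \<alpha>, \<beta>). iso \<alpha> \<and> ty (den F1) (den F2) x1 x2 \<alpha> \<and> ty (num F1) (num F2) x1 x2 \<beta>)"

definition link :: "('o, 'm) fmor \<Rightarrow> ('o, 'm) fmor \<Rightarrow> 'm list \<Rightarrow> 'm list \<Rightarrow> ('m, 'c) scell \<Rightarrow> ('m, 'c) scell
    \<Rightarrow> ('m, 'c) sdatum \<Rightarrow> ('m, 'c) sdatum \<Rightarrow> bool" where
  "link F1 F2 h h' s1 s2 = (\<lambda>(x1, x2, \<alpha>, \<beta>) (x1', x2', \<alpha>', \<beta>'). tp h h' s1 s2 x1 x2 x1' x2'
     \<and> lk (den F1) (den F2) h h' s1 s2 \<alpha> \<alpha>' \<and> lk (num F1) (num F2) h h' s1 s2 \<beta> \<beta>')"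

text \<open>The comparison of denominators alone: this is the part that can be produced from (BF),
  and \<open>alink_link\<close> recovers the rest for equivalent data.\<close>

definition alink :: "('o, 'm) fmor \<Rightarrow> ('o, 'm) fmor \<Rightarrow> 'm list \<Rightarrow> 'm list \<Rightarrow> ('m, 'c) scell \<Rightarrow> ('m, 'c) scell
    \<Rightarrow> ('m, 'c) sdatum \<Rightarrow> ('m, 'c) sdatum \<Rightarrow> bool" where
  "alink F1 F2 h h' s1 s2 = (\<lambda>(x1, x2, \<alpha>, \<beta>) (x1', x2', \<alpha>', \<beta>'). tp h h' s1 s2 x1 x2 x1' x2'
     \<and> lk (den F1) (den F2) h h' s1 s2 \<alpha> \<alpha>')"

lemma link_alink: "link F1 F2 h h' s1 s2 D D' \<Longrightarrow> alink F1 F2 h h' s1 s2 D D'"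
  by (auto simp: link_def alink_def split: prod.splits)

lemma link_sym:
  assumes "dat F1 F2 D" "dat F1 F2 D'" shows "link F1 F2 h h' s1 s2 D D' \<Longrightarrow> link F1 F2 h' h (sinv s1) (sinv s2) D' D"
  using assms unfolding link_def dat_def by (auto intro: tp_sym lk_sym)

lemma alink_sym:
  assumes "dat F1 F2 D" "dat F1 F2 D'" shows "alink F1 F2 h h' s1 s2 D D' \<Longrightarrow> alink F1 F2 h' h (sinv s1) (sinv s2) D' D"
  using assms unfolding alink_def dat_def by (auto intro: tp_sym lk_sym)

lemma link_trans: "link F1 F2 h h' s1 s2 D D' \<Longrightarrow> link F1 F2 h' h'' t1 t2 D' D''
    \<Longrightarrow> link F1 F2 h h'' (t1 \<bullet> s1) (t2 \<bullet> s2) D D''"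
  unfolding link_def by (auto intro: tp_trans lk_trans split: prod.splits)

lemma alink_trans: "alink F1 F2 h h' s1 s2 D D' \<Longrightarrow> alink F1 F2 h' h'' t1 t2 D' D''
    \<Longrightarrow> alink F1 F2 h h'' (t1 \<bullet> s1) (t2 \<bullet> s2) D D''"
  unfolding alink_def by (auto intro: tp_trans lk_trans split: prod.splits)

lemma link_res: "dat F1 F2 D \<Longrightarrow> link F1 F2 h h' s1 s2 D D' \<Longrightarrow> pth k \<Longrightarrow> tg k = sr h
    \<Longrightarrow> link F1 F2 (h @ k) (h' @ k) (s1 \<lhd> k) (s2 \<lhd> k) D D'"
  unfolding link_def dat_def by (auto intro: tp_res lk_res split: prod.splits)

lemma alink_res: "dat F1 F2 D \<Longrightarrow> alink F1 F2 h h' s1 s2 D D' \<Longrightarrow> pth k \<Longrightarrow> tg k = sr h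
    \<Longrightarrow> alink F1 F2 (h @ k) (h' @ k) (s1 \<lhd> k) (s2 \<lhd> k) D D'"
  unfolding alink_def dat_def by (auto intro: tp_res lk_res split: prod.splits)

lemma link_adj: "dat F1 F2 (x1, x2, \<alpha>, \<beta>) \<Longrightarrow> iso t \<Longrightarrow> tg (dom t) = sr x1 \<Longrightarrow>
    link F1 F2 (dom t) (cod t) (x1 \<rhd> t) (x2 \<rhd> t) (x1, x2, \<alpha>, \<beta>) (x1, x2, \<alpha>, \<beta>)"
  unfolding link_def dat_def
  using ty_D[of "den F1" "den F2" x1 x2 \<alpha>] by (auto intro: tp_adj lk_adj)

text \<open>A comparison of a datum with itself along two arbitrary morphisms is automatically compatible
  with the second component, because \<open>W\<close> lets one replace it by a single 2-cell \<open>h z \<Rightarrow> h' z\<close>.\<close>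

lemma alink_self:
  assumes D: "dat F1 F2 (x1, x2, \<alpha>, \<beta>)" and W: "WP (den F1 # x1)" "den F1 \<in> W" "den F2 \<in> W"
    and l: "alink F1 F2 h h' s1 s2 (x1, x2, \<alpha>, \<beta>) (x1, x2, \<alpha>, \<beta>)"
  shows "link F1 F2 h h' s1 s2 (x1, x2, \<alpha>, \<beta>) (x1, x2, \<alpha>, \<beta>)"
proof -
  let ?w1 = "den F1" and ?w2 = "den F2" and ?f1 = "num F1" and ?f2 = "num F2"
  have a: "iso \<alpha>" "ty ?w1 ?w2 x1 x2 \<alpha>" "ty ?f1 ?f2 x1 x2 \<beta>" using D by (auto simp: dat_def)
  have t: "tp h h' s1 s2 x1 x2 x1 x2" and lk: "[?w2] \<rhd> s2 \<bullet> \<alpha> \<lhd> h \<approx> \<alpha> \<lhd> h' \<bullet> [?w1] \<rhd> s1"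
    using l by (auto simp: alink_def lk_def)
  note d = ty_D[OF a(2)] ty_D[OF a(3)] tp_D[OF t]
  \<comment> \<open>Seen over the denominator, \<open>s1\<close> is a 2-cell between paths that
    start with \<open>den F1 # x1\<close>, which lies in \<open>W\<close>. So after restriction it
    comes from a 2-cell between \<open>h\<close> and \<open>h'\<close>.\<close>
  obtain z \<zeta> where z: "WP z" "tg z = sr h" "valid \<zeta>" "dom \<zeta> = h @ z" "cod \<zeta> = h' @ z"
    "([?w1] \<rhd> s1) \<lhd> z = (?w1 # x1) \<rhd> \<zeta>" "iso ([?w1] \<rhd> s1) \<Longrightarrow> iso \<zeta>"
    by (rule lift[OF W(1), of h h' "[?w1] \<rhd> s1"]) (use d in auto)
  have iz: "iso \<zeta>" using z(7) d by simp
  have e1: "x1 \<rhd> \<zeta> \<approx> s1 \<lhd> z"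
    by (rule germ_cancel_lw[of "[?w1]"]) (use z d W iz in auto)
  \<comment> \<open>\<zeta> passes through \<alpha> by interchange, so
    \<open>x2 \<rhd> \<zeta>\<close> solves the same equation over \<open>den F2\<close> as
    \<open>s2\<close> does; cancelling \<alpha> and \<open>den F2\<close> identifies the
    two.\<close>
  have "[?w2] \<rhd> (x2 \<rhd> \<zeta>) \<bullet> \<alpha> \<lhd> (h @ z) = \<alpha> \<lhd> (h' @ z) \<bullet> [?w1] \<rhd> (x1 \<rhd> \<zeta>)"
    using d z iz by (simp add: slides)
  also have "\<dots> = \<alpha> \<lhd> (h' @ z) \<bullet> [?w1] \<rhd> s1 \<lhd> z" using z(6) by simp
  also have "\<dots> \<approx> [?w2] \<rhd> (s2 \<lhd> z) \<bullet> \<alpha> \<lhd> (h @ z)"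
    using germ_rw[OF germ_sym[OF lk], of z] z d by simp
  finally have "[?w2] \<rhd> (x2 \<rhd> \<zeta>) \<approx> [?w2] \<rhd> (s2 \<lhd> z)"
    by (rule germ_cancel_vc') (use a z d iz in auto)
  then have e2: "x2 \<rhd> \<zeta> \<approx> s2 \<lhd> z"
    by (rule germ_cancel_lw) (use z d W iz in auto)
  have "([?f2] \<rhd> s2 \<bullet> \<beta> \<lhd> h) \<lhd> z \<approx> [?f2] \<rhd> (x2 \<rhd> \<zeta>) \<bullet> \<beta> \<lhd> (h @ z)"
    using germ_vc_left[OF germ_lw[OF germ_sym[OF e2], of "[?f2]"], of "\<beta> \<lhd> (h @ z)"] z d by simp
  also have "\<dots> = \<beta> \<lhd> (h' @ z) \<bullet> [?f1] \<rhd> (x1 \<rhd> \<zeta>)" using d z iz by (simp add: slides)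
  also have "\<dots> \<approx> (\<beta> \<lhd> h' \<bullet> [?f1] \<rhd> s1) \<lhd> z"
    using germ_vc_right[OF germ_lw[OF e1, of "[?f1]"], of "\<beta> \<lhd> (h' @ z)"] z d iz by simp
  finally have "[?f2] \<rhd> s2 \<bullet> \<beta> \<lhd> h \<approx> \<beta> \<lhd> h' \<bullet> [?f1] \<rhd> s1"
    by (rule germ_descend[OF _ _ _ _ z(1), rotated -1]) (use z d in auto)
  then show ?thesis using l by (auto simp: link_def alink_def lk_def)
qed

definition par :: "('o, 'm) fmor \<Rightarrow> ('o, 'm) fmor \<Rightarrow> bool" where
  "par F1 F2 \<longleftrightarrow> F1 \<in> frac_Mor C W \<and> F2 \<in> frac_Mor C W \<and> frac_src C F1 = frac_src C F2 \<and> frac_tgt C F1 = frac_tgt C F2"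

lemma W_Mor': "w \<in> W \<Longrightarrow> w \<in> Mor C" using W_Mor by auto

lemma frac_Mor_D:
  assumes "F \<in> frac_Mor C W"
  shows "den F \<in> W" "den F \<in> Mor C" "num F \<in> Mor C" "src C (den F) = fst F" "src C (num F) = fst F"
    "frac_src C F = tgt C (den F)" "frac_tgt C F = tgt C (num F)" "fst F \<in> Ob C"
  using assms W_Mor' src_Ob by (auto simp: frac_Mor_def den_def num_def frac_src_def frac_tgt_def split: prod.splits)

lemma par_D:
  assumes "par F1 F2"
  shows "den F1 \<in> W" "den F2 \<in> W" "den F1 \<in> Mor C" "den F2 \<in> Mor C" "num F1 \<in> Mor C" "num F2 \<in> Mor C"
    "src C (den F1) = fst F1" "src C (num F1) = fst F1" "src C (den F2) = fst F2" "src C (num F2) = fst F2"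
    "tgt C (den F2) = tgt C (den F1)" "tgt C (num F2) = tgt C (num F1)"
  using assms frac_Mor_D[of F1] frac_Mor_D[of F2] by (auto simp: par_def)

definition lnk :: "('o, 'm) fmor \<Rightarrow> ('o, 'm) fmor \<Rightarrow> ('m, 'c) sdatum \<Rightarrow> ('m, 'c) sdatum \<Rightarrow> bool" where
  "lnk F1 F2 D D' \<longleftrightarrow> (\<exists>h h' s1 s2. link F1 F2 h h' s1 s2 D D' \<and> WP (den F1 # fst D @ h))"

definition wdat :: "('o, 'm) fmor \<Rightarrow> ('o, 'm) fmor \<Rightarrow> ('m, 'c) sdatum \<Rightarrow> bool" where
  "wdat F1 F2 D \<longleftrightarrow> dat F1 F2 D \<and> WP (den F1 # fst D)"

lemma link_WP:
  assumes "dat F1 F2 D" "dat F1 F2 D'" "alink F1 F2 h h' s1 s2 D D'"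
  shows "WP (den F1 # fst D' @ h') \<longleftrightarrow> WP (den F1 # fst D @ h)"
proof -
  obtain x1 x2 \<alpha> \<beta> x1' x2' \<alpha>' \<beta>' where D: "D = (x1, x2, \<alpha>, \<beta>)" "D' = (x1', x2', \<alpha>', \<beta>')"
    by (cases D; cases D') auto
  have t: "tp h h' s1 s2 x1 x2 x1' x2'" "ty (den F1) (den F2) x1 x2 \<alpha>"
    using assms by (auto simp: D alink_def dat_def)
  show ?thesis using WP_iso[of "[den F1] \<rhd> s1"] tp_D[OF t(1)] ty_D[OF t(2)] by (simp add: D)
qed

lemma lnk_sym:
  assumes "dat F1 F2 D" "dat F1 F2 D'" "lnk F1 F2 D D'" shows "lnk F1 F2 D' D"
proof -
  obtain h h' s1 s2 where l: "link F1 F2 h h' s1 s2 D D'" "WP (den F1 # fst D @ h)"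
    using assms(3) by (auto simp: lnk_def)
  show ?thesis unfolding lnk_def
    using link_sym[OF assms(1,2) l(1)] link_WP[OF assms(1,2) link_alink[OF l(1)]] l(2) by blast
qed

lemma link_refl:
  assumes "dat F1 F2 (x1, x2, \<alpha>, \<beta>)" "pth h" "tg h = sr x1"
  shows "link F1 F2 h h (sid (x1 @ h)) (sid (x2 @ h)) (x1, x2, \<alpha>, \<beta>) (x1, x2, \<alpha>, \<beta>)"
  using link_adj[OF assms(1), of "sid h"] assms by (simp add: lw_sid)

lemma dat_D:
  assumes "dat F1 F2 (x1, x2, \<alpha>, \<beta>)"
  shows "iso \<alpha>" "valid \<alpha>" "dom \<alpha> = den F1 # x1" "cod \<alpha> = den F2 # x2" "valid \<beta>" "dom \<beta> = num F1 # x1" "cod \<beta> = num F2 # x2"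
    "pth x1" "pth x2" "den F1 \<in> Mor C" "den F2 \<in> Mor C" "num F1 \<in> Mor C" "num F2 \<in> Mor C"
    "src C (den F1) = tg x1" "src C (den F2) = tg x2" "src C (num F1) = tg x1" "src C (num F2) = tg x2"
    "tgt C (den F2) = tgt C (den F1)" "tgt C (num F2) = tgt C (num F1)" "sr x2 = sr x1"
  using assms ty_D[of "den F1" "den F2" x1 x2 \<alpha>] ty_D[of "num F1" "num F2" x1 x2 \<beta>] by (auto simp: dat_def)

lemma WP_append_iff: "WP (p @ q) \<Longrightarrow> WP z \<Longrightarrow> q \<noteq> [] \<Longrightarrow> tg z = sr q \<Longrightarrow> WP (p @ q @ z)"
  using WP_append[of "p @ q" z] by simp

text \<open>Two morphisms into the apex of a datum become isomorphic over a member of \<open>W\<close> as soon as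
  they do so over its denominator.\<close>

lemma compare:
  assumes D: "wdat F1 F2 (x1, x2, \<alpha>, \<beta>)" and h: "pth h" "tg h = sr x1" "pth k" "tg k = sr x1" and W: "WP (den F1 # x1 @ k)"
  obtains y t where "WP y" "tg y = sr h" "iso t" "dom t = h @ y" "\<exists>x. cod t = k @ x \<and> pth x \<and> tg x = sr k"
proof -
  have "dat F1 F2 (x1, x2, \<alpha>, \<beta>)" and W1: "WP (den F1 # x1)" using D by (auto simp: wdat_def)
  note d = dat_D[OF this(1)]
  obtain z x s where z: "WP z" "tg z = sr (den F1 # x1 @ h)" "iso s" "dom s = (den F1 # x1 @ h) @ z"
    "cod s = (den F1 # x1 @ k) @ x" "pth x" "tg x = sr (den F1 # x1 @ k)" "sr x = sr z"
    by (rule bf3[OF W, of "den F1 # x1 @ h"]) (use d h in auto)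
  obtain v t where v: "WP v" "tg v = sr (h @ z)" "valid t" "dom t = (h @ z) @ v" "cod t = (k @ x) @ v" "iso s \<Longrightarrow> iso t"
    by (rule lift[OF W1, of "h @ z" "k @ x" s]) (use z d h in auto)
  show ?thesis
    by (rule that[of "z @ v" t]) (use z v h d in \<open>auto intro!: WP_append exI[of _ "x @ v"]\<close>)
qed

text \<open>The two links restrict the middle datum along unrelated \<open>h'\<close> and
  \<open>k\<close>; \<open>compare\<close> makes these isomorphic after a restriction along
  \<open>W\<close>.\<close>

lemma lnk_trans:
  assumes D: "wdat F1 F2 D" "wdat F1 F2 D'" "wdat F1 F2 D''" and l: "lnk F1 F2 D D'" "lnk F1 F2 D' D''"
  shows "lnk F1 F2 D D''"
proof -
  obtain x1 x2 \<alpha> \<beta> where D': "D' = (x1, x2, \<alpha>, \<beta>)" by (cases D') auto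
  have dd: "dat F1 F2 D" "dat F1 F2 D'" "dat F1 F2 D''" using D by (auto simp: wdat_def)
  note d = dat_D[OF dd(2)[unfolded D']]
  obtain h h' s1 s2 where l1: "link F1 F2 h h' s1 s2 D D'" "WP (den F1 # fst D @ h)"
    using l(1) by (auto simp: lnk_def)
  obtain k k' t1 t2 where l2: "link F1 F2 k k' t1 t2 D' D''" "WP (den F1 # x1 @ k)"
    using l(2) by (auto simp: lnk_def D')
  have e: "pth h'" "tg h' = sr x1" "pth k" "tg k = sr x1" "sr h' = sr h" "pth h"
    "pth (fst D)" "tg h = sr (fst D)"
  proof -
    obtain a1 a2 \<alpha>1 \<beta>1 b1 b2 \<alpha>2 \<beta>2 where E: "D = (a1, a2, \<alpha>1, \<beta>1)" "D'' = (b1, b2, \<alpha>2, \<beta>2)"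
      by (cases D; cases D'') auto
    have "tp h h' s1 s2 a1 a2 x1 x2" "tp k k' t1 t2 x1 x2 b1 b2"
      using l1(1) l2(1) by (auto simp: link_def D' E)
    note t = tp_D[OF this(1)] tp_D[OF this(2)]
    show "pth h'" "tg h' = sr x1" "pth k" "tg k = sr x1" "sr h' = sr h" "pth h"
      "pth (fst D)" "tg h = sr (fst D)"
      using t by (simp_all add: E)
  qed
  obtain y t x where y: "WP y" "tg y = sr h'" "iso t" "dom t = h' @ y" "cod t = k @ x" "pth x" "tg x = sr k"
    using compare[OF D(2)[unfolded D'] e(1-4) l2(2)] by metis
  have L1: "link F1 F2 (h @ y) (h' @ y) (s1 \<lhd> y) (s2 \<lhd> y) D D'"
    by (rule link_res[OF dd(1) l1(1)]) (use y e in auto)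
  have "link F1 F2 (dom t) (cod t) (x1 \<rhd> t) (x2 \<rhd> t) D' D'" unfolding D'
    by (rule link_adj[OF dd(2)[unfolded D'] y(3)]) (use y e in auto)
  then have L2: "link F1 F2 (h' @ y) (k @ x) (x1 \<rhd> t) (x2 \<rhd> t) D' D'" using y by simp
  have L3: "link F1 F2 (k @ x) (k' @ x) (t1 \<lhd> x) (t2 \<lhd> x) D' D''"
    by (rule link_res[OF dd(2) l2(1)]) (use y e in auto)
  note link_trans[OF L1 link_trans[OF L2 L3]]
  moreover have "WP (den F1 # fst D @ h @ y)" using WP_append_iff[of "den F1 # fst D" h y] l1(2) y e by simp
  ultimately show ?thesis unfolding lnk_def by blast
qed

text \<open>The inverse of a known link followed by the given comparison compares \<open>D'\<close>
  with itself, and there \<open>alink_self\<close> applies. Hence for equivalent data it is enough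
  to compare denominators.\<close>

lemma alink_link:
  assumes D: "wdat F1 F2 D" "wdat F1 F2 D'" and P: "par F1 F2" and l: "lnk F1 F2 D D'" and a: "alink F1 F2 h h' s1 s2 D D'"
  shows "link F1 F2 h h' s1 s2 D D'"
proof -
  obtain x1 x2 \<alpha> \<beta> x1' x2' \<alpha>' \<beta>' where DD: "D = (x1, x2, \<alpha>, \<beta>)" "D' = (x1', x2', \<alpha>', \<beta>')"
    by (cases D; cases D') auto
  have dd: "dat F1 F2 D" "dat F1 F2 D'" using D by (auto simp: wdat_def)
  note d = dat_D[OF dd(1)[unfolded DD]] dat_D[OF dd(2)[unfolded DD]]
  obtain k k' t1 t2 where l2: "link F1 F2 k k' t1 t2 D D'" "WP (den F1 # x1 @ k)"
    using l by (auto simp: lnk_def DD)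
  have tpa: "tp h h' s1 s2 x1 x2 x1' x2'" "tp k k' t1 t2 x1 x2 x1' x2'"
    using a l2 by (auto simp: alink_def link_def DD)
  note e = tp_D[OF tpa(1)] tp_D[OF tpa(2)]
  obtain y t x where y: "WP y" "tg y = sr h" "iso t" "dom t = h @ y" "cod t = k @ x" "pth x" "tg x = sr k"
    using compare[OF D(1)[unfolded DD], of h k] e l2(2) by metis
  have L: "link F1 F2 (h @ y) (k' @ x) (t1 \<lhd> x \<bullet> x1 \<rhd> t) (t2 \<lhd> x \<bullet> x2 \<rhd> t) D D'"
  proof (rule link_trans)
    show "link F1 F2 (h @ y) (k @ x) (x1 \<rhd> t) (x2 \<rhd> t) D D"
      using link_adj[OF dd(1)[unfolded DD] y(3)] y e by (simp add: DD)
    show "link F1 F2 (k @ x) (k' @ x) (t1 \<lhd> x) (t2 \<lhd> x) D D'"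
      by (rule link_res[OF dd(1) l2(1)]) (use y e in auto)
  qed
  have A: "alink F1 F2 (h @ y) (h' @ y) (s1 \<lhd> y) (s2 \<lhd> y) D D'"
    by (rule alink_res[OF dd(1) a]) (use y e in auto)
  let ?u1 = "(s1 \<lhd> y) \<bullet> sinv (t1 \<lhd> x \<bullet> x1 \<rhd> t)" and ?u2 = "(s2 \<lhd> y) \<bullet> sinv (t2 \<lhd> x \<bullet> x2 \<rhd> t)"
  have "alink F1 F2 (k' @ x) (h' @ y) ?u1 ?u2 D' D'"
    by (rule alink_trans[OF alink_sym[OF dd link_alink[OF L]] A])
  then have "link F1 F2 (k' @ x) (h' @ y) ?u1 ?u2 D' D'"
    using alink_self[of F1 F2 x1' x2' \<alpha>' \<beta>'] D par_D[OF P] by (auto simp: DD wdat_def)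
  note link_trans[OF L this]
  moreover have "?u1 \<bullet> t1 \<lhd> x \<bullet> x1 \<rhd> t = s1 \<lhd> y" "?u2 \<bullet> t2 \<lhd> x \<bullet> x2 \<rhd> t = s2 \<lhd> y"
    using e y d by (simp_all add: cancels)
  ultimately have "link F1 F2 (h @ y) (h' @ y) (s1 \<lhd> y) (s2 \<lhd> y) D D'" by simp
  then have "([num F2] \<rhd> s2 \<bullet> \<beta> \<lhd> h) \<lhd> y \<approx> (\<beta>' \<lhd> h' \<bullet> [num F1] \<rhd> s1) \<lhd> y"
    by (simp add: link_def lk_def DD)
  then have "[num F2] \<rhd> s2 \<bullet> \<beta> \<lhd> h \<approx> \<beta>' \<lhd> h' \<bullet> [num F1] \<rhd> s1"
    by (rule germ_descend[OF _ _ _ _ y(1), rotated -1]) (use y e d in auto)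
  then show ?thesis using a by (auto simp: link_def alink_def lk_def DD)
qed

end

section \<open>Fraction data as links, and the values of a 2-morphism\<close>

context BF
begin

lemma raw_pull:
  assumes "valid ([g, x], a, [g', x'])" "z \<in> Mor C" "src C x = tgt C z"
  shows "raw (([g, x], a, [g', x']) \<lhd> [z]) = pull C g x g' x' a z"
  using arg_cong[OF pull_triple[OF assms], of raw] by simp

definition sd :: "('o, 'm) fmor \<Rightarrow> ('o, 'm) fmor \<Rightarrow> ('o, 'm, 'c) fdatum \<Rightarrow> ('m, 'c) sdatum" where
  "sd F1 F2 = (\<lambda>(E, v1, v2, a, b). ([v1], [v2], ([den F1, v1], a, [den F2, v2]), ([num F1, v1], b, [num F2, v2])))"

lemma frac_data_iff:
  assumes "par F1 F2"
  shows "(E, v1, v2, a, b) \<in> frac_data C W F1 F2 \<longleftrightarrow> wdat F1 F2 (sd F1 F2 (E, v1, v2, a, b)) \<and> E = src C v1"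
proof -
  obtain A1 w1 f1 A2 w2 f2 where F: "F1 = (A1, w1, f1)" "F2 = (A2, w2, f2)" by (cases F1; cases F2) auto
  note p = par_D[OF assms, unfolded F, simplified]
  show ?thesis
    by (rule iffI)
      (use p cellST(1)[of a] in \<open>auto simp: F frac_data_def sd_def wdat_def dat_def ty_def valid_triple iso_def inv_cells_iff hom_def cells_def WP_def\<close>)
qed

lemma frac_eq_iff:
  assumes "valid ([g1, v1], a, [g2, v2])" "valid ([g1, v1'], a', [g2, v2'])"
    and "iso ([v1', z'], b1, [v1, z])" "iso ([v2, z], b2, [v2', z'])"
  shows "(\<iota> g2 \<star> b2) \<odot> pull C g1 v1 g2 v2 a z \<odot> (\<iota> g1 \<star> b1) = pull C g1 v1' g2 v2' a' z'
    \<longleftrightarrow> [g2] \<rhd> ([v2, z], b2, [v2', z']) \<bullet> ([g1, v1], a, [g2, v2]) \<lhd> [z]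
       = ([g1, v1'], a', [g2, v2']) \<lhd> [z'] \<bullet> [g1] \<rhd> sinv ([v1', z'], b1, [v1, z])" (is "?l \<longleftrightarrow> ?S2 \<bullet> ?A = ?A' \<bullet> ?T")
proof -
  note d = valid_D[OF assms(1), simplified] valid_D[OF assms(2), simplified] valid_D[OF iso_valid[OF assms(3)], simplified]
    valid_D[OF iso_valid[OF assms(4)], simplified]
  have 1: "?S2 \<bullet> ?A = ?A' \<bullet> ?T \<longleftrightarrow> ?S2 \<bullet> ?A \<bullet> [g1] \<rhd> ([v1', z'], b1, [v1, z]) = ?A'"
  proof
    assume a: "?S2 \<bullet> ?A = ?A' \<bullet> ?T"
    have "?S2 \<bullet> ?A \<bullet> [g1] \<rhd> ([v1', z'], b1, [v1, z]) = (?S2 \<bullet> ?A) \<bullet> [g1] \<rhd> ([v1', z'], b1, [v1, z])" by simp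
    also have "\<dots> = ?A'" unfolding a using assms d by (simp add: cancels)
    finally show "?S2 \<bullet> ?A \<bullet> [g1] \<rhd> ([v1', z'], b1, [v1, z]) = ?A'" .
  next
    assume a: "?S2 \<bullet> ?A \<bullet> [g1] \<rhd> ([v1', z'], b1, [v1, z]) = ?A'"
    show "?S2 \<bullet> ?A = ?A' \<bullet> ?T" unfolding a[symmetric] using assms d by (simp add: cancels)
  qed
  have 2: "?l \<longleftrightarrow> raw (?S2 \<bullet> ?A \<bullet> [g1] \<rhd> ([v1', z'], b1, [v1, z])) = raw ?A'"
    using assms d by (simp add: raw_pull raw_lw1)
  have 3: "dom (?S2 \<bullet> ?A \<bullet> [g1] \<rhd> ([v1', z'], b1, [v1, z])) = dom ?A'"
    "cod (?S2 \<bullet> ?A \<bullet> [g1] \<rhd> ([v1', z'], b1, [v1, z])) = cod ?A'"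
    using assms d by simp_all
  show ?thesis unfolding 1 2 using 3 scell_eqI by metis
qed

text \<open>\<open>frac_rel\<close> and the definitions of the operations ask for equations, not for
  germs; restricting twice makes both squares commute at once.\<close>

lemma link_exact:
  assumes D: "dat F1 F2 (x1, x2, \<alpha>, \<beta>)" "dat F1 F2 (x1', x2', \<alpha>', \<beta>')"
    and l: "link F1 F2 h h' s1 s2 (x1, x2, \<alpha>, \<beta>) (x1', x2', \<alpha>', \<beta>')"
  obtains k where "WP k" "tg k = sr h"
    "[den F2] \<rhd> s2 \<lhd> k \<bullet> \<alpha> \<lhd> (h @ k) = \<alpha>' \<lhd> (h' @ k) \<bullet> [den F1] \<rhd> s1 \<lhd> k"
    "[num F2] \<rhd> s2 \<lhd> k \<bullet> \<beta> \<lhd> (h @ k) = \<beta>' \<lhd> (h' @ k) \<bullet> [num F1] \<rhd> s1 \<lhd> k"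
proof -
  have t: "tp h h' s1 s2 x1 x2 x1' x2'" "[den F2] \<rhd> s2 \<bullet> \<alpha> \<lhd> h \<approx> \<alpha>' \<lhd> h' \<bullet> [den F1] \<rhd> s1"
    "[num F2] \<rhd> s2 \<bullet> \<beta> \<lhd> h \<approx> \<beta>' \<lhd> h' \<bullet> [num F1] \<rhd> s1"
    using l by (auto simp: link_def lk_def)
  note d = dat_D[OF D(1)] dat_D[OF D(2)] tp_D[OF t(1)]
  obtain z where z: "WP z" "tg z = sr h" "([den F2] \<rhd> s2 \<bullet> \<alpha> \<lhd> h) \<lhd> z = (\<alpha>' \<lhd> h' \<bullet> [den F1] \<rhd> s1) \<lhd> z"
    using germ_E[OF t(2)] d by auto
  obtain y where y: "WP y" "tg y = sr z" "([num F2] \<rhd> s2 \<bullet> \<beta> \<lhd> h) \<lhd> (z @ y) = (\<beta>' \<lhd> h' \<bullet> [num F1] \<rhd> s1) \<lhd> (z @ y)"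
    by (rule germ_restrict_along[OF t(3), of z]) (use z d in auto)
  have zy: "[den F2] \<rhd> s2 \<lhd> (z @ y) \<bullet> \<alpha> \<lhd> (h @ z @ y) = \<alpha>' \<lhd> (h' @ z @ y) \<bullet> [den F1] \<rhd> s1 \<lhd> (z @ y)"
    using arg_cong[OF z(3), of "\<lambda>s. s \<lhd> y"] by simp
  show ?thesis
    by (rule that[of "z @ y"]) (use z(1,2) y zy d in \<open>auto intro: WP_append\<close>)
qed

lemma kap_restrict:
  assumes "valid s" "pth h" "sr (dom s) = tg h"
  shows "s \<lhd> [ev h] = cod s \<rhd> kap h \<bullet> s \<lhd> h \<bullet> dom s \<rhd> sinv (kap h)"
  using assms valid_D[OF assms(1)] by (simp add: slides cancels)

text \<open>The composites of the restricting paths serve as the morphisms \<open>z\<close> and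
  \<open>z'\<close> of the relation, once the link has been made exact.\<close>

lemma link_frac_rel:
  assumes P: "par F1 F2" and d: "d \<in> frac_data C W F1 F2" "d' \<in> frac_data C W F1 F2"
    and l: "lnk F1 F2 (sd F1 F2 d) (sd F1 F2 d')"
  shows "(d, d') \<in> frac_rel C W F1 F2"
proof -
  obtain A1 w1 f1 A2 w2 f2 where F: "F1 = (A1, w1, f1)" "F2 = (A2, w2, f2)" by (cases F1; cases F2) auto
  obtain E v1 v2 a b E' v1' v2' a' b' where dd: "d = (E, v1, v2, a, b)" "d' = (E', v1', v2', a', b')"
    by (cases d; cases d') auto
  have w: "wdat F1 F2 (sd F1 F2 d)" "wdat F1 F2 (sd F1 F2 d')" "E = src C v1" "E' = src C v1'"
    using d frac_data_iff[OF P] by (auto simp: dd)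
  let ?A = "([w1, v1], a, [w2, v2])" and ?B = "([f1, v1], b, [f2, v2])"
  let ?A' = "([w1, v1'], a', [w2, v2'])" and ?B' = "([f1, v1'], b', [f2, v2'])"
  have D: "dat F1 F2 ([v1], [v2], ?A, ?B)" "dat F1 F2 ([v1'], [v2'], ?A', ?B')"
    using w by (simp_all add: wdat_def sd_def dd F)
  obtain h h' s1 s2 where L: "link F1 F2 h h' s1 s2 ([v1], [v2], ?A, ?B) ([v1'], [v2'], ?A', ?B')"
    and W0: "WP (w1 # v1 # h)"
    using l by (auto simp: lnk_def sd_def dd F)
  obtain k where k: "WP k" "tg k = sr h" "[w2] \<rhd> s2 \<lhd> k \<bullet> ?A \<lhd> (h @ k) = ?A' \<lhd> (h' @ k) \<bullet> [w1] \<rhd> s1 \<lhd> k"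
    "[f2] \<rhd> s2 \<lhd> k \<bullet> ?B \<lhd> (h @ k) = ?B' \<lhd> (h' @ k) \<bullet> [f1] \<rhd> s1 \<lhd> k"
    using link_exact[OF D L] by (auto simp: F)
  have t: "tp h h' s1 s2 [v1] [v2] [v1'] [v2']" using L by (auto simp: link_def)
  note e = tp_D[OF t] dat_D[OF D(1), unfolded F, simplified] dat_D[OF D(2), unfolded F, simplified]
  let ?h = "h @ k" and ?h' = "h' @ k"
  \<comment> \<open>The first cell is inverted, as \<open>frac_rel\<close> orients it from the
    second datum to the first.\<close>
  define T1 where "T1 = ([v1', ev ?h'], raw (sinv (s1 \<lhd> k)), [v1, ev ?h])"
  define T2 where "T2 = ([v2, ev ?h], raw (s2 \<lhd> k), [v2', ev ?h'])"
  have pk: "pth k" "pth ?h" "pth ?h'" using k e by auto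
  have T1: "T1 = [v1] \<rhd> kap ?h \<bullet> sinv (s1 \<lhd> k) \<bullet> [v1'] \<rhd> sinv (kap ?h')"
    unfolding T1_def by (rule collapse_right[of _ "[v1']" ?h' "[v1]" ?h, simplified]) (use e k pk in auto)
  have T2: "T2 = [v2'] \<rhd> kap ?h' \<bullet> s2 \<lhd> k \<bullet> [v2] \<rhd> sinv (kap ?h)"
    unfolding T2_def by (rule collapse_right[of _ "[v2]" ?h "[v2']" ?h', simplified]) (use e k pk in auto)
  have i: "iso T1" "iso T2" unfolding T1 T2 using e k pk by simp_all
  have m1: "raw (sinv (s1 \<lhd> k)) \<in> inv_cells C (v1' \<cdot> ev ?h') (v1 \<cdot> ev ?h)"
    using iso_inv_cell[OF i(1)] by (simp add: T1_def)
  have m2: "raw (s2 \<lhd> k) \<in> inv_cells C (v2 \<cdot> ev ?h) (v2' \<cdot> ev ?h')"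
    using iso_inv_cell[OF i(2)] by (simp add: T2_def)
  have key: "[g2] \<rhd> T2 \<bullet> X \<lhd> [ev ?h] = X' \<lhd> [ev ?h'] \<bullet> [g1] \<rhd> sinv T1"
    if "valid X" "dom X = [g1, v1]" "cod X = [g2, v2]" "valid X'" "dom X' = [g1, v1']" "cod X' = [g2, v2']"
     "[g2] \<rhd> s2 \<lhd> k \<bullet> X \<lhd> ?h = X' \<lhd> ?h' \<bullet> [g1] \<rhd> s1 \<lhd> k" for g1 g2 X X'
  proof -
    note v = valid_D[OF that(1)] valid_D[OF that(4)]
    have "[g2] \<rhd> T2 \<bullet> X \<lhd> [ev ?h] = [g2, v2'] \<rhd> kap ?h' \<bullet> ([g2] \<rhd> s2 \<lhd> k \<bullet> X \<lhd> ?h) \<bullet> [g1, v1] \<rhd> sinv (kap ?h)"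
      unfolding T2 using that(1-6) v e pk k(2) by (subst kap_restrict) (simp_all add: cancels)
    also have "\<dots> = X' \<lhd> [ev ?h'] \<bullet> [g1] \<rhd> sinv T1"
      unfolding T1 that(7) using that(1-6) v e pk k(2) by (subst kap_restrict) (simp_all add: cancels)
    finally show ?thesis .
  qed
  have va: "valid ?A" "valid ?A'" "valid ?B" "valid ?B'" using e by auto
  have eqa: "(\<iota> w2 \<star> raw (s2 \<lhd> k)) \<odot> pull C w1 v1 w2 v2 a (ev ?h) \<odot> (\<iota> w1 \<star> raw (sinv (s1 \<lhd> k))) = pull C w1 v1' w2 v2' a' (ev ?h')"
    using frac_eq_iff[OF va(1,2) i[unfolded T1_def T2_def]] key[of ?A w1 w2 ?A'] va k(3) by (simp add: T1_def T2_def)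
  have eqb: "(\<iota> f2 \<star> raw (s2 \<lhd> k)) \<odot> pull C f1 v1 f2 v2 b (ev ?h) \<odot> (\<iota> f1 \<star> raw (sinv (s1 \<lhd> k))) = pull C f1 v1' f2 v2' b' (ev ?h')"
    using frac_eq_iff[OF va(3,4) i[unfolded T1_def T2_def]] key[of ?B f1 f2 ?B'] va k(4) by (simp add: T1_def T2_def)
  have "WP (w1 # v1 # h @ k)" using WP_append_iff[of "[w1, v1]" h k] W0 k e by simp
  then have W1: "WP [w1 \<cdot> v1, ev ?h]"
    using WP_iso[of "kap [w1, v1] \<lhd> [ev ?h] \<bullet> [w1, v1] \<rhd> kap ?h"] e pk k(2) by simp
  have "ev ?h \<in> hom C (sr k) E" "ev ?h' \<in> hom C (sr k) E'" "sr k \<in> Ob C"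
    using e pk k w by (auto simp: hom_def)
  note h3 = this
  have W2: "(w1 \<cdot> v1) \<cdot> ev ?h \<in> W" using W1 by (simp add: WP_def)
  have "\<exists>A4 \<in> Ob C. \<exists>z \<in> hom C A4 E. \<exists>z' \<in> hom C A4 E'.
      \<exists>\<sigma>1 \<in> inv_cells C (v1' \<cdot> z') (v1 \<cdot> z). \<exists>\<sigma>2 \<in> inv_cells C (v2 \<cdot> z) (v2' \<cdot> z').
       (w1 \<cdot> v1) \<cdot> z \<in> W
       \<and> (\<iota> w2 \<star> \<sigma>2) \<odot> pull C w1 v1 w2 v2 a z \<odot> (\<iota> w1 \<star> \<sigma>1) = pull C w1 v1' w2 v2' a' z'
       \<and> (\<iota> f2 \<star> \<sigma>2) \<odot> pull C f1 v1 f2 v2 b z \<odot> (\<iota> f1 \<star> \<sigma>1) = pull C f1 v1' f2 v2' b' z'"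
    using W2 eqa eqb m1 m2 h3 by blast
  then show ?thesis using d by (simp add: frac_rel_def dd F)
qed

lemma frac_rel_link:
  assumes P: "par F1 F2" and r: "(d, d') \<in> frac_rel C W F1 F2"
  shows "d \<in> frac_data C W F1 F2" "d' \<in> frac_data C W F1 F2" "lnk F1 F2 (sd F1 F2 d) (sd F1 F2 d')"
proof -
  obtain A1 w1 f1 A2 w2 f2 where F: "F1 = (A1, w1, f1)" "F2 = (A2, w2, f2)" by (cases F1; cases F2) auto
  obtain E v1 v2 a b E' v1' v2' a' b' where dd: "d = (E, v1, v2, a, b)" "d' = (E', v1', v2', a', b')"
    by (cases d; cases d') auto
  show d: "d \<in> frac_data C W F1 F2" "d' \<in> frac_data C W F1 F2" using r by (auto simp: frac_rel_def F dd)
  have w: "wdat F1 F2 (sd F1 F2 d)" "wdat F1 F2 (sd F1 F2 d')" "E = src C v1" "E' = src C v1'"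
    using d frac_data_iff[OF P] by (auto simp: dd)
  let ?A = "([w1, v1], a, [w2, v2])" and ?B = "([f1, v1], b, [f2, v2])"
  let ?A' = "([w1, v1'], a', [w2, v2'])" and ?B' = "([f1, v1'], b', [f2, v2'])"
  have D: "dat F1 F2 ([v1], [v2], ?A, ?B)" "dat F1 F2 ([v1'], [v2'], ?A', ?B')"
    using w by (simp_all add: wdat_def sd_def dd F)
  obtain A4 z z' b1 b2 where z: "z \<in> hom C A4 E" "z' \<in> hom C A4 E'" "b1 \<in> inv_cells C (v1' \<cdot> z') (v1 \<cdot> z)" "b2 \<in> inv_cells C (v2 \<cdot> z) (v2' \<cdot> z')"
    "(w1 \<cdot> v1) \<cdot> z \<in> W" "(\<iota> w2 \<star> b2) \<odot> pull C w1 v1 w2 v2 a z \<odot> (\<iota> w1 \<star> b1) = pull C w1 v1' w2 v2' a' z'"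
    "(\<iota> f2 \<star> b2) \<odot> pull C f1 v1 f2 v2 b z \<odot> (\<iota> f1 \<star> b1) = pull C f1 v1' f2 v2' b' z'"
    using r by (auto simp: frac_rel_def F dd)
  note e = dat_D[OF D(1), unfolded F, simplified] dat_D[OF D(2), unfolded F, simplified]
  have zm: "z \<in> Mor C" "tgt C z = src C v1" "z' \<in> Mor C" "tgt C z' = src C v1'" "src C z' = src C z"
    using z w by (auto simp: hom_def)
  have i: "iso ([v1', z'], b1, [v1, z])" "iso ([v2, z], b2, [v2', z'])"
    by (rule inv_cell_iso; use z zm e in auto)+
  have va: "valid ?A" "valid ?A'" "valid ?B" "valid ?B'" using e by auto
  let ?S1 = "sinv ([v1', z'], b1, [v1, z])" and ?S2 = "([v2, z], b2, [v2', z'])"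
  have eq: "[w2] \<rhd> ?S2 \<bullet> ?A \<lhd> [z] = ?A' \<lhd> [z'] \<bullet> [w1] \<rhd> ?S1" "[f2] \<rhd> ?S2 \<bullet> ?B \<lhd> [z] = ?B' \<lhd> [z'] \<bullet> [f1] \<rhd> ?S1"
    using frac_eq_iff[OF va(1,2) i] frac_eq_iff[OF va(3,4) i] z by auto
  have "link F1 F2 [z] [z'] ?S1 ?S2 (sd F1 F2 d) (sd F1 F2 d')"
    unfolding link_def lk_def sd_def dd F using eq i zm e by (auto simp: tp_def)
  moreover have "WP (den F1 # fst (sd F1 F2 d) @ [z])"
    using WP_iso[of "kap [w1, v1] \<lhd> [z]"] z(5) e zm by (simp add: WP_def F dd sd_def)
  ultimately show "lnk F1 F2 (sd F1 F2 d) (sd F1 F2 d')" unfolding lnk_def by blast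
qed

lemma lnk_refl: assumes "wdat F1 F2 D" shows "lnk F1 F2 D D"
proof -
  obtain x1 x2 \<alpha> \<beta> where D: "D = (x1, x2, \<alpha>, \<beta>)" by (cases D)
  have d: "dat F1 F2 (x1, x2, \<alpha>, \<beta>)" "WP (den F1 # x1)" using assms by (auto simp: D wdat_def)
  note e = dat_D[OF d(1)]
  let ?h = "[\<one> (sr x1)]"
  have "link F1 F2 ?h ?h (sid (x1 @ ?h)) (sid (x2 @ ?h)) D D" unfolding D by (rule link_refl[OF d(1)]) (use e in auto)
  moreover have "WP (den F1 # fst D @ ?h)" using WP_append[OF d(2), of ?h] e by (simp add: D)
  ultimately show ?thesis unfolding lnk_def by blast
qed

definition cell :: "('o, 'm) fmor \<Rightarrow> ('o, 'm) fmor \<Rightarrow> ('o, 'm, 'c) fcell \<Rightarrow> bool" where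
  "cell F1 F2 \<Gamma> \<longleftrightarrow> \<Gamma> \<in> frac_Cell C W \<and> fst \<Gamma> = F1 \<and> fst (snd \<Gamma>) = F2"

lemma cell_par: "cell F1 F2 \<Gamma> \<Longrightarrow> par F1 F2"
  by (auto simp: cell_def frac_Cell_def par_def)

lemma cell_class:
  assumes "cell F1 F2 \<Gamma>"
  obtains d0 where "d0 \<in> frac_data C W F1 F2" "\<Gamma> = (F1, F2, frac_rel C W F1 F2 `` {d0})"
  using assms by (auto simp: cell_def frac_Cell_def quotient_def)

lemma wdat_sd: "par F1 F2 \<Longrightarrow> d \<in> frac_data C W F1 F2 \<Longrightarrow> wdat F1 F2 (sd F1 F2 d)"
  using frac_data_iff by (cases d) blast

text \<open>Being a class of \<open>frac_rel\<close> is rephrased through \<open>lnk\<close>, whose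
  reflexivity, symmetry and transitivity are already known.\<close>

lemma cell_data:
  assumes "cell F1 F2 \<Gamma>"
  shows "snd (snd \<Gamma>) \<noteq> {}" "d \<in> snd (snd \<Gamma>) \<Longrightarrow> d \<in> frac_data C W F1 F2"
    "d \<in> snd (snd \<Gamma>) \<Longrightarrow> d' \<in> snd (snd \<Gamma>) \<Longrightarrow> lnk F1 F2 (sd F1 F2 d) (sd F1 F2 d')"
    "d \<in> snd (snd \<Gamma>) \<Longrightarrow> d' \<in> frac_data C W F1 F2 \<Longrightarrow> lnk F1 F2 (sd F1 F2 d) (sd F1 F2 d') \<Longrightarrow> d' \<in> snd (snd \<Gamma>)"
proof -
  note P = cell_par[OF assms]
  obtain d0 where d0: "d0 \<in> frac_data C W F1 F2" "\<Gamma> = (F1, F2, frac_rel C W F1 F2 `` {d0})"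
    using cell_class[OF assms] .
  note wd = wdat_sd[OF P]
  have dd: "\<And>d. d \<in> frac_data C W F1 F2 \<Longrightarrow> dat F1 F2 (sd F1 F2 d)" using wd by (auto simp: wdat_def)
  have X: "d \<in> snd (snd \<Gamma>) \<longleftrightarrow> d \<in> frac_data C W F1 F2 \<and> lnk F1 F2 (sd F1 F2 d0) (sd F1 F2 d)" for d
    using frac_rel_link[OF P, of d0 d] link_frac_rel[OF P d0(1), of d] d0(2) by auto
  show "snd (snd \<Gamma>) \<noteq> {}" using X[of d0] d0 lnk_refl wd by auto
  show "d \<in> snd (snd \<Gamma>) \<Longrightarrow> d \<in> frac_data C W F1 F2" using X by auto
  show "d \<in> snd (snd \<Gamma>) \<Longrightarrow> d' \<in> snd (snd \<Gamma>) \<Longrightarrow> lnk F1 F2 (sd F1 F2 d) (sd F1 F2 d')"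
    using X lnk_sym[OF dd[OF d0(1)] dd] lnk_trans[OF wd wd[OF d0(1)] wd] by blast
  show "d \<in> snd (snd \<Gamma>) \<Longrightarrow> d' \<in> frac_data C W F1 F2 \<Longrightarrow> lnk F1 F2 (sd F1 F2 d) (sd F1 F2 d') \<Longrightarrow> d' \<in> snd (snd \<Gamma>)"
    using X lnk_trans[OF wd[OF d0(1)] wd wd] by blast
qed

lemma cell_frac_class:
  assumes "par F1 F2" "d \<in> frac_data C W F1 F2"
  shows "cell F1 F2 (frac_class C W F1 F2 d)" "d \<in> snd (snd (frac_class C W F1 F2 d))"
proof -
  show "cell F1 F2 (frac_class C W F1 F2 d)"
    using assms by (auto simp: cell_def frac_Cell_def frac_class_def par_def intro: quotientI)
  show "d \<in> snd (snd (frac_class C W F1 F2 d))"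
    using link_frac_rel[OF assms assms(2)] lnk_refl[OF wdat_sd[OF assms]] by (auto simp: frac_class_def)
qed

lemma cell_eqI:
  assumes "cell F1 F2 \<Gamma>" "cell F1 F2 \<Delta>" "d \<in> snd (snd \<Gamma>)" "d \<in> snd (snd \<Delta>)"
  shows "\<Gamma> = \<Delta>"
proof -
  have "snd (snd \<Gamma>) = snd (snd \<Delta>)"
    using cell_data(2-4)[OF assms(1)] cell_data(2-4)[OF assms(2)] assms(3,4) by blast
  then show ?thesis using assms by (auto simp: cell_def prod_eq_iff)
qed

text \<open>
  \<open>holds \<Gamma> (x1, x2, \<alpha>, \<beta>)\<close>: restricted along morphisms \<open>x1\<close>, \<open>x2\<close> with common source and compared
  by \<open>\<alpha>\<close> over the source, \<open>\<Gamma>\<close> is represented by \<open>\<beta>\<close>, locally for \<open>W\<close>.  The source of \<open>x1\<close>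
  need not be mapped by a morphism of \<open>W\<close>.
\<close>

definition holds :: "('o, 'm, 'c) fcell \<Rightarrow> ('m, 'c) sdatum \<Rightarrow> bool" where
  "holds \<Gamma> D \<longleftrightarrow> (case \<Gamma> of (F1, F2, X) \<Rightarrow> dat F1 F2 D
     \<and> (\<exists>d \<in> X. \<exists>z h s1 s2. WP z \<and> link F1 F2 z h s1 s2 D (sd F1 F2 d)))"

lemma holds_iff:
  assumes "cell F1 F2 \<Gamma>"
  shows "holds \<Gamma> D \<longleftrightarrow> dat F1 F2 D \<and> (\<exists>d \<in> snd (snd \<Gamma>). \<exists>z h s1 s2. WP z \<and> link F1 F2 z h s1 s2 D (sd F1 F2 d))"
proof -
  obtain X where "\<Gamma> = (F1, F2, X)" using assms by (cases \<Gamma>) (auto simp: cell_def)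
  then show ?thesis by (simp add: holds_def)
qed

lemma link_tp: "link F1 F2 h h' s1 s2 (x1, x2, \<alpha>, \<beta>) (x1', x2', \<alpha>', \<beta>') \<Longrightarrow> tp h h' s1 s2 x1 x2 x1' x2'"
  by (simp add: link_def)

text \<open>A value is carried along any comparison whose restriction on the side of the new datum
  lies in \<open>W\<close>: (BF3) aligns the restriction hidden in \<open>holds\<close> with the one
  at the old datum.\<close>

lemma holds_link:
  assumes \<Gamma>: "cell F1 F2 \<Gamma>" and h: "holds \<Gamma> D" and D': "dat F1 F2 D'" and l: "link F1 F2 k k' t1 t2 D' D" and W: "WP k"
  shows "holds \<Gamma> D'"
proof -
  obtain d z h s1 s2 where d: "d \<in> snd (snd \<Gamma>)" "WP z" "link F1 F2 z h s1 s2 D (sd F1 F2 d)" "dat F1 F2 D"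
    using h holds_iff[OF \<Gamma>] by blast
  obtain x1 x2 \<alpha> \<beta> y1 y2 \<alpha>' \<beta>' e1 e2 \<alpha>'' \<beta>'' where D: "D = (x1, x2, \<alpha>, \<beta>)" "D' = (y1, y2, \<alpha>', \<beta>')" "sd F1 F2 d = (e1, e2, \<alpha>'', \<beta>'')"
    by (cases D; cases D'; cases "sd F1 F2 d") auto
  note t = tp_D[OF link_tp[OF d(3)[unfolded D]]] tp_D[OF link_tp[OF l[unfolded D]]]
  obtain y x s where y: "WP y" "tg y = sr k'" "iso s" "dom s = k' @ y" "cod s = z @ x" "pth x" "tg x = sr z" "sr x = sr y"
    by (rule bf3[OF d(2), of k']) (use t in auto)
  have L1: "link F1 F2 (k @ y) (k' @ y) (t1 \<lhd> y) (t2 \<lhd> y) D' D" by (rule link_res[OF D' l]) (use y t in auto)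
  have L2: "link F1 F2 (k' @ y) (z @ x) (x1 \<rhd> s) (x2 \<rhd> s) D D"
    using link_adj[OF d(4)[unfolded D] y(3)] y t by (simp add: D)
  have L3: "link F1 F2 (z @ x) (h @ x) (s1 \<lhd> x) (s2 \<lhd> x) D (sd F1 F2 d)"
    by (rule link_res[OF d(4) d(3)]) (use y t in auto)
  note link_trans[OF L1 link_trans[OF L2 L3]]
  moreover have "WP (k @ y)" using W y t by (auto intro: WP_append)
  ultimately show ?thesis using holds_iff[OF \<Gamma>] d(1) D' by blast
qed

lemma dat_res:
  assumes "dat F1 F2 (x1, x2, \<alpha>, \<beta>)" "pth h" "tg h = sr x1"
  shows "dat F1 F2 (x1 @ h, x2 @ h, \<alpha> \<lhd> h, \<beta> \<lhd> h)"
  using dat_D[OF assms(1)] assms(2,3) by (auto simp: dat_def ty_def)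

lemma dat_iso:
  assumes "dat F1 F2 (x1, x2, \<alpha>, \<beta>)" "iso t1" "iso t2" "cod t1 = x1" "cod t2 = x2"
  shows "dat F1 F2 (dom t1, dom t2, [den F2] \<rhd> sinv t2 \<bullet> \<alpha> \<bullet> [den F1] \<rhd> t1, [num F2] \<rhd> sinv t2 \<bullet> \<beta> \<bullet> [num F1] \<rhd> t1)"
  using dat_D[OF assms(1)] assms(2-) valid_D[OF iso_valid[OF assms(2)]] valid_D[OF iso_valid[OF assms(3)]]
  by (auto simp: dat_def ty_def)

lemma link_dat_res:
  assumes "dat F1 F2 (x1, x2, \<alpha>, \<beta>)" "pth h" "tg h = sr x1"
  shows "link F1 F2 [\<one> (sr h)] (h @ [\<one> (sr h)]) (sid (x1 @ h @ [\<one> (sr h)])) (sid (x2 @ h @ [\<one> (sr h)]))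
    (x1 @ h, x2 @ h, \<alpha> \<lhd> h, \<beta> \<lhd> h) (x1, x2, \<alpha>, \<beta>)"
  using dat_D[OF assms(1)] assms(2,3) by (auto simp: link_def tp_def lk_def lw_sid)

lemma link_dat_iso:
  assumes "dat F1 F2 (x1, x2, \<alpha>, \<beta>)" "iso t1" "iso t2" "cod t1 = x1" "cod t2 = x2" "pth h" "tg h = sr x1"
  shows "link F1 F2 h h (t1 \<lhd> h) (t2 \<lhd> h)
    (dom t1, dom t2, [den F2] \<rhd> sinv t2 \<bullet> \<alpha> \<bullet> [den F1] \<rhd> t1, [num F2] \<rhd> sinv t2 \<bullet> \<beta> \<bullet> [num F1] \<rhd> t1) (x1, x2, \<alpha>, \<beta>)"
  using dat_D[OF assms(1)] assms(2-) valid_D[OF iso_valid[OF assms(2)]] valid_D[OF iso_valid[OF assms(3)]]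
  by (auto simp: link_def tp_def lk_def cancels)

lemma link_dat_germ:
  assumes "dat F1 F2 (x1, x2, \<alpha>, \<beta>)" "\<alpha>' \<approx> \<alpha>" "\<beta>' \<approx> \<beta>" "pth h" "tg h = sr x1"
  shows "link F1 F2 h h (sid (x1 @ h)) (sid (x2 @ h)) (x1, x2, \<alpha>', \<beta>') (x1, x2, \<alpha>, \<beta>)"
  using dat_D[OF assms(1)] assms(4,5) germ_D[OF assms(2)] germ_D[OF assms(3)] germ_rw[OF assms(2), of h] germ_rw[OF assms(3), of h]
  by (auto simp: link_def tp_def lk_def lw_sid)

context
  fixes F1 F2 \<Gamma> assumes \<Gamma>: "cell F1 F2 \<Gamma>"
begin

lemma holds_dat: "holds \<Gamma> D \<Longrightarrow> dat F1 F2 D"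
  using holds_iff[OF \<Gamma>] by blast

lemma holds_res:
  assumes "holds \<Gamma> (x1, x2, \<alpha>, \<beta>)" "pth h" "tg h = sr x1"
  shows "holds \<Gamma> (x1 @ h, x2 @ h, \<alpha> \<lhd> h, \<beta> \<lhd> h)"
  using holds_link[OF \<Gamma> assms(1) dat_res link_dat_res] holds_dat[OF assms(1)] assms(2,3) by simp

lemma holds_iso:
  assumes "holds \<Gamma> (x1, x2, \<alpha>, \<beta>)" "iso t1" "iso t2" "cod t1 = x1" "cod t2 = x2"
  shows "holds \<Gamma> (dom t1, dom t2, [den F2] \<rhd> sinv t2 \<bullet> \<alpha> \<bullet> [den F1] \<rhd> t1, [num F2] \<rhd> sinv t2 \<bullet> \<beta> \<bullet> [num F1] \<rhd> t1)"
  using holds_link[OF \<Gamma> assms(1) dat_iso[OF _ assms(2-5)] link_dat_iso[OF _ assms(2-5), of _ _ _ _ "[\<one> (sr x1)]"]]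
    holds_dat[OF assms(1)] dat_D[OF holds_dat[OF assms(1)]] by simp

lemma holds_germ:
  assumes "holds \<Gamma> (x1, x2, \<alpha>, \<beta>)" "\<alpha>' \<approx> \<alpha>" "\<beta>' \<approx> \<beta>" "iso \<alpha>'"
  shows "holds \<Gamma> (x1, x2, \<alpha>', \<beta>')"
proof -
  note d = dat_D[OF holds_dat[OF assms(1)]]
  have "dat F1 F2 (x1, x2, \<alpha>', \<beta>')" using d assms(4) germ_D[OF assms(2)] germ_D[OF assms(3)] by (auto simp: dat_def ty_def)
  then show ?thesis
    using holds_link[OF \<Gamma> assms(1) _ link_dat_germ[OF holds_dat[OF assms(1)] assms(2,3)], of "[\<one> (sr x1)]"] d by simp
qed

text \<open>The restriction along \<open>z\<close> is absorbed by the one that \<open>holds\<close>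
  allows; an identity is appended because links are made of nonempty paths.\<close>

lemma holds_descend:
  assumes "holds \<Gamma> (x1 @ z, x2 @ z, \<alpha> \<lhd> z, \<beta> \<lhd> z)" "WP z" "tg z = sr x1" "dat F1 F2 (x1, x2, \<alpha>, \<beta>)"
  shows "holds \<Gamma> (x1, x2, \<alpha>, \<beta>)"
proof -
  note d = dat_D[OF assms(4)]
  have "pth z" using assms by simp
  let ?e = "[\<one> (sr z)]"
  have e: "WP (z @ ?e)" using assms(2) by (auto intro!: WP_append)
  have "link F1 F2 (z @ ?e) ?e (sid (x1 @ z @ ?e)) (sid (x2 @ z @ ?e)) (x1, x2, \<alpha>, \<beta>) (x1 @ z, x2 @ z, \<alpha> \<lhd> z, \<beta> \<lhd> z)"
    using d \<open>pth z\<close> assms(3) by (auto simp: link_def tp_def lk_def lw_sid)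
  then show ?thesis using holds_link[OF \<Gamma> assms(1) assms(4) _ e] by blast
qed

text \<open>Both data are linked to representatives of one class, and these to each other. On
  denominators the chain closes up through the test itself; \<open>alink_link\<close> extends the
  comparison of the representatives to numerators, and going round the loop leaves the identity
  comparison of \<beta>' with \<beta>.\<close>

lemma holds_unique:
  assumes h1: "holds \<Gamma> (x1, x2, \<alpha>, \<beta>)" and h2: "holds \<Gamma> (x1, x2, \<alpha>', \<beta>')" and a: "\<alpha>' \<approx> \<alpha>"
  shows "\<beta>' \<approx> \<beta>"
proof -
  let ?D = "(x1, x2, \<alpha>, \<beta>)" and ?D' = "(x1, x2, \<alpha>', \<beta>')"
  have dd: "dat F1 F2 ?D" "dat F1 F2 ?D'" using h1 h2 holds_dat by auto
  note P = cell_par[OF \<Gamma>]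
  obtain d z h s1 s2 where l: "d \<in> snd (snd \<Gamma>)" "WP z" "link F1 F2 z h s1 s2 ?D (sd F1 F2 d)"
    using h1 holds_iff[OF \<Gamma>] by blast
  obtain d' z' h' s1' s2' where l': "d' \<in> snd (snd \<Gamma>)" "WP z'" "link F1 F2 z' h' s1' s2' ?D' (sd F1 F2 d')"
    using h2 holds_iff[OF \<Gamma>] by blast
  have wd: "wdat F1 F2 (sd F1 F2 d)" "wdat F1 F2 (sd F1 F2 d')"
    using wdat_sd[OF P cell_data(2)[OF \<Gamma> l(1)]] wdat_sd[OF P cell_data(2)[OF \<Gamma> l'(1)]] .
  then have ds: "dat F1 F2 (sd F1 F2 d)" "dat F1 F2 (sd F1 F2 d')" by (auto simp: wdat_def)
  have K: "lnk F1 F2 (sd F1 F2 d') (sd F1 F2 d)" using cell_data(3)[OF \<Gamma> l'(1) l(1)] .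
  obtain e1 e2 \<alpha>1 \<beta>1 c1 c2 \<alpha>2 \<beta>2 where D: "sd F1 F2 d = (e1, e2, \<alpha>1, \<beta>1)" "sd F1 F2 d' = (c1, c2, \<alpha>2, \<beta>2)"
    by (cases "sd F1 F2 d"; cases "sd F1 F2 d'") auto
  note t = tp_D[OF link_tp[OF l(3)[unfolded D]]] tp_D[OF link_tp[OF l'(3)[unfolded D]]] dat_D[OF dd(1)] dat_D[OF dd(2)]
  obtain y x s where y: "WP y" "tg y = sr z'" "iso s" "dom s = z' @ y" "cod s = z @ x" "pth x" "tg x = sr z" "sr x = sr y"
    by (rule bf3[OF l(2), of z']) (use t in auto)
  have L1: "link F1 F2 (z' @ y) (h' @ y) (s1' \<lhd> y) (s2' \<lhd> y) ?D' (sd F1 F2 d')"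
    by (rule link_res[OF dd(2) l'(3)]) (use y t in auto)
  have L2: "link F1 F2 (z' @ y) (z @ x) (x1 \<rhd> s) (x2 \<rhd> s) ?D ?D"
    using link_adj[OF dd(1) y(3)] y t by simp
  have L3: "link F1 F2 (z @ x) (h @ x) (s1 \<lhd> x) (s2 \<lhd> x) ?D (sd F1 F2 d)"
    by (rule link_res[OF dd(1) l(3)]) (use y t in auto)
  note L23 = link_trans[OF L2 L3]
  \<comment> \<open>Here the hypothesis on \<alpha> enters: the identity compares the denominators
    of the two data.\<close>
  have "alink F1 F2 (z' @ y) (z' @ y) (sid (x1 @ z' @ y)) (sid (x2 @ z' @ y)) ?D' ?D"
    using link_dat_germ[OF dd(1) a, of \<beta> "z' @ y"] t y unfolding link_def alink_def by simp
  note A = alink_trans[OF alink_sym[OF dd(2) ds(2) link_alink[OF L1]] alink_trans[OF this link_alink[OF L23]]]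
  have "link F1 F2 (z' @ y) (z' @ y)
      (sinv (s1 \<lhd> x \<bullet> x1 \<rhd> s) \<bullet> (((s1 \<lhd> x \<bullet> x1 \<rhd> s) \<bullet> sid (x1 @ z' @ y)) \<bullet> sinv (s1' \<lhd> y)) \<bullet> s1' \<lhd> y)
      (sinv (s2 \<lhd> x \<bullet> x2 \<rhd> s) \<bullet> (((s2 \<lhd> x \<bullet> x2 \<rhd> s) \<bullet> sid (x2 @ z' @ y)) \<bullet> sinv (s2' \<lhd> y)) \<bullet> s2' \<lhd> y) ?D' ?D"
    using link_trans[OF L1 link_trans[OF alink_link[OF wd(2,1) P K A] link_sym[OF dd(1) ds(1) L23]]] by simp
  moreover have "sinv (s1 \<lhd> x \<bullet> x1 \<rhd> s) \<bullet> (((s1 \<lhd> x \<bullet> x1 \<rhd> s) \<bullet> sid (x1 @ z' @ y)) \<bullet> sinv (s1' \<lhd> y)) \<bullet> s1' \<lhd> y = sid (x1 @ z' @ y)"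
    "sinv (s2 \<lhd> x \<bullet> x2 \<rhd> s) \<bullet> (((s2 \<lhd> x \<bullet> x2 \<rhd> s) \<bullet> sid (x2 @ z' @ y)) \<bullet> sinv (s2' \<lhd> y)) \<bullet> s2' \<lhd> y = sid (x2 @ z' @ y)"
    using t y by (simp_all add: cancels)
  ultimately have "link F1 F2 (z' @ y) (z' @ y) (sid (x1 @ z' @ y)) (sid (x2 @ z' @ y)) ?D' ?D" by simp
  then have "\<beta>' \<lhd> (z' @ y) \<approx> \<beta> \<lhd> (z' @ y)"
    using t y by (simp add: link_def lk_def lw_sid)
  then show ?thesis
    by (rule germ_descend[rotated -1]) (use t y l' in \<open>auto intro: WP_append\<close>)
qed

end

end

section \<open>Computing 2-morphisms from their values\<close>

context BF
begin

text \<open>Any two morphisms compared over the source of a datum factor, locally for \<open>W\<close>, through it.\<close>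

lemma reach:
  assumes P: "par F1 F2" and D: "wdat F1 F2 (v1, v2, \<alpha>0, \<beta>0)"
    and a: "iso \<alpha>" "dom \<alpha> = den F1 # x1" "cod \<alpha> = den F2 # x2" "pth x1" "pth x2"
  obtains z h s1 s2 where "WP z" "tg z = sr x1" "tp z h s1 s2 x1 x2 v1 v2" "lk (den F1) (den F2) z h s1 s2 \<alpha> \<alpha>0"
proof -
  let ?w1 = "den F1" and ?w2 = "den F2"
  note p = par_D[OF P]
  have D': "dat F1 F2 (v1, v2, \<alpha>0, \<beta>0)" "WP (?w1 # v1)" using D by (auto simp: wdat_def)
  note d = dat_D[OF D'(1)]
  note e = valid_D[OF iso_valid[OF a(1)], unfolded a(2,3)]
  have x: "sr x2 = sr x1" "tg x1 = src C ?w1" "tg x2 = src C ?w2" using e a p by auto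
  \<comment> \<open>(BF3) and lifting through \<open>den F1\<close> relate \<open>x1\<close> to
    \<open>v1\<close>. Then \<alpha> and \<alpha>0 transport this comparison to the other side,
    where lifting through \<open>den F2\<close> relates \<open>x2\<close> to
    \<open>v2\<close>.\<close>
  obtain z h s where z: "WP z" "tg z = sr (?w1 # x1)" "iso s" "dom s = (?w1 # x1) @ z" "cod s = (?w1 # v1) @ h" "pth h" "tg h = sr (?w1 # v1)" "sr h = sr z"
    by (rule bf3[OF D'(2), of "?w1 # x1"]) (use e a d in auto)
  obtain y t1 where y: "WP y" "tg y = sr (x1 @ z)" "valid t1" "dom t1 = (x1 @ z) @ y" "cod t1 = (v1 @ h) @ y" "s \<lhd> y = [?w1] \<rhd> t1" "iso s \<Longrightarrow> iso t1"
    by (rule lift[of "[?w1]" "x1 @ z" "v1 @ h" s]) (use z p e d a x in auto)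
  have it: "iso t1" using y z by simp
  have u: "iso (\<alpha>0 \<lhd> (h @ y) \<bullet> [?w1] \<rhd> t1 \<bullet> sinv \<alpha> \<lhd> (z @ y))"
    using it y z d a p e x by simp
  obtain k t2 where k: "WP k" "tg k = sr (x2 @ z @ y)" "valid t2" "dom t2 = (x2 @ z @ y) @ k" "cod t2 = (v2 @ h @ y) @ k"
      "(\<alpha>0 \<lhd> (h @ y) \<bullet> [?w1] \<rhd> t1 \<bullet> sinv \<alpha> \<lhd> (z @ y)) \<lhd> k = [?w2] \<rhd> t2" "iso (\<alpha>0 \<lhd> (h @ y) \<bullet> [?w1] \<rhd> t1 \<bullet> sinv \<alpha> \<lhd> (z @ y)) \<Longrightarrow> iso t2"
    by (rule lift[of "[?w2]" "x2 @ z @ y" "v2 @ h @ y" "\<alpha>0 \<lhd> (h @ y) \<bullet> [?w1] \<rhd> t1 \<bullet> sinv \<alpha> \<lhd> (z @ y)"])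
      (use it y z p e d a x in auto)
  have it2: "iso t2" using k(7) u by simp
  have "tp (z @ y @ k) (h @ y @ k) (t1 \<lhd> k) t2 x1 x2 v1 v2"
    using it it2 k(1-5) y(1-5) z d e a x by (auto simp: tp_def)
  moreover have "[?w2] \<rhd> t2 \<bullet> \<alpha> \<lhd> (z @ y @ k) = \<alpha>0 \<lhd> (h @ y @ k) \<bullet> [?w1] \<rhd> (t1 \<lhd> k)"
    unfolding k(6)[symmetric] using it it2 k(1-5) y(1-5) z d e a x p by (simp add: cancels)
  then have "lk ?w1 ?w2 (z @ y @ k) (h @ y @ k) (t1 \<lhd> k) t2 \<alpha> \<alpha>0"
    unfolding lk_def using it it2 k(1-5) y(1-5) z d e a x p by simp
  moreover have "WP (z @ y @ k)" "tg (z @ y @ k) = sr x1"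
    using z y(1,2) k(1,2) e a x by (auto intro!: WP_append)
  ultimately show ?thesis using that by blast
qed

text \<open>
  The closure properties of \<open>holds \<Gamma>\<close>.  An operation of \<open>\<C>[W\<^sup>-\<^sup>1]\<close> is the class of a datum built from
  arbitrary auxiliary choices; if all data so obtained lie in one good set, then they all hold for the result.
\<close>

definition good :: "('o, 'm) fmor \<Rightarrow> ('o, 'm) fmor \<Rightarrow> (('m, 'c) sdatum \<Rightarrow> bool) \<Rightarrow> bool" where
  "good F1 F2 G \<longleftrightarrow> (\<forall>D. G D \<longrightarrow> dat F1 F2 D)
     \<and> (\<forall>x1 x2 \<alpha> \<beta> h. G (x1, x2, \<alpha>, \<beta>) \<longrightarrow> pth h \<longrightarrow> tg h = sr x1 \<longrightarrow> G (x1 @ h, x2 @ h, \<alpha> \<lhd> h, \<beta> \<lhd> h))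
     \<and> (\<forall>x1 x2 \<alpha> \<beta> t1 t2. G (x1, x2, \<alpha>, \<beta>) \<longrightarrow> iso t1 \<longrightarrow> iso t2 \<longrightarrow> cod t1 = x1 \<longrightarrow> cod t2 = x2 \<longrightarrow>
          G (dom t1, dom t2, [den F2] \<rhd> sinv t2 \<bullet> \<alpha> \<bullet> [den F1] \<rhd> t1, [num F2] \<rhd> sinv t2 \<bullet> \<beta> \<bullet> [num F1] \<rhd> t1))
     \<and> (\<forall>x1 x2 \<alpha> \<beta> \<alpha>' \<beta>'. G (x1, x2, \<alpha>, \<beta>) \<longrightarrow> G (x1, x2, \<alpha>', \<beta>') \<longrightarrow> \<alpha>' \<approx> \<alpha> \<longrightarrow> \<beta>' \<approx> \<beta>)"

lemma goodI:
  assumes "\<And>x1 x2 \<alpha> \<beta>. G (x1, x2, \<alpha>, \<beta>) \<Longrightarrow> dat F1 F2 (x1, x2, \<alpha>, \<beta>)"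
    and "\<And>x1 x2 \<alpha> \<beta> h. G (x1, x2, \<alpha>, \<beta>) \<Longrightarrow> pth h \<Longrightarrow> tg h = sr x1 \<Longrightarrow> G (x1 @ h, x2 @ h, \<alpha> \<lhd> h, \<beta> \<lhd> h)"
    and "\<And>x1 x2 \<alpha> \<beta> t1 t2. G (x1, x2, \<alpha>, \<beta>) \<Longrightarrow> iso t1 \<Longrightarrow> iso t2 \<Longrightarrow> cod t1 = x1 \<Longrightarrow> cod t2 = x2 \<Longrightarrow>
          G (dom t1, dom t2, [den F2] \<rhd> sinv t2 \<bullet> \<alpha> \<bullet> [den F1] \<rhd> t1, [num F2] \<rhd> sinv t2 \<bullet> \<beta> \<bullet> [num F1] \<rhd> t1)"
    and "\<And>x1 x2 \<alpha> \<beta> \<alpha>' \<beta>'. G (x1, x2, \<alpha>, \<beta>) \<Longrightarrow> G (x1, x2, \<alpha>', \<beta>') \<Longrightarrow> \<alpha>' \<approx> \<alpha> \<Longrightarrow> \<beta>' \<approx> \<beta>"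
  shows "good F1 F2 G"
  unfolding good_def using assms by auto

lemma goodD:
  assumes "good F1 F2 G"
  shows "G D \<Longrightarrow> dat F1 F2 D"
    and "G (x1, x2, \<alpha>, \<beta>) \<Longrightarrow> pth h \<Longrightarrow> tg h = sr x1 \<Longrightarrow> G (x1 @ h, x2 @ h, \<alpha> \<lhd> h, \<beta> \<lhd> h)"
    and "G (x1, x2, \<alpha>, \<beta>) \<Longrightarrow> iso t1 \<Longrightarrow> iso t2 \<Longrightarrow> cod t1 = x1 \<Longrightarrow> cod t2 = x2 \<Longrightarrow>
          G (dom t1, dom t2, [den F2] \<rhd> sinv t2 \<bullet> \<alpha> \<bullet> [den F1] \<rhd> t1, [num F2] \<rhd> sinv t2 \<bullet> \<beta> \<bullet> [num F1] \<rhd> t1)"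
    and "G (x1, x2, \<alpha>, \<beta>) \<Longrightarrow> G (x1, x2, \<alpha>', \<beta>') \<Longrightarrow> \<alpha>' \<approx> \<alpha> \<Longrightarrow> \<beta>' \<approx> \<beta>"
  using assms unfolding good_def by blast+

lemma holds_good: "cell F1 F2 \<Gamma> \<Longrightarrow> good F1 F2 (holds \<Gamma>)"
  by (rule goodI) (blast intro: holds_dat holds_res holds_iso holds_unique)+

lemma holds_sd:
  assumes "cell F1 F2 \<Gamma>" "d \<in> snd (snd \<Gamma>)"
  shows "holds \<Gamma> (sd F1 F2 d)"
proof -
  obtain x1 x2 \<alpha> \<beta> where D: "sd F1 F2 d = (x1, x2, \<alpha>, \<beta>)" by (cases "sd F1 F2 d")
  have "wdat F1 F2 (sd F1 F2 d)" using wdat_sd[OF cell_par[OF assms(1)] cell_data(2)[OF assms]] .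
  then have dd: "dat F1 F2 (x1, x2, \<alpha>, \<beta>)" by (simp add: wdat_def D)
  have "link F1 F2 [\<one> (sr x1)] [\<one> (sr x1)] (sid (x1 @ [\<one> (sr x1)])) (sid (x2 @ [\<one> (sr x1)])) (sd F1 F2 d) (sd F1 F2 d)"
    unfolding D by (rule link_refl[OF dd]) (use dat_D[OF dd] in auto)
  moreover have "WP [\<one> (sr x1)]" using dat_D[OF dd] by simp
  ultimately show ?thesis unfolding holds_iff[OF assms(1)] using assms(2) dd[folded D] by blast
qed

text \<open>By \<open>reach\<close> the test factors, after restriction, through that of the
  representative. Closure carries the value of the representative there, both in \<open>G\<close>
  and for \<Gamma>, and uniqueness in \<open>G\<close> identifies it with the given \<beta>.\<close>

lemma good_holds:
  assumes P: "par F1 F2" and g: "good F1 F2 G" and \<Gamma>: "cell F1 F2 \<Gamma>" "d0 \<in> snd (snd \<Gamma>)" "G (sd F1 F2 d0)"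
    and D: "G (x1, x2, \<alpha>, \<beta>)"
  shows "holds \<Gamma> (x1, x2, \<alpha>, \<beta>)"
proof -
  obtain v1 v2 \<alpha>0 \<beta>0 where D0: "sd F1 F2 d0 = (v1, v2, \<alpha>0, \<beta>0)" by (cases "sd F1 F2 d0")
  have wd: "wdat F1 F2 (v1, v2, \<alpha>0, \<beta>0)" using wdat_sd[OF P cell_data(2)[OF \<Gamma>(1,2)]] by (simp add: D0)
  then have "dat F1 F2 (v1, v2, \<alpha>0, \<beta>0)" by (simp add: wdat_def)
  note d0 = dat_D[OF this]
  have dD: "dat F1 F2 (x1, x2, \<alpha>, \<beta>)" using goodD(1)[OF g D] .
  note d = dat_D[OF dD]
  obtain z h s1 s2 where z: "WP z" "tg z = sr x1" "tp z h s1 s2 x1 x2 v1 v2" "lk (den F1) (den F2) z h s1 s2 \<alpha> \<alpha>0"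
    using reach[OF P wd d(1,3,4,8,9)] .
  note t = tp_D[OF z(3)]
  define \<alpha>1 where "\<alpha>1 = [den F2] \<rhd> sinv s2 \<bullet> \<alpha>0 \<lhd> h \<bullet> [den F1] \<rhd> s1"
  define \<beta>1 where "\<beta>1 = [num F2] \<rhd> sinv s2 \<bullet> \<beta>0 \<lhd> h \<bullet> [num F1] \<rhd> s1"
  \<comment> \<open>Stated for every good set, as it is applied to \<open>G\<close> and to
    \<open>holds \<Gamma>\<close>.\<close>
  have G1: "K (x1 @ z, x2 @ z, \<alpha>1, \<beta>1)" if "good F1 F2 K" "K (sd F1 F2 d0)" for K
  proof -
    have "K (v1 @ h, v2 @ h, \<alpha>0 \<lhd> h, \<beta>0 \<lhd> h)"
      using goodD(2)[OF that(1), of v1 v2 \<alpha>0 \<beta>0 h] that(2) t by (simp add: D0)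
    from goodD(3)[OF that(1) this, of s1 s2] show ?thesis using t by (simp add: \<alpha>1_def \<beta>1_def)
  qed
  have "[den F2] \<rhd> sinv s2 \<bullet> ([den F2] \<rhd> s2 \<bullet> \<alpha> \<lhd> z) \<approx> [den F2] \<rhd> sinv s2 \<bullet> (\<alpha>0 \<lhd> h \<bullet> [den F1] \<rhd> s1)"
    by (rule germ_vc_right[OF z(4)[unfolded lk_def]]) (use t d d0 in auto)
  then have a1: "\<alpha> \<lhd> z \<approx> \<alpha>1" using t d d0 by (simp add: \<alpha>1_def cancels)
  have Gz: "G (x1 @ z, x2 @ z, \<alpha> \<lhd> z, \<beta> \<lhd> z)" using goodD(2)[OF g D, of z] z by simp
  have "\<beta> \<lhd> z \<approx> \<beta>1" using goodD(4)[OF g G1[OF g \<Gamma>(3)] Gz a1] .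
  have "holds \<Gamma> (x1 @ z, x2 @ z, \<alpha>1, \<beta>1)"
    using G1[OF holds_good[OF \<Gamma>(1)] holds_sd[OF \<Gamma>(1,2)]] .
  then have "holds \<Gamma> (x1 @ z, x2 @ z, \<alpha> \<lhd> z, \<beta> \<lhd> z)"
    by (rule holds_germ[OF \<Gamma>(1) _ a1 \<open>\<beta> \<lhd> z \<approx> \<beta>1\<close>]) (use t d in auto)
  then show ?thesis by (rule holds_descend[OF \<Gamma>(1) _ z(1,2) dD])
qed

text \<open>Whichever result \<open>SOME\<close> picks, its datum lies in \<open>G\<close>, hence
  every member of \<open>G\<close> is a value of it. For each operation it remains to show that
  \<open>Q\<close> is satisfiable and that its solutions lie in a good set.\<close>

lemma some_good:
  assumes P: "par F1 F2" and g: "good F1 F2 G" and ex: "\<exists>R. Q R"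
    and Q: "\<And>R. Q R \<Longrightarrow> \<exists>d0 \<in> frac_data C W F1 F2. G (sd F1 F2 d0) \<and> R = frac_class C W F1 F2 d0"
  shows "cell F1 F2 (SOME R. Q R)" "G D \<Longrightarrow> holds (SOME R. Q R) D"
proof -
  obtain d0 where d0: "d0 \<in> frac_data C W F1 F2" "G (sd F1 F2 d0)" "(SOME R. Q R) = frac_class C W F1 F2 d0"
    using Q[OF someI_ex[OF ex]] by blast
  show c: "cell F1 F2 (SOME R. Q R)" using cell_frac_class(1)[OF P d0(1)] d0(3) by simp
  show "holds (SOME R. Q R) D" if "G D"
    using good_holds[OF P g c _ d0(2)] cell_frac_class(2)[OF P d0(1)] d0(3) that by (cases D) simp
qed

lemma holds_ex:
  assumes c: "cell F1 F2 \<Gamma>" and a: "iso \<alpha>" "dom \<alpha> = den F1 # x1" "cod \<alpha> = den F2 # x2" "pth x1" "pth x2"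
  obtains z \<beta> where "WP z" "tg z = sr x1" "holds \<Gamma> (x1 @ z, x2 @ z, \<alpha> \<lhd> z, \<beta>)"
proof -
  note P = cell_par[OF c]
  obtain d0 where d0: "d0 \<in> snd (snd \<Gamma>)" using cell_data(1)[OF c] by blast
  obtain v1 v2 \<alpha>0 \<beta>0 where D0: "sd F1 F2 d0 = (v1, v2, \<alpha>0, \<beta>0)" by (cases "sd F1 F2 d0")
  have wd: "wdat F1 F2 (v1, v2, \<alpha>0, \<beta>0)" using wdat_sd[OF P cell_data(2)[OF c d0]] by (simp add: D0)
  then have "dat F1 F2 (v1, v2, \<alpha>0, \<beta>0)" by (simp add: wdat_def)
  note e = dat_D[OF this]
  note v = valid_D[OF iso_valid[OF a(1)], unfolded a(2,3)] par_D[OF P]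
  obtain z h s1 s2 where z: "WP z" "tg z = sr x1" "tp z h s1 s2 x1 x2 v1 v2" "lk (den F1) (den F2) z h s1 s2 \<alpha> \<alpha>0"
    using reach[OF P wd a] .
  note t = tp_D[OF z(3)]
  have "holds \<Gamma> (v1 @ h, v2 @ h, \<alpha>0 \<lhd> h, \<beta>0 \<lhd> h)"
    using holds_res[OF c, of v1 v2 \<alpha>0 \<beta>0 h] holds_sd[OF c d0] t by (simp add: D0)
  from holds_iso[OF c this, of s1 s2]
  have H: "holds \<Gamma> (x1 @ z, x2 @ z, [den F2] \<rhd> sinv s2 \<bullet> \<alpha>0 \<lhd> h \<bullet> [den F1] \<rhd> s1, [num F2] \<rhd> sinv s2 \<bullet> \<beta>0 \<lhd> h \<bullet> [num F1] \<rhd> s1)"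
    using t by simp
  note dH = dat_D[OF holds_dat[OF c H]]
  have "[den F2] \<rhd> sinv s2 \<bullet> ([den F2] \<rhd> s2 \<bullet> \<alpha> \<lhd> z) \<approx> [den F2] \<rhd> sinv s2 \<bullet> (\<alpha>0 \<lhd> h \<bullet> [den F1] \<rhd> s1)"
    by (rule germ_vc_right[OF z(4)[unfolded lk_def]]) (use t e v a in auto)
  then have a1: "\<alpha> \<lhd> z \<approx> [den F2] \<rhd> sinv s2 \<bullet> \<alpha>0 \<lhd> h \<bullet> [den F1] \<rhd> s1" using t e v a by (simp add: cancels)
  have i: "iso (\<alpha> \<lhd> z)" by (rule iso_whisk(3)[OF a(1) t(1)]) (use t(1,9,13) a v(1) in simp)
  have "holds \<Gamma> (x1 @ z, x2 @ z, \<alpha> \<lhd> z, [num F2] \<rhd> sinv s2 \<bullet> \<beta>0 \<lhd> h \<bullet> [num F1] \<rhd> s1)"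
    by (rule holds_germ[OF c H a1 _ i]) (simp only: germ_refl dH(5))
  then show ?thesis using that z by blast
qed

text \<open>A way back from data on paths to data on single morphisms: by \<open>sd_col\<close>,
  reading the result as paths again changes the datum by isomorphisms of its tests.\<close>

definition col :: "('m, 'c) sdatum \<Rightarrow> ('o, 'm, 'c) fdatum" where
  "col = (\<lambda>(x1, x2, \<alpha>, \<beta>). (sr x1, ev x1, ev x2, raw \<alpha>, raw \<beta>))"

lemma sd_col:
  assumes "dat F1 F2 (x1, x2, \<alpha>, \<beta>)"
  shows "sd F1 F2 (col (x1, x2, \<alpha>, \<beta>)) = (dom (sinv (kap x1)), dom (sinv (kap x2)),
     [den F2] \<rhd> sinv (sinv (kap x2)) \<bullet> \<alpha> \<bullet> [den F1] \<rhd> sinv (kap x1), [num F2] \<rhd> sinv (sinv (kap x2)) \<bullet> \<beta> \<bullet> [num F1] \<rhd> sinv (kap x1))"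
proof -
  note d = dat_D[OF assms]
  show ?thesis
    using collapse_right[of \<alpha> "[den F1]" x1 "[den F2]" x2] collapse_right[of \<beta> "[num F1]" x1 "[num F2]" x2] d
    by (simp add: sd_def col_def)
qed

lemma col_data:
  assumes P: "par F1 F2" and "wdat F1 F2 (x1, x2, \<alpha>, \<beta>)"
  shows "col (x1, x2, \<alpha>, \<beta>) \<in> frac_data C W F1 F2"
proof -
  have D: "dat F1 F2 (x1, x2, \<alpha>, \<beta>)" "WP (den F1 # x1)" using assms by (auto simp: wdat_def)
  note d = dat_D[OF D(1)]
  have "dat F1 F2 (sd F1 F2 (col (x1, x2, \<alpha>, \<beta>)))"
    unfolding sd_col[OF D(1)] by (rule dat_iso[OF D(1)]) (use d in auto)
  moreover have "WP [den F1, ev x1]" using WP_iso[of "[den F1] \<rhd> kap x1"] D d by simp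
  ultimately have "wdat F1 F2 (sd F1 F2 (col (x1, x2, \<alpha>, \<beta>)))" by (simp add: wdat_def sd_def col_def)
  then show ?thesis using frac_data_iff[OF P] d by (simp add: col_def)
qed

lemma holds_mem:
  assumes c: "cell F1 F2 \<Gamma>" and h: "holds \<Gamma> (x1, x2, \<alpha>, \<beta>)" and W: "WP (den F1 # x1)"
  shows "col (x1, x2, \<alpha>, \<beta>) \<in> snd (snd \<Gamma>)"
proof -
  note P = cell_par[OF c]
  have D: "dat F1 F2 (x1, x2, \<alpha>, \<beta>)" using holds_dat[OF c h] .
  note d = dat_D[OF D]
  have wd: "wdat F1 F2 (x1, x2, \<alpha>, \<beta>)" using D W by (simp add: wdat_def)
  have cd: "col (x1, x2, \<alpha>, \<beta>) \<in> frac_data C W F1 F2" using col_data[OF P wd] .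
  let ?D' = "sd F1 F2 (col (x1, x2, \<alpha>, \<beta>))"
  have "holds \<Gamma> ?D'"
    unfolding sd_col[OF D] by (rule holds_iso[OF c h]) (use d in auto)
  then obtain d' z h s1 s2 where l: "d' \<in> snd (snd \<Gamma>)" "WP z" "link F1 F2 z h s1 s2 ?D' (sd F1 F2 d')"
    using holds_iff[OF c] by blast
  have dd: "wdat F1 F2 ?D'" "wdat F1 F2 (sd F1 F2 d')" using wdat_sd[OF P cd] wdat_sd[OF P cell_data(2)[OF c l(1)]] by auto
  obtain y1 y2 \<alpha>' \<beta>' where D': "sd F1 F2 d' = (y1, y2, \<alpha>', \<beta>')" by (cases "sd F1 F2 d'")
  have S: "?D' = ([ev x1], [ev x2], ([den F1, ev x1], raw \<alpha>, [den F2, ev x2]), ([num F1, ev x1], raw \<beta>, [num F2, ev x2]))"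
    by (simp add: sd_def col_def)
  have "tp z h s1 s2 [ev x1] [ev x2] y1 y2" using link_tp[OF l(3)[unfolded S D']] .
  note t = tp_D[OF this]
  have "WP [den F1, ev x1]" using dd(1) by (simp add: wdat_def sd_def col_def)
  then have "WP (den F1 # fst ?D' @ z)" using WP_append[of "[den F1, ev x1]" z] l(2) t d by (simp add: sd_def col_def)
  then have "lnk F1 F2 ?D' (sd F1 F2 d')" using l(3) unfolding lnk_def by blast
  then have "lnk F1 F2 (sd F1 F2 d') ?D'" using lnk_sym dd by (simp add: wdat_def)
  then show ?thesis using cell_data(4)[OF c l(1) cd] by simp
qed

text \<open>A value over a member of \<open>W\<close> is, after collapsing its paths, a
  representative of the class; so the two classes share a member.\<close>

lemma holds_eq:
  assumes "cell F1 F2 \<Gamma>" "cell F1 F2 \<Delta>" "holds \<Gamma> (x1, x2, \<alpha>, \<beta>)" "holds \<Delta> (x1, x2, \<alpha>, \<beta>)" "WP (den F1 # x1)"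
  shows "\<Gamma> = \<Delta>"
  using cell_eqI[OF assms(1,2) holds_mem[OF assms(1,3,5)] holds_mem[OF assms(2,4,5)]] .

definition cls :: "('o, 'm) fmor \<Rightarrow> ('o, 'm) fmor \<Rightarrow> ('m, 'c) sdatum \<Rightarrow> ('o, 'm, 'c) fcell" where
  "cls F1 F2 D = frac_class C W F1 F2 (col D)"

lemma cls:
  assumes P: "par F1 F2" and D: "dat F1 F2 (x1, x2, \<alpha>, \<beta>)" "WP (den F1 # x1)"
  shows "cell F1 F2 (cls F1 F2 (x1, x2, \<alpha>, \<beta>))" "holds (cls F1 F2 (x1, x2, \<alpha>, \<beta>)) (x1, x2, \<alpha>, \<beta>)"
proof -
  let ?D = "(x1, x2, \<alpha>, \<beta>)"
  note d = dat_D[OF D(1)]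
  have cd: "col ?D \<in> frac_data C W F1 F2" using col_data[OF P] D by (simp add: wdat_def)
  show c: "cell F1 F2 (cls F1 F2 ?D)" using cell_frac_class(1)[OF P cd] by (simp add: cls_def)
  have "holds (cls F1 F2 ?D) (sd F1 F2 (col ?D))"
    by (rule holds_sd[OF c]) (use cell_frac_class(2)[OF P cd] in \<open>simp add: cls_def\<close>)
  from holds_iso[OF c this[unfolded sd_col[OF D(1)]], of "kap x1" "kap x2"]
  show "holds (cls F1 F2 ?D) ?D" using d by (simp add: cancels)
qed

section \<open>Identities and vertical composition\<close>

lemma par_refl: "F \<in> frac_Mor C W \<Longrightarrow> par F F" by (simp add: par_def)

text \<open>The defining datum is restricted along \<open>cod t\<close>, and the left unitor removes
  the identity morphism that this leaves in front.\<close>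

lemma holds_idc:
  assumes F: "F \<in> frac_Mor C W"
  shows "cell F F (frac_idc C W F)"
    "iso t \<Longrightarrow> tg (dom t) = src C (den F) \<Longrightarrow> holds (frac_idc C W F) (dom t, cod t, [den F] \<rhd> t, [num F] \<rhd> t)"
proof -
  obtain A w f where FF: "F = (A, w, f)" by (cases F)
  note p = frac_Mor_D[OF F, unfolded FF, simplified]
  have P: "par F F" using par_refl[OF F] .
  let ?d = "(A, \<one> A, \<one> A, \<iota> (w \<cdot> \<one> A), \<iota> (f \<cdot> \<one> A))"
  have s: "sd F F ?d = ([\<one> A], [\<one> A], sid [w, \<one> A], sid [f, \<one> A])"
    using p by (simp add: sd_def FF sid_def)
  have D: "dat F F ([\<one> A], [\<one> A], sid [w, \<one> A], sid [f, \<one> A])"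
    using p by (auto simp: dat_def ty_def FF)
  have "WP [w, \<one> A]" using WP_append[of "[w]" "[\<one> A]"] p by simp
  then have d: "?d \<in> frac_data C W F F"
    using frac_data_iff[OF P] D p s by (auto simp: wdat_def FF sid_def)
  have i: "frac_idc C W F = frac_class C W F F ?d" by (simp add: frac_idc_def FF)
  show c: "cell F F (frac_idc C W F)" unfolding i by (rule cell_frac_class(1)[OF P d])
  have h: "holds (frac_idc C W F) ([\<one> A], [\<one> A], sid [w, \<one> A], sid [f, \<one> A])"
    unfolding i s[symmetric] by (rule holds_sd[OF cell_frac_class(1)[OF P d] cell_frac_class(2)[OF P d]])
  assume t: "iso t" "tg (dom t) = src C (den F)"
  note v = valid_D[OF iso_valid[OF t(1)]]
  have "holds (frac_idc C W F) ([\<one> A] @ cod t, [\<one> A] @ cod t, sid [w, \<one> A] \<lhd> cod t, sid [f, \<one> A] \<lhd> cod t)"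
    by (rule holds_res[OF c h]) (use v t p in \<open>auto simp: FF\<close>)
  from holds_iso[OF c this, of "sinv (lu (cod t)) \<bullet> t" "sinv (lu (cod t))"]
  show "holds (frac_idc C W F) (dom t, cod t, [den F] \<rhd> t, [num F] \<rhd> t)"
    using v t p by (simp add: FF rw_sid cancels)
qed

lemma wpath: "WP [w, x, y] \<longleftrightarrow> (w \<cdot> x) \<cdot> y \<in> W" if "pth [w, x, y]"
proof -
  have "WP [w \<cdot> x, y] \<longleftrightarrow> WP [w, x, y]" using WP_iso[of "kap [w, x] \<lhd> [y]"] that by simp
  then show ?thesis using that by (simp add: WP_def)
qed

context
  fixes F1 F2 F3 \<Gamma> \<Delta>
  assumes \<Gamma>: "cell F1 F2 \<Gamma>" and \<Delta>: "cell F2 F3 \<Delta>"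
begin

text \<open>The middle test \<open>x2\<close> is arbitrary rather than the one used in the
  construction, so that the outer tests can be changed freely.\<close>

definition vgood :: "('m, 'c) sdatum \<Rightarrow> bool" where
  "vgood = (\<lambda>(x1, x3, \<alpha>, \<beta>). \<exists>x2 \<alpha>1 \<alpha>2 \<beta>1 \<beta>2. \<alpha> = \<alpha>2 \<bullet> \<alpha>1 \<and> \<beta> = \<beta>2 \<bullet> \<beta>1
     \<and> holds \<Gamma> (x1, x2, \<alpha>1, \<beta>1) \<and> holds \<Delta> (x2, x3, \<alpha>2, \<beta>2))"

lemma vgoodI:
  "holds \<Gamma> (x1, x2, \<alpha>1, \<beta>1) \<Longrightarrow> holds \<Delta> (x2, x3, \<alpha>2, \<beta>2) \<Longrightarrow> vgood (x1, x3, \<alpha>2 \<bullet> \<alpha>1, \<beta>2 \<bullet> \<beta>1)"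
  unfolding vgood_def by blast

lemma vgood_good: "good F1 F3 vgood"
proof (rule goodI)
  fix x1 x3 \<alpha> \<beta> assume G: "vgood (x1, x3, \<alpha>, \<beta>)"
  then obtain x2 \<alpha>1 \<alpha>2 \<beta>1 \<beta>2 where g: "\<alpha> = \<alpha>2 \<bullet> \<alpha>1" "\<beta> = \<beta>2 \<bullet> \<beta>1" "holds \<Gamma> (x1, x2, \<alpha>1, \<beta>1)" "holds \<Delta> (x2, x3, \<alpha>2, \<beta>2)"
    by (auto simp: vgood_def)
  note d = dat_D[OF holds_dat[OF \<Gamma> g(3)]] dat_D[OF holds_dat[OF \<Delta> g(4)]]
  show "dat F1 F3 (x1, x3, \<alpha>, \<beta>)" using d by (auto simp: dat_def ty_def g)
  show "vgood (x1 @ h, x3 @ h, \<alpha> \<lhd> h, \<beta> \<lhd> h)" if "pth h" "tg h = sr x1" for h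
    using vgoodI[OF holds_res[OF \<Gamma> g(3) that] holds_res[OF \<Delta> g(4), of h]] d that by (simp add: g)
  show "vgood (dom t1, dom t3, [den F3] \<rhd> sinv t3 \<bullet> \<alpha> \<bullet> [den F1] \<rhd> t1, [num F3] \<rhd> sinv t3 \<bullet> \<beta> \<bullet> [num F1] \<rhd> t1)"
    if t: "iso t1" "iso t3" "cod t1 = x1" "cod t3 = x3" for t1 t3
  proof -
    note v = valid_D[OF iso_valid[OF t(1)]] valid_D[OF iso_valid[OF t(2)]]
    have h1: "holds \<Gamma> (dom t1, x2, \<alpha>1 \<bullet> [den F1] \<rhd> t1, \<beta>1 \<bullet> [num F1] \<rhd> t1)"
      using holds_iso[OF \<Gamma> g(3), of t1 "sid x2"] t d v by (simp add: lw_sid)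
    have h2: "holds \<Delta> (x2, dom t3, [den F3] \<rhd> sinv t3 \<bullet> \<alpha>2, [num F3] \<rhd> sinv t3 \<bullet> \<beta>2)"
      using holds_iso[OF \<Delta> g(4), of "sid x2" t3] t d v by (simp add: lw_sid)
    show ?thesis using vgoodI[OF h1 h2] by (simp add: g)
  qed
  fix \<alpha>' \<beta>' assume G': "vgood (x1, x3, \<alpha>', \<beta>')" and a: "\<alpha>' \<approx> \<alpha>"
  from G' obtain x2' \<alpha>1' \<alpha>2' \<beta>1' \<beta>2' where g': "\<alpha>' = \<alpha>2' \<bullet> \<alpha>1'" "\<beta>' = \<beta>2' \<bullet> \<beta>1'" "holds \<Gamma> (x1, x2', \<alpha>1', \<beta>1')" "holds \<Delta> (x2', x3, \<alpha>2', \<beta>2')"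
    by (auto simp: vgood_def)
  note d' = dat_D[OF holds_dat[OF \<Gamma> g'(3)]] dat_D[OF holds_dat[OF \<Delta> g'(4)]]
  note p = par_D[OF cell_par[OF \<Gamma>]] par_D[OF cell_par[OF \<Delta>]]
  \<comment> \<open>Two factorisations may use different middle tests. Their denominators give an
    isomorphism over \<open>den F2\<close>, which lifts to one between the middle tests; uniqueness
    of values is then applied to each factor.\<close>
  obtain z s where z: "WP z" "tg z = sr x2" "valid s" "dom s = x2 @ z" "cod s = x2' @ z" "(\<alpha>1' \<bullet> sinv \<alpha>1) \<lhd> z = [den F2] \<rhd> s"
      "iso (\<alpha>1' \<bullet> sinv \<alpha>1) \<Longrightarrow> iso s"
    by (rule lift[of "[den F2]" x2 x2' "\<alpha>1' \<bullet> sinv \<alpha>1"]) (use d d' p in auto)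
  have isz: "iso s" using z d d' by simp
  note zz = z(1-5) isz
  have za: "[den F2] \<rhd> s = \<alpha>1' \<lhd> z \<bullet> sinv \<alpha>1 \<lhd> z" using z(6) by simp
  have "holds \<Gamma> (x1 @ z, x2 @ z, \<alpha>1 \<lhd> z, \<beta>1 \<lhd> z)" by (rule holds_res[OF \<Gamma> g(3)]) (use zz d in auto)
  from holds_iso[OF \<Gamma> this, of "sid (x1 @ z)" "sinv s"]
  have "holds \<Gamma> (x1 @ z, x2' @ z, [den F2] \<rhd> s \<bullet> \<alpha>1 \<lhd> z, [num F2] \<rhd> s \<bullet> \<beta>1 \<lhd> z)"
    using zz d by (simp add: lw_sid)
  then have h1: "holds \<Gamma> (x1 @ z, x2' @ z, \<alpha>1' \<lhd> z, [num F2] \<rhd> s \<bullet> \<beta>1 \<lhd> z)"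
    unfolding za using zz d d' by (simp add: cancels)
  have h1': "holds \<Gamma> (x1 @ z, x2' @ z, \<alpha>1' \<lhd> z, \<beta>1' \<lhd> z)" by (rule holds_res[OF \<Gamma> g'(3)]) (use zz d in auto)
  have b1: "\<beta>1' \<lhd> z \<approx> [num F2] \<rhd> s \<bullet> \<beta>1 \<lhd> z" by (rule holds_unique[OF \<Gamma> h1 h1']) (use zz d d' in simp)
  have "holds \<Delta> (x2 @ z, x3 @ z, \<alpha>2 \<lhd> z, \<beta>2 \<lhd> z)" by (rule holds_res[OF \<Delta> g(4)]) (use zz d in auto)
  from holds_iso[OF \<Delta> this, of "sinv s" "sid (x3 @ z)"]
  have h2: "holds \<Delta> (x2' @ z, x3 @ z, \<alpha>2 \<lhd> z \<bullet> [den F2] \<rhd> sinv s, \<beta>2 \<lhd> z \<bullet> [num F2] \<rhd> sinv s)"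
    using zz d d' by (simp add: lw_sid)
  have h2': "holds \<Delta> (x2' @ z, x3 @ z, \<alpha>2' \<lhd> z, \<beta>2' \<lhd> z)" by (rule holds_res[OF \<Delta> g'(4)]) (use zz d d' in auto)
  have zb: "[den F2] \<rhd> sinv s = \<alpha>1 \<lhd> z \<bullet> sinv \<alpha>1' \<lhd> z"
    using arg_cong[OF za, of sinv] zz d d' by simp
  have "\<alpha>' \<lhd> z \<bullet> sinv \<alpha>1' \<lhd> z \<approx> \<alpha> \<lhd> z \<bullet> sinv \<alpha>1' \<lhd> z"
    by (rule germ_vc_left[OF germ_rw[OF a]]) (use zz d d' in \<open>auto simp: g g'\<close>)
  then have a2: "\<alpha>2' \<lhd> z \<approx> \<alpha>2 \<lhd> z \<bullet> [den F2] \<rhd> sinv s"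
    unfolding zb using zz d d' by (simp add: g g' cancels)
  have b2: "\<beta>2' \<lhd> z \<approx> \<beta>2 \<lhd> z \<bullet> [num F2] \<rhd> sinv s" by (rule holds_unique[OF \<Delta> h2 h2' a2])
  have "\<beta>2' \<lhd> z \<bullet> \<beta>1' \<lhd> z \<approx> (\<beta>2 \<lhd> z \<bullet> [num F2] \<rhd> sinv s) \<bullet> ([num F2] \<rhd> s \<bullet> \<beta>1 \<lhd> z)"
    by (rule germ_vc[OF b1 b2]) (use zz d d' in auto)
  then have "\<beta>' \<lhd> z \<approx> \<beta> \<lhd> z" using zz d d' by (simp add: g g' cancels)
  then show "\<beta>' \<approx> \<beta>" by (rule germ_descend[OF _ _ _ _ zz(1), rotated -1]) (use zz d d' in \<open>auto simp: g g'\<close>)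
qed

lemma par_trans: "par F1 F2 \<Longrightarrow> par F2 F3 \<Longrightarrow> par F1 F3" by (simp add: par_def)

lemma holds_vcomp:
  shows cell_vcomp: "cell F1 F3 (frac_vcomp C W \<Delta> \<Gamma>)"
    and "holds \<Gamma> (x1, x2, \<alpha>, \<beta>) \<Longrightarrow> holds \<Delta> (x2, x3, \<alpha>', \<beta>') \<Longrightarrow> holds (frac_vcomp C W \<Delta> \<Gamma>) (x1, x3, \<alpha>' \<bullet> \<alpha>, \<beta>' \<bullet> \<beta>)"
proof -
  obtain A1 w1 f1 A2 w2 f2 A3 w3 f3 where F: "F1 = (A1, w1, f1)" "F2 = (A2, w2, f2)" "F3 = (A3, w3, f3)"
    by (cases F1; cases F2; cases F3) auto
  note P = par_trans[OF cell_par[OF \<Gamma>] cell_par[OF \<Delta>]]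
  note p = par_D[OF cell_par[OF \<Gamma>], unfolded F, simplified] par_D[OF cell_par[OF \<Delta>], unfolded F, simplified]
  obtain X Y where XY: "\<Gamma> = (F1, F2, X)" "\<Delta> = (F2, F3, Y)" using \<Gamma> \<Delta> by (cases \<Gamma>; cases \<Delta>) (auto simp: cell_def)
  \<comment> \<open>The body of the definition with its case distinctions resolved, in the shape
    required by \<open>some_good\<close>.\<close>
  define Q where "Q = (\<lambda>R. \<exists>E1 v1 v2 \<alpha> \<beta> E2 u1 u2 \<gamma> \<delta> E t1 t2 \<rho>.
       (E1, v1, v2, \<alpha>, \<beta>) \<in> X \<and> (E2, u1, u2, \<gamma>, \<delta>) \<in> Y
       \<and> E \<in> Ob C \<and> t1 \<in> hom C E E1 \<and> t2 \<in> hom C E E2 \<and> \<rho> \<in> inv_cells C (v2 \<cdot> t1) (u1 \<cdot> t2)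
       \<and> (w1 \<cdot> v1) \<cdot> t1 \<in> W
       \<and> R = frac_class C W (A1, w1, f1) (A3, w3, f3)
           (E, v1 \<cdot> t1, u2 \<cdot> t2,
            pull C w2 u1 w3 u2 \<gamma> t2 \<odot> (\<iota> w2 \<star> \<rho>) \<odot> pull C w1 v1 w2 v2 \<alpha> t1,
            pull C f2 u1 f3 u2 \<delta> t2 \<odot> (\<iota> f2 \<star> \<rho>) \<odot> pull C f1 v1 f2 v2 \<beta> t1))"
  have eq: "frac_vcomp C W \<Delta> \<Gamma> = (SOME R. Q R)" unfolding XY F frac_vcomp_def Q_def by simp
  have XD: "dat F1 F2 (sd F1 F2 d) \<and> WP (w1 # fst (sd F1 F2 d))" if "d \<in> X" for d
    using wdat_sd[OF cell_par[OF \<Gamma>] cell_data(2)[OF \<Gamma>, of d]] that by (simp add: XY wdat_def F)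
  have YD: "dat F2 F3 (sd F2 F3 d) \<and> WP (w2 # fst (sd F2 F3 d))" if "d \<in> Y" for d
    using wdat_sd[OF cell_par[OF \<Delta>] cell_data(2)[OF \<Delta>, of d]] that by (simp add: XY wdat_def F)
  have E1: "fst d = sr (fst (sd F1 F2 d))" if "d \<in> X" for d
    using cell_data(2)[OF \<Gamma>, of d] frac_data_iff[OF cell_par[OF \<Gamma>]] that by (cases d) (auto simp: XY sd_def)
  have E2: "fst d = sr (fst (sd F2 F3 d))" if "d \<in> Y" for d
    using cell_data(2)[OF \<Delta>, of d] frac_data_iff[OF cell_par[OF \<Delta>]] that by (cases d) (auto simp: XY sd_def)
  have ex: "\<exists>R. Q R"
  proof -
    obtain d d' where dd: "d \<in> X" "d' \<in> Y" using cell_data(1)[OF \<Gamma>] cell_data(1)[OF \<Delta>] by (auto simp: XY)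
    obtain E1 v1 v2 \<alpha> \<beta> E2 u1 u2 \<gamma> \<delta> where d: "d = (E1, v1, v2, \<alpha>, \<beta>)" "d' = (E2, u1, u2, \<gamma>, \<delta>)" by (cases d; cases d') auto
    have e: "dat F1 F2 ([v1], [v2], ([w1, v1], \<alpha>, [w2, v2]), ([f1, v1], \<beta>, [f2, v2]))" "WP [w1, v1]"
      "dat F2 F3 ([u1], [u2], ([w2, u1], \<gamma>, [w3, u2]), ([f2, u1], \<delta>, [f3, u2]))" "WP [w2, u1]"
      using XD[OF dd(1)] YD[OF dd(2)] by (simp_all add: sd_def d F)
    have EE: "E1 = src C v1" "E2 = src C u1" using E1[OF dd(1)] E2[OF dd(2)] by (simp_all add: sd_def d)
    note e' = dat_D[OF e(1)[unfolded F], simplified] dat_D[OF e(3)[unfolded F], simplified]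
    \<comment> \<open>Existence of the auxiliary data: (BF3) completes \<open>[w2, v2]\<close>
      against \<open>[w2, u1]\<close>, and lifting through \<open>w2\<close> turns the square into
      the required comparison of \<open>v2\<close> with \<open>u1\<close>.\<close>
    obtain z x s where z: "WP z" "tg z = sr [w2, v2]" "iso s" "dom s = [w2, v2] @ z" "cod s = [w2, u1] @ x" "pth x" "tg x = sr [w2, u1]" "sr x = sr z"
      by (rule bf3[OF e(4), of "[w2, v2]"]) (use e' p in auto)
    obtain y t where y: "WP y" "tg y = sr ([v2] @ z)" "valid t" "dom t = ([v2] @ z) @ y" "cod t = ([u1] @ x) @ y" "iso s \<Longrightarrow> iso t"
      by (rule lift[of "[w2]" "[v2] @ z" "[u1] @ x" s]) (use z e' p in auto)
    let ?t1 = "ev (z @ y)" and ?t2 = "ev (x @ y)"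
    have it: "iso t" using y z by simp
    have "iso ([u1] \<rhd> kap (x @ y) \<bullet> t \<bullet> [v2] \<rhd> sinv (kap (z @ y)))" using it y(1-5) z e' by simp
    moreover have "[u1] \<rhd> kap (x @ y) \<bullet> t \<bullet> [v2] \<rhd> sinv (kap (z @ y)) = ([v2, ?t1], raw t, [u1, ?t2])"
      using collapse_right[of t "[v2]" "z @ y" "[u1]" "x @ y"] y(1-5) z e' by simp
    ultimately have "iso ([v2, ?t1], raw t, [u1, ?t2])" by simp
    from iso_inv_cell[OF this] have r: "raw t \<in> inv_cells C (v2 \<cdot> ?t1) (u1 \<cdot> ?t2)" by simp
    have "WP (z @ y)" by (rule WP_append[OF z(1) y(1)]) (use y z e' in simp)
    then have t1W: "WP [?t1]" by (simp add: WP_def)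
    have "WP [w1, v1, ?t1]"
      by (rule WP_append[OF e(2) t1W, simplified]) (use y(1,2) z(1,2) e' in simp)
    then have w: "(w1 \<cdot> v1) \<cdot> ?t1 \<in> W" using wpath[of w1 v1 ?t1] y z e' by simp
    have "?t1 \<in> hom C (sr y) E1" "?t2 \<in> hom C (sr y) E2" "sr y \<in> Ob C" using y(1-5) z e' EE by (auto simp: hom_def)
    then show ?thesis unfolding Q_def using dd[unfolded d] r w by blast
  qed
  have Q: "\<exists>d0 \<in> frac_data C W F1 F3. vgood (sd F1 F3 d0) \<and> R = frac_class C W F1 F3 d0" if "Q R" for R
  proof -
    from that[unfolded Q_def] show ?thesis
    proof (elim exE conjE, goal_cases)
      case q: (1 E1 v1 v2 \<alpha> \<beta> E2 u1 u2 \<gamma> \<delta> E t1 t2 \<rho>)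
      let ?a = "pull C w2 u1 w3 u2 \<gamma> t2 \<odot> (\<iota> w2 \<star> \<rho>) \<odot> pull C w1 v1 w2 v2 \<alpha> t1"
        and ?b = "pull C f2 u1 f3 u2 \<delta> t2 \<odot> (\<iota> f2 \<star> \<rho>) \<odot> pull C f1 v1 f2 v2 \<beta> t1"
      let ?A = "([w1, v1], \<alpha>, [w2, v2])" and ?B = "([f1, v1], \<beta>, [f2, v2])"
      let ?C = "([w2, u1], \<gamma>, [w3, u2])" and ?D = "([f2, u1], \<delta>, [f3, u2])"
      have e: "dat F1 F2 ([v1], [v2], ?A, ?B)" "WP [w1, v1]"
        "dat F2 F3 ([u1], [u2], ?C, ?D)" "WP [w2, u1]"
        using XD[OF q(1)] YD[OF q(2)] by (simp_all add: sd_def F)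
      have EE: "E1 = src C v1" "E2 = src C u1" using E1[OF q(1)] E2[OF q(2)] by (simp_all add: sd_def)
      note e' = dat_D[OF e(1)[unfolded F], simplified] dat_D[OF e(3)[unfolded F], simplified]
      have t: "t1 \<in> Mor C" "t2 \<in> Mor C" "src C t1 = E" "src C t2 = E" "tgt C t1 = src C v1" "tgt C t2 = src C u1"
        using q EE by (auto simp: hom_def)
      let ?r = "([v2, t1], \<rho>, [u1, t2])"
      have r: "iso ?r" by (rule inv_cell_iso) (use q t e' in auto)
      have h1: "holds \<Gamma> ([v1, t1], [v2, t1], ?A \<lhd> [t1], ?B \<lhd> [t1])"
        using holds_res[OF \<Gamma>, of "[v1]" "[v2]" ?A ?B "[t1]"] holds_sd[OF \<Gamma>, of "(E1, v1, v2, \<alpha>, \<beta>)"] q(1) t e' by (simp add: sd_def F XY)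
      have "holds \<Delta> ([u1, t2], [u2, t2], ?C \<lhd> [t2], ?D \<lhd> [t2])"
        using holds_res[OF \<Delta>, of "[u1]" "[u2]" ?C ?D "[t2]"] holds_sd[OF \<Delta>, of "(E2, u1, u2, \<gamma>, \<delta>)"] q(2) t e' by (simp add: sd_def F XY)
      from holds_iso[OF \<Delta> this, of ?r "sid [u2, t2]"]
      have h2: "holds \<Delta> ([v2, t1], [u2, t2], ?C \<lhd> [t2] \<bullet> [w2] \<rhd> ?r, ?D \<lhd> [t2] \<bullet> [f2] \<rhd> ?r)"
        using r t e' by (simp add: F lw_sid)
      let ?SA = "(?C \<lhd> [t2] \<bullet> [w2] \<rhd> ?r) \<bullet> ?A \<lhd> [t1]" and ?SB = "(?D \<lhd> [t2] \<bullet> [f2] \<rhd> ?r) \<bullet> ?B \<lhd> [t1]"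
      have "vgood ([v1, t1], [u2, t2], ?SA, ?SB)" by (rule vgoodI[OF h1 h2])
      \<comment> \<open>The datum of the construction is the value found on paths, with its two
        tests collapsed to composites.\<close>
      from goodD(3)[OF vgood_good this, of "sinv (kap [v1, t1])" "sinv (kap [u2, t2])"]
      have g: "vgood ([v1 \<cdot> t1], [u2 \<cdot> t2], [w3] \<rhd> kap [u2, t2] \<bullet> ?SA \<bullet> [w1] \<rhd> sinv (kap [v1, t1]),
         [f3] \<rhd> kap [u2, t2] \<bullet> ?SB \<bullet> [f1] \<rhd> sinv (kap [v1, t1]))"
        using t e' by (simp add: F)
      have vr: "valid ?SA" "dom ?SA = [w1, v1, t1]" "cod ?SA = [w3, u2, t2]" "valid ?SB" "dom ?SB = [f1, v1, t1]" "cod ?SB = [f3, u2, t2]"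
        "raw ?SA = ?a" "raw ?SB = ?b"
        using r t e' valid_D[OF iso_valid[OF r]] by (simp_all add: raw_pull raw_lw1)
      have "[w3] \<rhd> kap [u2, t2] \<bullet> ?SA \<bullet> [w1] \<rhd> sinv (kap [v1, t1]) = ([w1, v1 \<cdot> t1], ?a, [w3, u2 \<cdot> t2])"
        "[f3] \<rhd> kap [u2, t2] \<bullet> ?SB \<bullet> [f1] \<rhd> sinv (kap [v1, t1]) = ([f1, v1 \<cdot> t1], ?b, [f3, u2 \<cdot> t2])"
        using collapse_right[OF vr(1), of "[w1]" "[v1, t1]" "[w3]" "[u2, t2]"]
          collapse_right[OF vr(4), of "[f1]" "[v1, t1]" "[f3]" "[u2, t2]"] vr by simp_all
      with g have g': "vgood (sd F1 F3 (E, v1 \<cdot> t1, u2 \<cdot> t2, ?a, ?b))" by (simp add: sd_def F)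
      have "WP [w1, v1, t1]" using wpath[of w1 v1 t1] q(7) t e' by simp
      then have "WP [w1, v1 \<cdot> t1]" using WP_iso[of "[w1] \<rhd> kap [v1, t1]"] t e' by simp
      then have "(E, v1 \<cdot> t1, u2 \<cdot> t2, ?a, ?b) \<in> frac_data C W F1 F3"
        using frac_data_iff[OF P] goodD(1)[OF vgood_good g'] t e' by (simp add: wdat_def sd_def F)
      then show ?case using g' q(8)[folded F] by blast
    qed
  qed
  show "cell F1 F3 (frac_vcomp C W \<Delta> \<Gamma>)" unfolding eq by (rule some_good(1)[OF P vgood_good ex Q])
  show "holds (frac_vcomp C W \<Delta> \<Gamma>) (x1, x3, \<alpha>' \<bullet> \<alpha>, \<beta>' \<bullet> \<beta>)" if "holds \<Gamma> (x1, x2, \<alpha>, \<beta>)" "holds \<Delta> (x2, x3, \<alpha>', \<beta>')"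
    unfolding eq by (rule some_good(2)[OF P vgood_good ex Q vgoodI[OF that]])
qed

end

end

context BF
begin

text \<open>The link behind a value, sharpened to equations by \<open>link_exact\<close> and solved
  for the value. It produces auxiliary data for the whiskerings, whose definitions start from a
  representative.\<close>

lemma holds_repr:
  assumes c: "cell F1 F2 \<Gamma>" and h: "holds \<Gamma> (x1, x2, \<alpha>, \<beta>)"
  obtains E u1 u2 a b z k t1 t2 where "(E, u1, u2, a, b) \<in> snd (snd \<Gamma>)" "WP z" "tg z = sr x1"
    "iso t1" "dom t1 = x1 @ z" "cod t1 = u1 # k" "iso t2" "dom t2 = x2 @ z" "cod t2 = u2 # k" "pth k"
    "dat F1 F2 ([u1], [u2], ([den F1, u1], a, [den F2, u2]), ([num F1, u1], b, [num F2, u2]))" "E = src C u1" "tg k = src C u1"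
    "\<alpha> \<lhd> z = [den F2] \<rhd> sinv t2 \<bullet> ([den F1, u1], a, [den F2, u2]) \<lhd> k \<bullet> [den F1] \<rhd> t1"
    "\<beta> \<lhd> z = [num F2] \<rhd> sinv t2 \<bullet> ([num F1, u1], b, [num F2, u2]) \<lhd> k \<bullet> [num F1] \<rhd> t1"
proof -
  note P = cell_par[OF c]
  have D: "dat F1 F2 (x1, x2, \<alpha>, \<beta>)" using holds_dat[OF c h] .
  obtain d z k s1 s2 where d: "d \<in> snd (snd \<Gamma>)" "WP z" "link F1 F2 z k s1 s2 (x1, x2, \<alpha>, \<beta>) (sd F1 F2 d)"
    using h holds_iff[OF c] by blast
  obtain E u1 u2 a b where dd: "d = (E, u1, u2, a, b)" by (cases d)
  let ?A = "([den F1, u1], a, [den F2, u2])" and ?B = "([num F1, u1], b, [num F2, u2])"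
  have fd: "d \<in> frac_data C W F1 F2" using cell_data(2)[OF c d(1)] .
  then have D': "dat F1 F2 ([u1], [u2], ?A, ?B)" "E = src C u1"
    using frac_data_iff[OF P] by (auto simp: dd wdat_def sd_def)
  have L: "link F1 F2 z k s1 s2 (x1, x2, \<alpha>, \<beta>) ([u1], [u2], ?A, ?B)" using d(3) by (simp add: dd sd_def)
  note t = tp_D[OF link_tp[OF L]] dat_D[OF D] dat_D[OF D'(1)]
  obtain y where y: "WP y" "tg y = sr z" "[den F2] \<rhd> s2 \<lhd> y \<bullet> \<alpha> \<lhd> (z @ y) = ?A \<lhd> (k @ y) \<bullet> [den F1] \<rhd> s1 \<lhd> y"
    "[num F2] \<rhd> s2 \<lhd> y \<bullet> \<beta> \<lhd> (z @ y) = ?B \<lhd> (k @ y) \<bullet> [num F1] \<rhd> s1 \<lhd> y"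
    using link_exact[OF D D'(1) L] by blast
  have W: "WP (z @ y)" by (rule WP_append[OF d(2) y(1)]) (simp add: y)
  have "[den F2] \<rhd> sinv (s2 \<lhd> y) \<bullet> ([den F2] \<rhd> s2 \<lhd> y \<bullet> \<alpha> \<lhd> (z @ y)) = \<alpha> \<lhd> (z @ y)"
    using t y(1,2) by (simp add: cancels)
  then have A: "\<alpha> \<lhd> (z @ y) = [den F2] \<rhd> sinv (s2 \<lhd> y) \<bullet> ?A \<lhd> (k @ y) \<bullet> [den F1] \<rhd> (s1 \<lhd> y)" unfolding y(3) by simp
  have "[num F2] \<rhd> sinv (s2 \<lhd> y) \<bullet> ([num F2] \<rhd> s2 \<lhd> y \<bullet> \<beta> \<lhd> (z @ y)) = \<beta> \<lhd> (z @ y)"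
    using t y(1,2) by (simp add: cancels)
  then have B: "\<beta> \<lhd> (z @ y) = [num F2] \<rhd> sinv (s2 \<lhd> y) \<bullet> ?B \<lhd> (k @ y) \<bullet> [num F1] \<rhd> (s1 \<lhd> y)" unfolding y(4) by simp
  show ?thesis
    by (rule that[OF d(1)[unfolded dd] W _ _ _ _ _ _ _ _ D' _ A B]) (use t y(1,2) in simp_all)
qed

lemma raw_restrict_ev:
  assumes "valid s" "pth z" "sr (dom s) = tg z"
  shows "raw (s \<lhd> [ev z]) = raw (s \<lhd> z)"
  using assms valid_D[OF assms(1)] by (simp add: raw_rw coh_ev)

end

locale fraction_choices = BF C W for C :: "('o, 'm, 'c) bicat" (structure) and W +
  fixes ch :: "('o, 'm, 'c) choices"
  assumes choices: "set_of_choices C W ch"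
begin

text \<open>Together with \<open>pf\<close> and \<open>pr\<close> these are the components v', f'
  and \<rho> of the fixed choice, with \<rho> turned into a 2-cell of paths.\<close>

definition pv :: "'m \<Rightarrow> 'm \<Rightarrow> 'm" where "pv f v = fst (snd (ch f v))"
definition pf :: "'m \<Rightarrow> 'm \<Rightarrow> 'm" where "pf f v = fst (snd (snd (ch f v)))"
definition pr :: "'m \<Rightarrow> 'm \<Rightarrow> ('m, 'c) scell" where
  "pr f v = ([f, pv f v], snd (snd (snd (ch f v))), [v, pf f v])"

lemma choice:
  assumes "f \<in> Mor C" "v \<in> W" "tgt C f = tgt C v"
  shows "pv f v \<in> W" "pv f v \<in> Mor C" "tgt C (pv f v) = src C f" "pf f v \<in> Mor C" "tgt C (pf f v) = src C v"
    "src C (pf f v) = src C (pv f v)" "iso (pr f v)" "dom (pr f v) = [f, pv f v]" "cod (pr f v) = [v, pf f v]"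
    and ch_eq: "ch f v = (src C (pv f v), pv f v, pf f v, raw (pr f v))"
proof -
  obtain A v' f' \<rho> where e: "ch f v = (A, v', f', \<rho>)" by (cases "ch f v")
  have p: "pv f v = v'" "pf f v = f'" "pr f v = ([f, v'], \<rho>, [v, f'])" by (simp_all add: pv_def pf_def pr_def e)
  have c: "A \<in> Ob C" "v' \<in> W" "v' \<in> hom C A (src C f)" "f' \<in> hom C A (src C v)" "\<rho> \<in> inv_cells C (f \<cdot> v') (v \<cdot> f')"
    using choices assms e unfolding set_of_choices_def by (fastforce split: prod.splits)+
  have m: "v \<in> Mor C" using assms W_Mor' by simp
  have "iso ([f, v'], \<rho>, [v, f'])" by (rule inv_cell_iso) (use c m assms in \<open>auto simp: hom_def\<close>)
  then show "pv f v \<in> W" "pv f v \<in> Mor C" "tgt C (pv f v) = src C f" "pf f v \<in> Mor C" "tgt C (pf f v) = src C v"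
    "src C (pf f v) = src C (pv f v)" "iso (pr f v)" "dom (pr f v) = [f, pv f v]" "cod (pr f v) = [v, pf f v]"
    "ch f v = (src C (pv f v), pv f v, pf f v, raw (pr f v))"
    using c by (auto simp: p e hom_def)
qed

lemma pr_triple: "([f, pv f v], raw (pr f v), [v, pf f v]) = pr f v" by (simp add: pr_def)

text \<open>The normalisation of choices against identity denominators; the projections of the
  square have such denominators.\<close>

lemma choice_id_right:
  assumes "f \<in> Mor C"
  shows "pv f (\<one> (tgt C f)) = \<one> (src C f)" "pf f (\<one> (tgt C f)) = f" "pr f (\<one> (tgt C f)) = sinv (lu [f]) \<bullet> ru f"
proof -
  have c: "ch f (\<one> (tgt C f)) = (src C f, \<one> (src C f), f, vinv C (\<upsilon> f) \<odot> \<pi> f)"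
    using choices assms by (auto simp: set_of_choices_def)
  show "pv f (\<one> (tgt C f)) = \<one> (src C f)" "pf f (\<one> (tgt C f)) = f" by (simp_all add: pv_def pf_def c)
  show "pr f (\<one> (tgt C f)) = sinv (lu [f]) \<bullet> ru f"
    using assms by (intro scell_eqI) (simp_all add: pr_def pv_def pf_def c raw_sinv, simp add: lu_def ru_def)
qed

abbreviation cmpf where "cmpf G F \<equiv> frac_cmp C ch G F"

definition composable :: "('o, 'm) fmor \<Rightarrow> ('o, 'm) fmor \<Rightarrow> bool" where
  "composable G F \<longleftrightarrow> F \<in> frac_Mor C W \<and> G \<in> frac_Mor C W \<and> frac_src C G = frac_tgt C F"

lemma composable_D:
  assumes "composable G F"
  shows "den F \<in> W" "den F \<in> Mor C" "num F \<in> Mor C" "den G \<in> W" "den G \<in> Mor C" "num G \<in> Mor C"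
    "src C (den F) = src C (num F)" "src C (den G) = src C (num G)" "tgt C (den G) = tgt C (num F)"
  using assms frac_Mor_D[of F] frac_Mor_D[of G] by (auto simp: composable_def)

lemma cmpf:
  assumes "composable G F"
  shows "cmpf G F = (src C (pv (num F) (den G)), den F \<cdot> pv (num F) (den G), num G \<cdot> pf (num F) (den G))"
    "den (cmpf G F) = den F \<cdot> pv (num F) (den G)" "num (cmpf G F) = num G \<cdot> pf (num F) (den G)"
    "cmpf G F \<in> frac_Mor C W" "frac_src C (cmpf G F) = frac_src C F" "frac_tgt C (cmpf G F) = frac_tgt C G"
proof -
  note c = composable_D[OF assms]
  have t: "tgt C (num F) = tgt C (den G)" using c by simp
  note h = choice[OF c(3,4) t]
  show e: "cmpf G F = (src C (pv (num F) (den G)), den F \<cdot> pv (num F) (den G), num G \<cdot> pf (num F) (den G))"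
  proof -
    obtain A w f B v g where FG: "F = (A, w, f)" "G = (B, v, g)" by (cases F; cases G)
    show ?thesis unfolding frac_cmp_def FG prod.case den_num ch_eq[OF c(3,4) t, unfolded FG den_num] ..
  qed
  show d: "den (cmpf G F) = den F \<cdot> pv (num F) (den G)" "num (cmpf G F) = num G \<cdot> pf (num F) (den G)"
    by (simp_all add: e)
  have "den F \<cdot> pv (num F) (den G) \<in> W" by (rule BF2) (use c h in auto)
  then show m: "cmpf G F \<in> frac_Mor C W" using c h by (auto simp: e frac_Mor_def)
  show "frac_src C (cmpf G F) = frac_src C F" "frac_tgt C (cmpf G F) = frac_tgt C G"
    using frac_Mor_D(6,7)[OF m] frac_Mor_D(6,7)[of F] frac_Mor_D(6,7)[of G] c h assms
    by (auto simp: d composable_def)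
qed

end

section \<open>Whiskering\<close>

locale left_whisker = fraction_choices C W ch for C :: "('o, 'm, 'c) bicat" (structure) and W ch +
  fixes F1 F2 :: "('o, 'm) fmor" and G :: "('o, 'm) fmor" and \<Gamma> :: "('o, 'm, 'c) fcell"
  assumes \<Gamma>: "cell F1 F2 \<Gamma>" and comp1: "composable G F1"
begin

lemma comp2: "composable G F2"
  using comp1 cell_par[OF \<Gamma>] by (simp add: composable_def par_def)

abbreviation (input) "w1 \<equiv> den F1"
abbreviation (input) "w2 \<equiv> den F2"
abbreviation (input) "f1 \<equiv> num F1"
abbreviation (input) "f2 \<equiv> num F2"
abbreviation (input) "v \<equiv> den G"
abbreviation (input) "g \<equiv> num G"
abbreviation (input) "v1 \<equiv> pv f1 v"
abbreviation (input) "v2 \<equiv> pv f2 v"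
abbreviation (input) "p1 \<equiv> pf f1 v"
abbreviation (input) "p2 \<equiv> pf f2 v"
abbreviation (input) "\<rho>1 \<equiv> pr f1 v"
abbreviation (input) "\<rho>2 \<equiv> pr f2 v"

lemma lw_facts:
  "w1 \<in> W" "w1 \<in> Mor C" "f1 \<in> Mor C" "w2 \<in> W" "w2 \<in> Mor C" "f2 \<in> Mor C" "v \<in> W" "v \<in> Mor C" "g \<in> Mor C"
  "src C w1 = src C f1" "src C w2 = src C f2" "src C v = src C g" "tgt C v = tgt C f1" "tgt C f2 = tgt C f1" "tgt C w2 = tgt C w1"
  "v1 \<in> W" "v1 \<in> Mor C" "tgt C v1 = src C f1" "p1 \<in> Mor C" "tgt C p1 = src C g" "src C p1 = src C v1"
  "iso \<rho>1" "dom \<rho>1 = [f1, v1]" "cod \<rho>1 = [v, p1]"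
  "v2 \<in> W" "v2 \<in> Mor C" "tgt C v2 = src C f2" "p2 \<in> Mor C" "tgt C p2 = src C g" "src C p2 = src C v2"
  "iso \<rho>2" "dom \<rho>2 = [f2, v2]" "cod \<rho>2 = [v, p2]"
proof -
  note a = composable_D[OF comp1] and b = composable_D[OF comp2] and c = par_D[OF cell_par[OF \<Gamma>]]
  note d = choice[OF a(3,4) a(9)[symmetric]] choice[OF b(3,4) b(9)[symmetric]]
  show "w1 \<in> W" "w1 \<in> Mor C" "f1 \<in> Mor C" "w2 \<in> W" "w2 \<in> Mor C" "f2 \<in> Mor C" "v \<in> W" "v \<in> Mor C" "g \<in> Mor C"
  "src C w1 = src C f1" "src C w2 = src C f2" "src C v = src C g" "tgt C v = tgt C f1" "tgt C f2 = tgt C f1" "tgt C w2 = tgt C w1"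
  "v1 \<in> W" "v1 \<in> Mor C" "tgt C v1 = src C f1" "p1 \<in> Mor C" "tgt C p1 = src C g" "src C p1 = src C v1"
  "iso \<rho>1" "dom \<rho>1 = [f1, v1]" "cod \<rho>1 = [v, p1]"
  "v2 \<in> W" "v2 \<in> Mor C" "tgt C v2 = src C f2" "p2 \<in> Mor C" "tgt C p2 = src C g" "src C p2 = src C v2"
  "iso \<rho>2" "dom \<rho>2 = [f2, v2]" "cod \<rho>2 = [v, p2]"
    using a b c d by simp_all
qed

text \<open>\<phi> is the value of \<Gamma> carried through the chosen squares and lifted through
  \<open>v\<close>, as in the definition of whiskering. The \<open>kap\<close> cells pass from paths
  to the composites that are the legs of the composed fractions.\<close>

definition lgood :: "('m, 'c) sdatum \<Rightarrow> bool" where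
  "lgood = (\<lambda>(x1, x2, \<alpha>, \<beta>). \<exists>\<alpha>' \<phi>. valid \<phi> \<and> dom \<phi> = p1 # x1 \<and> cod \<phi> = p2 # x2
     \<and> \<alpha> = kap [w2, v2] \<lhd> x2 \<bullet> \<alpha>' \<bullet> sinv (kap [w1, v1]) \<lhd> x1
     \<and> \<beta> = kap [g, p2] \<lhd> x2 \<bullet> [g] \<rhd> \<phi> \<bullet> sinv (kap [g, p1]) \<lhd> x1
     \<and> x1 \<noteq> [] \<and> x2 \<noteq> []
     \<and> holds \<Gamma> (v1 # x1, v2 # x2, \<alpha>', sinv \<rho>2 \<lhd> x2 \<bullet> [v] \<rhd> \<phi> \<bullet> \<rho>1 \<lhd> x1))"

lemma lgoodI:
  assumes "valid \<phi>" "dom \<phi> = p1 # x1" "cod \<phi> = p2 # x2" "x1 \<noteq> []" "x2 \<noteq> []"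
    "holds \<Gamma> (v1 # x1, v2 # x2, \<alpha>', \<beta>')" "\<beta>' = sinv \<rho>2 \<lhd> x2 \<bullet> [v] \<rhd> \<phi> \<bullet> \<rho>1 \<lhd> x1"
    "\<alpha> = kap [w2, v2] \<lhd> x2 \<bullet> \<alpha>' \<bullet> sinv (kap [w1, v1]) \<lhd> x1"
    "\<beta> = kap [g, p2] \<lhd> x2 \<bullet> [g] \<rhd> \<phi> \<bullet> sinv (kap [g, p1]) \<lhd> x1"
  shows "lgood (x1, x2, \<alpha>, \<beta>)"
  unfolding lgood_def prod.case using assms by blast

text \<open>For uniqueness: the denominators determine \<alpha>' and hence the value of \<Gamma> as
  a germ, and \<open>v\<close>, being in \<open>W\<close>, can be cancelled to recover
  \<phi>.\<close>

lemma lgood_good: "good (cmpf G F1) (cmpf G F2) lgood"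
proof (rule goodI)
  note l = lw_facts and K = cmpf(2,3)[OF comp1] cmpf(2,3)[OF comp2]
  fix x1 x2 \<alpha> \<beta> assume "lgood (x1, x2, \<alpha>, \<beta>)"
  then obtain \<alpha>' \<phi> where g: "valid \<phi>" "dom \<phi> = p1 # x1" "cod \<phi> = p2 # x2" "x1 \<noteq> []" "x2 \<noteq> []"
     "\<alpha> = kap [w2, v2] \<lhd> x2 \<bullet> \<alpha>' \<bullet> sinv (kap [w1, v1]) \<lhd> x1" "\<beta> = kap [g, p2] \<lhd> x2 \<bullet> [g] \<rhd> \<phi> \<bullet> sinv (kap [g, p1]) \<lhd> x1"
     "holds \<Gamma> (v1 # x1, v2 # x2, \<alpha>', sinv \<rho>2 \<lhd> x2 \<bullet> [v] \<rhd> \<phi> \<bullet> \<rho>1 \<lhd> x1)" unfolding lgood_def by blast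
  have x: "pth x1" "pth x2" "src C p1 = tg x1" "src C p2 = tg x2" "sr x2 = sr x1"
    using valid_D[OF g(1)] g(2-5) by auto
  note a = dat_D(1-4)[OF holds_dat[OF \<Gamma> g(8)]] and gg = g(1-5) x
  show "dat (cmpf G F1) (cmpf G F2) (x1, x2, \<alpha>, \<beta>)"
    unfolding dat_def ty_def prod.case K g(6,7) using l gg a by simp
  show "lgood (x1 @ h, x2 @ h, \<alpha> \<lhd> h, \<beta> \<lhd> h)" if h: "pth h" "tg h = sr x1" for h
  proof (rule lgoodI[of "\<phi> \<lhd> h"])
    show "holds \<Gamma> (v1 # x1 @ h, v2 # x2 @ h, \<alpha>' \<lhd> h, (sinv \<rho>2 \<lhd> x2 \<bullet> [v] \<rhd> \<phi> \<bullet> \<rho>1 \<lhd> x1) \<lhd> h)"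
      using holds_res[OF \<Gamma> g(8), of h] h gg by simp
  qed (use gg h in \<open>simp_all add: g(6,7)\<close>)
  show "lgood (dom t1, dom t2, [den (cmpf G F2)] \<rhd> sinv t2 \<bullet> \<alpha> \<bullet> [den (cmpf G F1)] \<rhd> t1,
     [num (cmpf G F2)] \<rhd> sinv t2 \<bullet> \<beta> \<bullet> [num (cmpf G F1)] \<rhd> t1)"
    if t: "iso t1" "iso t2" "cod t1 = x1" "cod t2 = x2" for t1 t2
  proof -
    note tt = valid_D[OF iso_valid[OF t(1)]] valid_D[OF iso_valid[OF t(2)]]
    from holds_iso[OF \<Gamma> g(8), of "[v1] \<rhd> t1" "[v2] \<rhd> t2"]
    have H: "holds \<Gamma> (v1 # dom t1, v2 # dom t2, [w2, v2] \<rhd> sinv t2 \<bullet> \<alpha>' \<bullet> [w1, v1] \<rhd> t1,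
       [f2, v2] \<rhd> sinv t2 \<bullet> (sinv \<rho>2 \<lhd> x2 \<bullet> [v] \<rhd> \<phi> \<bullet> \<rho>1 \<lhd> x1) \<bullet> [f1, v1] \<rhd> t1)"
      using t tt gg l by simp
    show ?thesis
      by (rule lgoodI[OF _ _ _ _ _ H, of "[p2] \<rhd> sinv t2 \<bullet> \<phi> \<bullet> [p1] \<rhd> t1"])
        (use t tt gg l a in \<open>simp_all add: g(6,7) K slides\<close>)
  qed
  fix \<gamma> \<delta> assume "lgood (x1, x2, \<gamma>, \<delta>)" and e: "\<gamma> \<approx> \<alpha>"
  then obtain \<gamma>' \<psi> where g': "valid \<psi>" "dom \<psi> = p1 # x1" "cod \<psi> = p2 # x2"
     "\<gamma> = kap [w2, v2] \<lhd> x2 \<bullet> \<gamma>' \<bullet> sinv (kap [w1, v1]) \<lhd> x1" "\<delta> = kap [g, p2] \<lhd> x2 \<bullet> [g] \<rhd> \<psi> \<bullet> sinv (kap [g, p1]) \<lhd> x1"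
     "holds \<Gamma> (v1 # x1, v2 # x2, \<gamma>', sinv \<rho>2 \<lhd> x2 \<bullet> [v] \<rhd> \<psi> \<bullet> \<rho>1 \<lhd> x1)" unfolding lgood_def by blast
  note a' = dat_D(1-4)[OF holds_dat[OF \<Gamma> g'(6)]] and gg' = g'(1-3)
  have "\<gamma>' \<bullet> sinv (kap [w1, v1]) \<lhd> x1 \<approx> \<alpha>' \<bullet> sinv (kap [w1, v1]) \<lhd> x1"
    by (rule germ_cancel_vc[of "kap [w2, v2] \<lhd> x2"]) (use e l gg a a' in \<open>simp_all add: g(6) g'(4)\<close>)
  then have e1: "\<gamma>' \<approx> \<alpha>'" by (rule germ_cancel_vc') (use l gg a a' in simp_all)
  have e2: "sinv \<rho>2 \<lhd> x2 \<bullet> [v] \<rhd> \<psi> \<bullet> \<rho>1 \<lhd> x1 \<approx> sinv \<rho>2 \<lhd> x2 \<bullet> [v] \<rhd> \<phi> \<bullet> \<rho>1 \<lhd> x1"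
    using holds_unique[OF \<Gamma> g(8) g'(6) e1] .
  have "[v] \<rhd> \<psi> \<bullet> \<rho>1 \<lhd> x1 \<approx> [v] \<rhd> \<phi> \<bullet> \<rho>1 \<lhd> x1"
    by (rule germ_cancel_vc[of "sinv \<rho>2 \<lhd> x2"]) (use e2 l gg gg' in simp_all)
  then have "[v] \<rhd> \<psi> \<approx> [v] \<rhd> \<phi>" by (rule germ_cancel_vc') (use l gg gg' in simp_all)
  then have e3: "\<psi> \<approx> \<phi>" by (rule germ_cancel_lw) (use l gg gg' in simp_all)
  have "[g] \<rhd> \<psi> \<bullet> sinv (kap [g, p1]) \<lhd> x1 \<approx> [g] \<rhd> \<phi> \<bullet> sinv (kap [g, p1]) \<lhd> x1"
    by (rule germ_vc_left[OF germ_lw[OF e3]]) (use l gg gg' in simp_all)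
  then show "\<delta> \<approx> \<beta>" unfolding g(7) g'(5) by (rule germ_vc_right) (use l gg gg' in simp_all)
qed

lemma par_lw: "par (cmpf G F1) (cmpf G F2)"
  using cmpf[OF comp1] cmpf[OF comp2] cell_par[OF \<Gamma>] by (simp add: par_def)

lemma holds_lwhisk_aux:
  "cell (cmpf G F1) (cmpf G F2) (frac_lwhisk C W ch G \<Gamma>)"
  "lgood D \<Longrightarrow> holds (frac_lwhisk C W ch G \<Gamma>) D"
proof -
  note l = lw_facts and K = cmpf(2,3)[OF comp1] cmpf(2,3)[OF comp2]
  have t1: "tgt C f1 = tgt C v" and t2: "tgt C f2 = tgt C v" using l by simp_all
  define Q where "Q = (\<lambda>R. \<exists>A3 u1 u2 \<alpha> \<beta> E a1 a2 a \<tau>1 \<tau>2 \<phi>.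
       (A3, u1, u2, \<alpha>, \<beta>) \<in> snd (snd \<Gamma>)
       \<and> E \<in> Ob C \<and> a1 \<in> hom C E (src C v1) \<and> a2 \<in> hom C E (src C v2) \<and> a \<in> hom C E A3
       \<and> \<tau>1 \<in> inv_cells C (v1 \<cdot> a1) (u1 \<cdot> a) \<and> \<tau>2 \<in> inv_cells C (v2 \<cdot> a2) (u2 \<cdot> a)
       \<and> (w1 \<cdot> v1) \<cdot> a1 \<in> W
       \<and> \<phi> \<in> cells C (p1 \<cdot> a1) (p2 \<cdot> a2)
       \<and> \<iota> v \<star> \<phi>
         = pull C f2 v2 v p2 (raw \<rho>2) a2 \<odot> (\<iota> f2 \<star> vinv C \<tau>2) \<odot> pull C f1 u1 f2 u2 \<beta> a
             \<odot> (\<iota> f1 \<star> \<tau>1) \<odot> pull C v p1 f1 v1 (vinv C (raw \<rho>1)) a1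
       \<and> R = frac_class C W (cmpf G F1) (cmpf G F2)
           (E, a1, a2,
            push C w1 v1 a1 w2 v2 a2
              ((\<iota> w2 \<star> vinv C \<tau>2) \<odot> pull C w1 u1 w2 u2 \<alpha> a \<odot> (\<iota> w1 \<star> \<tau>1)),
            push C g p1 a1 g p2 a2 (\<iota> g \<star> \<phi>)))"
  have eq: "frac_lwhisk C W ch G \<Gamma> = (SOME R. Q R)"
  proof -
    obtain X where X: "\<Gamma> = (F1, F2, X)" using \<Gamma> by (cases \<Gamma>) (auto simp: cell_def)
    obtain A1 ww1 ff1 A2 ww2 ff2 B vv gg where F: "F1 = (A1, ww1, ff1)" "F2 = (A2, ww2, ff2)" "G = (B, vv, gg)"
      by (cases F1; cases F2; cases G) auto
    note e1 = ch_eq[OF l(3,7) t1, unfolded F den_num] and e2 = ch_eq[OF l(6,7) t2, unfolded F den_num]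
    show ?thesis unfolding frac_lwhisk_def Q_def X F prod.case den_num e1 e2 snd_conv ..
  qed
  have ex: "\<exists>R. Q R"
  proof -
    have W1: "WP [w1, v1]" "WP [w2, v2]" using WP_append[of "[w1]" "[v1]"] WP_append[of "[w2]" "[v2]"] l by simp_all
    \<comment> \<open>The auxiliary data take four refinements: (BF3) compares the two composed
      denominators, \<Gamma> has a value there, this value lifts through \<open>v\<close>, and a
      representative reproduces it exactly.\<close>
    obtain z x s where z0: "WP z" "tg z = sr [w1, v1]" "iso s" "dom s = [w1, v1] @ z" "cod s = [w2, v2] @ x" "pth x" "tg x = sr [w2, v2]" "sr x = sr z"
      by (rule bf3[OF W1(2), of "[w1, v1]"]) (use l in auto)
    note z = z0[simplified]
    obtain y b where y: "WP y" "tg y = sr (v1 # z)" "holds \<Gamma> ((v1 # z) @ y, (v2 # x) @ y, s \<lhd> y, b)"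
      by (rule holds_ex[OF \<Gamma> z(3), of "v1 # z" "v2 # x"]) (use z l in auto)
    have y: "WP y" "tg y = sr z" "holds \<Gamma> ((v1 # z) @ y, (v2 # x) @ y, s \<lhd> y, b)" using y z by auto
    have H: "holds \<Gamma> (v1 # z @ y, v2 # x @ y, s \<lhd> y, b)" using y(3) by simp
    note b = dat_D(5-7)[OF holds_dat[OF \<Gamma> H]]
    have Y: "pth z" "pth y" using z y by simp_all
    obtain k ph where k0: "WP k" "tg k = sr (p1 # z @ y)" "valid ph" "dom ph = (p1 # z @ y) @ k" "cod ph = (p2 # x @ y) @ k"
      "(\<rho>2 \<lhd> (x @ y) \<bullet> b \<bullet> sinv \<rho>1 \<lhd> (z @ y)) \<lhd> k = [v] \<rhd> ph"
      by (rule lift[of "[v]" "p1 # z @ y" "p2 # x @ y" "\<rho>2 \<lhd> (x @ y) \<bullet> b \<bullet> sinv \<rho>1 \<lhd> (z @ y)"])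
        (use l b z(2,6-) y(2) Y in auto)
    have k: "WP k" "tg k = sr y" "valid ph" "dom ph = p1 # z @ y @ k" "cod ph = p2 # x @ y @ k"
      "(\<rho>2 \<lhd> (x @ y) \<bullet> b \<bullet> sinv \<rho>1 \<lhd> (z @ y)) \<lhd> k = [v] \<rhd> ph"
      using k0 Y by simp_all
    have H2: "holds \<Gamma> (v1 # z @ y @ k, v2 # x @ y @ k, s \<lhd> (y @ k), b \<lhd> k)"
      using holds_res[OF \<Gamma> H, of k] k y Y by simp
    obtain E u1 u2 a b' m c s1 s2 where r0: "(E, u1, u2, a, b') \<in> snd (snd \<Gamma>)" "WP m" "tg m = sr (v1 # z @ y @ k)"
      "iso s1" "dom s1 = (v1 # z @ y @ k) @ m" "cod s1 = u1 # c" "iso s2" "dom s2 = (v2 # x @ y @ k) @ m" "cod s2 = u2 # c" "pth c"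
      "dat F1 F2 ([u1], [u2], ([w1, u1], a, [w2, u2]), ([f1, u1], b', [f2, u2]))" "E = src C u1" "tg c = src C u1"
      "b \<lhd> k \<lhd> m = [f2] \<rhd> sinv s2 \<bullet> ([f1, u1], b', [f2, u2]) \<lhd> c \<bullet> [f1] \<rhd> s1"
      by (rule holds_repr[OF \<Gamma> H2])
    have r: "(E, u1, u2, a, b') \<in> snd (snd \<Gamma>)" "WP m" "tg m = sr k"
      "iso s1" "dom s1 = v1 # z @ y @ k @ m" "cod s1 = u1 # c" "iso s2" "dom s2 = v2 # x @ y @ k @ m" "cod s2 = u2 # c" "pth c"
      "dat F1 F2 ([u1], [u2], ([w1, u1], a, [w2, u2]), ([f1, u1], b', [f2, u2]))" "E = src C u1" "tg c = src C u1"
      "b \<lhd> (k @ m) = [f2] \<rhd> sinv s2 \<bullet> ([f1, u1], b', [f2, u2]) \<lhd> c \<bullet> [f1] \<rhd> s1"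
      using r0 k Y by simp_all
    note e = dat_D[OF r(11)]
    \<comment> \<open>All refinements together, on either side. \<open>Z\<close> lies in
      \<open>W\<close>, and this puts the denominator of the result into \<open>W\<close>.\<close>
    define Z where "Z = z @ y @ k @ m"
    define Z' where "Z' = x @ y @ k @ m"
    have pZ: "pth Z" "pth Z'" "tg Z = src C v1" "tg Z' = src C v2" "sr Z = sr m" "sr Z' = sr m" "WP Z"
      using z y(1,2) k(1,2) r(2,3) by (auto simp: Z_def Z'_def intro!: WP_append)
    have sc: "sr c = sr m" using valid_D(8)[OF iso_valid[OF r(4)]] r(5,6,10) pZ by (simp flip: Z_def)
    note rr = r(4) r(5)[folded Z_def] r(6,7) r(8)[folded Z'_def] r(9,10,13)
    define T1 where "T1 = ([v1, ev Z], raw s1, [u1, ev c])"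
    define T2 where "T2 = ([v2, ev Z'], raw s2, [u2, ev c])"
    define Ph where "Ph = ([p1, ev Z], raw (ph \<lhd> m), [p2, ev Z'])"
    have T1: "T1 = [u1] \<rhd> kap c \<bullet> s1 \<bullet> [v1] \<rhd> sinv (kap Z)"
      unfolding T1_def using collapse_right[of s1 "[v1]" Z "[u1]" c] rr pZ by simp
    have T2: "T2 = [u2] \<rhd> kap c \<bullet> s2 \<bullet> [v2] \<rhd> sinv (kap Z')"
      unfolding T2_def using collapse_right[of s2 "[v2]" Z' "[u2]" c] rr pZ by simp
    have pm: "valid (ph \<lhd> m)" "dom (ph \<lhd> m) = p1 # Z" "cod (ph \<lhd> m) = p2 # Z'"
      using k(1-5) r(2,3) z y(1,2) Y by (simp_all add: Z_def Z'_def)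
    have Ph: "Ph = [p2] \<rhd> kap Z' \<bullet> (ph \<lhd> m) \<bullet> [p1] \<rhd> sinv (kap Z)"
      unfolding Ph_def using collapse_right[of "ph \<lhd> m" "[p1]" Z "[p2]" Z'] pm pZ by simp
    have i: "iso T1" "iso T2" "valid Ph" unfolding T1 T2 Ph using rr pZ l e pm sc by simp_all
    let ?B = "([f1, u1], b', [f2, u2])"
    have vp: "[v] \<rhd> (ph \<lhd> m) = \<rho>2 \<lhd> Z' \<bullet> ([f2] \<rhd> sinv s2 \<bullet> ?B \<lhd> c \<bullet> [f1] \<rhd> s1) \<bullet> sinv \<rho>1 \<lhd> Z"
      using arg_cong[OF k(6), of "\<lambda>s. s \<lhd> m"] unfolding r(14)[symmetric] by (simp add: Z_def Z'_def)
    have "[v] \<rhd> Ph = [v, p2] \<rhd> kap Z' \<bullet> ([v] \<rhd> (ph \<lhd> m)) \<bullet> [v, p1] \<rhd> sinv (kap Z)"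
      unfolding Ph by simp
    also have "\<dots> = \<rho>2 \<lhd> [ev Z'] \<bullet> [f2] \<rhd> sinv T2 \<bullet> ?B \<lhd> [ev c] \<bullet> [f1] \<rhd> T1 \<bullet> sinv \<rho>1 \<lhd> [ev Z]"
      unfolding vp T1 T2
      using rr pZ l e sc by (simp add: kap_restrict[of \<rho>2] kap_restrict[of ?B] kap_restrict[of "sinv \<rho>1"] cancels)
    finally have key: "raw ([v] \<rhd> Ph) = raw (\<rho>2 \<lhd> [ev Z'] \<bullet> [f2] \<rhd> sinv T2 \<bullet> ?B \<lhd> [ev c] \<bullet> [f1] \<rhd> T1 \<bullet> sinv \<rho>1 \<lhd> [ev Z])"
      by simp
    have ZM: "ev Z \<in> Mor C" "ev Z' \<in> Mor C" "ev c \<in> Mor C" "tgt C (ev Z) = src C v1" "tgt C (ev Z') = src C v2" "tgt C (ev c) = src C u1"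
      "src C (ev Z) = sr m" "src C (ev Z') = sr m" "src C (ev c) = sr m"
      using pZ rr sc by simp_all
    have rp1: "raw (\<rho>2 \<lhd> [ev Z']) = pull C f2 v2 v p2 (raw \<rho>2) (ev Z')"
      using raw_pull[of f2 v2 "raw \<rho>2" v p2 "ev Z'"] l ZM by (simp add: pr_triple)
    have rp2: "raw (sinv \<rho>1 \<lhd> [ev Z]) = pull C v p1 f1 v1 (vinv C (raw \<rho>1)) (ev Z)"
      using raw_pull[of v p1 "vinv C (raw \<rho>1)" f1 v1 "ev Z"] l ZM sinv_simps(2)[OF l(22)]
      by (simp add: sinv_triple[symmetric] pr_triple)
    have rp3: "raw (?B \<lhd> [ev c]) = pull C f1 u1 f2 u2 b' (ev c)"
      using raw_pull[of f1 u1 b' f2 u2 "ev c"] e ZM by simp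
    have dT: "dom T1 = [v1, ev Z]" "cod T1 = [u1, ev c]" "raw T1 = raw s1" "dom T2 = [v2, ev Z']" "cod T2 = [u2, ev c]" "raw T2 = raw s2"
      "dom Ph = [p1, ev Z]" "cod Ph = [p2, ev Z']" "raw Ph = raw (ph \<lhd> m)"
      by (simp_all add: T1_def T2_def Ph_def)
    have eqn: "\<iota> v \<star> raw (ph \<lhd> m) = pull C f2 v2 v p2 (raw \<rho>2) (ev Z') \<odot> (\<iota> f2 \<star> vinv C (raw s2)) \<odot> pull C f1 u1 f2 u2 b' (ev c)
       \<odot> (\<iota> f1 \<star> raw s1) \<odot> pull C v p1 f1 v1 (vinv C (raw \<rho>1)) (ev Z)"
      using key i l ZM e dT by (simp add: raw_lw1 raw_sinv rp1 rp2 rp3)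
    have m: "raw s1 \<in> inv_cells C (v1 \<cdot> ev Z) (u1 \<cdot> ev c)" "raw s2 \<in> inv_cells C (v2 \<cdot> ev Z') (u2 \<cdot> ev c)"
      "raw (ph \<lhd> m) \<in> cells C (p1 \<cdot> ev Z) (p2 \<cdot> ev Z')"
      using iso_inv_cell[OF i(1)] iso_inv_cell[OF i(2)] valid_D(3-5)[OF i(3)] dT by (simp_all add: cells_def)
    have "WP [ev Z]" using pZ(7) by (simp add: WP_def)
    then have "WP [w1, v1, ev Z]" using WP_append[OF W1(1), of "[ev Z]"] ZM by simp
    then have w: "(w1 \<cdot> v1) \<cdot> ev Z \<in> W" using wpath[of w1 v1 "ev Z"] ZM l by simp
    have "ev Z \<in> hom C (sr m) (src C v1)" "ev Z' \<in> hom C (sr m) (src C v2)" "ev c \<in> hom C (sr m) E" "sr m \<in> Ob C"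
      using ZM r(2,12) by (auto simp: hom_def)
    then show ?thesis unfolding Q_def using r(1) m eqn w by blast
  qed
  have Q: "\<exists>d0 \<in> frac_data C W (cmpf G F1) (cmpf G F2). lgood (sd (cmpf G F1) (cmpf G F2) d0) \<and> R = frac_class C W (cmpf G F1) (cmpf G F2) d0" if "Q R" for R
  proof -
    from that[unfolded Q_def] show ?thesis
    proof (elim exE conjE, goal_cases)
      case q: (1 A3 u1 u2 \<alpha> \<beta> E a1 a2 a \<tau>1 \<tau>2 \<phi>)
      let ?d = "(E, a1, a2, push C w1 v1 a1 w2 v2 a2 ((\<iota> w2 \<star> vinv C \<tau>2) \<odot> pull C w1 u1 w2 u2 \<alpha> a \<odot> (\<iota> w1 \<star> \<tau>1)),
        push C g p1 a1 g p2 a2 (\<iota> g \<star> \<phi>))"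
      let ?A = "([w1, u1], \<alpha>, [w2, u2])" and ?B = "([f1, u1], \<beta>, [f2, u2])"
      have fd: "(A3, u1, u2, \<alpha>, \<beta>) \<in> frac_data C W F1 F2" using cell_data(2)[OF \<Gamma> q(1)] .
      then have e0: "dat F1 F2 ([u1], [u2], ?A, ?B)" "A3 = src C u1"
        using frac_data_iff[OF cell_par[OF \<Gamma>]] by (auto simp: wdat_def sd_def)
      note e = dat_D[OF e0(1)]
      have t: "a1 \<in> Mor C" "a2 \<in> Mor C" "a \<in> Mor C" "src C a1 = E" "src C a2 = E" "src C a = E"
        "tgt C a1 = src C v1" "tgt C a2 = src C v2" "tgt C a = src C u1"
        using q e0 by (auto simp: hom_def)
      let ?T1 = "([v1, a1], \<tau>1, [u1, a])" and ?T2 = "([v2, a2], \<tau>2, [u2, a])" and ?P = "([p1, a1], \<phi>, [p2, a2])"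
      have i: "iso ?T1" "iso ?T2" by (rule inv_cell_iso; use q(6,7) t e l in simp)+
      have vP: "valid ?P" using q(9) t l by (simp add: valid_triple cells_def)
      have rp: "raw (\<rho>2 \<lhd> [a2]) = pull C f2 v2 v p2 (raw \<rho>2) a2" "raw (sinv \<rho>1 \<lhd> [a1]) = pull C v p1 f1 v1 (vinv C (raw \<rho>1)) a1"
        "raw (?A \<lhd> [a]) = pull C w1 u1 w2 u2 \<alpha> a" "raw (?B \<lhd> [a]) = pull C f1 u1 f2 u2 \<beta> a"
        using raw_pull[of f2 v2 "raw \<rho>2" v p2 a2] raw_pull[of v p1 "vinv C (raw \<rho>1)" f1 v1 a1] raw_pull[of w1 u1 \<alpha> w2 u2 a]
         raw_pull[of f1 u1 \<beta> f2 u2 a] l t sinv_simps(2)[OF l(22)] e by (simp_all add: sinv_triple[symmetric] pr_triple)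
      have key: "[v] \<rhd> ?P = \<rho>2 \<lhd> [a2] \<bullet> [f2] \<rhd> sinv ?T2 \<bullet> ?B \<lhd> [a] \<bullet> [f1] \<rhd> ?T1 \<bullet> sinv \<rho>1 \<lhd> [a1]"
        by (rule scell_eqI) (use q(10) i l t e vP in \<open>simp_all add: raw_lw1 raw_sinv rp\<close>)
      have "holds \<Gamma> ([u1, a], [u2, a], ?A \<lhd> [a], ?B \<lhd> [a])"
        using holds_res[OF \<Gamma>, of "[u1]" "[u2]" ?A ?B "[a]"] holds_sd[OF \<Gamma> q(1)] t by (simp add: sd_def)
      from holds_iso[OF \<Gamma> this, of ?T1 ?T2]
      have H: "holds \<Gamma> ([v1, a1], [v2, a2], [w2] \<rhd> sinv ?T2 \<bullet> ?A \<lhd> [a] \<bullet> [w1] \<rhd> ?T1, [f2] \<rhd> sinv ?T2 \<bullet> ?B \<lhd> [a] \<bullet> [f1] \<rhd> ?T1)"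
        using i by simp
      let ?S = "[w2] \<rhd> sinv ?T2 \<bullet> ?A \<lhd> [a] \<bullet> [w1] \<rhd> ?T1"
      have S: "?S = ([w1, v1, a1], (\<iota> w2 \<star> vinv C \<tau>2) \<odot> pull C w1 u1 w2 u2 \<alpha> a \<odot> (\<iota> w1 \<star> \<tau>1), [w2, v2, a2])"
        by (rule scell_eqI) (use i l t e in \<open>simp_all add: raw_lw1 raw_sinv rp\<close>)
      have vS: "valid ?S" using i l t e by simp
      have S2: "[g] \<rhd> ?P = ([g, p1, a1], \<iota> g \<star> \<phi>, [g, p2, a2])"
        by (rule scell_eqI) (use vP l t in \<open>simp_all add: raw_lw1\<close>)
      have vS2: "valid ([g] \<rhd> ?P)" using vP l t by simp
      have "lgood (sd (cmpf G F1) (cmpf G F2) ?d)"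
        unfolding sd_def prod.case K push_triple[OF vS[unfolded S]] push_triple[OF vS2[unfolded S2]]
        by (rule lgoodI[OF vP _ _ _ _ H]) (use i l t e vP in \<open>simp_all add: S[symmetric] S2[symmetric] key cancels\<close>)
      moreover have "?d \<in> frac_data C W (cmpf G F1) (cmpf G F2)"
        unfolding frac_data_iff[OF par_lw] wdat_def
        using goodD(1)[OF lgood_good calculation] wpath[of w1 v1 a1] q(8) t l by (simp add: sd_def K WP_def)
      ultimately show ?case using q(11) by blast
    qed
  qed
  show "cell (cmpf G F1) (cmpf G F2) (frac_lwhisk C W ch G \<Gamma>)" unfolding eq by (rule some_good(1)[OF par_lw lgood_good ex Q])
  show "holds (frac_lwhisk C W ch G \<Gamma>) D" if "lgood D" unfolding eq by (rule some_good(2)[OF par_lw lgood_good ex Q that])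
qed

end

context fraction_choices
begin

lemma holds_lwhisk:
  assumes "cell F1 F2 \<Gamma>" "composable G F1"
  shows cell_lwhisk: "cell (cmpf G F1) (cmpf G F2) (frac_lwhisk C W ch G \<Gamma>)"
    and "valid \<phi> \<Longrightarrow> dom \<phi> = pf (num F1) (den G) # x1 \<Longrightarrow> cod \<phi> = pf (num F2) (den G) # x2 \<Longrightarrow> x1 \<noteq> [] \<Longrightarrow> x2 \<noteq> []
      \<Longrightarrow> holds \<Gamma> (pv (num F1) (den G) # x1, pv (num F2) (den G) # x2, \<alpha>',
           sinv (pr (num F2) (den G)) \<lhd> x2 \<bullet> [den G] \<rhd> \<phi> \<bullet> pr (num F1) (den G) \<lhd> x1)
      \<Longrightarrow> holds (frac_lwhisk C W ch G \<Gamma>) (x1, x2,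
           kap [den F2, pv (num F2) (den G)] \<lhd> x2 \<bullet> \<alpha>' \<bullet> sinv (kap [den F1, pv (num F1) (den G)]) \<lhd> x1,
           kap [num G, pf (num F2) (den G)] \<lhd> x2 \<bullet> [num G] \<rhd> \<phi> \<bullet> sinv (kap [num G, pf (num F1) (den G)]) \<lhd> x1)"
proof -
  interpret left_whisker C W ch F1 F2 G \<Gamma> by unfold_locales (use assms in auto)
  show "cell (cmpf G F1) (cmpf G F2) (frac_lwhisk C W ch G \<Gamma>)" by (rule holds_lwhisk_aux)
  show "holds (frac_lwhisk C W ch G \<Gamma>) (x1, x2,
           kap [den F2, pv (num F2) (den G)] \<lhd> x2 \<bullet> \<alpha>' \<bullet> sinv (kap [den F1, pv (num F1) (den G)]) \<lhd> x1,
           kap [num G, pf (num F2) (den G)] \<lhd> x2 \<bullet> [num G] \<rhd> \<phi> \<bullet> sinv (kap [num G, pf (num F1) (den G)]) \<lhd> x1)"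
    if "valid \<phi>" "dom \<phi> = pf (num F1) (den G) # x1" "cod \<phi> = pf (num F2) (den G) # x2" "x1 \<noteq> []" "x2 \<noteq> []"
      "holds \<Gamma> (pv (num F1) (den G) # x1, pv (num F2) (den G) # x2, \<alpha>',
           sinv (pr (num F2) (den G)) \<lhd> x2 \<bullet> [den G] \<rhd> \<phi> \<bullet> pr (num F1) (den G) \<lhd> x1)"
    by (rule holds_lwhisk_aux(2)[OF lgoodI[OF that refl refl refl]])
qed

end

locale right_whisker = fraction_choices C W ch for C :: "('o, 'm, 'c) bicat" (structure) and W ch +
  fixes G1 G2 :: "('o, 'm) fmor" and F :: "('o, 'm) fmor" and \<Gamma> :: "('o, 'm, 'c) fcell"
  assumes \<Gamma>: "cell G1 G2 \<Gamma>" and comp1: "composable G1 F"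
begin

lemma comp2: "composable G2 F"
  using comp1 cell_par[OF \<Gamma>] by (simp add: composable_def par_def)

abbreviation (input) "w \<equiv> den F"
abbreviation (input) "f \<equiv> num F"
abbreviation (input) "b1 \<equiv> den G1"
abbreviation (input) "b2 \<equiv> den G2"
abbreviation (input) "g1 \<equiv> num G1"
abbreviation (input) "g2 \<equiv> num G2"
abbreviation (input) "v1 \<equiv> pv f b1"
abbreviation (input) "v2 \<equiv> pv f b2"
abbreviation (input) "p1 \<equiv> pf f b1"
abbreviation (input) "p2 \<equiv> pf f b2"
abbreviation (input) "\<rho>1 \<equiv> pr f b1"
abbreviation (input) "\<rho>2 \<equiv> pr f b2"

lemma rw_facts:
  "w \<in> W" "w \<in> Mor C" "f \<in> Mor C" "b1 \<in> W" "b1 \<in> Mor C" "b2 \<in> W" "b2 \<in> Mor C" "g1 \<in> Mor C" "g2 \<in> Mor C"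
  "src C w = src C f" "src C b1 = src C g1" "src C b2 = src C g2" "tgt C b1 = tgt C f" "tgt C b2 = tgt C f" "tgt C g2 = tgt C g1"
  "v1 \<in> W" "v1 \<in> Mor C" "tgt C v1 = src C f" "p1 \<in> Mor C" "tgt C p1 = src C g1" "src C p1 = src C v1"
  "iso \<rho>1" "dom \<rho>1 = [f, v1]" "cod \<rho>1 = [b1, p1]"
  "v2 \<in> W" "v2 \<in> Mor C" "tgt C v2 = src C f" "p2 \<in> Mor C" "tgt C p2 = src C g2" "src C p2 = src C v2"
  "iso \<rho>2" "dom \<rho>2 = [f, v2]" "cod \<rho>2 = [b2, p2]"
proof -
  note a = composable_D[OF comp1] and b = composable_D[OF comp2] and c = par_D[OF cell_par[OF \<Gamma>]]
  note d = choice[OF a(3,4) a(9)[symmetric]] choice[OF b(3,4) b(9)[symmetric]]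
  show "w \<in> W" "w \<in> Mor C" "f \<in> Mor C" "b1 \<in> W" "b1 \<in> Mor C" "b2 \<in> W" "b2 \<in> Mor C" "g1 \<in> Mor C" "g2 \<in> Mor C"
  "src C w = src C f" "src C b1 = src C g1" "src C b2 = src C g2" "tgt C b1 = tgt C f" "tgt C b2 = tgt C f" "tgt C g2 = tgt C g1"
  "v1 \<in> W" "v1 \<in> Mor C" "tgt C v1 = src C f" "p1 \<in> Mor C" "tgt C p1 = src C g1" "src C p1 = src C v1"
  "iso \<rho>1" "dom \<rho>1 = [f, v1]" "cod \<rho>1 = [b1, p1]"
  "v2 \<in> W" "v2 \<in> Mor C" "tgt C v2 = src C f" "p2 \<in> Mor C" "tgt C p2 = src C g2" "src C p2 = src C v2"
  "iso \<rho>2" "dom \<rho>2 = [f, v2]" "cod \<rho>2 = [b2, p2]"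
    using a b c d by simp_all
qed

text \<open>The common denominator \<open>w\<close> belongs to \<open>F\<close>, so the comparison
  \<epsilon> of the tests comes first; through the chosen squares it becomes a test of \<Gamma>,
  whose value there is \<beta>'.\<close>

definition rgood :: "('m, 'c) sdatum \<Rightarrow> bool" where
  "rgood = (\<lambda>(x1, x2, \<alpha>, \<beta>). \<exists>\<epsilon> \<beta>'. iso \<epsilon> \<and> dom \<epsilon> = v1 # x1 \<and> cod \<epsilon> = v2 # x2
     \<and> \<alpha> = kap [w, v2] \<lhd> x2 \<bullet> [w] \<rhd> \<epsilon> \<bullet> sinv (kap [w, v1]) \<lhd> x1
     \<and> \<beta> = kap [g2, p2] \<lhd> x2 \<bullet> \<beta>' \<bullet> sinv (kap [g1, p1]) \<lhd> x1
     \<and> x1 \<noteq> [] \<and> x2 \<noteq> []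
     \<and> holds \<Gamma> (p1 # x1, p2 # x2, \<rho>2 \<lhd> x2 \<bullet> [f] \<rhd> \<epsilon> \<bullet> sinv \<rho>1 \<lhd> x1, \<beta>'))"

lemma rgoodI:
  assumes "iso \<epsilon>" "dom \<epsilon> = v1 # x1" "cod \<epsilon> = v2 # x2" "x1 \<noteq> []" "x2 \<noteq> []"
    "holds \<Gamma> (p1 # x1, p2 # x2, \<alpha>', \<beta>')" "\<alpha>' = \<rho>2 \<lhd> x2 \<bullet> [f] \<rhd> \<epsilon> \<bullet> sinv \<rho>1 \<lhd> x1"
    "\<alpha> = kap [w, v2] \<lhd> x2 \<bullet> [w] \<rhd> \<epsilon> \<bullet> sinv (kap [w, v1]) \<lhd> x1"
    "\<beta> = kap [g2, p2] \<lhd> x2 \<bullet> \<beta>' \<bullet> sinv (kap [g1, p1]) \<lhd> x1"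
  shows "rgood (x1, x2, \<alpha>, \<beta>)"
  unfolding rgood_def prod.case using assms by blast

text \<open>Uniqueness runs in the opposite order to left whiskering: cancelling \<open>w\<close>
  determines \<epsilon>, hence the test of \<Gamma>, hence its value.\<close>

lemma rgood_good: "good (cmpf G1 F) (cmpf G2 F) rgood"
proof (rule goodI)
  note l = rw_facts and K = cmpf(2,3)[OF comp1] cmpf(2,3)[OF comp2]
  fix x1 x2 \<alpha> \<beta> assume "rgood (x1, x2, \<alpha>, \<beta>)"
  then obtain \<epsilon> \<beta>' where g: "iso \<epsilon>" "dom \<epsilon> = v1 # x1" "cod \<epsilon> = v2 # x2" "x1 \<noteq> []" "x2 \<noteq> []"
     "\<alpha> = kap [w, v2] \<lhd> x2 \<bullet> [w] \<rhd> \<epsilon> \<bullet> sinv (kap [w, v1]) \<lhd> x1" "\<beta> = kap [g2, p2] \<lhd> x2 \<bullet> \<beta>' \<bullet> sinv (kap [g1, p1]) \<lhd> x1"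
     "holds \<Gamma> (p1 # x1, p2 # x2, \<rho>2 \<lhd> x2 \<bullet> [f] \<rhd> \<epsilon> \<bullet> sinv \<rho>1 \<lhd> x1, \<beta>')" unfolding rgood_def by blast
  have x: "pth x1" "pth x2" "src C v1 = tg x1" "src C v2 = tg x2" "sr x2 = sr x1"
    using valid_D[OF iso_valid[OF g(1)]] g(2-5) by auto
  note a = dat_D(5-7)[OF holds_dat[OF \<Gamma> g(8)]] and gg = g(1-5) x
  show "dat (cmpf G1 F) (cmpf G2 F) (x1, x2, \<alpha>, \<beta>)"
    unfolding dat_def ty_def prod.case K g(6,7) using l gg a by simp
  show "rgood (x1 @ h, x2 @ h, \<alpha> \<lhd> h, \<beta> \<lhd> h)" if h: "pth h" "tg h = sr x1" for h
  proof (rule rgoodI[of "\<epsilon> \<lhd> h"])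
    show "holds \<Gamma> (p1 # x1 @ h, p2 # x2 @ h, (\<rho>2 \<lhd> x2 \<bullet> [f] \<rhd> \<epsilon> \<bullet> sinv \<rho>1 \<lhd> x1) \<lhd> h, \<beta>' \<lhd> h)"
      using holds_res[OF \<Gamma> g(8), of h] h gg by simp
  qed (use gg h l in \<open>simp_all add: g(6,7)\<close>)
  show "rgood (dom t1, dom t2, [den (cmpf G2 F)] \<rhd> sinv t2 \<bullet> \<alpha> \<bullet> [den (cmpf G1 F)] \<rhd> t1,
     [num (cmpf G2 F)] \<rhd> sinv t2 \<bullet> \<beta> \<bullet> [num (cmpf G1 F)] \<rhd> t1)"
    if t: "iso t1" "iso t2" "cod t1 = x1" "cod t2 = x2" for t1 t2
  proof -
    note tt = valid_D[OF iso_valid[OF t(1)]] valid_D[OF iso_valid[OF t(2)]]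
    from holds_iso[OF \<Gamma> g(8), of "[p1] \<rhd> t1" "[p2] \<rhd> t2"]
    have H: "holds \<Gamma> (p1 # dom t1, p2 # dom t2, [b2, p2] \<rhd> sinv t2 \<bullet> (\<rho>2 \<lhd> x2 \<bullet> [f] \<rhd> \<epsilon> \<bullet> sinv \<rho>1 \<lhd> x1) \<bullet> [b1, p1] \<rhd> t1,
       [g2, p2] \<rhd> sinv t2 \<bullet> \<beta>' \<bullet> [g1, p1] \<rhd> t1)"
      using t tt gg l by simp
    show ?thesis
      by (rule rgoodI[OF _ _ _ _ _ H, of "[v2] \<rhd> sinv t2 \<bullet> \<epsilon> \<bullet> [v1] \<rhd> t1"])
        (use t tt gg l a in \<open>simp_all add: g(6,7) K slides\<close>)
  qed
  fix \<gamma> \<delta> assume "rgood (x1, x2, \<gamma>, \<delta>)" and e: "\<gamma> \<approx> \<alpha>"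
  then obtain \<epsilon>' \<delta>' where g': "iso \<epsilon>'" "dom \<epsilon>' = v1 # x1" "cod \<epsilon>' = v2 # x2"
     "\<gamma> = kap [w, v2] \<lhd> x2 \<bullet> [w] \<rhd> \<epsilon>' \<bullet> sinv (kap [w, v1]) \<lhd> x1" "\<delta> = kap [g2, p2] \<lhd> x2 \<bullet> \<delta>' \<bullet> sinv (kap [g1, p1]) \<lhd> x1"
     "holds \<Gamma> (p1 # x1, p2 # x2, \<rho>2 \<lhd> x2 \<bullet> [f] \<rhd> \<epsilon>' \<bullet> sinv \<rho>1 \<lhd> x1, \<delta>')" unfolding rgood_def by blast
  note a' = dat_D(5-7)[OF holds_dat[OF \<Gamma> g'(6)]] and gg' = g'(1-3)
  have "[w] \<rhd> \<epsilon>' \<bullet> sinv (kap [w, v1]) \<lhd> x1 \<approx> [w] \<rhd> \<epsilon> \<bullet> sinv (kap [w, v1]) \<lhd> x1"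
    by (rule germ_cancel_vc[of "kap [w, v2] \<lhd> x2"]) (use e l gg gg' in \<open>simp_all add: g(6) g'(4)\<close>)
  then have "[w] \<rhd> \<epsilon>' \<approx> [w] \<rhd> \<epsilon>" by (rule germ_cancel_vc') (use l gg gg' in simp_all)
  then have e1: "\<epsilon>' \<approx> \<epsilon>" by (rule germ_cancel_lw) (use l gg gg' in simp_all)
  have "[f] \<rhd> \<epsilon>' \<bullet> sinv \<rho>1 \<lhd> x1 \<approx> [f] \<rhd> \<epsilon> \<bullet> sinv \<rho>1 \<lhd> x1"
    by (rule germ_vc_left[OF germ_lw[OF e1]]) (use l gg gg' in simp_all)
  then have e2: "\<rho>2 \<lhd> x2 \<bullet> [f] \<rhd> \<epsilon>' \<bullet> sinv \<rho>1 \<lhd> x1 \<approx> \<rho>2 \<lhd> x2 \<bullet> [f] \<rhd> \<epsilon> \<bullet> sinv \<rho>1 \<lhd> x1"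
    by (rule germ_vc_right) (use l gg gg' in simp_all)
  have e3: "\<delta>' \<approx> \<beta>'" using holds_unique[OF \<Gamma> g(8) g'(6) e2] .
  have "\<delta>' \<bullet> sinv (kap [g1, p1]) \<lhd> x1 \<approx> \<beta>' \<bullet> sinv (kap [g1, p1]) \<lhd> x1"
    by (rule germ_vc_left[OF e3]) (use l gg a' in simp_all)
  then show "\<delta> \<approx> \<beta>" unfolding g(7) g'(5) by (rule germ_vc_right) (use l gg a' in simp_all)
qed

lemma par_rw: "par (cmpf G1 F) (cmpf G2 F)"
  using cmpf[OF comp1] cmpf[OF comp2] cell_par[OF \<Gamma>] by (simp add: par_def)

lemma holds_rwhisk_aux:
  "cell (cmpf G1 F) (cmpf G2 F) (frac_rwhisk C W ch \<Gamma> F)"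
  "rgood D \<Longrightarrow> holds (frac_rwhisk C W ch \<Gamma> F) D"
proof -
  note l = rw_facts and K = cmpf(2,3)[OF comp1] cmpf(2,3)[OF comp2]
  have t1: "tgt C f = tgt C b1" and t2: "tgt C f = tgt C b2" using l by simp_all
  define Q where "Q = (\<lambda>R. \<exists>B3 u1 u2 \<alpha> \<beta> E a1 a2 h \<epsilon> \<sigma>1 \<sigma>2.
       (B3, u1, u2, \<alpha>, \<beta>) \<in> snd (snd \<Gamma>)
       \<and> E \<in> Ob C \<and> a1 \<in> hom C E (src C v1) \<and> a2 \<in> hom C E (src C v2) \<and> h \<in> hom C E B3
       \<and> \<epsilon> \<in> inv_cells C (v1 \<cdot> a1) (v2 \<cdot> a2)
       \<and> \<sigma>1 \<in> inv_cells C (p1 \<cdot> a1) (u1 \<cdot> h) \<and> \<sigma>2 \<in> inv_cells C (p2 \<cdot> a2) (u2 \<cdot> h)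
       \<and> (w \<cdot> v1) \<cdot> a1 \<in> W
       \<and> pull C b1 u1 b2 u2 \<alpha> h \<odot> (\<iota> b1 \<star> \<sigma>1) \<odot> pull C f v1 b1 p1 (raw \<rho>1) a1
         = (\<iota> b2 \<star> \<sigma>2) \<odot> pull C f v2 b2 p2 (raw \<rho>2) a2 \<odot> (\<iota> f \<star> \<epsilon>)
       \<and> R = frac_class C W (cmpf G1 F) (cmpf G2 F)
           (E, a1, a2,
            push C w v1 a1 w v2 a2 (\<iota> w \<star> \<epsilon>),
            push C g1 p1 a1 g2 p2 a2
              ((\<iota> g2 \<star> vinv C \<sigma>2) \<odot> pull C g1 u1 g2 u2 \<beta> h \<odot> (\<iota> g1 \<star> \<sigma>1))))"
  have eq: "frac_rwhisk C W ch \<Gamma> F = (SOME R. Q R)"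
  proof -
    obtain X where X: "\<Gamma> = (G1, G2, X)" using \<Gamma> by (cases \<Gamma>) (auto simp: cell_def)
    obtain A1 ww1 ff1 A2 ww2 ff2 B vv gg where FG: "G1 = (A1, ww1, ff1)" "G2 = (A2, ww2, ff2)" "F = (B, vv, gg)"
      by (cases G1; cases G2; cases F) auto
    note e1 = ch_eq[OF l(3,4) t1, unfolded FG den_num] and e2 = ch_eq[OF l(3,6) t2, unfolded FG den_num]
    show ?thesis unfolding frac_rwhisk_def Q_def X FG prod.case den_num e1 e2 snd_conv ..
  qed
  have ex: "\<exists>R. Q R"
  proof -
    have W1: "WP [w, v1]" "WP [w, v2]" using WP_append[of "[w]" "[v1]"] WP_append[of "[w]" "[v2]"] l by simp_all
    \<comment> \<open>Here the lift through \<open>w\<close> precedes the evaluation of \<Gamma>; as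
      before, a representative then reproduces the data exactly.\<close>
    obtain z x s where z0: "WP z" "tg z = sr [w, v1]" "iso s" "dom s = [w, v1] @ z" "cod s = [w, v2] @ x" "pth x" "tg x = sr [w, v2]" "sr x = sr z"
      by (rule bf3[OF W1(2), of "[w, v1]"]) (use l in auto)
    note z = z0[simplified]
    obtain y ep where y0: "WP y" "tg y = sr (v1 # z)" "valid ep" "dom ep = (v1 # z) @ y" "cod ep = (v2 # x) @ y" "iso s \<Longrightarrow> iso ep"
      by (rule lift[of "[w]" "v1 # z" "v2 # x" s]) (use z l in auto)
    have Y: "pth z" "pth y" using z y0 by simp_all
    have y: "WP y" "tg y = sr z" "iso ep" "dom ep = v1 # z @ y" "cod ep = v2 # x @ y" using y0 z Y by simp_all
    let ?s = "\<rho>2 \<lhd> (x @ y) \<bullet> [f] \<rhd> ep \<bullet> sinv \<rho>1 \<lhd> (z @ y)"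
    have is0: "iso ?s" "dom ?s = b1 # p1 # z @ y" "cod ?s = b2 # p2 # x @ y" using l y z Y by simp_all
    obtain k b where k0: "WP k" "tg k = sr (p1 # z @ y)" "holds \<Gamma> ((p1 # z @ y) @ k, (p2 # x @ y) @ k, ?s \<lhd> k, b)"
      by (rule holds_ex[OF \<Gamma> is0]) (use l y z Y in auto)
    have k: "WP k" "tg k = sr y" using k0 Y by simp_all
    have H: "holds \<Gamma> (p1 # z @ y @ k, p2 # x @ y @ k, ?s \<lhd> k, b)" using k0 by simp
    obtain E u1 u2 a b' m c s1 s2 where r0: "(E, u1, u2, a, b') \<in> snd (snd \<Gamma>)" "WP m" "tg m = sr (p1 # z @ y @ k)"
      "iso s1" "dom s1 = (p1 # z @ y @ k) @ m" "cod s1 = u1 # c" "iso s2" "dom s2 = (p2 # x @ y @ k) @ m" "cod s2 = u2 # c" "pth c"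
      "dat G1 G2 ([u1], [u2], ([b1, u1], a, [b2, u2]), ([g1, u1], b', [g2, u2]))" "E = src C u1" "tg c = src C u1"
      "?s \<lhd> k \<lhd> m = [b2] \<rhd> sinv s2 \<bullet> ([b1, u1], a, [b2, u2]) \<lhd> c \<bullet> [b1] \<rhd> s1"
      by (rule holds_repr[OF \<Gamma> H])
    have pk: "pth k" using k by simp
    have r: "(E, u1, u2, a, b') \<in> snd (snd \<Gamma>)" "WP m" "tg m = sr k"
      "iso s1" "dom s1 = p1 # z @ y @ k @ m" "cod s1 = u1 # c" "iso s2" "dom s2 = p2 # x @ y @ k @ m" "cod s2 = u2 # c" "pth c"
      "dat G1 G2 ([u1], [u2], ([b1, u1], a, [b2, u2]), ([g1, u1], b', [g2, u2]))" "E = src C u1" "tg c = src C u1"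
      using r0(1-13) pk by simp_all
    note e = dat_D[OF r(11)]
    define Z where "Z = z @ y @ k @ m"
    define Z' where "Z' = x @ y @ k @ m"
    have r14: "\<rho>2 \<lhd> Z' \<bullet> [f] \<rhd> ep \<lhd> (k @ m) \<bullet> sinv \<rho>1 \<lhd> Z = [b2] \<rhd> sinv s2 \<bullet> ([b1, u1], a, [b2, u2]) \<lhd> c \<bullet> [b1] \<rhd> s1"
      using r0(14) by (simp add: Z_def Z'_def)
    have pZ: "pth Z" "pth Z'" "tg Z = src C v1" "tg Z' = src C v2" "sr Z = sr m" "sr Z' = sr m" "WP Z"
      using z y(1,2) k(1,2) r(2,3) by (auto simp: Z_def Z'_def intro!: WP_append)
    have sc: "sr c = sr m" using valid_D(8)[OF iso_valid[OF r(4)]] r(5,6,10) pZ by (simp flip: Z_def)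
    note rr = r(4) r(5)[folded Z_def] r(6,7) r(8)[folded Z'_def] r(9,10,13)
    define T1 where "T1 = ([p1, ev Z], raw s1, [u1, ev c])"
    define T2 where "T2 = ([p2, ev Z'], raw s2, [u2, ev c])"
    define Ep where "Ep = ([v1, ev Z], raw (ep \<lhd> (k @ m)), [v2, ev Z'])"
    have T1: "T1 = [u1] \<rhd> kap c \<bullet> s1 \<bullet> [p1] \<rhd> sinv (kap Z)"
      unfolding T1_def using collapse_right[of s1 "[p1]" Z "[u1]" c] rr pZ by simp
    have T2: "T2 = [u2] \<rhd> kap c \<bullet> s2 \<bullet> [p2] \<rhd> sinv (kap Z')"
      unfolding T2_def using collapse_right[of s2 "[p2]" Z' "[u2]" c] rr pZ by simp
    have pm: "iso (ep \<lhd> (k @ m))" "dom (ep \<lhd> (k @ m)) = v1 # Z" "cod (ep \<lhd> (k @ m)) = v2 # Z'"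
      using k r(2,3) z y Y by (simp_all add: Z_def Z'_def)
    have Ep: "Ep = [v2] \<rhd> kap Z' \<bullet> (ep \<lhd> (k @ m)) \<bullet> [v1] \<rhd> sinv (kap Z)"
      unfolding Ep_def using collapse_right[of "ep \<lhd> (k @ m)" "[v1]" Z "[v2]" Z'] pm pZ by simp
    have i: "iso T1" "iso T2" "iso Ep" unfolding T1 T2 Ep using rr pZ l e pm sc by simp_all
    let ?A = "([b1, u1], a, [b2, u2])"
    have "[b2] \<rhd> T2 \<bullet> \<rho>2 \<lhd> [ev Z'] \<bullet> [f] \<rhd> Ep
        = [b2, u2] \<rhd> kap c \<bullet> [b2] \<rhd> s2 \<bullet> (\<rho>2 \<lhd> Z' \<bullet> [f] \<rhd> ep \<lhd> (k @ m) \<bullet> sinv \<rho>1 \<lhd> Z) \<bullet> \<rho>1 \<lhd> Z \<bullet> [f, v1] \<rhd> sinv (kap Z)"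
      unfolding Ep T2 using rr pZ l e sc pm by (simp add: kap_restrict[of \<rho>2] cancels del: rw_rw)
    also have "\<dots> = ?A \<lhd> [ev c] \<bullet> [b1] \<rhd> T1 \<bullet> \<rho>1 \<lhd> [ev Z]"
      unfolding r14 T1 using rr pZ l e sc by (simp add: kap_restrict[of \<rho>1] kap_restrict[of ?A] cancels)
    finally have key: "raw ([b2] \<rhd> T2 \<bullet> \<rho>2 \<lhd> [ev Z'] \<bullet> [f] \<rhd> Ep) = raw (?A \<lhd> [ev c] \<bullet> [b1] \<rhd> T1 \<bullet> \<rho>1 \<lhd> [ev Z])"
      by simp
    have ZM: "ev Z \<in> Mor C" "ev Z' \<in> Mor C" "ev c \<in> Mor C" "tgt C (ev Z) = src C v1" "tgt C (ev Z') = src C v2" "tgt C (ev c) = src C u1"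
      "src C (ev Z) = sr m" "src C (ev Z') = sr m" "src C (ev c) = sr m"
      using pZ rr sc by simp_all
    have rp1: "raw (\<rho>2 \<lhd> [ev Z']) = pull C f v2 b2 p2 (raw \<rho>2) (ev Z')"
      using raw_pull[of f v2 "raw \<rho>2" b2 p2 "ev Z'"] l ZM by (simp add: pr_triple)
    have rp2: "raw (\<rho>1 \<lhd> [ev Z]) = pull C f v1 b1 p1 (raw \<rho>1) (ev Z)"
      using raw_pull[of f v1 "raw \<rho>1" b1 p1 "ev Z"] l ZM by (simp add: pr_triple)
    have rp3: "raw (?A \<lhd> [ev c]) = pull C b1 u1 b2 u2 a (ev c)"
      using raw_pull[of b1 u1 a b2 u2 "ev c"] e ZM by simp
    have dT: "dom T1 = [p1, ev Z]" "cod T1 = [u1, ev c]" "raw T1 = raw s1" "dom T2 = [p2, ev Z']" "cod T2 = [u2, ev c]" "raw T2 = raw s2"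
      "dom Ep = [v1, ev Z]" "cod Ep = [v2, ev Z']" "raw Ep = raw (ep \<lhd> (k @ m))"
      by (simp_all add: T1_def T2_def Ep_def)
    have eqn: "pull C b1 u1 b2 u2 a (ev c) \<odot> (\<iota> b1 \<star> raw s1) \<odot> pull C f v1 b1 p1 (raw \<rho>1) (ev Z)
        = (\<iota> b2 \<star> raw s2) \<odot> pull C f v2 b2 p2 (raw \<rho>2) (ev Z') \<odot> (\<iota> f \<star> raw (ep \<lhd> (k @ m)))"
      using key i l ZM e dT by (simp add: raw_lw1 raw_sinv rp1 rp2 rp3)
    have m: "raw s1 \<in> inv_cells C (p1 \<cdot> ev Z) (u1 \<cdot> ev c)" "raw s2 \<in> inv_cells C (p2 \<cdot> ev Z') (u2 \<cdot> ev c)"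
      "raw (ep \<lhd> (k @ m)) \<in> inv_cells C (v1 \<cdot> ev Z) (v2 \<cdot> ev Z')"
      using iso_inv_cell[OF i(1)] iso_inv_cell[OF i(2)] iso_inv_cell[OF i(3)] dT by simp_all
    have "WP [ev Z]" using pZ(7) by (simp add: WP_def)
    then have "WP [w, v1, ev Z]" using WP_append[OF W1(1), of "[ev Z]"] ZM by simp
    then have w: "(w \<cdot> v1) \<cdot> ev Z \<in> W" using wpath[of w v1 "ev Z"] ZM l by simp
    have "ev Z \<in> hom C (sr m) (src C v1)" "ev Z' \<in> hom C (sr m) (src C v2)" "ev c \<in> hom C (sr m) E" "sr m \<in> Ob C"
      using ZM r(2,12) by (auto simp: hom_def)
    then show ?thesis unfolding Q_def using r(1) m eqn w by blast
  qed
  have Q: "\<exists>d0 \<in> frac_data C W (cmpf G1 F) (cmpf G2 F). rgood (sd (cmpf G1 F) (cmpf G2 F) d0) \<and> R = frac_class C W (cmpf G1 F) (cmpf G2 F) d0" if "Q R" for R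
  proof -
    from that[unfolded Q_def] show ?thesis
    proof (elim exE conjE, goal_cases)
      case q: (1 B3 u1 u2 \<alpha> \<beta> E a1 a2 h \<epsilon> \<sigma>1 \<sigma>2)
      let ?d = "(E, a1, a2, push C w v1 a1 w v2 a2 (\<iota> w \<star> \<epsilon>),
        push C g1 p1 a1 g2 p2 a2 ((\<iota> g2 \<star> vinv C \<sigma>2) \<odot> pull C g1 u1 g2 u2 \<beta> h \<odot> (\<iota> g1 \<star> \<sigma>1)))"
      let ?A = "([b1, u1], \<alpha>, [b2, u2])" and ?B = "([g1, u1], \<beta>, [g2, u2])"
      have fd: "(B3, u1, u2, \<alpha>, \<beta>) \<in> frac_data C W G1 G2" using cell_data(2)[OF \<Gamma> q(1)] .
      then have e0: "dat G1 G2 ([u1], [u2], ?A, ?B)" "B3 = src C u1"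
        using frac_data_iff[OF cell_par[OF \<Gamma>]] by (auto simp: wdat_def sd_def)
      note e = dat_D[OF e0(1)]
      have t: "a1 \<in> Mor C" "a2 \<in> Mor C" "h \<in> Mor C" "src C a1 = E" "src C a2 = E" "src C h = E"
        "tgt C a1 = src C v1" "tgt C a2 = src C v2" "tgt C h = src C u1"
        using q e0 by (auto simp: hom_def)
      let ?T1 = "([p1, a1], \<sigma>1, [u1, h])" and ?T2 = "([p2, a2], \<sigma>2, [u2, h])" and ?P = "([v1, a1], \<epsilon>, [v2, a2])"
      have i: "iso ?T1" "iso ?T2" "iso ?P" by (rule inv_cell_iso; use q(6-8) t e l in simp)+
      have rp: "raw (\<rho>2 \<lhd> [a2]) = pull C f v2 b2 p2 (raw \<rho>2) a2" "raw (\<rho>1 \<lhd> [a1]) = pull C f v1 b1 p1 (raw \<rho>1) a1"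
        "raw (?A \<lhd> [h]) = pull C b1 u1 b2 u2 \<alpha> h" "raw (?B \<lhd> [h]) = pull C g1 u1 g2 u2 \<beta> h"
        using raw_pull[of f v2 "raw \<rho>2" b2 p2 a2] raw_pull[of f v1 "raw \<rho>1" b1 p1 a1] raw_pull[of b1 u1 \<alpha> b2 u2 h]
         raw_pull[of g1 u1 \<beta> g2 u2 h] l t e by (simp_all add: pr_triple)
      have key: "?A \<lhd> [h] \<bullet> [b1] \<rhd> ?T1 \<bullet> \<rho>1 \<lhd> [a1] = [b2] \<rhd> ?T2 \<bullet> \<rho>2 \<lhd> [a2] \<bullet> [f] \<rhd> ?P"
        by (rule scell_eqI) (use q(10) i l t e in \<open>simp_all add: raw_lw1 rp\<close>)
      have "holds \<Gamma> ([u1, h], [u2, h], ?A \<lhd> [h], ?B \<lhd> [h])"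
        using holds_res[OF \<Gamma>, of "[u1]" "[u2]" ?A ?B "[h]"] holds_sd[OF \<Gamma> q(1)] t by (simp add: sd_def)
      from holds_iso[OF \<Gamma> this, of ?T1 ?T2]
      have H: "holds \<Gamma> ([p1, a1], [p2, a2], [b2] \<rhd> sinv ?T2 \<bullet> ?A \<lhd> [h] \<bullet> [b1] \<rhd> ?T1, [g2] \<rhd> sinv ?T2 \<bullet> ?B \<lhd> [h] \<bullet> [g1] \<rhd> ?T1)"
        using i by simp
      have HA: "[b2] \<rhd> sinv ?T2 \<bullet> ?A \<lhd> [h] \<bullet> [b1] \<rhd> ?T1 = \<rho>2 \<lhd> [a2] \<bullet> [f] \<rhd> ?P \<bullet> sinv \<rho>1 \<lhd> [a1]"
      proof -
        have "[b2] \<rhd> sinv ?T2 \<bullet> ?A \<lhd> [h] \<bullet> [b1] \<rhd> ?T1 = [b2] \<rhd> sinv ?T2 \<bullet> (?A \<lhd> [h] \<bullet> [b1] \<rhd> ?T1 \<bullet> \<rho>1 \<lhd> [a1]) \<bullet> sinv \<rho>1 \<lhd> [a1]"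
          using i l t e by (simp add: cancels)
        also have "\<dots> = \<rho>2 \<lhd> [a2] \<bullet> [f] \<rhd> ?P \<bullet> sinv \<rho>1 \<lhd> [a1]" unfolding key using i l t e by (simp add: cancels)
        finally show ?thesis .
      qed
      let ?S = "[g2] \<rhd> sinv ?T2 \<bullet> ?B \<lhd> [h] \<bullet> [g1] \<rhd> ?T1"
      have S: "?S = ([g1, p1, a1], (\<iota> g2 \<star> vinv C \<sigma>2) \<odot> pull C g1 u1 g2 u2 \<beta> h \<odot> (\<iota> g1 \<star> \<sigma>1), [g2, p2, a2])"
        by (rule scell_eqI) (use i l t e in \<open>simp_all add: raw_lw1 raw_sinv rp\<close>)
      have vS: "valid ?S" using i l t e by simp
      have S2: "[w] \<rhd> ?P = ([w, v1, a1], \<iota> w \<star> \<epsilon>, [w, v2, a2])"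
        by (rule scell_eqI) (use i l t in \<open>simp_all add: raw_lw1\<close>)
      have vS2: "valid ([w] \<rhd> ?P)" using i l t by simp
      have "rgood (sd (cmpf G1 F) (cmpf G2 F) ?d)"
        unfolding sd_def prod.case K push_triple[OF vS[unfolded S]] push_triple[OF vS2[unfolded S2]]
        by (rule rgoodI[OF i(3) _ _ _ _ H HA]) (simp_all add: S[symmetric] S2[symmetric])
      moreover have "?d \<in> frac_data C W (cmpf G1 F) (cmpf G2 F)"
        unfolding frac_data_iff[OF par_rw] wdat_def
        using goodD(1)[OF rgood_good calculation] wpath[of w v1 a1] q(9) t l by (simp add: sd_def K WP_def)
      ultimately show ?case using q(11) by blast
    qed
  qed
  show "cell (cmpf G1 F) (cmpf G2 F) (frac_rwhisk C W ch \<Gamma> F)" unfolding eq by (rule some_good(1)[OF par_rw rgood_good ex Q])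
  show "holds (frac_rwhisk C W ch \<Gamma> F) D" if "rgood D" unfolding eq by (rule some_good(2)[OF par_rw rgood_good ex Q that])
qed

end

context fraction_choices
begin

lemma holds_rwhisk:
  assumes "cell G1 G2 \<Gamma>" "composable G1 F"
  shows cell_rwhisk: "cell (cmpf G1 F) (cmpf G2 F) (frac_rwhisk C W ch \<Gamma> F)"
    and "iso \<epsilon> \<Longrightarrow> dom \<epsilon> = pv (num F) (den G1) # x1 \<Longrightarrow> cod \<epsilon> = pv (num F) (den G2) # x2 \<Longrightarrow> x1 \<noteq> [] \<Longrightarrow> x2 \<noteq> []
      \<Longrightarrow> holds \<Gamma> (pf (num F) (den G1) # x1, pf (num F) (den G2) # x2,
           pr (num F) (den G2) \<lhd> x2 \<bullet> [num F] \<rhd> \<epsilon> \<bullet> sinv (pr (num F) (den G1)) \<lhd> x1, \<beta>)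
      \<Longrightarrow> holds (frac_rwhisk C W ch \<Gamma> F) (x1, x2,
           kap [den F, pv (num F) (den G2)] \<lhd> x2 \<bullet> [den F] \<rhd> \<epsilon> \<bullet> sinv (kap [den F, pv (num F) (den G1)]) \<lhd> x1,
           kap [num G2, pf (num F) (den G2)] \<lhd> x2 \<bullet> \<beta> \<bullet> sinv (kap [num G1, pf (num F) (den G1)]) \<lhd> x1)"
proof -
  interpret right_whisker C W ch G1 G2 F \<Gamma> by unfold_locales (use assms in auto)
  show "cell (cmpf G1 F) (cmpf G2 F) (frac_rwhisk C W ch \<Gamma> F)" by (rule holds_rwhisk_aux)
  show "holds (frac_rwhisk C W ch \<Gamma> F) (x1, x2,
           kap [den F, pv (num F) (den G2)] \<lhd> x2 \<bullet> [den F] \<rhd> \<epsilon> \<bullet> sinv (kap [den F, pv (num F) (den G1)]) \<lhd> x1,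
           kap [num G2, pf (num F) (den G2)] \<lhd> x2 \<bullet> \<beta> \<bullet> sinv (kap [num G1, pf (num F) (den G1)]) \<lhd> x1)"
    if "iso \<epsilon>" "dom \<epsilon> = pv (num F) (den G1) # x1" "cod \<epsilon> = pv (num F) (den G2) # x2" "x1 \<noteq> []" "x2 \<noteq> []"
     "holds \<Gamma> (pf (num F) (den G1) # x1, pf (num F) (den G2) # x2,
           pr (num F) (den G2) \<lhd> x2 \<bullet> [num F] \<rhd> \<epsilon> \<bullet> sinv (pr (num F) (den G1)) \<lhd> x1, \<beta>)"
    by (rule holds_rwhisk_aux(2)[OF rgoodI[OF that refl refl refl]])
qed

end

section \<open>The associator\<close>

locale composable_triple = fraction_choices C W ch for C :: "('o, 'm, 'c) bicat" (structure) and W ch +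
  fixes F G H :: "('o, 'm) fmor"
  assumes GF: "composable G F" and HG: "composable H G"
begin

abbreviation (input) "u \<equiv> den F"
abbreviation (input) "f \<equiv> num F"
abbreviation (input) "v \<equiv> den G"
abbreviation (input) "g \<equiv> num G"
abbreviation (input) "w \<equiv> den H"
abbreviation (input) "h \<equiv> num H"
abbreviation (input) "v1 \<equiv> pv f v"
abbreviation (input) "f1 \<equiv> pf f v"
abbreviation (input) "\<delta> \<equiv> pr f v"
abbreviation (input) "w1 \<equiv> pv (g \<cdot> f1) w"
abbreviation (input) "g1 \<equiv> pf (g \<cdot> f1) w"
abbreviation (input) "\<sigma> \<equiv> pr (g \<cdot> f1) w"
abbreviation (input) "w2 \<equiv> pv g w"
abbreviation (input) "g2 \<equiv> pf g w"
abbreviation (input) "\<xi> \<equiv> pr g w"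
abbreviation (input) "y \<equiv> pv f (v \<cdot> w2)"
abbreviation (input) "f3 \<equiv> pf f (v \<cdot> w2)"
abbreviation (input) "\<eta> \<equiv> pr f (v \<cdot> w2)"

text \<open>\<open>sg\<close> and \<open>et\<close> are chosen cells with the composites
  \<open>g \<cdot> f1\<close> and \<open>v \<cdot> w2\<close> spelled out; the \<open>J\<close> and
  \<open>K\<close> cells form the composed denominators and numerators of the two
  bracketings.\<close>

definition "sg = \<sigma> \<bullet> kap [g, f1] \<lhd> [w1]"
definition "et = sinv (kap [v, w2]) \<lhd> [f3] \<bullet> \<eta>"
definition "J1 = kap [u \<cdot> v1, w1] \<bullet> kap [u, v1] \<lhd> [w1]"
definition "J2 = kap [u, y]"
definition "K1 = kap [h, g1]"
definition "K2 = kap [h \<cdot> g2, f3] \<bullet> kap [h, g2] \<lhd> [f3]"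

lemma facts:
  "u \<in> W" "u \<in> Mor C" "f \<in> Mor C" "v \<in> W" "v \<in> Mor C" "g \<in> Mor C" "w \<in> W" "w \<in> Mor C" "h \<in> Mor C"
  "src C u = src C f" "src C v = src C g" "src C w = src C h" "tgt C v = tgt C f" "tgt C w = tgt C g"
  "v1 \<in> W" "v1 \<in> Mor C" "tgt C v1 = src C f" "f1 \<in> Mor C" "tgt C f1 = src C g" "src C f1 = src C v1"
  "iso \<delta>" "dom \<delta> = [f, v1]" "cod \<delta> = [v, f1]"
  "w1 \<in> W" "w1 \<in> Mor C" "tgt C w1 = src C v1" "g1 \<in> Mor C" "tgt C g1 = src C h" "src C g1 = src C w1"
  "iso \<sigma>" "dom \<sigma> = [g \<cdot> f1, w1]" "cod \<sigma> = [w, g1]"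
  "w2 \<in> W" "w2 \<in> Mor C" "tgt C w2 = src C g" "g2 \<in> Mor C" "tgt C g2 = src C h" "src C g2 = src C w2"
  "iso \<xi>" "dom \<xi> = [g, w2]" "cod \<xi> = [w, g2]"
  "y \<in> W" "y \<in> Mor C" "tgt C y = src C f" "f3 \<in> Mor C" "tgt C f3 = src C w2" "src C f3 = src C y"
  "iso \<eta>" "dom \<eta> = [f, y]" "cod \<eta> = [v \<cdot> w2, f3]"
proof -
  note a = composable_D[OF GF] and b = composable_D[OF HG]
  note c = choice[OF a(3,4) a(9)[symmetric]] and d = choice[OF b(3,4) b(9)[symmetric]]
  have m: "g \<cdot> f1 \<in> Mor C" "tgt C (g \<cdot> f1) = tgt C w" "src C (g \<cdot> f1) = src C v1" using a b c by simp_all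
  have n: "v \<cdot> w2 \<in> W" using BF2[of w2 v] a b d by simp
  have n': "tgt C f = tgt C (v \<cdot> w2)" "src C (v \<cdot> w2) = src C w2" using a b d by simp_all
  note e = choice[OF m(1) b(4) m(2)] and k = choice[OF a(3) n n'(1)]
  show
  "u \<in> W" "u \<in> Mor C" "f \<in> Mor C" "v \<in> W" "v \<in> Mor C" "g \<in> Mor C" "w \<in> W" "w \<in> Mor C" "h \<in> Mor C"
  "src C u = src C f" "src C v = src C g" "src C w = src C h" "tgt C v = tgt C f" "tgt C w = tgt C g"
  "v1 \<in> W" "v1 \<in> Mor C" "tgt C v1 = src C f" "f1 \<in> Mor C" "tgt C f1 = src C g" "src C f1 = src C v1"
  "iso \<delta>" "dom \<delta> = [f, v1]" "cod \<delta> = [v, f1]"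
  "w1 \<in> W" "w1 \<in> Mor C" "tgt C w1 = src C v1" "g1 \<in> Mor C" "tgt C g1 = src C h" "src C g1 = src C w1"
  "iso \<sigma>" "dom \<sigma> = [g \<cdot> f1, w1]" "cod \<sigma> = [w, g1]"
  "w2 \<in> W" "w2 \<in> Mor C" "tgt C w2 = src C g" "g2 \<in> Mor C" "tgt C g2 = src C h" "src C g2 = src C w2"
  "iso \<xi>" "dom \<xi> = [g, w2]" "cod \<xi> = [w, g2]"
  "y \<in> W" "y \<in> Mor C" "tgt C y = src C f" "f3 \<in> Mor C" "tgt C f3 = src C w2" "src C f3 = src C y"
  "iso \<eta>" "dom \<eta> = [f, y]" "cod \<eta> = [v \<cdot> w2, f3]"
    by (simp_all add: a b c d e k m(1,3) n'(2))
qed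

lemma derived:
  "iso sg" "dom sg = [g, f1, w1]" "cod sg = [w, g1]"
  "iso et" "dom et = [f, y]" "cod et = [v, w2, f3]"
  "iso J1" "dom J1 = [u, v1, w1]" "cod J1 = [(u \<cdot> v1) \<cdot> w1]"
  "iso J2" "dom J2 = [u, y]" "cod J2 = [u \<cdot> y]"
  "iso K1" "dom K1 = [h, g1]" "cod K1 = [h \<cdot> g1]"
  "iso K2" "dom K2 = [h, g2, f3]" "cod K2 = [(h \<cdot> g2) \<cdot> f3]"
  using facts by (simp_all add: sg_def et_def J1_def J2_def K1_def K2_def)

lemma comps: "composable H (cmpf G F)" "composable (cmpf H G) F"
  using GF HG cmpf[OF GF] cmpf[OF HG] by (simp_all add: composable_def)

abbreviation (input) "S1 \<equiv> cmpf H (cmpf G F)"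
abbreviation (input) "S2 \<equiv> cmpf (cmpf H G) F"

lemma S_simps: "den S1 = (u \<cdot> v1) \<cdot> w1" "num S1 = h \<cdot> g1" "den S2 = u \<cdot> y" "num S2 = (h \<cdot> g2) \<cdot> f3"
  using cmpf(2,3)[OF comps(1)] cmpf(2,3)[OF comps(2)] cmpf(2,3)[OF GF] cmpf(2,3)[OF HG] by simp_all

lemma par_S: "par S1 S2"
  using cmpf[OF comps(1)] cmpf[OF comps(2)] cmpf[OF GF] cmpf[OF HG] by (simp add: par_def)

text \<open>The three comparisons arise one from another: \<gamma> over \<open>u\<close>, then
  \<omega> by lifting through \<open>v\<close>, then \<rho> by lifting through \<open>w\<close>. So
  \<gamma> alone determines the value up to germs, which is the uniqueness needed for a good
  set.\<close>

definition agood :: "('m, 'c) sdatum \<Rightarrow> bool" where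
  "agood = (\<lambda>(x1, x2, \<alpha>, \<beta>). \<exists>\<gamma> \<omega> \<rho>. iso \<gamma> \<and> dom \<gamma> = v1 # w1 # x1 \<and> cod \<gamma> = y # x2
     \<and> iso \<omega> \<and> dom \<omega> = f1 # w1 # x1 \<and> cod \<omega> = w2 # f3 # x2
     \<and> iso \<rho> \<and> dom \<rho> = g1 # x1 \<and> cod \<rho> = g2 # f3 # x2
     \<and> x1 \<noteq> [] \<and> x2 \<noteq> []
     \<and> [v] \<rhd> \<omega> = et \<lhd> x2 \<bullet> [f] \<rhd> \<gamma> \<bullet> sinv \<delta> \<lhd> (w1 # x1)
     \<and> [w] \<rhd> \<rho> = \<xi> \<lhd> (f3 # x2) \<bullet> [g] \<rhd> \<omega> \<bullet> sinv sg \<lhd> x1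
     \<and> \<alpha> = J2 \<lhd> x2 \<bullet> [u] \<rhd> \<gamma> \<bullet> sinv J1 \<lhd> x1
     \<and> \<beta> = K2 \<lhd> x2 \<bullet> [h] \<rhd> \<rho> \<bullet> sinv K1 \<lhd> x1)"

lemma agoodI:
  assumes "iso \<gamma>" "dom \<gamma> = v1 # w1 # x1" "cod \<gamma> = y # x2"
    "iso \<omega>" "dom \<omega> = f1 # w1 # x1" "cod \<omega> = w2 # f3 # x2"
    "iso \<rho>" "dom \<rho> = g1 # x1" "cod \<rho> = g2 # f3 # x2" "x1 \<noteq> []" "x2 \<noteq> []"
    "[v] \<rhd> \<omega> = et \<lhd> x2 \<bullet> [f] \<rhd> \<gamma> \<bullet> sinv \<delta> \<lhd> (w1 # x1)"
    "[w] \<rhd> \<rho> = \<xi> \<lhd> (f3 # x2) \<bullet> [g] \<rhd> \<omega> \<bullet> sinv sg \<lhd> x1"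
    "\<alpha> = J2 \<lhd> x2 \<bullet> [u] \<rhd> \<gamma> \<bullet> sinv J1 \<lhd> x1"
    "\<beta> = K2 \<lhd> x2 \<bullet> [h] \<rhd> \<rho> \<bullet> sinv K1 \<lhd> x1"
  shows "agood (x1, x2, \<alpha>, \<beta>)"
  unfolding agood_def prod.case using assms by blast

lemma agood_good: "good S1 S2 agood"
proof (rule goodI)
  note l = facts derived and K = S_simps
  fix x1 x2 \<alpha> \<beta> assume "agood (x1, x2, \<alpha>, \<beta>)"
  then obtain \<gamma> \<omega> \<rho> where g: "iso \<gamma>" "dom \<gamma> = v1 # w1 # x1" "cod \<gamma> = y # x2"
    "iso \<omega>" "dom \<omega> = f1 # w1 # x1" "cod \<omega> = w2 # f3 # x2"
    "iso \<rho>" "dom \<rho> = g1 # x1" "cod \<rho> = g2 # f3 # x2" "x1 \<noteq> []" "x2 \<noteq> []"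
    "[v] \<rhd> \<omega> = et \<lhd> x2 \<bullet> [f] \<rhd> \<gamma> \<bullet> sinv \<delta> \<lhd> (w1 # x1)"
    "[w] \<rhd> \<rho> = \<xi> \<lhd> (f3 # x2) \<bullet> [g] \<rhd> \<omega> \<bullet> sinv sg \<lhd> x1"
    "\<alpha> = J2 \<lhd> x2 \<bullet> [u] \<rhd> \<gamma> \<bullet> sinv J1 \<lhd> x1"
    "\<beta> = K2 \<lhd> x2 \<bullet> [h] \<rhd> \<rho> \<bullet> sinv K1 \<lhd> x1" unfolding agood_def by blast
  have x: "pth x1" "pth x2" "src C w1 = tg x1" "src C y = tg x2" "sr x2 = sr x1"
    using valid_D[OF iso_valid[OF g(1)]] g(2,3,10,11) by auto
  note gg = g(1-11) x
  show "dat S1 S2 (x1, x2, \<alpha>, \<beta>)"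
    unfolding dat_def ty_def prod.case K g(14,15) by (simp add: l gg)
  show "agood (x1 @ k, x2 @ k, \<alpha> \<lhd> k, \<beta> \<lhd> k)" if k: "pth k" "tg k = sr x1" for k
  proof (rule agoodI[of "\<gamma> \<lhd> k" _ _ "\<omega> \<lhd> k" "\<rho> \<lhd> k"])
    show "[v] \<rhd> \<omega> \<lhd> k = et \<lhd> (x2 @ k) \<bullet> [f] \<rhd> \<gamma> \<lhd> k \<bullet> sinv \<delta> \<lhd> (w1 # x1 @ k)"
      using arg_cong[OF g(12), of "\<lambda>s. s \<lhd> k"] by simp
    show "[w] \<rhd> \<rho> \<lhd> k = \<xi> \<lhd> (f3 # x2 @ k) \<bullet> [g] \<rhd> \<omega> \<lhd> k \<bullet> sinv sg \<lhd> (x1 @ k)"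
      using arg_cong[OF g(13), of "\<lambda>s. s \<lhd> k"] by simp
  qed (simp_all add: gg k l g(14,15))
  show "agood (dom t1, dom t2, [den S2] \<rhd> sinv t2 \<bullet> \<alpha> \<bullet> [den S1] \<rhd> t1, [num S2] \<rhd> sinv t2 \<bullet> \<beta> \<bullet> [num S1] \<rhd> t1)"
    if t: "iso t1" "iso t2" "cod t1 = x1" "cod t2 = x2" for t1 t2
  proof -
    note tt = valid_D[OF iso_valid[OF t(1)], unfolded t] valid_D[OF iso_valid[OF t(2)], unfolded t]
    have e1: "[v] \<rhd> ([w2, f3] \<rhd> sinv t2 \<bullet> \<omega> \<bullet> [f1, w1] \<rhd> t1) =
       [v, w2, f3] \<rhd> sinv t2 \<bullet> (et \<lhd> x2 \<bullet> [f] \<rhd> \<gamma> \<bullet> sinv \<delta> \<lhd> (w1 # x1)) \<bullet> [v, f1, w1] \<rhd> t1"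
      unfolding g(12)[symmetric] by simp
    have e2: "[w] \<rhd> ([g2, f3] \<rhd> sinv t2 \<bullet> \<rho> \<bullet> [g1] \<rhd> t1) =
       [w, g2, f3] \<rhd> sinv t2 \<bullet> (\<xi> \<lhd> (f3 # x2) \<bullet> [g] \<rhd> \<omega> \<bullet> sinv sg \<lhd> x1) \<bullet> [w, g1] \<rhd> t1"
      unfolding g(13)[symmetric] by simp
    show ?thesis
    proof (rule agoodI[of "[y] \<rhd> sinv t2 \<bullet> \<gamma> \<bullet> [v1, w1] \<rhd> t1" _ _ "[w2, f3] \<rhd> sinv t2 \<bullet> \<omega> \<bullet> [f1, w1] \<rhd> t1"
        "[g2, f3] \<rhd> sinv t2 \<bullet> \<rho> \<bullet> [g1] \<rhd> t1"])
      show "[v] \<rhd> ([w2, f3] \<rhd> sinv t2 \<bullet> \<omega> \<bullet> [f1, w1] \<rhd> t1) =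
        et \<lhd> dom t2 \<bullet> [f] \<rhd> ([y] \<rhd> sinv t2 \<bullet> \<gamma> \<bullet> [v1, w1] \<rhd> t1) \<bullet> sinv \<delta> \<lhd> (w1 # dom t1)"
        unfolding e1 by (simp add: t tt gg l slides)
      show "[w] \<rhd> ([g2, f3] \<rhd> sinv t2 \<bullet> \<rho> \<bullet> [g1] \<rhd> t1) =
        \<xi> \<lhd> (f3 # dom t2) \<bullet> [g] \<rhd> ([w2, f3] \<rhd> sinv t2 \<bullet> \<omega> \<bullet> [f1, w1] \<rhd> t1) \<bullet> sinv sg \<lhd> dom t1"
        unfolding e2 by (simp add: t tt gg l slides)
      show "[den S2] \<rhd> sinv t2 \<bullet> \<alpha> \<bullet> [den S1] \<rhd> t1 = J2 \<lhd> dom t2 \<bullet> [u] \<rhd> ([y] \<rhd> sinv t2 \<bullet> \<gamma> \<bullet> [v1, w1] \<rhd> t1) \<bullet> sinv J1 \<lhd> dom t1"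
        unfolding K g(14) by (simp add: t tt gg l slides)
      show "[num S2] \<rhd> sinv t2 \<bullet> \<beta> \<bullet> [num S1] \<rhd> t1 = K2 \<lhd> dom t2 \<bullet> [h] \<rhd> ([g2, f3] \<rhd> sinv t2 \<bullet> \<rho> \<bullet> [g1] \<rhd> t1) \<bullet> sinv K1 \<lhd> dom t1"
        unfolding K g(15) by (simp add: t tt gg l slides)
    qed (simp_all add: t tt gg l)
  qed
  fix \<alpha>' \<beta>' assume "agood (x1, x2, \<alpha>', \<beta>')" and e: "\<alpha>' \<approx> \<alpha>"
  then obtain \<gamma>' \<omega>' \<rho>' where g': "iso \<gamma>'" "dom \<gamma>' = v1 # w1 # x1" "cod \<gamma>' = y # x2"
    "iso \<omega>'" "dom \<omega>' = f1 # w1 # x1" "cod \<omega>' = w2 # f3 # x2"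
    "iso \<rho>'" "dom \<rho>' = g1 # x1" "cod \<rho>' = g2 # f3 # x2"
    "[v] \<rhd> \<omega>' = et \<lhd> x2 \<bullet> [f] \<rhd> \<gamma>' \<bullet> sinv \<delta> \<lhd> (w1 # x1)"
    "[w] \<rhd> \<rho>' = \<xi> \<lhd> (f3 # x2) \<bullet> [g] \<rhd> \<omega>' \<bullet> sinv sg \<lhd> x1"
    "\<alpha>' = J2 \<lhd> x2 \<bullet> [u] \<rhd> \<gamma>' \<bullet> sinv J1 \<lhd> x1"
    "\<beta>' = K2 \<lhd> x2 \<bullet> [h] \<rhd> \<rho>' \<bullet> sinv K1 \<lhd> x1" unfolding agood_def by blast
  note gg' = g'(1-9)
  have "[u] \<rhd> \<gamma>' \<approx> [u] \<rhd> \<gamma>"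
    by (rule germ_unsandwich[OF e[unfolded g(14) g'(12)]]) (simp_all add: l gg gg')
  then have e1: "\<gamma>' \<approx> \<gamma>" by (rule germ_cancel_lw) (simp_all add: l gg gg')
  have "[v] \<rhd> \<omega>' \<approx> [v] \<rhd> \<omega>" unfolding g(12) g'(10)
    by (rule germ_sandwich[OF germ_lw[OF e1]]) (simp_all add: l gg gg')
  then have e2: "\<omega>' \<approx> \<omega>" by (rule germ_cancel_lw) (simp_all add: l gg gg')
  have "[w] \<rhd> \<rho>' \<approx> [w] \<rhd> \<rho>" unfolding g(13) g'(11)
    by (rule germ_sandwich[OF germ_lw[OF e2]]) (simp_all add: l gg gg')
  then have e3: "\<rho>' \<approx> \<rho>" by (rule germ_cancel_lw) (simp_all add: l gg gg')
  show "\<beta>' \<approx> \<beta>" unfolding g(15) g'(13)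
    by (rule germ_sandwich[OF germ_lw[OF e3]]) (simp_all add: l gg gg')
qed

lemma raw_kap_restrict:
  assumes "pth [a, b]" "pth p" "src C b = tg p"
  shows "raw (kap [a, b] \<lhd> p) = \<theta> a b (ev p)" "raw (sinv (kap [a, b]) \<lhd> p) = vinv C (\<theta> a b (ev p))"
  using assms by (simp_all add: raw_rw)

text \<open>The definition of the associator starts \<gamma> from the composite
  \<open>v1 \<cdot> w1\<close>; \<open>kap\<close> spells it out, and this accounts for the term
  with \<open>\<theta> v1 w1 a\<close>.\<close>

lemma raw_eq1:
  assumes "valid \<Gamma>" "dom \<Gamma> = [v1 \<cdot> w1, a]" "cod \<Gamma> = [y, b]" "a \<in> Mor C" "b \<in> Mor C" "tgt C a = src C w1" "tgt C b = src C y" "src C b = src C a"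
  shows "raw (et \<lhd> [b] \<bullet> [f] \<rhd> (\<Gamma> \<bullet> kap [v1, w1] \<lhd> [a]) \<bullet> sinv \<delta> \<lhd> [w1, a])
    = vinv C (\<theta> v w2 (f3 \<cdot> b)) \<odot> pull C f y (v \<cdot> w2) f3 (raw \<eta>) b \<odot> (\<iota> f \<star> raw \<Gamma>)
             \<odot> (\<iota> f \<star> \<theta> v1 w1 a) \<odot> pull C v f1 f v1 (vinv C (raw \<delta>)) (w1 \<cdot> a)"
proof -
  note l = facts
  have r: "raw (\<eta> \<lhd> [b]) = pull C f y (v \<cdot> w2) f3 (raw \<eta>) b"
    using raw_pull[of f y "raw \<eta>" "v \<cdot> w2" f3 b] l assms by (simp add: pr_triple)
  have "raw (sinv \<delta> \<lhd> [ev [w1, a]]) = pull C v f1 f v1 (vinv C (raw \<delta>)) (w1 \<cdot> a)"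
    using raw_pull[of v f1 "vinv C (raw \<delta>)" f v1 "w1 \<cdot> a"] l assms sinv_simps(2)[OF l(21)]
    by (simp add: sinv_triple[symmetric] pr_triple)
  then have r2: "raw (sinv \<delta> \<lhd> [w1, a]) = pull C v f1 f v1 (vinv C (raw \<delta>)) (w1 \<cdot> a)"
    using raw_restrict_ev[of "sinv \<delta>" "[w1, a]"] l assms by simp
  show ?thesis unfolding et_def by (simp add: l assms raw_lw1 raw_kap_restrict r r2)
qed

lemma raw_eq2:
  assumes "valid \<Omega>" "dom \<Omega> = [f1, w1, a]" "cod \<Omega> = [w2, f3, b]" "a \<in> Mor C" "b \<in> Mor C" "tgt C a = src C w1" "tgt C b = src C y" "src C b = src C a"
  shows "raw (\<xi> \<lhd> [f3, b] \<bullet> [g] \<rhd> \<Omega> \<bullet> sinv sg \<lhd> [a])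
    = pull C g w2 w g2 (raw \<xi>) (f3 \<cdot> b) \<odot> (\<iota> g \<star> raw \<Omega>) \<odot> vinv C (\<theta> g f1 (w1 \<cdot> a))
             \<odot> pull C w g1 (g \<cdot> f1) w1 (vinv C (raw \<sigma>)) a"
proof -
  note l = facts
  have r: "raw (sinv \<sigma> \<lhd> [a]) = pull C w g1 (g \<cdot> f1) w1 (vinv C (raw \<sigma>)) a"
    using raw_pull[of w g1 "vinv C (raw \<sigma>)" "g \<cdot> f1" w1 a] l assms sinv_simps(2)[OF l(30)]
    by (simp add: sinv_triple[symmetric] pr_triple)
  have "raw (\<xi> \<lhd> [ev [f3, b]]) = pull C g w2 w g2 (raw \<xi>) (f3 \<cdot> b)"
    using raw_pull[of g w2 "raw \<xi>" w g2 "f3 \<cdot> b"] l assms by (simp add: pr_triple)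
  then have r2: "raw (\<xi> \<lhd> [f3, b]) = pull C g w2 w g2 (raw \<xi>) (f3 \<cdot> b)"
    using raw_restrict_ev[of "\<xi>" "[f3, b]"] l assms by simp
  have s: "sinv sg = sinv (kap [g, f1]) \<lhd> [w1] \<bullet> sinv \<sigma>" unfolding sg_def using l by simp
  show ?thesis unfolding s by (simp add: l assms raw_lw1 raw_kap_restrict r r2)
qed

text \<open>The definition rebrackets the denominator through
  \<open>\<theta> u (v1 \<cdot> w1) a\<close>, the cell \<open>J1\<close> through
  \<open>\<theta> (u \<cdot> v1) w1 a\<close>; the pentagon reconciles the two.\<close>

lemma raw_alpha:
  assumes "valid \<Gamma>" "dom \<Gamma> = [v1 \<cdot> w1, a]" "cod \<Gamma> = [y, b]" "a \<in> Mor C" "b \<in> Mor C" "tgt C a = src C w1" "tgt C b = src C y" "src C b = src C a"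
  shows "raw (J2 \<lhd> [b] \<bullet> [u] \<rhd> (\<Gamma> \<bullet> kap [v1, w1] \<lhd> [a]) \<bullet> sinv J1 \<lhd> [a])
    = \<theta> u y b \<odot> (\<iota> u \<star> raw \<Gamma>) \<odot> vinv C (\<theta> u (v1 \<cdot> w1) a) \<odot> (vinv C (\<theta> u v1 w1) \<star> \<iota> a)"
proof -
  note l = facts
  have P: "(\<iota> u \<star> \<theta> v1 w1 a) \<odot> vinv C (\<theta> u v1 (w1 \<cdot> a)) \<odot> vinv C (\<theta> (u \<cdot> v1) w1 a)
     = vinv C (\<theta> u (v1 \<cdot> w1) a) \<odot> (vinv C (\<theta> u v1 w1) \<star> \<iota> a)"
  proof -
    have "((\<iota> u \<star> \<theta> v1 w1 a) \<odot> vinv C (\<theta> u v1 (w1 \<cdot> a))) \<odot> vinv C (\<theta> (u \<cdot> v1) w1 a)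
     = vinv C (\<theta> u (v1 \<cdot> w1) a) \<odot> (vinv C (\<theta> u v1 w1) \<star> \<iota> a)"
      using l assms by (subst pentagon_inv[symmetric]) simp_all
    then show ?thesis by (simp add: l assms)
  qed
  have s: "sinv J1 = sinv (kap [u, v1]) \<lhd> [w1] \<bullet> sinv (kap [u \<cdot> v1, w1])" unfolding J1_def using l by simp
  show ?thesis unfolding s J2_def by (simp add: l assms raw_lw1 raw_kap_restrict P)
qed

lemma raw_beta:
  assumes "valid R" "dom R = [g1, a]" "cod R = [g2, f3, b]" "a \<in> Mor C" "b \<in> Mor C" "tgt C a = src C w1" "tgt C b = src C y" "src C b = src C a"
  shows "raw (K2 \<lhd> [b] \<bullet> [h] \<rhd> R \<bullet> sinv K1 \<lhd> [a])
    = \<theta> (h \<cdot> g2) f3 b \<odot> \<theta> h g2 (f3 \<cdot> b) \<odot> (\<iota> h \<star> raw R) \<odot> vinv C (\<theta> h g1 a)"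
  unfolding K1_def K2_def by (simp add: facts assms raw_lw1 raw_kap_restrict)

lemma holds_associator_aux:
  "cell S1 S2 (frac_associator C W ch H G F)"
  "agood D \<Longrightarrow> holds (frac_associator C W ch H G F) D"
proof -
  note l = facts derived and K = S_simps
  define Q where "Q = (\<lambda>R. \<exists>E a b \<gamma> \<omega> \<rho>.
       E \<in> Ob C \<and> a \<in> hom C E (src C w1) \<and> b \<in> hom C E (src C y)
       \<and> \<gamma> \<in> inv_cells C ((v1 \<cdot> w1) \<cdot> a) (y \<cdot> b)
       \<and> \<omega> \<in> inv_cells C (f1 \<cdot> (w1 \<cdot> a)) (w2 \<cdot> (f3 \<cdot> b))
       \<and> \<rho> \<in> inv_cells C (g1 \<cdot> a) (g2 \<cdot> (f3 \<cdot> b))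
       \<and> ((u \<cdot> v1) \<cdot> w1) \<cdot> a \<in> W
       \<and> \<iota> v \<star> \<omega>
         = vinv C (\<theta> v w2 (f3 \<cdot> b)) \<odot> pull C f y (v \<cdot> w2) f3 (raw \<eta>) b \<odot> (\<iota> f \<star> \<gamma>)
             \<odot> (\<iota> f \<star> \<theta> v1 w1 a) \<odot> pull C v f1 f v1 (vinv C (raw \<delta>)) (w1 \<cdot> a)
       \<and> \<iota> w \<star> \<rho>
         = pull C g w2 w g2 (raw \<xi>) (f3 \<cdot> b) \<odot> (\<iota> g \<star> \<omega>) \<odot> vinv C (\<theta> g f1 (w1 \<cdot> a))
             \<odot> pull C w g1 (g \<cdot> f1) w1 (vinv C (raw \<sigma>)) a
       \<and> R = frac_class C W S1 S2
           (E, a, b,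
            \<theta> u y b \<odot> (\<iota> u \<star> \<gamma>) \<odot> vinv C (\<theta> u (v1 \<cdot> w1) a) \<odot> (vinv C (\<theta> u v1 w1) \<star> \<iota> a),
            \<theta> (h \<cdot> g2) f3 b \<odot> \<theta> h g2 (f3 \<cdot> b) \<odot> (\<iota> h \<star> \<rho>) \<odot> vinv C (\<theta> h g1 a)))"
  have eq: "frac_associator C W ch H G F = (SOME R. Q R)"
  proof -
    obtain A' uu ff B' vv gg C' ww hh where FGH: "F = (A', uu, ff)" "G = (B', vv, gg)" "H = (C', ww, hh)"
      by (cases F; cases G; cases H) auto
    have n: "v \<cdot> w2 \<in> W" using BF2[of w2 v] l by simp
    note e1 = ch_eq[OF l(3,4) l(13)[symmetric], unfolded FGH den_num]
    have "tgt C (g \<cdot> f1) = tgt C w" "g \<cdot> f1 \<in> Mor C" using l by simp_all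
    note e2 = ch_eq[OF this(2) l(7) this(1), unfolded FGH den_num]
    note e3 = ch_eq[OF l(6,7) l(14)[symmetric], unfolded FGH den_num]
    have "tgt C f = tgt C (v \<cdot> w2)" using l by simp
    note e4 = ch_eq[OF l(3) n this, unfolded FGH den_num]
    show ?thesis unfolding frac_associator_def Q_def FGH prod.case den_num e1 e2 e3 e4 ..
  qed
  have ex: "\<exists>R. Q R"
  proof -
    have W1: "WP [u, v1, w1]" "WP [u, y]"
      using WP_append[of "[u]" "[v1]"] WP_append[of "[u]" "[y]"] WP_append[of "[u, v1]" "[w1]"] l by simp_all
    \<comment> \<open>\<gamma>, \<omega> and \<rho> come from three successive lifts, through
      \<open>u\<close>, \<open>v\<close> and \<open>w\<close>, each on a further
      restriction.\<close>
    obtain z x s where z0: "WP z" "tg z = sr [u, v1, w1]" "iso s" "dom s = [u, v1, w1] @ z" "cod s = [u, y] @ x" "pth x" "tg x = sr [u, y]" "sr x = sr z"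
      by (rule bf3[OF W1(2), of "[u, v1, w1]"]) (use l in auto)
    note z = z0[simplified]
    have pz: "pth z" using z by simp
    obtain k1 \<gamma>0 where k10: "WP k1" "tg k1 = sr (v1 # w1 # z)" "valid \<gamma>0" "dom \<gamma>0 = (v1 # w1 # z) @ k1" "cod \<gamma>0 = (y # x) @ k1" "iso s \<Longrightarrow> iso \<gamma>0"
      by (rule lift[of "[u]" "v1 # w1 # z" "y # x" s]) (use z l in auto)
    have k1: "WP k1" "pth k1" "tg k1 = sr z" "iso \<gamma>0" "dom \<gamma>0 = v1 # w1 # z @ k1" "cod \<gamma>0 = y # x @ k1"
      using k10 z pz by simp_all
    let ?z1 = "z @ k1" and ?x1 = "x @ k1"
    have i1: "iso (et \<lhd> ?x1 \<bullet> [f] \<rhd> \<gamma>0 \<bullet> sinv \<delta> \<lhd> (w1 # ?z1))" by (simp add: l k1 z pz)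
    obtain k2 \<omega>0 where k20: "WP k2" "tg k2 = sr (f1 # w1 # ?z1)" "valid \<omega>0" "dom \<omega>0 = (f1 # w1 # ?z1) @ k2" "cod \<omega>0 = (w2 # f3 # ?x1) @ k2"
      "(et \<lhd> ?x1 \<bullet> [f] \<rhd> \<gamma>0 \<bullet> sinv \<delta> \<lhd> (w1 # ?z1)) \<lhd> k2 = [v] \<rhd> \<omega>0"
      "iso (et \<lhd> ?x1 \<bullet> [f] \<rhd> \<gamma>0 \<bullet> sinv \<delta> \<lhd> (w1 # ?z1)) \<Longrightarrow> iso \<omega>0"
      by (rule lift[of "[v]" "f1 # w1 # ?z1" "w2 # f3 # ?x1" "et \<lhd> ?x1 \<bullet> [f] \<rhd> \<gamma>0 \<bullet> sinv \<delta> \<lhd> (w1 # ?z1)"]) (simp_all add: z k1 l pz)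
    have k2: "WP k2" "pth k2" "tg k2 = sr k1" "iso \<omega>0" "dom \<omega>0 = f1 # w1 # z @ k1 @ k2" "cod \<omega>0 = w2 # f3 # x @ k1 @ k2"
      using k20(1-5) k20(7)[OF i1] k1 by simp_all
    let ?z2 = "z @ k1 @ k2" and ?x2 = "x @ k1 @ k2"
    have i2: "iso (\<xi> \<lhd> (f3 # ?x2) \<bullet> [g] \<rhd> \<omega>0 \<bullet> sinv sg \<lhd> ?z2)" by (simp add: l k1 k2 z pz)
    obtain k3 \<rho>0 where k30: "WP k3" "tg k3 = sr (g1 # ?z2)" "valid \<rho>0" "dom \<rho>0 = (g1 # ?z2) @ k3" "cod \<rho>0 = (g2 # f3 # ?x2) @ k3"
      "(\<xi> \<lhd> (f3 # ?x2) \<bullet> [g] \<rhd> \<omega>0 \<bullet> sinv sg \<lhd> ?z2) \<lhd> k3 = [w] \<rhd> \<rho>0"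
      "iso (\<xi> \<lhd> (f3 # ?x2) \<bullet> [g] \<rhd> \<omega>0 \<bullet> sinv sg \<lhd> ?z2) \<Longrightarrow> iso \<rho>0"
      by (rule lift[of "[w]" "g1 # ?z2" "g2 # f3 # ?x2" "\<xi> \<lhd> (f3 # ?x2) \<bullet> [g] \<rhd> \<omega>0 \<bullet> sinv sg \<lhd> ?z2"]) (simp_all add: z k1 k2 l pz)
    define Z where "Z = z @ k1 @ k2 @ k3"
    define Z' where "Z' = x @ k1 @ k2 @ k3"
    define gp where "gp = \<gamma>0 \<lhd> (k2 @ k3)"
    define op where "op = \<omega>0 \<lhd> k3"
    have k3: "WP k3" "pth k3" "tg k3 = sr k2" using k30(1,2) k2 by simp_all
    have rp: "iso \<rho>0" "dom \<rho>0 = g1 # Z" "cod \<rho>0 = g2 # f3 # Z'" using k30(4,5) k30(7)[OF i2] by (simp_all add: Z_def Z'_def)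
    have gp: "iso gp" "dom gp = v1 # w1 # Z" "cod gp = y # Z'" using k1 k2 k3 z pz by (simp_all add: gp_def Z_def Z'_def)
    have op: "iso op" "dom op = f1 # w1 # Z" "cod op = w2 # f3 # Z'" using k1 k2 k3 z pz by (simp_all add: op_def Z_def Z'_def)
    have E1: "[v] \<rhd> op = et \<lhd> Z' \<bullet> [f] \<rhd> gp \<bullet> sinv \<delta> \<lhd> (w1 # Z)"
      using arg_cong[OF k20(6), of "\<lambda>s. s \<lhd> k3"] by (simp add: op_def gp_def Z_def Z'_def)
    have E2: "[w] \<rhd> \<rho>0 = \<xi> \<lhd> (f3 # Z') \<bullet> [g] \<rhd> op \<bullet> sinv sg \<lhd> Z"
      using k30(6) by (simp add: op_def Z_def Z'_def)
    have pZ: "pth Z" "pth Z'" "tg Z = src C w1" "tg Z' = src C y" "sr Z = sr k3" "sr Z' = sr k3" "WP Z"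
      using z k1 k2 k3 pz by (auto simp: Z_def Z'_def intro!: WP_append)
    let ?a = "ev Z" and ?b = "ev Z'"
    have ab: "?a \<in> Mor C" "?b \<in> Mor C" "tgt C ?a = src C w1" "tgt C ?b = src C y" "src C ?b = src C ?a" "src C ?a = sr k3"
      using pZ by simp_all
    define Ga where "Ga = ([v1 \<cdot> w1, ?a], raw (gp \<bullet> sinv (kap [v1, w1]) \<lhd> Z), [y, ?b])"
    define Om where "Om = ([f1, w1, ?a], raw op, [w2, f3, ?b])"
    define Rh where "Rh = ([g1, ?a], raw \<rho>0, [g2, f3, ?b])"
    have Ga: "Ga = [y] \<rhd> kap Z' \<bullet> (gp \<bullet> sinv (kap [v1, w1]) \<lhd> Z) \<bullet> [v1 \<cdot> w1] \<rhd> sinv (kap Z)"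
      unfolding Ga_def using collapse_right[of "gp \<bullet> sinv (kap [v1, w1]) \<lhd> Z" "[v1 \<cdot> w1]" Z "[y]" Z'] gp pZ l by simp
    have Om: "Om = [w2, f3] \<rhd> kap Z' \<bullet> op \<bullet> [f1, w1] \<rhd> sinv (kap Z)"
      unfolding Om_def using collapse_right[of op "[f1, w1]" Z "[w2, f3]" Z'] op pZ by simp
    have Rh: "Rh = [g2, f3] \<rhd> kap Z' \<bullet> \<rho>0 \<bullet> [g1] \<rhd> sinv (kap Z)"
      unfolding Rh_def using collapse_right[of \<rho>0 "[g1]" Z "[g2, f3]" Z'] rp pZ by simp
    have i: "iso Ga" "iso Om" "iso Rh" unfolding Ga Om Rh by (simp_all add: gp op rp pZ l)
    have dG: "dom Ga = [v1 \<cdot> w1, ?a]" "cod Ga = [y, ?b]" "dom Om = [f1, w1, ?a]" "cod Om = [w2, f3, ?b]" "raw Om = raw op"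
       "dom Rh = [g1, ?a]" "cod Rh = [g2, f3, ?b]" "raw Rh = raw \<rho>0" by (simp_all add: Ga_def Om_def Rh_def)
    have "[v] \<rhd> Om = [v, w2, f3] \<rhd> kap Z' \<bullet> ([v] \<rhd> op) \<bullet> [v, f1, w1] \<rhd> sinv (kap Z)" unfolding Om by simp
    also have "\<dots> = et \<lhd> [?b] \<bullet> [f] \<rhd> (Ga \<bullet> kap [v1, w1] \<lhd> [?a]) \<bullet> sinv \<delta> \<lhd> [w1, ?a]"
      unfolding E1 Ga by (simp add: gp op rp pZ l slides cancels)
    finally have "raw ([v] \<rhd> Om) = raw (et \<lhd> [?b] \<bullet> [f] \<rhd> (Ga \<bullet> kap [v1, w1] \<lhd> [?a]) \<bullet> sinv \<delta> \<lhd> [w1, ?a])" by (rule arg_cong)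
    then have eq1: "\<iota> v \<star> raw Om = vinv C (\<theta> v w2 (f3 \<cdot> ?b)) \<odot> pull C f y (v \<cdot> w2) f3 (raw \<eta>) ?b \<odot> (\<iota> f \<star> raw Ga)
             \<odot> (\<iota> f \<star> \<theta> v1 w1 ?a) \<odot> pull C v f1 f v1 (vinv C (raw \<delta>)) (w1 \<cdot> ?a)"
      using raw_eq1[of Ga ?a ?b] i dG(1-4) ab l by (simp only: raw_lw1 iso_valid tg_simps)
    have "[w] \<rhd> Rh = [w, g2, f3] \<rhd> kap Z' \<bullet> ([w] \<rhd> \<rho>0) \<bullet> [w, g1] \<rhd> sinv (kap Z)" unfolding Rh by simp
    also have "\<dots> = \<xi> \<lhd> [f3, ?b] \<bullet> [g] \<rhd> Om \<bullet> sinv sg \<lhd> [?a]"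
      unfolding E2 Om by (simp add: gp op rp pZ l slides cancels)
    finally have "raw ([w] \<rhd> Rh) = raw (\<xi> \<lhd> [f3, ?b] \<bullet> [g] \<rhd> Om \<bullet> sinv sg \<lhd> [?a])" by (rule arg_cong)
    then have eq2: "\<iota> w \<star> raw Rh = pull C g w2 w g2 (raw \<xi>) (f3 \<cdot> ?b) \<odot> (\<iota> g \<star> raw Om) \<odot> vinv C (\<theta> g f1 (w1 \<cdot> ?a))
             \<odot> pull C w g1 (g \<cdot> f1) w1 (vinv C (raw \<sigma>)) ?a"
      using raw_eq2[of Om ?a ?b] i dG ab l by (simp only: raw_lw1 iso_valid tg_simps)
    have m: "raw Ga \<in> inv_cells C ((v1 \<cdot> w1) \<cdot> ?a) (y \<cdot> ?b)" "raw Om \<in> inv_cells C (f1 \<cdot> (w1 \<cdot> ?a)) (w2 \<cdot> (f3 \<cdot> ?b))"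
      "raw Rh \<in> inv_cells C (g1 \<cdot> ?a) (g2 \<cdot> (f3 \<cdot> ?b))"
      using iso_inv_cell[OF i(1)] iso_inv_cell[OF i(2)] iso_inv_cell[OF i(3)] dG by simp_all
    have "WP [?a]" using pZ(7) by (simp add: WP_def)
    then have "WP [u, v1, w1, ?a]" using WP_append[OF W1(1), of "[?a]"] ab by simp
    then have "WP [(u \<cdot> v1) \<cdot> w1, ?a]" using WP_iso[of "J1 \<lhd> [?a]"] l ab by simp
    then have w: "((u \<cdot> v1) \<cdot> w1) \<cdot> ?a \<in> W" by (simp add: WP_def)
    have "?a \<in> hom C (sr k3) (src C w1)" "?b \<in> hom C (sr k3) (src C y)" "sr k3 \<in> Ob C"
      using ab k3 by (auto simp: hom_def)
    then show ?thesis unfolding Q_def using m eq1 eq2 w by blast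
  qed
  have Q: "\<exists>d0 \<in> frac_data C W S1 S2. agood (sd S1 S2 d0) \<and> R = frac_class C W S1 S2 d0" if "Q R" for R
  proof -
    from that[unfolded Q_def] show ?thesis
    proof (elim exE conjE, goal_cases)
      case q: (1 E a b \<gamma> \<omega> \<rho>)
      let ?d = "(E, a, b, \<theta> u y b \<odot> (\<iota> u \<star> \<gamma>) \<odot> vinv C (\<theta> u (v1 \<cdot> w1) a) \<odot> (vinv C (\<theta> u v1 w1) \<star> \<iota> a),
        \<theta> (h \<cdot> g2) f3 b \<odot> \<theta> h g2 (f3 \<cdot> b) \<odot> (\<iota> h \<star> \<rho>) \<odot> vinv C (\<theta> h g1 a))"
      have t: "a \<in> Mor C" "b \<in> Mor C" "src C a = E" "src C b = E" "tgt C a = src C w1" "tgt C b = src C y"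
        using q by (auto simp: hom_def)
      have t': "src C b = src C a" using t by simp
      let ?G = "([v1 \<cdot> w1, a], \<gamma>, [y, b])" and ?O = "([f1, w1, a], \<omega>, [w2, f3, b])" and ?R = "([g1, a], \<rho>, [g2, f3, b])"
      have i: "iso ?G" "iso ?O" "iso ?R" by (rule inv_cell_iso; use q(4-6) t l in simp)+
      note vG = iso_valid[OF i(1)] and vO = iso_valid[OF i(2)] and vR = iso_valid[OF i(3)]
      let ?G' = "?G \<bullet> kap [v1, w1] \<lhd> [a]"
      have iG: "iso ?G'" "dom ?G' = [v1, w1, a]" "cod ?G' = [y, b]" by (simp_all add: i t l)
      have e1: "[v] \<rhd> ?O = et \<lhd> [b] \<bullet> [f] \<rhd> ?G' \<bullet> sinv \<delta> \<lhd> [w1, a]"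
      proof (rule scell_eqI)
        show "raw ([v] \<rhd> ?O) = raw (et \<lhd> [b] \<bullet> [f] \<rhd> ?G' \<bullet> sinv \<delta> \<lhd> [w1, a])"
          unfolding raw_eq1[OF vG scell_simps(1,3) t(1,2,5,6) t'] by (simp add: q(8) vO t l raw_lw1)
      qed (simp_all add: i t l)
      have e2: "[w] \<rhd> ?R = \<xi> \<lhd> [f3, b] \<bullet> [g] \<rhd> ?O \<bullet> sinv sg \<lhd> [a]"
      proof (rule scell_eqI)
        show "raw ([w] \<rhd> ?R) = raw (\<xi> \<lhd> [f3, b] \<bullet> [g] \<rhd> ?O \<bullet> sinv sg \<lhd> [a])"
          unfolding raw_eq2[OF vO scell_simps(1,3) t(1,2,5,6) t'] by (simp add: q(9) vR t l raw_lw1)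
      qed (simp_all add: i t l)
      have A: "([(u \<cdot> v1) \<cdot> w1, a], \<theta> u y b \<odot> (\<iota> u \<star> \<gamma>) \<odot> vinv C (\<theta> u (v1 \<cdot> w1) a) \<odot> (vinv C (\<theta> u v1 w1) \<star> \<iota> a), [u \<cdot> y, b])
         = J2 \<lhd> [b] \<bullet> [u] \<rhd> ?G' \<bullet> sinv J1 \<lhd> [a]"
      proof (rule scell_eqI)
        show "raw ([(u \<cdot> v1) \<cdot> w1, a], \<theta> u y b \<odot> (\<iota> u \<star> \<gamma>) \<odot> vinv C (\<theta> u (v1 \<cdot> w1) a) \<odot> (vinv C (\<theta> u v1 w1) \<star> \<iota> a), [u \<cdot> y, b])
          = raw (J2 \<lhd> [b] \<bullet> [u] \<rhd> ?G' \<bullet> sinv J1 \<lhd> [a])"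
          unfolding raw_alpha[OF vG scell_simps(1,3) t(1,2,5,6) t'] by simp
      qed (simp_all add: i t l)
      have B: "([h \<cdot> g1, a], \<theta> (h \<cdot> g2) f3 b \<odot> \<theta> h g2 (f3 \<cdot> b) \<odot> (\<iota> h \<star> \<rho>) \<odot> vinv C (\<theta> h g1 a), [(h \<cdot> g2) \<cdot> f3, b])
         = K2 \<lhd> [b] \<bullet> [h] \<rhd> ?R \<bullet> sinv K1 \<lhd> [a]"
      proof (rule scell_eqI)
        show "raw ([h \<cdot> g1, a], \<theta> (h \<cdot> g2) f3 b \<odot> \<theta> h g2 (f3 \<cdot> b) \<odot> (\<iota> h \<star> \<rho>) \<odot> vinv C (\<theta> h g1 a), [(h \<cdot> g2) \<cdot> f3, b])
          = raw (K2 \<lhd> [b] \<bullet> [h] \<rhd> ?R \<bullet> sinv K1 \<lhd> [a])"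
          unfolding raw_beta[OF vR scell_simps(1,3) t(1,2,5,6) t'] by simp
      qed (simp_all add: i t l)
      have "agood (sd S1 S2 ?d)"
        unfolding sd_def prod.case K A B
        by (rule agoodI[OF iG i(2) _ _ i(3) _ _ _ _ e1 e2 refl refl]) simp_all
      moreover have "?d \<in> frac_data C W S1 S2"
        unfolding frac_data_iff[OF par_S] wdat_def
        using goodD(1)[OF agood_good calculation] q(7) t l by (simp add: sd_def K WP_def)
      ultimately show ?case using q(10) by blast
    qed
  qed
  show "cell S1 S2 (frac_associator C W ch H G F)" unfolding eq by (rule some_good(1)[OF par_S agood_good ex Q])
  show "holds (frac_associator C W ch H G F) D" if "agood D" unfolding eq by (rule some_good(2)[OF par_S agood_good ex Q that])
qed

end

section \<open>Coherence of left unitors on paths\<close>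

context bicategory
begin

text \<open>Naturality of the left unitor recovers a 2-cell from its whiskering by an
  identity.\<close>

lemma lu_faithful:
  assumes "valid s" "valid t" "dom t = dom s" "cod t = cod s" "[\<one> (tg (dom s))] \<rhd> s = [\<one> (tg (dom s))] \<rhd> t"
  shows "s = t"
proof -
  note d = valid_D[OF assms(1)]
  have e: "r = (lu (cod r) \<bullet> [\<one> (tg (dom r))] \<rhd> r) \<bullet> sinv (lu (dom r))" if "valid r" for r
    unfolding lu_natural[OF that] using that valid_D[OF that] by simp
  show ?thesis using e[OF assms(1)] e[OF assms(2)] assms(3-5) by metis
qed

text \<open>The classical argument for the left unitor of a composite: by \<open>lu_faithful\<close>
  it suffices to whisker by an identity, where the triangle turns both sides into the right unitor
  of that identity, restricted along \<open>p @ z\<close>.\<close>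

lemma lu_rw:
  assumes "pth p" "pth z" "sr p = tg z"
  shows "lu p \<lhd> z = lu (p @ z)"
proof (rule lu_faithful)
  have e: "tg (dom (lu p \<lhd> z)) = tg p" "dom (lu p \<lhd> z) = \<one> (tg p) # p @ z" using assms by simp_all
  have "[\<one> (tg p)] \<rhd> lu p \<lhd> z = ([\<one> (tg p)] \<rhd> lu p) \<lhd> z" by simp
  also have "\<dots> = ru (\<one> (tg p)) \<lhd> (p @ z)" using triangle_scell[of p "\<one> (tg p)"] assms by (simp flip: rw_rw)
  also have "\<dots> = [\<one> (tg p)] \<rhd> lu (p @ z)" using triangle_scell[of "p @ z" "\<one> (tg p)"] assms by simp
  finally show "[\<one> (tg (dom (lu p \<lhd> z)))] \<rhd> lu p \<lhd> z = [\<one> (tg (dom (lu p \<lhd> z)))] \<rhd> lu (p @ z)" unfolding e using assms by simp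
qed (use assms in simp_all)

lemma lu_conj:
  assumes "valid s" "X = tg (dom s)"
  shows "[\<one> X] \<rhd> s = sinv (lu (cod s)) \<bullet> s \<bullet> lu (dom s)"
proof -
  note d = valid_D[OF assms(1)]
  have "[\<one> X] \<rhd> s = sinv (lu (cod s)) \<bullet> (lu (cod s) \<bullet> [\<one> X] \<rhd> s)" using assms d by simp
  also have "\<dots> = sinv (lu (cod s)) \<bullet> s \<bullet> lu (dom s)" unfolding assms(2) lu_natural[OF assms(1)] ..
  finally show ?thesis .
qed

end

context composable_triple
begin

lemma holds_associator:
  assumes "iso \<gamma>" "dom \<gamma> = v1 # w1 # x1" "cod \<gamma> = y # x2"
    "iso \<omega>" "dom \<omega> = f1 # w1 # x1" "cod \<omega> = w2 # f3 # x2"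
    "iso \<rho>" "dom \<rho> = g1 # x1" "cod \<rho> = g2 # f3 # x2" "x1 \<noteq> []" "x2 \<noteq> []"
    "[v] \<rhd> \<omega> = et \<lhd> x2 \<bullet> [f] \<rhd> \<gamma> \<bullet> sinv \<delta> \<lhd> (w1 # x1)"
    "[w] \<rhd> \<rho> = \<xi> \<lhd> (f3 # x2) \<bullet> [g] \<rhd> \<omega> \<bullet> sinv sg \<lhd> x1"
  shows "holds (frac_associator C W ch H G F) (x1, x2,
     J2 \<lhd> x2 \<bullet> [u] \<rhd> \<gamma> \<bullet> sinv J1 \<lhd> x1, K2 \<lhd> x2 \<bullet> [h] \<rhd> \<rho> \<bullet> sinv K1 \<lhd> x1)"
  by (rule holds_associator_aux(2)[OF agoodI[OF assms refl refl]])

end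

section \<open>Inverses and horizontal composition in the bicategory of fractions\<close>

context fraction_choices
begin

abbreviation Fr where "Fr \<equiv> fractions C W ch"

abbreviation vcF where "vcF \<equiv> frac_vcomp C W"
abbreviation idF where "idF \<equiv> frac_idc C W"
abbreviation ascF where "ascF \<equiv> frac_associator C W ch"
abbreviation whlF where "whlF G \<Gamma> \<equiv> frac_hcomp C W ch (idF G) \<Gamma>"
abbreviation whrF where "whrF \<Gamma> F \<equiv> frac_hcomp C W ch \<Gamma> (idF F)"

lemma Fr_simps [simp]:
  "Ob Fr = Ob C" "Mor Fr = frac_Mor C W" "Cell Fr = frac_Cell C W" "src Fr = frac_src C" "tgt Fr = frac_tgt C"
  "dm Fr = fst" "cd Fr = fst \<circ> snd" "cmp Fr = frac_cmp C ch" "idc Fr = frac_idc C W" "vcomp Fr = frac_vcomp C W"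
  "hcomp Fr = frac_hcomp C W ch" "associator Fr = frac_associator C W ch"
  by (simp_all add: fractions_def)

lemma cells_Fr: "\<Gamma> \<in> cells Fr F1 F2 \<longleftrightarrow> cell F1 F2 \<Gamma>"
  by (simp add: cells_def cell_def)

definition inverse :: "('o, 'm) fmor \<Rightarrow> ('o, 'm) fmor \<Rightarrow> ('o, 'm, 'c) fcell \<Rightarrow> ('o, 'm, 'c) fcell \<Rightarrow> bool" where
  "inverse F1 F2 \<Gamma> \<Delta> \<longleftrightarrow> cell F1 F2 \<Gamma> \<and> cell F2 F1 \<Delta>
     \<and> vcF \<Delta> \<Gamma> = idF F1 \<and> vcF \<Gamma> \<Delta> = idF F2"

lemma inverse_cells_Fr: "cell F1 F2 \<Gamma> \<Longrightarrow> inverse_cells Fr \<Gamma> \<Delta> \<longleftrightarrow> inverse F1 F2 \<Gamma> \<Delta>"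
  by (auto simp: inverse_cells_def inverse_def cells_Fr) (auto simp: cell_def)

lemma inv_cells_Fr: "\<Gamma> \<in> inv_cells Fr F1 F2 \<longleftrightarrow> (\<exists>\<Delta>. inverse F1 F2 \<Gamma> \<Delta>)"
proof -
  have "\<Gamma> \<in> inv_cells Fr F1 F2 \<longleftrightarrow> cell F1 F2 \<Gamma> \<and> (\<exists>\<Delta>. inverse_cells Fr \<Gamma> \<Delta>)"
    by (simp add: inv_cells_def cells_Fr)
  also have "\<dots> \<longleftrightarrow> (\<exists>\<Delta>. inverse F1 F2 \<Gamma> \<Delta>)"
    using inverse_cells_Fr inverse_def by blast
  finally show ?thesis .
qed

lemma cell_frac_Mor: assumes "cell F1 F2 \<Gamma>" shows "F1 \<in> frac_Mor C W" "F2 \<in> frac_Mor C W"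
  using cell_par[OF assms] by (auto simp: par_def)

lemma germ_exact2:
  assumes "s \<approx> s'" "t \<approx> t'" "sr (dom t) = sr (dom s)"
  obtains y where "WP y" "tg y = sr (dom s)" "s \<lhd> y = s' \<lhd> y" "t \<lhd> y = t' \<lhd> y"
proof -
  obtain z where z: "WP z" "tg z = sr (dom s)" "s \<lhd> z = s' \<lhd> z" using germ_E[OF assms(1)] .
  obtain y where y: "WP y" "tg y = sr z" "t \<lhd> (z @ y) = t' \<lhd> (z @ y)"
    by (rule germ_restrict_along[OF assms(2), of z]) (use z assms in simp_all)
  show ?thesis
  proof (rule that[of "z @ y"])
    show "WP (z @ y)" by (rule WP_append[OF z(1) y(1)]) (simp add: y)
    show "tg (z @ y) = sr (dom s)" using z by simp
    show "s \<lhd> (z @ y) = s' \<lhd> (z @ y)" using z(3) by (simp flip: rw_rw)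
    show "t \<lhd> (z @ y) = t' \<lhd> (z @ y)" using y by simp
  qed
qed

text \<open>The inverse has a value over the inverse denominators. Its composites with \<beta> are
  values of identity 2-morphisms, so they are identities as germs, and a single restriction makes
  both equations exact.\<close>

lemma holds_inverse_ex:
  assumes I: "inverse F1 F2 \<Gamma> \<Delta>" and h: "holds \<Gamma> (x1, x2, \<alpha>, \<beta>)"
  obtains z where "WP z" "tg z = sr x1" "iso (\<beta> \<lhd> z)" "holds \<Delta> (x2 @ z, x1 @ z, sinv \<alpha> \<lhd> z, sinv (\<beta> \<lhd> z))"
proof -
  have c: "cell F1 F2 \<Gamma>" "cell F2 F1 \<Delta>" and v: "vcF \<Delta> \<Gamma> = idF F1" "vcF \<Gamma> \<Delta> = idF F2"
    using I by (auto simp: inverse_def)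
  note d = dat_D[OF holds_dat[OF c(1) h]]
  obtain z \<beta>' where z: "WP z" "tg z = sr x2" "holds \<Delta> (x2 @ z, x1 @ z, sinv \<alpha> \<lhd> z, \<beta>')"
    by (rule holds_ex[OF c(2), of "sinv \<alpha>" x2 x1]) (use d in simp_all)
  note e = dat_D[OF holds_dat[OF c(2) z(3)]]
  have pz: "pth z" using z by simp
  have h': "holds \<Gamma> (x1 @ z, x2 @ z, \<alpha> \<lhd> z, \<beta> \<lhd> z)" by (rule holds_res[OF c(1) h]) (use z d in simp_all)
  have m: "F1 \<in> frac_Mor C W" "F2 \<in> frac_Mor C W" using cell_frac_Mor[OF c(1)] by simp_all
  have "holds (idF F1) (x1 @ z, x1 @ z, sinv \<alpha> \<lhd> z \<bullet> \<alpha> \<lhd> z, \<beta>' \<bullet> \<beta> \<lhd> z)"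
    using holds_vcomp(2)[OF c h' z(3)] v by simp
  then have h1: "holds (idF F1) (x1 @ z, x1 @ z, sid (den F1 # x1 @ z), \<beta>' \<bullet> \<beta> \<lhd> z)"
    using z(1,2) d by (simp add: cancels)
  have h1': "holds (idF F1) (x1 @ z, x1 @ z, sid (den F1 # x1 @ z), sid (num F1 # x1 @ z))"
    using holds_idc(2)[OF m(1), of "sid (x1 @ z)"] z(1,2) d by (simp add: lw_sid)
  have b1: "\<beta>' \<bullet> \<beta> \<lhd> z \<approx> sid (num F1 # x1 @ z)"
    by (rule holds_unique[OF holds_idc(1)[OF m(1)] h1' h1]) (use z(1,2) d in simp)
  have "holds (idF F2) (x2 @ z, x2 @ z, \<alpha> \<lhd> z \<bullet> sinv \<alpha> \<lhd> z, \<beta> \<lhd> z \<bullet> \<beta>')"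
    using holds_vcomp(2)[OF c(2,1) z(3) h'] v by simp
  then have h2: "holds (idF F2) (x2 @ z, x2 @ z, sid (den F2 # x2 @ z), \<beta> \<lhd> z \<bullet> \<beta>')"
    using z(1,2) d by (simp add: cancels)
  have h2': "holds (idF F2) (x2 @ z, x2 @ z, sid (den F2 # x2 @ z), sid (num F2 # x2 @ z))"
    using holds_idc(2)[OF m(2), of "sid (x2 @ z)"] z(1,2) d by (simp add: lw_sid)
  have b2: "\<beta> \<lhd> z \<bullet> \<beta>' \<approx> sid (num F2 # x2 @ z)"
    by (rule holds_unique[OF holds_idc(1)[OF m(2)] h2' h2]) (use z(1,2) d in simp)
  obtain y where y: "WP y" "tg y = sr (dom (\<beta>' \<bullet> \<beta> \<lhd> z))" "(\<beta>' \<bullet> \<beta> \<lhd> z) \<lhd> y = sid (num F1 # x1 @ z) \<lhd> y"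
     "(\<beta> \<lhd> z \<bullet> \<beta>') \<lhd> y = sid (num F2 # x2 @ z) \<lhd> y"
    by (rule germ_exact2[OF b1 b2]) (use z(1,2) d e in simp_all)
  have ty: "tg y = sr z" "pth y" using y(1,2) z(1,2) d e by simp_all
  have "iso (\<beta> \<lhd> (z @ y)) \<and> sinv (\<beta> \<lhd> (z @ y)) = \<beta>' \<lhd> y"
    using isoI[of "\<beta> \<lhd> (z @ y)" "\<beta>' \<lhd> y"] y(3,4) ty pz z(2) d(1-20) e(5-7) by (simp add: rw_sid)
  then have i: "iso (\<beta> \<lhd> (z @ y))" "sinv (\<beta> \<lhd> (z @ y)) = \<beta>' \<lhd> y" by simp_all
  have "holds \<Delta> ((x2 @ z) @ y, (x1 @ z) @ y, sinv \<alpha> \<lhd> z \<lhd> y, \<beta>' \<lhd> y)"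
    by (rule holds_res[OF c(2) z(3)]) (use ty pz in simp_all)
  then have "holds \<Delta> (x2 @ z @ y, x1 @ z @ y, sinv \<alpha> \<lhd> (z @ y), sinv (\<beta> \<lhd> (z @ y)))" using i by simp
  moreover have "WP (z @ y)" by (rule WP_append[OF z(1) y(1)]) (simp add: ty)
  ultimately show ?thesis using that[of "z @ y"] i z d pz by simp
qed

lemma holds_inverse:
  assumes I: "inverse F1 F2 \<Gamma> \<Delta>" and h: "holds \<Gamma> (x1, x2, \<alpha>, \<beta>)" and b: "iso \<beta>"
  shows "holds \<Delta> (x2, x1, sinv \<alpha>, sinv \<beta>)"
proof -
  have c: "cell F1 F2 \<Gamma>" "cell F2 F1 \<Delta>" using I by (auto simp: inverse_def)
  note d = dat_D[OF holds_dat[OF c(1) h]]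
  obtain z where z: "WP z" "tg z = sr x1" "holds \<Delta> (x2 @ z, x1 @ z, sinv \<alpha> \<lhd> z, sinv (\<beta> \<lhd> z))"
    using holds_inverse_ex[OF I h] by blast
  have "holds \<Delta> (x2 @ z, x1 @ z, sinv \<alpha> \<lhd> z, sinv \<beta> \<lhd> z)" using z b d by simp
  then show ?thesis
    by (rule holds_descend[OF c(2) _ z(1)]) (use z(2) d b in \<open>simp_all add: dat_def ty_def\<close>)
qed

text \<open>\<open>vinv\<close> is a definite description, so inverses must be shown unique: two of
  them share a value over a member of \<open>W\<close>.\<close>

lemma inverse_unique:
  assumes I: "inverse F1 F2 \<Gamma> \<Delta>" "inverse F1 F2 \<Gamma> \<Delta>'" shows "\<Delta> = \<Delta>'"
proof -
  have c: "cell F1 F2 \<Gamma>" "cell F2 F1 \<Delta>" "cell F2 F1 \<Delta>'" using I by (auto simp: inverse_def)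
  obtain d0 where d0: "d0 \<in> snd (snd \<Gamma>)" using cell_data(1)[OF c(1)] by blast
  obtain x1 x2 \<alpha> \<beta> where D0: "sd F1 F2 d0 = (x1, x2, \<alpha>, \<beta>)" by (cases "sd F1 F2 d0")
  have h: "holds \<Gamma> (x1, x2, \<alpha>, \<beta>)" using holds_sd[OF c(1) d0] by (simp add: D0)
  have W0: "WP (den F1 # x1)" using wdat_sd[OF cell_par[OF c(1)] cell_data(2)[OF c(1) d0]] by (simp add: D0 wdat_def)
  note d = dat_D[OF holds_dat[OF c(1) h]]
  obtain z where z: "WP z" "tg z = sr x1" "iso (\<beta> \<lhd> z)" "holds \<Delta> (x2 @ z, x1 @ z, sinv \<alpha> \<lhd> z, sinv (\<beta> \<lhd> z))"
    using holds_inverse_ex[OF I(1) h] .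
  have pz: "pth z" using z by simp
  have hz: "holds \<Gamma> (x1 @ z, x2 @ z, \<alpha> \<lhd> z, \<beta> \<lhd> z)" by (rule holds_res[OF c(1) h]) (use z in simp_all)
  have "holds \<Delta>' (x2 @ z, x1 @ z, sinv (\<alpha> \<lhd> z), sinv (\<beta> \<lhd> z))" by (rule holds_inverse[OF I(2) hz z(3)])
  moreover have "sinv (\<alpha> \<lhd> z) = sinv \<alpha> \<lhd> z" using d z by simp
  moreover have "WP (den F2 # x2)" using WP_iso[OF d(1)] W0 d by simp
  then have "WP (den F2 # x2 @ z)" using WP_append[of "den F2 # x2" z] z d by simp
  ultimately show ?thesis using holds_eq[OF c(2,3) z(4)] by simp
qed

lemma vinv_Fr:
  assumes "\<Gamma> \<in> inv_cells Fr F1 F2"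
  shows "inverse F1 F2 \<Gamma> (vinv Fr \<Gamma>)"
proof -
  obtain \<Delta> where I: "inverse F1 F2 \<Gamma> \<Delta>" using assms inv_cells_Fr by blast
  then have c: "cell F1 F2 \<Gamma>" by (simp add: inverse_def)
  have "vinv Fr \<Gamma> = \<Delta>" unfolding vinv_def inverse_cells_Fr[OF c] using I inverse_unique by blast
  then show ?thesis using I by simp
qed

text \<open>The inverse of the value spans a candidate class, and both composites are recognised as
  identities by one value each.\<close>

lemma inverseI:
  assumes c: "cell F1 F2 \<Gamma>" and h: "holds \<Gamma> (x1, x2, \<alpha>, \<beta>)" and b: "iso \<beta>" and W0: "WP (den F1 # x1)"
  shows "\<Gamma> \<in> inv_cells Fr F1 F2"
proof -
  note d = dat_D[OF holds_dat[OF c h]]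
  have P: "par F2 F1" using cell_par[OF c] by (simp add: par_def)
  have W1: "WP (den F2 # x2)" using WP_iso[OF d(1)] W0 d by simp
  have D: "dat F2 F1 (x2, x1, sinv \<alpha>, sinv \<beta>)" using d b by (simp add: dat_def ty_def)
  define \<Delta> where "\<Delta> = cls F2 F1 (x2, x1, sinv \<alpha>, sinv \<beta>)"
  have c': "cell F2 F1 \<Delta>" and h': "holds \<Delta> (x2, x1, sinv \<alpha>, sinv \<beta>)" using cls[OF P D W1] by (simp_all add: \<Delta>_def)
  have m: "F1 \<in> frac_Mor C W" "F2 \<in> frac_Mor C W" using cell_frac_Mor[OF c] by simp_all
  have "vcF \<Delta> \<Gamma> = idF F1"
  proof (rule holds_eq[OF cell_vcomp[OF c c'] holds_idc(1)[OF m(1)] _ _ W0])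
    show "holds (vcF \<Delta> \<Gamma>) (x1, x1, sid (den F1 # x1), sid (num F1 # x1))"
      using holds_vcomp(2)[OF c c' h h'] d b by simp
    show "holds (idF F1) (x1, x1, sid (den F1 # x1), sid (num F1 # x1))"
      using holds_idc(2)[OF m(1), of "sid x1"] d by (simp add: lw_sid)
  qed
  moreover have "vcF \<Gamma> \<Delta> = idF F2"
  proof (rule holds_eq[OF cell_vcomp[OF c' c] holds_idc(1)[OF m(2)] _ _ W1])
    show "holds (vcF \<Gamma> \<Delta>) (x2, x2, sid (den F2 # x2), sid (num F2 # x2))"
      using holds_vcomp(2)[OF c' c h' h] d b by simp
    show "holds (idF F2) (x2, x2, sid (den F2 # x2), sid (num F2 # x2))"
      using holds_idc(2)[OF m(2), of "sid x2"] d by (simp add: lw_sid)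
  qed
  ultimately show ?thesis using c c' unfolding inv_cells_Fr inverse_def by blast
qed

lemma inv_cells_cell: "\<Gamma> \<in> inv_cells Fr F1 F2 \<Longrightarrow> cell F1 F2 \<Gamma>"
  by (auto simp: inv_cells_Fr inverse_def)

lemma cell_triple: "cell F1 F2 \<Gamma> \<Longrightarrow> \<Gamma> = (F1, F2, snd (snd \<Gamma>))"
  by (auto simp: cell_def)

text \<open>Horizontal composition is defined through both whiskerings. Here the right one acts on
  an identity 2-morphism and has an identity value, so only the left one remains visible.\<close>

lemma holds_hcomp_left:
  assumes c: "cell F1 F2 \<Gamma>" and k: "composable G F1"
  shows cell_hcomp_left: "cell (cmpf G F1) (cmpf G F2) (whlF G \<Gamma>)"
    and "valid \<phi> \<Longrightarrow> dom \<phi> = pf (num F1) (den G) # x1 \<Longrightarrow> cod \<phi> = pf (num F2) (den G) # x2 \<Longrightarrow> x1 \<noteq> [] \<Longrightarrow> x2 \<noteq> []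
      \<Longrightarrow> holds \<Gamma> (pv (num F1) (den G) # x1, pv (num F2) (den G) # x2, \<alpha>',
           sinv (pr (num F2) (den G)) \<lhd> x2 \<bullet> [den G] \<rhd> \<phi> \<bullet> pr (num F1) (den G) \<lhd> x1)
      \<Longrightarrow> holds (whlF G \<Gamma>) (x1, x2,
           kap [den F2, pv (num F2) (den G)] \<lhd> x2 \<bullet> \<alpha>' \<bullet> sinv (kap [den F1, pv (num F1) (den G)]) \<lhd> x1,
           kap [num G, pf (num F2) (den G)] \<lhd> x2 \<bullet> [num G] \<rhd> \<phi> \<bullet> sinv (kap [num G, pf (num F1) (den G)]) \<lhd> x1)"
proof -
  have k2: "composable G F2" using k cell_par[OF c] by (simp add: composable_def par_def)
  have G: "G \<in> frac_Mor C W" using k by (simp add: composable_def)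
  have cG: "cell G G (idF G)" using holds_idc(1)[OF G] .
  note l = composable_D[OF k2] choice[OF composable_D(3,4)[OF k2] composable_D(9)[OF k2, symmetric]]
  have e: "whlF G \<Gamma> = vcF (frac_rwhisk C W ch (idF G) F2) (frac_lwhisk C W ch G \<Gamma>)"
    using cell_triple[OF c] cell_triple[OF cG] unfolding frac_hcomp_def by (metis (no_types, lifting) case_prod_conv)
  note C1 = cell_lwhisk[OF c k] and C2 = cell_rwhisk[OF cG k2]
  show "cell (cmpf G F1) (cmpf G F2) (whlF G \<Gamma>)"
    unfolding e by (rule cell_vcomp[OF C1 C2])
  assume a: "valid \<phi>" "dom \<phi> = pf (num F1) (den G) # x1" "cod \<phi> = pf (num F2) (den G) # x2" "x1 \<noteq> []" "x2 \<noteq> []"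
      "holds \<Gamma> (pv (num F1) (den G) # x1, pv (num F2) (den G) # x2, \<alpha>',
           sinv (pr (num F2) (den G)) \<lhd> x2 \<bullet> [den G] \<rhd> \<phi> \<bullet> pr (num F1) (den G) \<lhd> x1)"
  note H1 = holds_lwhisk(2)[OF c k a]
  note d = dat_D[OF holds_dat[OF C1 H1]] dat_D[OF holds_dat[OF c a(6)]]
  have x2: "pth x2" "src C (pf (num F2) (den G)) = tg x2" using valid_D[OF a(1)] a by auto
  have hid: "holds (idF G) (pf (num F2) (den G) # x2, pf (num F2) (den G) # x2,
      pr (num F2) (den G) \<lhd> x2 \<bullet> [num F2] \<rhd> sid (pv (num F2) (den G) # x2) \<bullet> sinv (pr (num F2) (den G)) \<lhd> x2, sid (num G # pf (num F2) (den G) # x2))"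
    using holds_idc(2)[OF G, of "sid (pf (num F2) (den G) # x2)"] l x2 by (simp add: lw_sid rw_sid cancels)
  have "holds (frac_rwhisk C W ch (idF G) F2) (x2, x2,
      kap [den F2, pv (num F2) (den G)] \<lhd> x2 \<bullet> [den F2] \<rhd> sid (pv (num F2) (den G) # x2) \<bullet> sinv (kap [den F2, pv (num F2) (den G)]) \<lhd> x2,
      kap [num G, pf (num F2) (den G)] \<lhd> x2 \<bullet> sid (num G # pf (num F2) (den G) # x2) \<bullet> sinv (kap [num G, pf (num F2) (den G)]) \<lhd> x2)"
    by (rule holds_rwhisk(2)[OF cG k2 _ _ _ _ _ hid]) (use l x2 in simp_all)
  then have H2: "holds (frac_rwhisk C W ch (idF G) F2) (x2, x2, sid (den (cmpf G F2) # x2), sid (num (cmpf G F2) # x2))"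
    using l x2 cmpf(2,3)[OF k2] by (simp add: lw_sid cancels)
  show "holds (whlF G \<Gamma>) (x1, x2,
           kap [den F2, pv (num F2) (den G)] \<lhd> x2 \<bullet> \<alpha>' \<bullet> sinv (kap [den F1, pv (num F1) (den G)]) \<lhd> x1,
           kap [num G, pf (num F2) (den G)] \<lhd> x2 \<bullet> [num G] \<rhd> \<phi> \<bullet> sinv (kap [num G, pf (num F1) (den G)]) \<lhd> x1)"
    unfolding e using holds_vcomp(2)[OF C1 C2 H1 H2] d(1-7) by (simp del: valid_vc valid_lw valid_rw)
qed

lemma holds_hcomp_right:
  assumes c: "cell G1 G2 \<Gamma>" and k: "composable G1 F"
  shows cell_hcomp_right: "cell (cmpf G1 F) (cmpf G2 F) (whrF \<Gamma> F)"
    and "iso \<epsilon> \<Longrightarrow> dom \<epsilon> = pv (num F) (den G1) # x1 \<Longrightarrow> cod \<epsilon> = pv (num F) (den G2) # x2 \<Longrightarrow> x1 \<noteq> [] \<Longrightarrow> x2 \<noteq> []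
      \<Longrightarrow> holds \<Gamma> (pf (num F) (den G1) # x1, pf (num F) (den G2) # x2,
           pr (num F) (den G2) \<lhd> x2 \<bullet> [num F] \<rhd> \<epsilon> \<bullet> sinv (pr (num F) (den G1)) \<lhd> x1, \<beta>)
      \<Longrightarrow> holds (whrF \<Gamma> F) (x1, x2,
           kap [den F, pv (num F) (den G2)] \<lhd> x2 \<bullet> [den F] \<rhd> \<epsilon> \<bullet> sinv (kap [den F, pv (num F) (den G1)]) \<lhd> x1,
           kap [num G2, pf (num F) (den G2)] \<lhd> x2 \<bullet> \<beta> \<bullet> sinv (kap [num G1, pf (num F) (den G1)]) \<lhd> x1)"
proof -
  have F: "F \<in> frac_Mor C W" using k by (simp add: composable_def)
  have cF: "cell F F (idF F)" using holds_idc(1)[OF F] .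
  note l = composable_D[OF k] choice[OF composable_D(3,4)[OF k] composable_D(9)[OF k, symmetric]]
  have e: "whrF \<Gamma> F = vcF (frac_rwhisk C W ch \<Gamma> F) (frac_lwhisk C W ch G1 (idF F))"
    using cell_triple[OF c] cell_triple[OF cF] unfolding frac_hcomp_def by (metis (no_types, lifting) case_prod_conv)
  note C1 = cell_lwhisk[OF cF k] and C2 = cell_rwhisk[OF c k]
  show "cell (cmpf G1 F) (cmpf G2 F) (whrF \<Gamma> F)"
    unfolding e by (rule cell_vcomp[OF C1 C2])
  assume a: "iso \<epsilon>" "dom \<epsilon> = pv (num F) (den G1) # x1" "cod \<epsilon> = pv (num F) (den G2) # x2" "x1 \<noteq> []" "x2 \<noteq> []"
      "holds \<Gamma> (pf (num F) (den G1) # x1, pf (num F) (den G2) # x2,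
           pr (num F) (den G2) \<lhd> x2 \<bullet> [num F] \<rhd> \<epsilon> \<bullet> sinv (pr (num F) (den G1)) \<lhd> x1, \<beta>)"
  note H2 = holds_rwhisk(2)[OF c k a]
  note d = dat_D[OF holds_dat[OF C2 H2]]
  have x1: "pth x1" "src C (pv (num F) (den G1)) = tg x1" using valid_D[OF iso_valid[OF a(1)]] a by auto
  have hid: "holds (idF F) (pv (num F) (den G1) # x1, pv (num F) (den G1) # x1, sid (den F # pv (num F) (den G1) # x1),
      sinv (pr (num F) (den G1)) \<lhd> x1 \<bullet> [den G1] \<rhd> sid (pf (num F) (den G1) # x1) \<bullet> pr (num F) (den G1) \<lhd> x1)"
    using holds_idc(2)[OF F, of "sid (pv (num F) (den G1) # x1)"] l x1 by (simp add: lw_sid rw_sid cancels)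
  have "holds (frac_lwhisk C W ch G1 (idF F)) (x1, x1,
      kap [den F, pv (num F) (den G1)] \<lhd> x1 \<bullet> sid (den F # pv (num F) (den G1) # x1) \<bullet> sinv (kap [den F, pv (num F) (den G1)]) \<lhd> x1,
      kap [num G1, pf (num F) (den G1)] \<lhd> x1 \<bullet> [num G1] \<rhd> sid (pf (num F) (den G1) # x1) \<bullet> sinv (kap [num G1, pf (num F) (den G1)]) \<lhd> x1)"
    by (rule holds_lwhisk(2)[OF cF k _ _ _ _ _ hid]) (use l x1 in simp_all)
  then have H1: "holds (frac_lwhisk C W ch G1 (idF F)) (x1, x1, sid (den (cmpf G1 F) # x1), sid (num (cmpf G1 F) # x1))"
    using l x1 cmpf(2,3)[OF k] by (simp add: lw_sid cancels)
  show "holds (whrF \<Gamma> F) (x1, x2,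
           kap [den F, pv (num F) (den G2)] \<lhd> x2 \<bullet> [den F] \<rhd> \<epsilon> \<bullet> sinv (kap [den F, pv (num F) (den G1)]) \<lhd> x1,
           kap [num G2, pf (num F) (den G2)] \<lhd> x2 \<bullet> \<beta> \<bullet> sinv (kap [num G1, pf (num F) (den G1)]) \<lhd> x1)"
    unfolding e using holds_vcomp(2)[OF C1 C2 H1 H2] sid_right[OF d(2,3)] sid_right[OF d(5,6)] by simp
qed

text \<open>A class spanned by one member of a good set has the whole set as values; the 2-morphism
  of the square is obtained in this way.\<close>

lemma cls_good:
  assumes P: "par F1 F2" and g: "good F1 F2 G" and G0: "G (x1, x2, \<alpha>, \<beta>)" and W0: "WP (den F1 # x1)"
  shows "cell F1 F2 (cls F1 F2 (x1, x2, \<alpha>, \<beta>))" "G D \<Longrightarrow> holds (cls F1 F2 (x1, x2, \<alpha>, \<beta>)) D"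
proof -
  let ?D = "(x1, x2, \<alpha>, \<beta>)"
  have D0: "dat F1 F2 ?D" using goodD(1)[OF g G0] .
  note d = dat_D[OF D0]
  show c: "cell F1 F2 (cls F1 F2 ?D)" using cls(1)[OF P D0 W0] .
  have cd: "col ?D \<in> frac_data C W F1 F2" using col_data[OF P] D0 W0 by (simp add: wdat_def)
  have m: "col ?D \<in> snd (snd (cls F1 F2 ?D))" using cell_frac_class(2)[OF P cd] by (simp add: cls_def)
  have "G (sd F1 F2 (col ?D))" unfolding sd_col[OF D0] by (rule goodD(3)[OF g G0]) (use d in simp_all)
  then show "holds (cls F1 F2 ?D) D" if "G D" using good_holds[OF P g c m] that by (cases D) simp
qed

end

section \<open>The weak fiber product seen in \<open>\<C>\<close>\<close>

locale wfp = BF C W for C :: "('o, 'm, 'c) bicat" (structure) and W +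
  fixes f1 f2 :: 'm and P :: 'o and p1 p2 :: 'm and \<omega> :: 'c
  assumes wfp: "weak_fiber_product C f1 f2 P p1 p2 \<omega>"
begin

definition Om :: "('m, 'c) scell" where "Om = ([f1, p1], \<omega>, [f2, p2])"

lemma wfp_facts:
  "f1 \<in> Mor C" "f2 \<in> Mor C" "tgt C f2 = tgt C f1" "P \<in> Ob C" "p1 \<in> Mor C" "p2 \<in> Mor C" "src C p1 = P" "src C p2 = P"
  "tgt C p1 = src C f1" "tgt C p2 = src C f2" "iso Om" "dom Om = [f1, p1]" "cod Om = [f2, p2]" "raw Om = \<omega>"
proof -
  have w: "f1 \<in> Mor C" "f2 \<in> Mor C" "tgt C f1 = tgt C f2" "P \<in> Ob C" "p1 \<in> hom C P (src C f1)" "p2 \<in> hom C P (src C f2)"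
    "\<omega> \<in> inv_cells C (f1 \<cdot> p1) (f2 \<cdot> p2)"
    using wfp by (simp_all add: weak_fiber_product_def)
  show "f1 \<in> Mor C" "f2 \<in> Mor C" "tgt C f2 = tgt C f1" "P \<in> Ob C" "p1 \<in> Mor C" "p2 \<in> Mor C" "src C p1 = P" "src C p2 = P"
    "tgt C p1 = src C f1" "tgt C p2 = src C f2" "dom Om = [f1, p1]" "cod Om = [f2, p2]" "raw Om = \<omega>"
    using w by (auto simp: hom_def Om_def)
  then show "iso Om" unfolding Om_def by (intro inv_cell_iso) (use w in simp_all)
qed

lemma raw_Om: "s \<in> Mor C \<Longrightarrow> tgt C s = P \<Longrightarrow> raw (Om \<lhd> [s]) = vinv C (\<theta> f2 p2 s) \<odot> (\<omega> \<star> \<iota> s) \<odot> \<theta> f1 p1 s"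
  using raw_pull[of f1 p1 \<omega> f2 p2 s] wfp_facts by (simp add: Om_def pull_def)

lemma A1:
  assumes s: "pth s1" "pth s2" and L: "iso L" "dom L = f1 # s1" "cod L = f2 # s2"
  obtains s L1 L2 where "s \<in> Mor C" "tgt C s = P" "src C s = sr s1" "iso L1" "dom L1 = s1" "cod L1 = [p1, s]"
    "iso L2" "dom L2 = s2" "cod L2 = [p2, s]" "Om \<lhd> [s] \<bullet> [f1] \<rhd> L1 = [f2] \<rhd> L2 \<bullet> L"
proof -
  note l = wfp_facts
  note d = valid_D[OF iso_valid[OF L(1)], unfolded L(2,3)]
  have t: "tg s1 = src C f1" "tg s2 = src C f2" "sr s2 = sr s1" using d s by simp_all
  have rL: "raw L \<in> inv_cells C (f1 \<cdot> ev s1) (f2 \<cdot> ev s2)" using iso_inv_cell[OF L(1)] L s by simp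
  have h: "ev s1 \<in> hom C (sr s1) (src C f1)" "ev s2 \<in> hom C (sr s1) (src C f2)" "sr s1 \<in> Ob C"
    using s t by (simp_all add: hom_def)
  obtain s M1 M2 where sM: "s \<in> hom C (sr s1) P" "M1 \<in> inv_cells C (ev s1) (p1 \<cdot> s)" "M2 \<in> inv_cells C (ev s2) (p2 \<cdot> s)"
    and eq: "(\<omega> \<star> \<iota> s) \<odot> \<theta> f1 p1 s \<odot> (\<iota> f1 \<star> M1) = \<theta> f2 p2 s \<odot> (\<iota> f2 \<star> M2) \<odot> raw L"
    using wfp h rL unfolding weak_fiber_product_def by blast
  have sm: "s \<in> Mor C" "tgt C s = P" "src C s = sr s1" using sM by (simp_all add: hom_def)
  let ?L1 = "(s1, M1, [p1, s])" and ?L2 = "(s2, M2, [p2, s])"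
  have i: "iso ?L1" "iso ?L2" by (rule inv_cell_iso; use sM sm l s in simp)+
  have vO: "valid Om" using l by simp
  have M: "M1 \<in> Cell C" "dm C M1 = ev s1" "cd C M1 = p1 \<cdot> s" "M2 \<in> Cell C" "dm C M2 = ev s2" "cd C M2 = p2 \<cdot> s"
    using valid_D(3-5)[OF iso_valid[OF i(1)]] valid_D(3-5)[OF iso_valid[OF i(2)]] by simp_all
  have O: "\<omega> \<in> Cell C" "dm C \<omega> = f1 \<cdot> p1" "cd C \<omega> = f2 \<cdot> p2" using valid_D(3-5)[OF vO] l by simp_all
  have R: "raw L \<in> Cell C" "dm C (raw L) = f1 \<cdot> ev s1" "cd C (raw L) = f2 \<cdot> ev s2" using d(3-5) s by simp_all
  have "raw (Om \<lhd> [s] \<bullet> [f1] \<rhd> ?L1) = vinv C (\<theta> f2 p2 s) \<odot> ((\<omega> \<star> \<iota> s) \<odot> \<theta> f1 p1 s \<odot> (\<iota> f1 \<star> M1))"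
    using vO i sm l t s O M by (simp add: raw_Om raw_lw1)
  also have "\<dots> = raw ([f2] \<rhd> ?L2 \<bullet> L)"
    unfolding eq using i sm l t s M R L by (simp add: raw_lw1)
  finally have "Om \<lhd> [s] \<bullet> [f1] \<rhd> ?L1 = [f2] \<rhd> ?L2 \<bullet> L"
    by (intro scell_eqI) (use vO i sm l t s L in simp_all)
  then show ?thesis using that[of s ?L1 ?L2] sm i by simp
qed

lemma A2_raw:
  assumes t: "pth t" "pth t'" "tg t = P" "tg t' = P" "sr t' = sr t"
    and G: "iso G1" "dom G1 = p1 # t" "cod G1 = p1 # t'" "iso G2" "dom G2 = p2 # t" "cod G2 = p2 # t'"
    and e: "Om \<lhd> t' \<bullet> [f1] \<rhd> G1 = [f2] \<rhd> G2 \<bullet> Om \<lhd> t"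
  shows "\<exists>!a. a \<in> inv_cells C (ev t) (ev t') \<and> \<iota> p1 \<star> a = raw G1 \<and> \<iota> p2 \<star> a = raw G2"
proof -
  note l = wfp_facts
  have vO: "valid Om" using l by simp
  have h: "ev t \<in> hom C (sr t) P" "ev t' \<in> hom C (sr t) P" "sr t \<in> Ob C"
    using t by (simp_all add: hom_def)
  have r: "raw G1 \<in> inv_cells C (p1 \<cdot> ev t) (p1 \<cdot> ev t')" "raw G2 \<in> inv_cells C (p2 \<cdot> ev t) (p2 \<cdot> ev t')"
    using iso_inv_cell[OF G(1)] iso_inv_cell[OF G(4)] G t by simp_all
  have rO: "raw (Om \<lhd> x) = vinv C (\<theta> f2 p2 (ev x)) \<odot> (\<omega> \<star> \<iota> (ev x)) \<odot> \<theta> f1 p1 (ev x)" if "pth x" "tg x = P" for x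
    using raw_restrict_ev[of Om x] raw_Om[of "ev x"] that l by simp
  have O: "\<omega> \<in> Cell C" "dm C \<omega> = f1 \<cdot> p1" "cd C \<omega> = f2 \<cdot> p2" using valid_D(3-5)[OF vO] l by simp_all
  have M: "raw G1 \<in> Cell C" "dm C (raw G1) = p1 \<cdot> ev t" "cd C (raw G1) = p1 \<cdot> ev t'" "raw G2 \<in> Cell C" "dm C (raw G2) = p2 \<cdot> ev t" "cd C (raw G2) = p2 \<cdot> ev t'"
    using valid_D(3-5)[OF iso_valid[OF G(1)]] valid_D(3-5)[OF iso_valid[OF G(4)]] G t by simp_all
  have "raw (Om \<lhd> t' \<bullet> [f1] \<rhd> G1) = raw ([f2] \<rhd> G2 \<bullet> Om \<lhd> t)" unfolding e ..
  then have "vinv C (\<theta> f2 p2 (ev t')) \<odot> (\<omega> \<star> \<iota> (ev t')) \<odot> \<theta> f1 p1 (ev t') \<odot> (\<iota> f1 \<star> raw G1)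
     = (\<iota> f2 \<star> raw G2) \<odot> vinv C (\<theta> f2 p2 (ev t)) \<odot> (\<omega> \<star> \<iota> (ev t)) \<odot> \<theta> f1 p1 (ev t)"
    using vO G t l O M by (simp add: rO raw_lw1)
  then show ?thesis using wfp h r unfolding weak_fiber_product_def by blast
qed

lemma A2:
  assumes t: "pth t" "pth t'" "tg t = P" "tg t' = P" "sr t' = sr t"
    and G: "iso G1" "dom G1 = p1 # t" "cod G1 = p1 # t'" "iso G2" "dom G2 = p2 # t" "cod G2 = p2 # t'"
    and e: "Om \<lhd> t' \<bullet> [f1] \<rhd> G1 = [f2] \<rhd> G2 \<bullet> Om \<lhd> t"
  obtains G where "iso G" "dom G = t" "cod G = t'" "[p1] \<rhd> G = G1" "[p2] \<rhd> G = G2"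
proof -
  note l = wfp_facts
  obtain a where a: "a \<in> inv_cells C (ev t) (ev t')" "\<iota> p1 \<star> a = raw G1" "\<iota> p2 \<star> a = raw G2"
    using A2_raw[OF assms] by blast
  let ?G = "(t, a, t')"
  have i: "iso ?G" by (rule inv_cell_iso[OF a(1) t(1,2)])
  have "[p1] \<rhd> ?G = G1" "[p2] \<rhd> ?G = G2"
    by (rule scell_eqI; use i G t l a in \<open>simp add: raw_lw1\<close>)+
  then show ?thesis using that[of ?G] i by simp
qed

text \<open>\<open>G\<close> and \<open>G'\<close> solve the same lifting problem, the one posed by
  the whiskerings of \<open>G\<close>; its compatibility with \<open>Om\<close> is
  interchange.\<close>

lemma A2_unique:
  assumes G: "iso G" "iso G'" "dom G' = dom G" "cod G' = cod G" "tg (dom G) = P"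
    and e: "[p1] \<rhd> G = [p1] \<rhd> G'" "[p2] \<rhd> G = [p2] \<rhd> G'"
  shows "G = G'"
proof -
  note l = wfp_facts
  note d = valid_D[OF iso_valid[OF G(1)]]
  have "\<exists>!a. a \<in> inv_cells C (ev (dom G)) (ev (cod G)) \<and> \<iota> p1 \<star> a = raw ([p1] \<rhd> G) \<and> \<iota> p2 \<star> a = raw ([p2] \<rhd> G)"
    by (rule A2_raw) (use l G d in \<open>simp_all add: slides\<close>)
  moreover have "raw G \<in> inv_cells C (ev (dom G)) (ev (cod G))" "raw G' \<in> inv_cells C (ev (dom G)) (ev (cod G))"
    using iso_inv_cell[OF G(1)] iso_inv_cell[OF G(2)] G(3,4) by simp_all
  moreover have "\<iota> p1 \<star> raw G = raw ([p1] \<rhd> G)" "\<iota> p2 \<star> raw G = raw ([p2] \<rhd> G)"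
    "\<iota> p1 \<star> raw G' = raw ([p1] \<rhd> G)" "\<iota> p2 \<star> raw G' = raw ([p2] \<rhd> G)"
  proof -
    have r: "raw ([p1] \<rhd> G) = \<iota> p1 \<star> raw G" "raw ([p2] \<rhd> G) = \<iota> p2 \<star> raw G"
      "raw ([p1] \<rhd> G') = \<iota> p1 \<star> raw G'" "raw ([p2] \<rhd> G') = \<iota> p2 \<star> raw G'"
      using l G by (simp_all add: raw_lw1)
    then show "\<iota> p1 \<star> raw G = raw ([p1] \<rhd> G)" "\<iota> p2 \<star> raw G = raw ([p2] \<rhd> G)"
      "\<iota> p1 \<star> raw G' = raw ([p1] \<rhd> G)" "\<iota> p2 \<star> raw G' = raw ([p2] \<rhd> G)" using e by simp_all
  qed
  ultimately have "raw G = raw G'" by blast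
  then show ?thesis using G by (intro scell_eqI) simp_all
qed

lemma part_a:
  assumes D: "D \<in> Ob C" "q1 \<in> hom C D (src C f1)" "q2 \<in> hom C D (src C f2)" "l \<in> inv_cells C (f1 \<cdot> q1) (f2 \<cdot> q2)"
  shows "\<exists>E \<in> Ob C. \<exists>v \<in> hom C E D. \<exists>q \<in> hom C E P.
            \<exists>l1 \<in> inv_cells C (q1 \<cdot> v) (p1 \<cdot> q). \<exists>l2 \<in> inv_cells C (q2 \<cdot> v) (p2 \<cdot> q).
              v \<in> W
              \<and> vinv C (\<theta> f2 p2 q) \<odot> (\<omega> \<star> \<iota> q) \<odot> \<theta> f1 p1 q \<odot> (\<iota> f1 \<star> l1)
                = (\<iota> f2 \<star> l2) \<odot> vinv C (\<theta> f2 q2 v) \<odot> (l \<star> \<iota> v) \<odot> \<theta> f1 q1 v"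
proof -
  note lf = wfp_facts
  let ?L = "([f1, q1], l, [f2, q2])" and ?i = "\<one> D"
  have q: "q1 \<in> Mor C" "src C q1 = D" "tgt C q1 = src C f1" "q2 \<in> Mor C" "src C q2 = D" "tgt C q2 = src C f2"
    using D by (auto simp: hom_def)
  have L: "iso ?L" by (rule inv_cell_iso) (use D q lf in simp_all)
  obtain s L1 L2 where s: "s \<in> Mor C" "tgt C s = P" "src C s = sr [q1]" "iso L1" "dom L1 = [q1]" "cod L1 = [p1, s]"
    "iso L2" "dom L2 = [q2]" "cod L2 = [p2, s]" "Om \<lhd> [s] \<bullet> [f1] \<rhd> L1 = [f2] \<rhd> L2 \<bullet> ?L"
    by (rule A1[of "[q1]" "[q2]" ?L]) (use L q in simp_all)
  have sd: "src C s = D" using s q by simp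
  \<comment> \<open>The sources of the required 2-morphisms contain the identity of
    \<open>D\<close>, so the factor \<open>s\<close> is composed with this identity as well; no
    unitor is then involved.\<close>
  let ?q = "s \<cdot> ?i"
  define M1 where "M1 = ([q1, ?i], raw (L1 \<lhd> [?i]), [p1, ?q])"
  define M2 where "M2 = ([q2, ?i], raw (L2 \<lhd> [?i]), [p2, ?q])"
  have i1: "valid (L1 \<lhd> [?i])" "dom (L1 \<lhd> [?i]) = [q1, ?i]" "cod (L1 \<lhd> [?i]) = [p1, s, ?i]"
    "valid (L2 \<lhd> [?i])" "dom (L2 \<lhd> [?i]) = [q2, ?i]" "cod (L2 \<lhd> [?i]) = [p2, s, ?i]"
    using s(1,2,4-9) sd q D(1) lf by simp_all
  have M: "M1 = [p1] \<rhd> kap [s, ?i] \<bullet> L1 \<lhd> [?i]" "M2 = [p2] \<rhd> kap [s, ?i] \<bullet> L2 \<lhd> [?i]"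
    unfolding M1_def M2_def
    using i1 valid_D(3-5)[OF i1(1)] valid_D(3-5)[OF i1(4)] s(1,2) sd q D(1) lf
    by (auto intro!: scell_eqI simp: raw_lw_kap)
  have "Om \<lhd> [?q] = Om \<lhd> [ev [s, ?i]]" by simp
  also have "\<dots> = [f2, p2] \<rhd> kap [s, ?i] \<bullet> Om \<lhd> [s, ?i] \<bullet> [f1, p1] \<rhd> sinv (kap [s, ?i])"
    using kap_restrict[of Om "[s, ?i]"] s(1,2) sd D(1) lf by simp
  finally have O: "Om \<lhd> [?q] = [f2, p2] \<rhd> kap [s, ?i] \<bullet> Om \<lhd> [s, ?i] \<bullet> [f1, p1] \<rhd> sinv (kap [s, ?i])" .
  have i: "iso M1" "iso M2" unfolding M using s(1,2,4-9) sd q D(1) lf by simp_all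
  have "Om \<lhd> [?q] \<bullet> [f1] \<rhd> M1 = [f2, p2] \<rhd> kap [s, ?i] \<bullet> ((Om \<lhd> [s] \<bullet> [f1] \<rhd> L1) \<lhd> [?i])"
    unfolding O M using s(1,2,4-9) sd q D(1) lf by (simp add: cancels)
  also have "\<dots> = [f2] \<rhd> M2 \<bullet> ?L \<lhd> [?i]" unfolding s(10) M by simp
  finally have e: "raw (Om \<lhd> [?q] \<bullet> [f1] \<rhd> M1) = raw ([f2] \<rhd> M2 \<bullet> ?L \<lhd> [?i])" by simp
  have dM: "dom M1 = [q1, ?i]" "cod M1 = [p1, ?q]" "dom M2 = [q2, ?i]" "cod M2 = [p2, ?q]" by (simp_all add: M1_def M2_def)
  have qq: "?q \<in> Mor C" "tgt C ?q = P" "src C ?q = D" using s(1,2) sd D(1) by simp_all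
  have rL: "raw (?L \<lhd> [?i]) = vinv C (\<theta> f2 q2 ?i) \<odot> (l \<star> \<iota> ?i) \<odot> \<theta> f1 q1 ?i"
    using raw_pull[of f1 q1 l f2 q2 ?i] L q D(1) by (simp add: pull_def)
  have vO: "valid Om" using lf by simp
  have OC: "\<omega> \<in> Cell C" "dm C \<omega> = f1 \<cdot> p1" "cd C \<omega> = f2 \<cdot> p2" using valid_D(3-5)[OF vO] lf by simp_all
  have MC: "raw M1 \<in> Cell C" "dm C (raw M1) = q1 \<cdot> ?i" "cd C (raw M1) = p1 \<cdot> ?q"
    using valid_D(3-5)[OF iso_valid[OF i(1)]] dM by simp_all
  have "vinv C (\<theta> f2 p2 ?q) \<odot> (\<omega> \<star> \<iota> ?q) \<odot> \<theta> f1 p1 ?q \<odot> (\<iota> f1 \<star> raw M1)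
                = (\<iota> f2 \<star> raw M2) \<odot> vinv C (\<theta> f2 q2 ?i) \<odot> (l \<star> \<iota> ?i) \<odot> \<theta> f1 q1 ?i"
    using e vO i dM qq L q D(1) lf OC MC by (simp add: raw_Om raw_lw1 rL)
  moreover have "raw M1 \<in> inv_cells C (q1 \<cdot> ?i) (p1 \<cdot> ?q)" "raw M2 \<in> inv_cells C (q2 \<cdot> ?i) (p2 \<cdot> ?q)"
    using iso_inv_cell[OF i(1)] iso_inv_cell[OF i(2)] dM by simp_all
  moreover have "?i \<in> hom C D D" "?q \<in> hom C D P" "?i \<in> W" using qq D(1) by (simp_all add: hom_def)
  ultimately show ?thesis using D(1) by blast
qed

text \<open>The equations of (b) and (c) carry one associator on each side. With both moved to one
  side they become whiskering equations between 2-cells of paths.\<close>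

lemma theta_form:
  assumes "valid ([p, t], a, [p', t'])" "u \<in> Mor C" "tgt C u = src C t"
    "b \<in> Cell C" "dm C b = t \<cdot> u" "cd C b = t' \<cdot> u" "p = p'"
  shows "\<theta> p t' u \<odot> (\<iota> p \<star> b) = (a \<star> \<iota> u) \<odot> \<theta> p t u \<longleftrightarrow> [p] \<rhd> ([t, u], b, [t', u]) = ([p, t], a, [p', t']) \<lhd> [u]"
proof -
  note d = valid_D[OF assms(1), simplified]
  have vb: "valid ([t, u], b, [t', u])" using d assms by (simp add: valid_triple)
  have "[p] \<rhd> ([t, u], b, [t', u]) = ([p, t], a, [p', t']) \<lhd> [u] \<longleftrightarrow> \<iota> p \<star> b = pull C p t p' t' a u"
    using lw_triple[OF vb, of p] pull_triple[OF assms(1), of u, symmetric] d assms by simp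
  also have "\<dots> \<longleftrightarrow> \<theta> p t' u \<odot> (\<iota> p \<star> b) = (a \<star> \<iota> u) \<odot> \<theta> p t u"
  proof -
    have "\<iota> p \<star> b = vinv C (\<theta> p t' u) \<odot> ((a \<star> \<iota> u) \<odot> \<theta> p t u) \<longleftrightarrow> \<theta> p t' u \<odot> (\<iota> p \<star> b) = (a \<star> \<iota> u) \<odot> \<theta> p t u"
      by (rule vinv_eqI) (use d assms in simp_all)
    then show ?thesis using assms(7) by (simp add: pull_def)
  qed
  finally show ?thesis by blast
qed

context
  fixes D t t' \<gamma>1 \<gamma>2
  assumes D: "D \<in> Ob C" and t: "t \<in> hom C D P" "t' \<in> hom C D P"
    and \<gamma>: "\<gamma>1 \<in> inv_cells C (p1 \<cdot> t) (p1 \<cdot> t')" "\<gamma>2 \<in> inv_cells C (p2 \<cdot> t) (p2 \<cdot> t')"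
begin

lemma bc_facts:
  "t \<in> Mor C" "t' \<in> Mor C" "src C t = D" "src C t' = D" "tgt C t = P" "tgt C t' = P"
  "iso ([p1, t], \<gamma>1, [p1, t'])" "iso ([p2, t], \<gamma>2, [p2, t'])"
proof -
  show a: "t \<in> Mor C" "t' \<in> Mor C" "src C t = D" "src C t' = D" "tgt C t = P" "tgt C t' = P" using t by (auto simp: hom_def)
  show "iso ([p1, t], \<gamma>1, [p1, t'])" "iso ([p2, t], \<gamma>2, [p2, t'])"
    by (rule inv_cell_iso; use \<gamma> a wfp_facts in simp)+
qed

lemma part_b:
  assumes e: "vinv C (\<theta> f2 p2 t') \<odot> (\<omega> \<star> \<iota> t') \<odot> \<theta> f1 p1 t' \<odot> (\<iota> f1 \<star> \<gamma>1)
              = (\<iota> f2 \<star> \<gamma>2) \<odot> vinv C (\<theta> f2 p2 t) \<odot> (\<omega> \<star> \<iota> t) \<odot> \<theta> f1 p1 t"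
  shows "\<exists>F \<in> Ob C. \<exists>u \<in> hom C F D. \<exists>\<gamma> \<in> inv_cells C (t \<cdot> u) (t' \<cdot> u).
               u \<in> W
               \<and> \<theta> p1 t' u \<odot> (\<iota> p1 \<star> \<gamma>) = (\<gamma>1 \<star> \<iota> u) \<odot> \<theta> p1 t u
               \<and> \<theta> p2 t' u \<odot> (\<iota> p2 \<star> \<gamma>) = (\<gamma>2 \<star> \<iota> u) \<odot> \<theta> p2 t u"
proof -
  note l = wfp_facts and b = bc_facts
  let ?G1 = "([p1, t], \<gamma>1, [p1, t'])" and ?G2 = "([p2, t], \<gamma>2, [p2, t'])" and ?i = "\<one> D"
  have vO: "valid Om" using l by simp
  have OC: "\<omega> \<in> Cell C" "dm C \<omega> = f1 \<cdot> p1" "cd C \<omega> = f2 \<cdot> p2" using valid_D(3-5)[OF vO] l by simp_all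
  have gC: "\<gamma>1 \<in> Cell C" "dm C \<gamma>1 = p1 \<cdot> t" "cd C \<gamma>1 = p1 \<cdot> t'" "\<gamma>2 \<in> Cell C" "dm C \<gamma>2 = p2 \<cdot> t" "cd C \<gamma>2 = p2 \<cdot> t'"
    using \<gamma> by (simp_all add: inv_cells_iff)
  have "Om \<lhd> [t'] \<bullet> [f1] \<rhd> ?G1 = [f2] \<rhd> ?G2 \<bullet> Om \<lhd> [t]"
    by (rule scell_eqI) (use e vO l b OC gC in \<open>simp_all add: raw_Om raw_lw1\<close>)
  then obtain G where G: "iso G" "dom G = [t]" "cod G = [t']" "[p1] \<rhd> G = ?G1" "[p2] \<rhd> G = ?G2"
    using A2[of "[t]" "[t']" ?G1 ?G2] b l by auto
  let ?g = "raw (G \<lhd> [?i])"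
  have iG: "iso (G \<lhd> [?i])" "dom (G \<lhd> [?i]) = [t, ?i]" "cod (G \<lhd> [?i]) = [t', ?i]" using G(1-3) b D by simp_all
  have g: "([t, ?i], ?g, [t', ?i]) = G \<lhd> [?i]" using triple_eta[of "G \<lhd> [?i]"] iG by simp
  have gm: "?g \<in> inv_cells C (t \<cdot> ?i) (t' \<cdot> ?i)" using iso_inv_cell[OF iG(1)] iG by simp
  have gc: "?g \<in> Cell C" "dm C ?g = t \<cdot> ?i" "cd C ?g = t' \<cdot> ?i" using gm by (simp_all add: inv_cells_iff)
  have v: "valid ?G1" "valid ?G2" "?i \<in> Mor C" "tgt C ?i = src C t" using b D by simp_all
  have "[p1] \<rhd> ([t, ?i], ?g, [t', ?i]) = ?G1 \<lhd> [?i]" "[p2] \<rhd> ([t, ?i], ?g, [t', ?i]) = ?G2 \<lhd> [?i]"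
    unfolding g G(4,5)[symmetric] by simp_all
  then have "\<theta> p1 t' ?i \<odot> (\<iota> p1 \<star> ?g) = (\<gamma>1 \<star> \<iota> ?i) \<odot> \<theta> p1 t ?i"
    "\<theta> p2 t' ?i \<odot> (\<iota> p2 \<star> ?g) = (\<gamma>2 \<star> \<iota> ?i) \<odot> \<theta> p2 t ?i"
    using theta_form[OF v(1,3,4) gc refl] theta_form[OF v(2,3,4) gc refl] by blast+
  moreover have "?i \<in> hom C D D" "?i \<in> W" using D by (simp_all add: hom_def)
  ultimately show ?thesis using D gm by blast
qed

text \<open>(BF3) makes \<open>u\<close> and \<open>u'\<close> isomorphic after restriction.
  Transported along this isomorphism, the restrictions of \<gamma> and \<gamma>' lift the same
  restrictions of \<gamma>1 and \<gamma>2, so uniqueness in the weak fiber product of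
  \<open>C\<close> makes them equal.\<close>

lemma part_c:
  assumes u: "u \<in> hom C F D" "u \<in> W" "\<gamma> \<in> inv_cells C (t \<cdot> u) (t' \<cdot> u)"
    and e: "\<theta> p1 t' u \<odot> (\<iota> p1 \<star> \<gamma>) = (\<gamma>1 \<star> \<iota> u) \<odot> \<theta> p1 t u" "\<theta> p2 t' u \<odot> (\<iota> p2 \<star> \<gamma>) = (\<gamma>2 \<star> \<iota> u) \<odot> \<theta> p2 t u"
    and u': "u' \<in> hom C F' D" "u' \<in> W" "\<gamma>' \<in> inv_cells C (t \<cdot> u') (t' \<cdot> u')"
    and e': "\<theta> p1 t' u' \<odot> (\<iota> p1 \<star> \<gamma>') = (\<gamma>1 \<star> \<iota> u') \<odot> \<theta> p1 t u'" "\<theta> p2 t' u' \<odot> (\<iota> p2 \<star> \<gamma>') = (\<gamma>2 \<star> \<iota> u') \<odot> \<theta> p2 t u'"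
  shows "\<exists>G \<in> Ob C. \<exists>z \<in> hom C G F. \<exists>z' \<in> hom C G F'.
             \<exists>\<mu> \<in> inv_cells C (u \<cdot> z) (u' \<cdot> z').
               z \<in> W
               \<and> \<theta> t' u' z' \<odot> (\<iota> t' \<star> \<mu>) \<odot> vinv C (\<theta> t' u z) \<odot> (\<gamma> \<star> \<iota> z)
                 = (\<gamma>' \<star> \<iota> z') \<odot> \<theta> t u' z' \<odot> (\<iota> t \<star> \<mu>) \<odot> vinv C (\<theta> t u z)"
proof -
  note l = wfp_facts and b = bc_facts
  have m: "u \<in> Mor C" "src C u = F" "tgt C u = D" "u' \<in> Mor C" "src C u' = F'" "tgt C u' = D" using u u' by (auto simp: hom_def)
  let ?G1 = "([p1, t], \<gamma>1, [p1, t'])" and ?G2 = "([p2, t], \<gamma>2, [p2, t'])"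
  let ?g = "([t, u], \<gamma>, [t', u])" and ?g' = "([t, u'], \<gamma>', [t', u'])"
  have ig: "iso ?g" "iso ?g'" by (rule inv_cell_iso; use u u' m b in simp)+
  have gC: "\<gamma> \<in> Cell C" "dm C \<gamma> = t \<cdot> u" "cd C \<gamma> = t' \<cdot> u" "\<gamma>' \<in> Cell C" "dm C \<gamma>' = t \<cdot> u'" "cd C \<gamma>' = t' \<cdot> u'"
    using u u' by (simp_all add: inv_cells_iff)
  have v: "valid ?G1" "valid ?G2" using b by simp_all
  have T: "tgt C u = src C t" "tgt C u' = src C t" using m b by simp_all
  have E: "[p1] \<rhd> ?g = ?G1 \<lhd> [u]" "[p2] \<rhd> ?g = ?G2 \<lhd> [u]" "[p1] \<rhd> ?g' = ?G1 \<lhd> [u']" "[p2] \<rhd> ?g' = ?G2 \<lhd> [u']"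
    using theta_form[OF v(1) m(1) T(1) gC(1-3) refl] theta_form[OF v(2) m(1) T(1) gC(1-3) refl]
      theta_form[OF v(1) m(4) T(2) gC(4-6) refl] theta_form[OF v(2) m(4) T(2) gC(4-6) refl] e e' by blast+
  have Wu: "WP [u']" using u' by simp
  obtain z x M where z0: "WP z" "tg z = sr [u]" "iso M" "dom M = [u] @ z" "cod M = [u'] @ x" "pth x" "tg x = sr [u']" "sr x = sr z"
    by (rule bf3[OF Wu, of "[u]"]) (use m in simp_all)
  have z: "WP z" "pth z" "tg z = F" "iso M" "dom M = u # z" "cod M = u' # x" "pth x" "tg x = F'" "sr x = sr z"
    using z0 m by simp_all
  \<comment> \<open>The restriction of \<gamma>', conjugated by the comparison \<open>M\<close> so
    as to have the boundary of the restriction of \<gamma>.\<close>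
  let ?H = "[t'] \<rhd> sinv M \<bullet> ?g' \<lhd> x \<bullet> [t] \<rhd> M"
  have H: "[p1] \<rhd> ?H = [p1, t'] \<rhd> sinv M \<bullet> ([p1] \<rhd> ?g') \<lhd> x \<bullet> [p1, t] \<rhd> M" "[p2] \<rhd> ?H = [p2, t'] \<rhd> sinv M \<bullet> ([p2] \<rhd> ?g') \<lhd> x \<bullet> [p2, t] \<rhd> M" by simp_all
  have "[p1] \<rhd> ?H = ?G1 \<lhd> (u # z)" "[p2] \<rhd> ?H = ?G2 \<lhd> (u # z)"
    unfolding H E using z m b l by (simp_all add: slides cancels)
  note H1 = this
  have "[p1] \<rhd> (?g \<lhd> z) = ([p1] \<rhd> ?g) \<lhd> z" "[p2] \<rhd> (?g \<lhd> z) = ([p2] \<rhd> ?g) \<lhd> z" by simp_all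
  then have H2: "[p1] \<rhd> (?g \<lhd> z) = ?G1 \<lhd> (u # z)" "[p2] \<rhd> (?g \<lhd> z) = ?G2 \<lhd> (u # z)"
    unfolding E by simp_all
  have "?g \<lhd> z = ?H"
    by (rule A2_unique[OF _ _ _ _ _ trans[OF H2(1) H1(1)[symmetric]] trans[OF H2(2) H1(2)[symmetric]]])
      (simp_all add: z m b l ig)
  then have K: "[t'] \<rhd> M \<bullet> ?g \<lhd> z = ?g' \<lhd> x \<bullet> [t] \<rhd> M"
    using z m b l ig by (simp add: cancels)
  let ?z = "ev z" and ?x = "ev x"
  have zx: "?z \<in> Mor C" "tgt C ?z = F" "?x \<in> Mor C" "tgt C ?x = F'" "src C ?x = src C ?z" "src C ?z = sr z" using z by simp_all
  define N where "N = ([u, ?z], raw M, [u', ?x])"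
  have N: "N = [u'] \<rhd> kap x \<bullet> M \<bullet> [u] \<rhd> sinv (kap z)"
    unfolding N_def using collapse_right[of M "[u]" z "[u']" x] z by simp
  have iN: "iso N" unfolding N using z m by simp
  have vg: "valid ?g" "valid ?g'" "dom ?g = [t, u]" "cod ?g = [t', u]" "dom ?g' = [t, u']" "cod ?g' = [t', u']" using ig by simp_all
  have "[t'] \<rhd> N \<bullet> ?g \<lhd> [?z] = [t', u'] \<rhd> kap x \<bullet> ([t'] \<rhd> M \<bullet> ?g \<lhd> z) \<bullet> [t, u] \<rhd> sinv (kap z)"
    unfolding N using z m b vg by (subst kap_restrict) (simp_all add: cancels)
  also have "\<dots> = ?g' \<lhd> [?x] \<bullet> [t] \<rhd> N"
    unfolding N K using z m b vg by (subst kap_restrict) (simp_all add: cancels)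
  finally have "raw ([t'] \<rhd> N \<bullet> ?g \<lhd> [?z]) = raw (?g' \<lhd> [?x] \<bullet> [t] \<rhd> N)" by simp
  moreover have dN: "dom N = [u, ?z]" "cod N = [u', ?x]" "raw N = raw M" by (simp_all add: N_def)
  moreover have NC: "raw M \<in> Cell C" "dm C (raw M) = u \<cdot> ?z" "cd C (raw M) = u' \<cdot> ?x"
    using valid_D(3-5)[OF iso_valid[OF iN]] dN by simp_all
  ultimately have R: "(\<iota> t' \<star> raw M) \<odot> vinv C (\<theta> t' u ?z) \<odot> (\<gamma> \<star> \<iota> ?z) \<odot> \<theta> t u ?z = vinv C (\<theta> t' u' ?x) \<odot> (\<gamma>' \<star> \<iota> ?x) \<odot> \<theta> t u' ?x \<odot> (\<iota> t \<star> raw M)"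
    using raw_pull[of t u \<gamma> t' u ?z] raw_pull[of t u' \<gamma>' t' u' ?x] vg zx m b iN gC by (simp add: raw_lw1 pull_def)
  have "\<theta> t' u' ?x \<odot> (\<iota> t' \<star> raw M) \<odot> vinv C (\<theta> t' u ?z) \<odot> (\<gamma> \<star> \<iota> ?z)
      = \<theta> t' u' ?x \<odot> ((\<iota> t' \<star> raw M) \<odot> vinv C (\<theta> t' u ?z) \<odot> (\<gamma> \<star> \<iota> ?z) \<odot> \<theta> t u ?z) \<odot> vinv C (\<theta> t u ?z)"
    using zx m b gC NC by simp
  also have "\<dots> = (\<gamma>' \<star> \<iota> ?x) \<odot> \<theta> t u' ?x \<odot> (\<iota> t \<star> raw M) \<odot> vinv C (\<theta> t u ?z)"
    unfolding R using zx m b gC NC by simp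
  finally have "\<theta> t' u' ?x \<odot> (\<iota> t' \<star> raw M) \<odot> vinv C (\<theta> t' u ?z) \<odot> (\<gamma> \<star> \<iota> ?z)
     = (\<gamma>' \<star> \<iota> ?x) \<odot> \<theta> t u' ?x \<odot> (\<iota> t \<star> raw M) \<odot> vinv C (\<theta> t u ?z)" .
  moreover have "raw M \<in> inv_cells C (u \<cdot> ?z) (u' \<cdot> ?x)" using iso_inv_cell[OF iN] dN by simp
  moreover have "?z \<in> hom C (sr z) F" "?x \<in> hom C (sr z) F'" "sr z \<in> Ob C" using zx z(2) by (simp_all add: hom_def)
  moreover have "?z \<in> W" using z by (simp add: WP_def)
  ultimately show ?thesis by blast
qed

end

end

section \<open>One leg of the square in \<open>\<C>[W\<^sup>-\<^sup>1]\<close>\<close>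

locale leg = fraction_choices C W ch for C :: "('o, 'm, 'c) bicat" (structure) and W ch +
  fixes w f p :: 'm and P :: 'o
  assumes w: "w \<in> W" and f: "f \<in> Mor C" and wf: "src C w = src C f"
    and p: "p \<in> Mor C" "tgt C p = src C f" "src C p = P"
begin

lemma P_Ob [simp]: "P \<in> Ob C" using p by auto

definition gg :: "('o, 'm) fmor" where "gg = (src C w, w, f)"
definition R :: "('o, 'm) fmor" where "R = (P, \<one> P, w \<cdot> p)"
text \<open>\<open>k\<close>, \<open>l\<close>, \<open>rK\<close> come from the choice made in
  \<open>gg \<circ> R\<close>; \<open>n\<close>, \<open>b\<close>, \<open>rN\<close> from that in
  \<open>gg \<circ> (R \<circ> T)\<close>; \<open>m\<close>, \<open>c\<close>, \<open>rM\<close>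
  from that in \<open>(gg \<circ> R) \<circ> T\<close>. The cells have their composites spelled out
  and the identity \<open>\<one> P\<close> removed. \<open>jj\<close>, \<open>KK\<close> and
  \<open>K2\<close> form composed denominators and numerators.\<close>

definition k where "k = pv (w \<cdot> p) w"
definition l where "l = pf (w \<cdot> p) w"
definition rK where "rK = pr (w \<cdot> p) w \<bullet> kap [w, p] \<lhd> [k]"
definition n where "n T = pv ((w \<cdot> p) \<cdot> num T) w"
definition b where "b T = pf ((w \<cdot> p) \<cdot> num T) w"
definition rN where "rN T = pr ((w \<cdot> p) \<cdot> num T) w \<bullet> kap [w \<cdot> p, num T] \<lhd> [n T] \<bullet> kap [w, p] \<lhd> [num T, n T]"
definition m where "m T = pv (num T) (\<one> P \<cdot> k)"
definition c where "c T = pf (num T) (\<one> P \<cdot> k)"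
definition rM where "rM T = lu [k, c T] \<bullet> sinv (kap [\<one> P, k]) \<lhd> [c T] \<bullet> pr (num T) (\<one> P \<cdot> k)"
definition jj where "jj T = kap [den T, \<one> (src C (num T))] \<bullet> sinv (ru (den T))"
definition KK where "KK T = kap [w \<cdot> p, num T] \<bullet> kap [w, p] \<lhd> [num T]"
definition K2 where "K2 T = kap [f \<cdot> l, c T] \<bullet> kap [f, l] \<lhd> [c T]"

definition ok :: "('o, 'm) fmor \<Rightarrow> bool" where "ok T \<longleftrightarrow> T \<in> frac_Mor C W \<and> frac_tgt C T = P"

lemma frac_mor: "gg \<in> frac_Mor C W" "R \<in> frac_Mor C W"
  using w f wf p W_Mor' by (auto simp: gg_def R_def frac_Mor_def)

lemma dn [simp]: "den gg = w" "num gg = f" "den R = \<one> P" "num R = w \<cdot> p"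
  by (simp_all add: gg_def R_def)

lemma compg: "composable gg R"
  using frac_mor W_Mor'[OF w] p f wf by (simp add: composable_def) (simp add: gg_def R_def frac_src_def frac_tgt_def)

lemma base:
  "w \<in> W" "w \<in> Mor C" "f \<in> Mor C" "src C w = src C f" "p \<in> Mor C" "tgt C p = src C f" "src C p = P"
  "k \<in> W" "k \<in> Mor C" "tgt C k = P" "l \<in> Mor C" "tgt C l = src C f" "src C l = src C k"
  "iso rK" "dom rK = [w, p, k]" "cod rK = [w, l]"
proof -
  have wm: "w \<in> Mor C" "w \<cdot> p \<in> Mor C" "tgt C (w \<cdot> p) = tgt C w" "src C (w \<cdot> p) = P" using W_Mor'[OF w] p wf by simp_all
  note h = choice[OF wm(2) w wm(3), folded k_def l_def]
  show "w \<in> W" "w \<in> Mor C" "f \<in> Mor C" "src C w = src C f" "p \<in> Mor C" "tgt C p = src C f" "src C p = P"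
    "k \<in> W" "k \<in> Mor C" "tgt C k = P" "l \<in> Mor C" "tgt C l = src C f" "src C l = src C k"
    using w wm f wf p h by simp_all
  show "iso rK" "dom rK = [w, p, k]" "cod rK = [w, l]" using h wm p wf by (simp_all add: rK_def)
qed

lemma choiceK: "iso (pr (w \<cdot> p) w)" "dom (pr (w \<cdot> p) w) = [w \<cdot> p, k]" "cod (pr (w \<cdot> p) w) = [w, l]"
proof -
  have wm: "w \<cdot> p \<in> Mor C" "tgt C (w \<cdot> p) = tgt C w" using base(1-7) by simp_all
  note h = choice[OF wm(1) w wm(2), folded k_def l_def]
  show "iso (pr (w \<cdot> p) w)" "dom (pr (w \<cdot> p) w) = [w \<cdot> p, k]" "cod (pr (w \<cdot> p) w) = [w, l]" using h by simp_all
qed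

lemma gR_simps: "den (cmpf gg R) = \<one> P \<cdot> k" "num (cmpf gg R) = f \<cdot> l"
  using cmpf(2,3)[OF compg] by (simp_all add: k_def l_def)

context
  fixes T assumes T: "ok T"
begin

lemma compR: "composable R T"
  using T frac_mor(2) by (simp add: composable_def ok_def) (simp add: R_def frac_src_def frac_tgt_def)

lemma compRT: "composable gg (cmpf R T)"
  using compR cmpf[OF compR] compg by (simp add: composable_def)

lemma compGR: "composable (cmpf gg R) T"
  using compR cmpf[OF compg] by (simp add: composable_def)

lemma Tbase:
  "den T \<in> W" "den T \<in> Mor C" "num T \<in> Mor C" "src C (den T) = src C (num T)" "tgt C (num T) = P"
  "n T \<in> W" "n T \<in> Mor C" "tgt C (n T) = src C (num T)" "b T \<in> Mor C" "tgt C (b T) = src C f" "src C (b T) = src C (n T)"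
  "iso (rN T)" "dom (rN T) = [w, p, num T, n T]" "cod (rN T) = [w, b T]"
  "m T \<in> W" "m T \<in> Mor C" "tgt C (m T) = src C (num T)" "c T \<in> Mor C" "tgt C (c T) = src C k" "src C (c T) = src C (m T)"
  "iso (rM T)" "dom (rM T) = [num T, m T]" "cod (rM T) = [k, c T]"
  "iso (jj T)" "dom (jj T) = [den T]" "cod (jj T) = [den T \<cdot> \<one> (src C (num T))]"
  "iso (KK T)" "dom (KK T) = [w, p, num T]" "cod (KK T) = [(w \<cdot> p) \<cdot> num T]"
  "iso (K2 T)" "dom (K2 T) = [f, l, c T]" "cod (K2 T) = [(f \<cdot> l) \<cdot> c T]"
  "iso (pr ((w \<cdot> p) \<cdot> num T) w)" "dom (pr ((w \<cdot> p) \<cdot> num T) w) = [(w \<cdot> p) \<cdot> num T, n T]" "cod (pr ((w \<cdot> p) \<cdot> num T) w) = [w, b T]"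
  "iso (pr (num T) (\<one> P \<cdot> k))" "dom (pr (num T) (\<one> P \<cdot> k)) = [num T, m T]" "cod (pr (num T) (\<one> P \<cdot> k)) = [\<one> P \<cdot> k, c T]"
proof -
  have a: "den T \<in> W" "den T \<in> Mor C" "num T \<in> Mor C" "src C (den T) = src C (num T)" "tgt C (num T) = P"
    using composable_D[OF compR, unfolded dn] by simp_all
  show "den T \<in> W" "den T \<in> Mor C" "num T \<in> Mor C" "src C (den T) = src C (num T)" "tgt C (num T) = P" by (rule a)+
  note B = base
  have r: "(w \<cdot> p) \<cdot> num T \<in> Mor C" "tgt C ((w \<cdot> p) \<cdot> num T) = tgt C w" using a B by simp_all
  have o: "\<one> P \<cdot> k \<in> W" "tgt C (num T) = tgt C (\<one> P \<cdot> k)" using a B BF2[of k "\<one> P"] by simp_all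
  note h = choice[OF r(1) w r(2), folded n_def b_def] and h' = choice[OF a(3) o, folded m_def c_def]
  have s: "src C ((w \<cdot> p) \<cdot> num T) = src C (num T)" "src C (\<one> P \<cdot> k) = src C k" using a B by simp_all
  show "n T \<in> W" "n T \<in> Mor C" "tgt C (n T) = src C (num T)" "b T \<in> Mor C" "tgt C (b T) = src C f" "src C (b T) = src C (n T)"
    "m T \<in> W" "m T \<in> Mor C" "tgt C (m T) = src C (num T)" "c T \<in> Mor C" "tgt C (c T) = src C k" "src C (c T) = src C (m T)"
    "iso (pr ((w \<cdot> p) \<cdot> num T) w)" "dom (pr ((w \<cdot> p) \<cdot> num T) w) = [(w \<cdot> p) \<cdot> num T, n T]" "cod (pr ((w \<cdot> p) \<cdot> num T) w) = [w, b T]"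
    "iso (pr (num T) (\<one> P \<cdot> k))" "dom (pr (num T) (\<one> P \<cdot> k)) = [num T, m T]" "cod (pr (num T) (\<one> P \<cdot> k)) = [\<one> P \<cdot> k, c T]"
    using h h' s wf by simp_all
  then show "iso (rN T)" "dom (rN T) = [w, p, num T, n T]" "cod (rN T) = [w, b T]"
    "iso (rM T)" "dom (rM T) = [num T, m T]" "cod (rM T) = [k, c T]"
    "iso (jj T)" "dom (jj T) = [den T]" "cod (jj T) = [den T \<cdot> \<one> (src C (num T))]"
    "iso (KK T)" "dom (KK T) = [w, p, num T]" "cod (KK T) = [(w \<cdot> p) \<cdot> num T]"
    "iso (K2 T)" "dom (K2 T) = [f, l, c T]" "cod (K2 T) = [(f \<cdot> l) \<cdot> c T]"
    by (simp_all add: a B rN_def rM_def jj_def KK_def K2_def)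
qed

lemma pT: "pv (num T) (\<one> P) = \<one> (src C (num T))" "pf (num T) (\<one> P) = num T" "pr (num T) (\<one> P) = sinv (lu [num T]) \<bullet> ru (num T)"
  using choice_id_right[OF Tbase(3)] Tbase(5) by simp_all

lemma RT_simps: "den (cmpf R T) = den T \<cdot> \<one> (src C (num T))" "num (cmpf R T) = (w \<cdot> p) \<cdot> num T"
  using cmpf(2,3)[OF compR] by (simp_all add: pT)

lemma gRT_simps: "den (cmpf gg (cmpf R T)) = (den T \<cdot> \<one> (src C (num T))) \<cdot> n T" "num (cmpf gg (cmpf R T)) = f \<cdot> b T"
  using cmpf(2,3)[OF compRT] by (simp_all add: RT_simps n_def b_def)

lemma gRT2_simps: "den (cmpf (cmpf gg R) T) = den T \<cdot> m T" "num (cmpf (cmpf gg R) T) = (f \<cdot> l) \<cdot> c T"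
  using cmpf(2,3)[OF compGR] by (simp_all add: gR_simps m_def c_def)

definition ee where "ee A \<tau> = [num T] \<rhd> \<tau> \<bullet> sinv (rM T) \<lhd> A"

text \<open>
  The composites \<open>g \<circ> (R \<circ> T)\<close> and \<open>(g \<circ> R) \<circ> T\<close> are formed through different chosen squares, but both are
  \<open>f \<circ> p \<circ> num T\<close> over \<open>den T\<close> up to refinement: \<open>N\<close> and \<open>A\<close> are their tests corresponding to the test
  \<open>X\<close> of \<open>T\<close>, and \<open>DN, BN, DA, BA\<close> below are the resulting changes of coordinates.
\<close>

definition legs where
  "legs X N A \<eta> \<tau> \<delta> q \<longleftrightarrow> pth X \<and> tg X = src C (num T) \<and> N \<noteq> [] \<and> A \<noteq> []
     \<and> iso \<eta> \<and> dom \<eta> = n T # N \<and> cod \<eta> = X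
     \<and> iso \<tau> \<and> dom \<tau> = m T # A \<and> cod \<tau> = X
     \<and> iso \<delta> \<and> dom \<delta> = b T # N \<and> cod \<delta> = p # num T # X
     \<and> [w] \<rhd> \<delta> = [w, p, num T] \<rhd> \<eta> \<bullet> sinv (rN T) \<lhd> N
     \<and> iso q \<and> dom q = p # k # c T # A \<and> cod q = l # c T # A
     \<and> [w] \<rhd> q = rK \<lhd> (c T # A)"

lemma legs_D:
  assumes "legs X N A \<eta> \<tau> \<delta> q"
  shows "pth X" "tg X = src C (num T)" "N \<noteq> []" "A \<noteq> []"
    "iso \<eta>" "dom \<eta> = n T # N" "cod \<eta> = X" "iso \<tau>" "dom \<tau> = m T # A" "cod \<tau> = X"
    "iso \<delta>" "dom \<delta> = b T # N" "cod \<delta> = p # num T # X"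
    "iso q" "dom q = p # k # c T # A" "cod q = l # c T # A"
    "pth N" "pth A" "src C (n T) = tg N" "src C (m T) = tg A" "sr N = sr X" "sr A = sr X"
    "[w] \<rhd> \<delta> = [w, p, num T] \<rhd> \<eta> \<bullet> sinv (rN T) \<lhd> N" "[w] \<rhd> q = rK \<lhd> (c T # A)"
proof -
  show a: "pth X" "tg X = src C (num T)" "N \<noteq> []" "A \<noteq> []"
    "iso \<eta>" "dom \<eta> = n T # N" "cod \<eta> = X" "iso \<tau>" "dom \<tau> = m T # A" "cod \<tau> = X"
    "iso \<delta>" "dom \<delta> = b T # N" "cod \<delta> = p # num T # X"
    "iso q" "dom q = p # k # c T # A" "cod q = l # c T # A"
    "[w] \<rhd> \<delta> = [w, p, num T] \<rhd> \<eta> \<bullet> sinv (rN T) \<lhd> N" "[w] \<rhd> q = rK \<lhd> (c T # A)"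
    using assms by (simp_all add: legs_def)
  show "pth N" "pth A" "src C (n T) = tg N" "src C (m T) = tg A" "sr N = sr X" "sr A = sr X"
    using valid_D[OF iso_valid[OF a(5)]] valid_D[OF iso_valid[OF a(8)]] a(3,4,6,7,9,10) by auto
qed

lemma ee:
  assumes "legs X N A \<eta> \<tau> \<delta> q"
  shows "iso (ee A \<tau>)" "dom (ee A \<tau>) = k # c T # A" "cod (ee A \<tau>) = num T # X"
  by (simp_all add: legs_D(1-22)[OF assms] Tbase base ee_def)

lemma legs_res:
  assumes L: "legs X N A \<eta> \<tau> \<delta> q" and z: "pth z" "tg z = sr X"
  shows "legs (X @ z) (N @ z) (A @ z) (\<eta> \<lhd> z) (\<tau> \<lhd> z) (\<delta> \<lhd> z) (q \<lhd> z)"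
proof -
  note d = legs_D[OF L]
  have "([w] \<rhd> \<delta>) \<lhd> z = ([w, p, num T] \<rhd> \<eta> \<bullet> sinv (rN T) \<lhd> N) \<lhd> z" "([w] \<rhd> q) \<lhd> z = (rK \<lhd> (c T # A)) \<lhd> z" unfolding d(23,24) by simp_all
  then have E: "[w] \<rhd> \<delta> \<lhd> z = [w, p, num T] \<rhd> \<eta> \<lhd> z \<bullet> sinv (rN T) \<lhd> (N @ z)" "[w] \<rhd> q \<lhd> z = rK \<lhd> (c T # A @ z)" by simp_all
  show ?thesis unfolding legs_def by (simp add: d(1-22) E z Tbase base)
qed

text \<open>(BF3) refines \<open>X\<close> to tests that pass through \<open>n T\<close> and
  \<open>m T\<close>. The chosen squares relate \<open>b T\<close> and \<open>l\<close> to
  \<open>p\<close> only behind \<open>w\<close>, so \<delta> and \<open>q\<close> require two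
  further lifts through \<open>w\<close>.\<close>

lemma legs_ex:
  assumes X: "pth X" "tg X = src C (num T)"
  obtains z N A \<eta> \<tau> \<delta> q where "WP z" "tg z = sr X" "legs (X @ z) N A \<eta> \<tau> \<delta> q"
proof -
  note B = Tbase base
  have Wn: "WP [n T]" "WP [m T]" "WP [w]" using B by simp_all
  obtain z1 N0 s1 where s1: "WP z1" "tg z1 = sr X" "iso s1" "dom s1 = X @ z1" "cod s1 = [n T] @ N0" "pth N0" "tg N0 = sr [n T]" "sr N0 = sr z1"
    by (rule bf3[OF Wn(1), of X]) (use B X in simp_all)
  have p1: "pth z1" using s1 by simp
  obtain z2 A0 s2 where s2: "WP z2" "tg z2 = sr (X @ z1)" "iso s2" "dom s2 = (X @ z1) @ z2" "cod s2 = [m T] @ A0" "pth A0" "tg A0 = sr [m T]" "sr A0 = sr z2"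
    by (rule bf3[OF Wn(2), of "X @ z1"]) (use B X s1 p1 in simp_all)
  have p2: "pth z2" using s2 by simp
  let ?N = "N0 @ z2" and ?X = "X @ z1 @ z2"
  let ?h = "sinv s1 \<lhd> z2" and ?t = "sinv s2"
  have h: "iso ?h" "dom ?h = n T # ?N" "cod ?h = ?X" "iso ?t" "dom ?t = m T # A0" "cod ?t = ?X"
    using s1(2-8) s2(2-8) p1 p2 X B by simp_all
  have pN: "pth ?N" "tg ?N = src C (n T)" "sr ?N = sr z2" "pth ?X" "tg ?X = src C (num T)" "sr ?X = sr z2" "pth A0" "tg A0 = src C (m T)" "sr A0 = sr z2"
    using s1(2-8) s2(2-8) p1 p2 X B by simp_all
  let ?D = "[w, p, num T] \<rhd> ?h \<bullet> sinv (rN T) \<lhd> ?N"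
  have D: "iso ?D" "dom ?D = [w] @ b T # ?N" "cod ?D = [w] @ p # num T # ?X" by (simp_all add: h pN B del: rw_rw)
  obtain z3 \<delta> where d: "WP z3" "tg z3 = sr (b T # ?N)" "valid \<delta>" "dom \<delta> = (b T # ?N) @ z3" "cod \<delta> = (p # num T # ?X) @ z3" "?D \<lhd> z3 = [w] \<rhd> \<delta>" "iso ?D \<Longrightarrow> iso \<delta>"
    by (rule lift[OF Wn(3) _ _ iso_valid[OF D(1)] D(2,3)]) (simp_all add: pN B X p1 p2 s1(2) s2(2))
  have p3: "pth z3" using d by simp
  have tz3: "tg z3 = sr z2" using d(2) pN p2 by simp
  let ?Q = "rK \<lhd> (c T # A0 @ z3)"
  have Q: "iso ?Q" "dom ?Q = [w] @ p # k # c T # A0 @ z3" "cod ?Q = [w] @ l # c T # A0 @ z3" by (simp_all add: pN B p3 tz3)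
  obtain z4 q where q: "WP z4" "tg z4 = sr (p # k # c T # A0 @ z3)" "valid q" "dom q = (p # k # c T # A0 @ z3) @ z4" "cod q = (l # c T # A0 @ z3) @ z4"
    "?Q \<lhd> z4 = [w] \<rhd> q" "iso ?Q \<Longrightarrow> iso q"
    by (rule lift[OF Wn(3) _ _ iso_valid[OF Q(1)] Q(2,3)]) (simp_all add: pN B p3 tz3)
  have p4: "pth z4" "tg z4 = sr z3" using q(1,2) p3 by simp_all
  have id: "iso \<delta>" "iso q" using d(7) D q(7) Q by simp_all
  show ?thesis
  proof (rule that[of "z1 @ z2 @ z3 @ z4" "?N @ z3 @ z4" "A0 @ z3 @ z4" "?h \<lhd> (z3 @ z4)" "?t \<lhd> (z3 @ z4)" "\<delta> \<lhd> z4" q])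
    have "WP (z3 @ z4)" by (rule WP_append[OF d(1) q(1)]) (simp add: p4)
    then have "WP (z2 @ z3 @ z4)" by (rule WP_append[OF s2(1)]) (simp add: p3 tz3)
    then show "WP (z1 @ z2 @ z3 @ z4)" by (rule WP_append[OF s1(1)]) (use p1 p2 s2(2) in simp)
    show "tg (z1 @ z2 @ z3 @ z4) = sr X" using s1(2) p1 by simp
    have "[w] \<rhd> \<delta> \<lhd> z4 = ([w] \<rhd> \<delta>) \<lhd> z4" by simp
    also have "\<dots> = [w, p, num T] \<rhd> ?h \<lhd> (z3 @ z4) \<bullet> sinv (rN T) \<lhd> (?N @ z3 @ z4)"
      unfolding d(6)[symmetric] by simp
    finally have E1: "[w] \<rhd> \<delta> \<lhd> z4 = [w, p, num T] \<rhd> ?h \<lhd> (z3 @ z4) \<bullet> sinv (rN T) \<lhd> (?N @ z3 @ z4)" .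
    have E2: "[w] \<rhd> q = rK \<lhd> (c T # A0 @ z3 @ z4)" using q(6) by simp
    have hh: "iso (?h \<lhd> (z3 @ z4))" "dom (?h \<lhd> (z3 @ z4)) = n T # ?N @ z3 @ z4" "cod (?h \<lhd> (z3 @ z4)) = X @ z1 @ z2 @ z3 @ z4"
      "iso (?t \<lhd> (z3 @ z4))" "dom (?t \<lhd> (z3 @ z4)) = m T # A0 @ z3 @ z4" "cod (?t \<lhd> (z3 @ z4)) = X @ z1 @ z2 @ z3 @ z4"
      by (simp_all add: h pN p1 p2 p3 tz3 p4 B del: rw_rw)
    have dd: "iso (\<delta> \<lhd> z4)" "dom (\<delta> \<lhd> z4) = b T # ?N @ z3 @ z4" "cod (\<delta> \<lhd> z4) = p # num T # X @ z1 @ z2 @ z3 @ z4"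
      "dom q = p # k # c T # A0 @ z3 @ z4" "cod q = l # c T # A0 @ z3 @ z4"
      using id d(4,5) q(4,5) by (simp_all add: p3 p4 pN)
    have XX: "pth (X @ z1 @ z2 @ z3 @ z4)" "tg (X @ z1 @ z2 @ z3 @ z4) = src C (num T)"
      using X p1 p2 p3 p4 s1(2) s2(2) tz3 by simp_all
    have ne: "?N @ z3 @ z4 \<noteq> []" "A0 @ z3 @ z4 \<noteq> []" using s1(6) s2(6) by auto
    show "legs (X @ z1 @ z2 @ z3 @ z4) (?N @ z3 @ z4) (A0 @ z3 @ z4) (?h \<lhd> (z3 @ z4)) (?t \<lhd> (z3 @ z4)) (\<delta> \<lhd> z4) q"
      unfolding legs_def using XX hh dd id E1 E2 ne by blast
  qed
qed

definition DN where "DN N \<eta> = [den T] \<rhd> \<eta> \<bullet> ru (den T) \<lhd> (n T # N)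
   \<bullet> sinv (kap [den T, \<one> (src C (num T))]) \<lhd> (n T # N) \<bullet> sinv (kap [den T \<cdot> \<one> (src C (num T)), n T]) \<lhd> N"
definition DA where "DA A \<tau> = [den T] \<rhd> \<tau> \<bullet> sinv (kap [den T, m T]) \<lhd> A"
definition BN where "BN N \<delta> = [f] \<rhd> \<delta> \<bullet> sinv (kap [f, b T]) \<lhd> N"
definition BA where "BA A \<tau> q = [f, p] \<rhd> ee A \<tau> \<bullet> [f] \<rhd> sinv q \<bullet> sinv (K2 T) \<lhd> A"

lemma conj_iso:
  assumes "legs X N A \<eta> \<tau> \<delta> q"
  shows "iso (DN N \<eta>)" "dom (DN N \<eta>) = den (cmpf gg (cmpf R T)) # N" "cod (DN N \<eta>) = den T # X"
    "iso (DA A \<tau>)" "dom (DA A \<tau>) = den (cmpf (cmpf gg R) T) # A" "cod (DA A \<tau>) = den T # X"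
    "iso (BN N \<delta>)" "dom (BN N \<delta>) = num (cmpf gg (cmpf R T)) # N" "cod (BN N \<delta>) = f # p # num T # X"
    "iso (BA A \<tau> q)" "dom (BA A \<tau> q) = num (cmpf (cmpf gg R) T) # A" "cod (BA A \<tau> q) = f # p # num T # X"
  by (simp_all add: legs_D(1-22)[OF assms] ee[OF assms] Tbase base DN_def DA_def BN_def BA_def gRT_simps gRT2_simps)

lemma rN_pr: "sinv (rN T) \<bullet> pr ((w \<cdot> p) \<cdot> num T) w = sinv (KK T) \<lhd> [n T]"
  by (simp add: rN_def KK_def Tbase base cancels)

text \<open>After the changes of coordinates on both sides the associator is the identity: the
  comparisons that its definition asks for can be assembled from \<eta>, \<tau>, \<delta> and
  \<open>q\<close>.\<close>

lemma holds_assoc_legs: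
  assumes L: "legs X N A \<eta> \<tau> \<delta> q"
  shows "cell (cmpf gg (cmpf R T)) (cmpf (cmpf gg R) T) (ascF gg R T)"
    "holds (ascF gg R T) (N, A, sinv (DA A \<tau>) \<bullet> DN N \<eta>, sinv (BA A \<tau> q) \<bullet> BN N \<delta>)"
proof -
  interpret ct: composable_triple C W ch T R gg by unfold_locales (use compR compg in auto)
  show "cell (cmpf gg (cmpf R T)) (cmpf (cmpf gg R) T) (ascF gg R T)" by (rule ct.holds_associator_aux(1))
  note B = Tbase base choiceK
  note d = legs_D(1-22)[OF L] and e = ee[OF L]
  have cc: "ct.sg = pr ((w \<cdot> p) \<cdot> num T) w \<bullet> kap [w \<cdot> p, num T] \<lhd> [n T]"
    "ct.et = sinv (kap [\<one> P, k]) \<lhd> [c T] \<bullet> pr (num T) (\<one> P \<cdot> k)"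
    "ct.J1 = kap [den T \<cdot> \<one> (src C (num T)), n T] \<bullet> kap [den T, \<one> (src C (num T))] \<lhd> [n T]"
    "ct.J2 = kap [den T, m T]" "ct.K1 = kap [f, b T]" "ct.K2 = K2 T" "ct.\<delta> = sinv (lu [num T]) \<bullet> ru (num T)" "ct.\<xi> = pr (w \<cdot> p) w"
    by (simp_all add: ct.sg_def ct.et_def ct.J1_def ct.J2_def ct.K1_def ct.K2_def K2_def pT n_def b_def k_def l_def m_def c_def)
  have et: "sinv (kap [\<one> P, k]) \<lhd> [c T] \<bullet> pr (num T) (\<one> P \<cdot> k) = sinv (lu [k, c T]) \<bullet> rM T"
    by (simp add: rM_def B)
  \<comment> \<open>The unitor accounts for the identity denominator of \<open>R\<close>: the choice
    for \<open>R \<circ> T\<close> puts an identity in front of \<open>n T # N\<close>.\<close>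
  define \<gamma> where "\<gamma> = sinv \<tau> \<bullet> \<eta> \<bullet> lu (n T # N)"
  define \<omega>' where "\<omega>' = sinv (ee A \<tau>) \<bullet> [num T] \<rhd> \<eta>"
  define \<rho> where "\<rho> = q \<bullet> [p] \<rhd> sinv (ee A \<tau>) \<bullet> \<delta>"
  have ig: "iso \<gamma>" "dom \<gamma> = \<one> (src C (num T)) # n T # N" "cod \<gamma> = m T # A" by (simp_all add: \<gamma>_def d B)
  have io: "iso \<omega>'" "dom \<omega>' = num T # n T # N" "cod \<omega>' = k # c T # A" by (simp_all add: \<omega>'_def d e B)
  have ir: "iso \<rho>" "dom \<rho> = b T # N" "cod \<rho> = l # c T # A" by (simp_all add: \<rho>_def d e B)
  have se: "sinv (ee A \<tau>) = rM T \<lhd> A \<bullet> [num T] \<rhd> sinv \<tau>" by (simp add: ee_def d B)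
  have ruN: "ru (num T) \<lhd> (n T # N) = [num T] \<rhd> lu (n T # N)" by (rule triangle_scell) (simp_all add: d B)
  have luN: "lu [num T] \<lhd> (n T # N) = lu (num T # n T # N)" using lu_rw[of "[num T]" "n T # N"] by (simp add: d B)
  have luA: "lu [k, c T] \<lhd> A = lu (k # c T # A)" using lu_rw[of "[k, c T]" A] by (simp add: d B)
  have sluA: "sinv (lu [k, c T]) \<lhd> A = sinv (lu (k # c T # A))" unfolding luA[symmetric] by (simp add: d B)
  have sd: "sinv (sinv (lu [num T]) \<bullet> ru (num T)) \<lhd> (n T # N) = [num T] \<rhd> sinv (lu (n T # N)) \<bullet> lu (num T # n T # N)"
  proof -
    have "sinv (sinv (lu [num T]) \<bullet> ru (num T)) \<lhd> (n T # N) = sinv (ru (num T) \<lhd> (n T # N)) \<bullet> lu [num T] \<lhd> (n T # N)" by (simp add: d B)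
    also have "\<dots> = [num T] \<rhd> sinv (lu (n T # N)) \<bullet> lu (num T # n T # N)" unfolding ruN luN by (simp add: d B)
    finally show ?thesis .
  qed
  have P1: "P = tg (dom \<omega>')" by (simp add: io B)
  have E1: "[\<one> P] \<rhd> \<omega>' = (sinv (lu [k, c T]) \<bullet> rM T) \<lhd> A \<bullet> [num T] \<rhd> \<gamma> \<bullet> sinv (sinv (lu [num T]) \<bullet> ru (num T)) \<lhd> (n T # N)"
    unfolding lu_conj[OF iso_valid[OF io(1)] P1] sd rw_vc sluA io(2,3) \<gamma>_def
    by (simp add: \<omega>'_def se d B cancels)
  have E2: "[w] \<rhd> \<rho> = pr (w \<cdot> p) w \<lhd> (c T # A) \<bullet> [w \<cdot> p] \<rhd> \<omega>' \<bullet> sinv (pr ((w \<cdot> p) \<cdot> num T) w \<bullet> kap [w \<cdot> p, num T] \<lhd> [n T]) \<lhd> N"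
  proof -
    have "[w] \<rhd> \<rho> = ([w] \<rhd> q) \<bullet> [w, p] \<rhd> sinv (ee A \<tau>) \<bullet> ([w] \<rhd> \<delta>)" by (simp add: \<rho>_def)
    also have "\<dots> = rK \<lhd> (c T # A) \<bullet> [w, p] \<rhd> sinv (ee A \<tau>) \<bullet> [w, p, num T] \<rhd> \<eta> \<bullet> sinv (rN T) \<lhd> N"
      unfolding legs_D(23,24)[OF L] by simp
    also have "\<dots> = pr (w \<cdot> p) w \<lhd> (c T # A) \<bullet> [w \<cdot> p] \<rhd> \<omega>' \<bullet> sinv (pr ((w \<cdot> p) \<cdot> num T) w \<bullet> kap [w \<cdot> p, num T] \<lhd> [n T]) \<lhd> N"
      by (simp add: \<omega>'_def rK_def rN_def d e B slides cancels)
    finally show ?thesis .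
  qed
  have H: "holds (ascF gg R T) (N, A,
     kap [den T, m T] \<lhd> A \<bullet> [den T] \<rhd> \<gamma> \<bullet> sinv (kap [den T \<cdot> \<one> (src C (num T)), n T] \<bullet> kap [den T, \<one> (src C (num T))] \<lhd> [n T]) \<lhd> N,
     K2 T \<lhd> A \<bullet> [f] \<rhd> \<rho> \<bullet> sinv (kap [f, b T]) \<lhd> N)"
    using ct.holds_associator[unfolded cc dn pT et, folded k_def l_def, folded n_def b_def m_def c_def, OF ig io ir d(3,4) E1 E2] .
  have ruD: "ru (den T) \<lhd> (n T # N) = [den T] \<rhd> lu (n T # N)" by (rule triangle_scell) (simp_all add: d B)
  have "kap [den T, m T] \<lhd> A \<bullet> [den T] \<rhd> \<gamma> \<bullet> sinv (kap [den T \<cdot> \<one> (src C (num T)), n T] \<bullet> kap [den T, \<one> (src C (num T))] \<lhd> [n T]) \<lhd> N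
     = sinv (DA A \<tau>) \<bullet> DN N \<eta>"
    unfolding DN_def DA_def \<gamma>_def ruD by (simp add: d B)
  moreover have "K2 T \<lhd> A \<bullet> [f] \<rhd> \<rho> \<bullet> sinv (kap [f, b T]) \<lhd> N = sinv (BA A \<tau> q) \<bullet> BN N \<delta>"
    unfolding BN_def BA_def \<rho>_def by (simp add: d e B)
  ultimately show "holds (ascF gg R T) (N, A, sinv (DA A \<tau>) \<bullet> DN N \<eta>, sinv (BA A \<tau> q) \<bullet> BN N \<delta>)" using H by simp
qed

text \<open>If the numerator part of a value of \<Lambda> is \<open>w\<close> applied to \<phi>,
  whiskering by \<open>gg\<close> gives \<open>f\<close> applied to \<phi>, because the lift through
  the denominator \<open>w\<close> of \<open>gg\<close> is \<phi> itself up to coordinates.\<close>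

lemma holds_lwhisk_legs:
  assumes c: "cell S (cmpf R T) \<Lambda>" and k: "composable gg S" and L: "legs X N A \<eta> \<tau> \<delta> q"
    and h: "holds \<Lambda> (pv (num S) w # Y, X, jj T \<lhd> X \<bullet> \<alpha>, KK T \<lhd> X \<bullet> [w] \<rhd> \<phi> \<bullet> pr (num S) w \<lhd> Y)"
    and a: "iso \<alpha>" "dom \<alpha> = den S # pv (num S) w # Y" "cod \<alpha> = den T # X"
    and \<phi>: "valid \<phi>" "dom \<phi> = pf (num S) w # Y" "cod \<phi> = p # num T # X" "Y \<noteq> []"
  shows "holds (whlF gg \<Lambda>) (Y, N,
     sinv (DN N \<eta>) \<bullet> \<alpha> \<bullet> sinv (kap [den S, pv (num S) w]) \<lhd> Y, sinv (BN N \<delta>) \<bullet> [f] \<rhd> \<phi> \<bullet> sinv (kap [f, pf (num S) w]) \<lhd> Y)"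
proof -
  note B = Tbase base and d = legs_D(1-22)[OF L]
  note sc = composable_D[OF k, simplified]
  note s = sc choice[OF sc(3) base(1) sc(9)[symmetric]]
  have y: "pth Y" "src C (pf (num S) w) = tg Y" "sr Y = sr X"
    using valid_D[OF \<phi>(1)] \<phi>(2-4) d by auto
  have yy: "tg Y = src C (pv (num S) w)" using y(2) s by simp
  from holds_iso[OF c h, of "sid (pv (num S) w # Y)" \<eta>]
  have H: "holds \<Lambda> (pv (num S) w # Y, n T # N, [den T \<cdot> \<one> (src C (num T))] \<rhd> sinv \<eta> \<bullet> jj T \<lhd> X \<bullet> \<alpha>,
     [(w \<cdot> p) \<cdot> num T] \<rhd> sinv \<eta> \<bullet> KK T \<lhd> X \<bullet> [w] \<rhd> \<phi> \<bullet> pr (num S) w \<lhd> Y)"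
    by (simp add: d s(1-9) s(11-17) y(1,3) yy a \<phi> RT_simps lw_sid B)
  have W1: "sinv (pr ((w \<cdot> p) \<cdot> num T) w) \<lhd> N \<bullet> [w] \<rhd> (sinv \<delta> \<bullet> \<phi>) = KK T \<lhd> (n T # N) \<bullet> [w, p, num T] \<rhd> sinv \<eta> \<bullet> [w] \<rhd> \<phi>"
  proof -
    have "[w] \<rhd> sinv \<delta> = sinv ([w] \<rhd> \<delta>)" by (simp add: d B)
    also have "\<dots> = rN T \<lhd> N \<bullet> [w, p, num T] \<rhd> sinv \<eta>" unfolding legs_D(23)[OF L] by (simp add: d B)
    finally have "[w] \<rhd> sinv \<delta> = rN T \<lhd> N \<bullet> [w, p, num T] \<rhd> sinv \<eta>" .
    then show ?thesis by (simp add: rN_def KK_def d B \<phi>(1-3) s(1-9) s(11-17) y(1,3) yy cancels)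
  qed
  have E: "[(w \<cdot> p) \<cdot> num T] \<rhd> sinv \<eta> \<bullet> KK T \<lhd> X \<bullet> [w] \<rhd> \<phi> \<bullet> pr (num S) w \<lhd> Y
    = sinv (pr ((w \<cdot> p) \<cdot> num T) w) \<lhd> N \<bullet> [w] \<rhd> (sinv \<delta> \<bullet> \<phi>) \<bullet> pr (num S) w \<lhd> Y"
  proof -
    have "sinv (pr ((w \<cdot> p) \<cdot> num T) w) \<lhd> N \<bullet> [w] \<rhd> (sinv \<delta> \<bullet> \<phi>) \<bullet> pr (num S) w \<lhd> Y
      = (sinv (pr ((w \<cdot> p) \<cdot> num T) w) \<lhd> N \<bullet> [w] \<rhd> (sinv \<delta> \<bullet> \<phi>)) \<bullet> pr (num S) w \<lhd> Y" by simp
    also have "\<dots> = KK T \<lhd> (n T # N) \<bullet> [w, p, num T] \<rhd> sinv \<eta> \<bullet> [w] \<rhd> \<phi> \<bullet> pr (num S) w \<lhd> Y" unfolding W1 by simp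
    also have "\<dots> = [(w \<cdot> p) \<cdot> num T] \<rhd> sinv \<eta> \<bullet> KK T \<lhd> X \<bullet> [w] \<rhd> \<phi> \<bullet> pr (num S) w \<lhd> Y"
      by (simp add: d B \<phi>(1-3) s(11-17) y(1,3) yy slides)
    finally show ?thesis by simp
  qed
  have ph: "valid (sinv \<delta> \<bullet> \<phi>)" "dom (sinv \<delta> \<bullet> \<phi>) = pf (num S) w # Y" "cod (sinv \<delta> \<bullet> \<phi>) = b T # N"
    using d \<phi> by simp_all
  have "holds (whlF gg \<Lambda>) (Y, N,
      kap [den T \<cdot> \<one> (src C (num T)), n T] \<lhd> N \<bullet> ([den T \<cdot> \<one> (src C (num T))] \<rhd> sinv \<eta> \<bullet> jj T \<lhd> X \<bullet> \<alpha>) \<bullet> sinv (kap [den S, pv (num S) w]) \<lhd> Y,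
      kap [f, b T] \<lhd> N \<bullet> [f] \<rhd> (sinv \<delta> \<bullet> \<phi>) \<bullet> sinv (kap [f, pf (num S) w]) \<lhd> Y)"
    using holds_hcomp_left(2)[OF c k, unfolded dn RT_simps, folded n_def b_def, OF ph \<phi>(4) d(3) H[unfolded E]] .
  moreover have "kap [den T \<cdot> \<one> (src C (num T)), n T] \<lhd> N \<bullet> ([den T \<cdot> \<one> (src C (num T))] \<rhd> sinv \<eta> \<bullet> jj T \<lhd> X \<bullet> \<alpha>) \<bullet> sinv (kap [den S, pv (num S) w]) \<lhd> Y
    = sinv (DN N \<eta>) \<bullet> \<alpha> \<bullet> sinv (kap [den S, pv (num S) w]) \<lhd> Y"
    by (simp add: DN_def jj_def d B s(1-9) s(11-17) y(1,3) yy a slides)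
  moreover have "kap [f, b T] \<lhd> N \<bullet> [f] \<rhd> (sinv \<delta> \<bullet> \<phi>) \<bullet> sinv (kap [f, pf (num S) w]) \<lhd> Y = sinv (BN N \<delta>) \<bullet> [f] \<rhd> \<phi> \<bullet> sinv (kap [f, pf (num S) w]) \<lhd> Y"
    by (simp add: BN_def d B)
  ultimately show ?thesis by simp
qed

end

text \<open>The same for a 2-morphism between two composites with \<open>R\<close>; \<eta> and
  \<delta> bring the source into the form treated before.\<close>

lemma holds_lwhisk_legs2:
  assumes T: "ok T" "ok T'" and c: "cell (cmpf R T) (cmpf R T') \<Gamma>"
    and L: "legs T X N A \<eta> \<tau> \<delta> q" and L': "legs T' X' N' A' \<eta>' \<tau>' \<delta>' q'"
    and h: "holds \<Gamma> (X, X', jj T' \<lhd> X' \<bullet> \<alpha> \<bullet> sinv (jj T) \<lhd> X, KK T' \<lhd> X' \<bullet> [w] \<rhd> \<gamma> \<bullet> sinv (KK T) \<lhd> X)"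
    and a: "iso \<alpha>" "dom \<alpha> = den T # X" "cod \<alpha> = den T' # X'"
    and \<gamma>: "valid \<gamma>" "dom \<gamma> = p # num T # X" "cod \<gamma> = p # num T' # X'"
  shows "holds (whlF gg \<Gamma>) (N, N',
     sinv (DN T' N' \<eta>') \<bullet> \<alpha> \<bullet> DN T N \<eta>, sinv (BN T' N' \<delta>') \<bullet> [f] \<rhd> \<gamma> \<bullet> BN T N \<delta>)"
proof -
  note B = Tbase[OF T(1)] base and d = legs_D(1-22)[OF T(1) L]
  note B' = Tbase[OF T(2)] and d' = legs_D(1-22)[OF T(2) L']
  from holds_iso[OF c h, of \<eta> "sid X'"]
  have H: "holds \<Gamma> (n T # N, X', jj T' \<lhd> X' \<bullet> \<alpha> \<bullet> sinv (jj T) \<lhd> X \<bullet> [den T \<cdot> \<one> (src C (num T))] \<rhd> \<eta>,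
     KK T' \<lhd> X' \<bullet> [w] \<rhd> \<gamma> \<bullet> sinv (KK T) \<lhd> X \<bullet> [(w \<cdot> p) \<cdot> num T] \<rhd> \<eta>)"
    by (simp add: d B d' B' a \<gamma> RT_simps[OF T(1)] RT_simps[OF T(2)] lw_sid)
  have E: "KK T' \<lhd> X' \<bullet> [w] \<rhd> \<gamma> \<bullet> sinv (KK T) \<lhd> X \<bullet> [(w \<cdot> p) \<cdot> num T] \<rhd> \<eta>
    = KK T' \<lhd> X' \<bullet> [w] \<rhd> (\<gamma> \<bullet> \<delta>) \<bullet> pr ((w \<cdot> p) \<cdot> num T) w \<lhd> N"
  proof -
    have "[w] \<rhd> (\<gamma> \<bullet> \<delta>) \<bullet> pr ((w \<cdot> p) \<cdot> num T) w \<lhd> N = [w] \<rhd> \<gamma> \<bullet> [w, p, num T] \<rhd> \<eta> \<bullet> ((sinv (rN T) \<bullet> pr ((w \<cdot> p) \<cdot> num T) w) \<lhd> N)"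
      using legs_D(23)[OF T(1) L] by simp
    also have "\<dots> = [w] \<rhd> \<gamma> \<bullet> sinv (KK T) \<lhd> X \<bullet> [(w \<cdot> p) \<cdot> num T] \<rhd> \<eta>"
      unfolding rN_pr[OF T(1)] by (simp add: d B \<gamma> slides)
    finally show ?thesis by simp
  qed
  have E2: "jj T' \<lhd> X' \<bullet> \<alpha> \<bullet> sinv (jj T) \<lhd> X \<bullet> [den T \<cdot> \<one> (src C (num T))] \<rhd> \<eta>
    = jj T' \<lhd> X' \<bullet> (\<alpha> \<bullet> [den T] \<rhd> \<eta> \<bullet> sinv (jj T) \<lhd> (n T # N))"
    by (simp add: d B a slides)
  note q = holds_lwhisk_legs[OF T(2) c compRT[OF T(1)] L', unfolded RT_simps[OF T(1)], folded n_def b_def, OF H[unfolded E E2]]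
  have "holds (whlF gg \<Gamma>) (N, N',
     sinv (DN T' N' \<eta>') \<bullet> (\<alpha> \<bullet> [den T] \<rhd> \<eta> \<bullet> sinv (jj T) \<lhd> (n T # N)) \<bullet> sinv (kap [den T \<cdot> \<one> (src C (num T)), n T]) \<lhd> N,
     sinv (BN T' N' \<delta>') \<bullet> [f] \<rhd> (\<gamma> \<bullet> \<delta>) \<bullet> sinv (kap [f, b T]) \<lhd> N)"
    by (rule q) (simp_all add: d B a \<gamma>)
  moreover have "(\<alpha> \<bullet> [den T] \<rhd> \<eta> \<bullet> sinv (jj T) \<lhd> (n T # N)) \<bullet> sinv (kap [den T \<cdot> \<one> (src C (num T)), n T]) \<lhd> N = \<alpha> \<bullet> DN T N \<eta>"
    by (simp add: DN_def[OF T(1)] jj_def d B a)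
  moreover have "[f] \<rhd> (\<gamma> \<bullet> \<delta>) \<bullet> sinv (kap [f, b T]) \<lhd> N = [f] \<rhd> \<gamma> \<bullet> BN T N \<delta>"
    by (simp add: BN_def[OF T(1)])
  ultimately show ?thesis by simp
qed

end

section \<open>The weak fiber product in \<open>\<C>[W\<^sup>-\<^sup>1]\<close>\<close>

locale two_legs = wfp C W f1 f2 P p1 p2 \<omega> + fraction_choices C W ch
  for C :: "('o, 'm, 'c) bicat" (structure) and W f1 f2 P p1 p2 \<omega> ch +
  fixes w1 w2 :: 'm
  assumes ww: "w1 \<in> W" "src C w1 = src C f1" "w2 \<in> W" "src C w2 = src C f2"
begin

sublocale L1: leg C W ch w1 f1 p1 P
  by unfold_locales (use ww wfp_facts in auto)

sublocale L2: leg C W ch w2 f2 p2 P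
  by unfold_locales (use ww wfp_facts in auto)

lemma facts:
  "iso Om" "dom Om = [f1, p1]" "cod Om = [f2, p2]" "tgt C f2 = tgt C f1"
  using wfp_facts by simp_all

abbreviation gR1 where "gR1 \<equiv> cmpf L1.gg L1.R"
abbreviation gR2 where "gR2 \<equiv> cmpf L2.gg L2.R"

text \<open>With \<open>oB\<close>, the values of the 2-morphism of the square. The numerator of
  \<open>gg \<circ> R\<close> is \<open>f \<cdot> l\<close>, so \<omega> can be inserted only after
  \<open>l\<close> has been replaced by \<open>k\<close> followed by \<open>p\<close>; \<delta>1 and
  \<delta>2 are these replacements, available locally.\<close>

definition oA where "oA x1 x2 \<alpha> = kap [\<one> P, L2.k] \<lhd> x2 \<bullet> [\<one> P] \<rhd> \<alpha> \<bullet> sinv (kap [\<one> P, L1.k]) \<lhd> x1"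
definition oB where "oB x1 x2 \<alpha> \<delta>1 \<delta>2 = kap [f2, L2.l] \<lhd> x2
   \<bullet> ([f2] \<rhd> \<delta>2 \<bullet> Om \<lhd> (L2.k # x2) \<bullet> [f1, p1] \<rhd> \<alpha> \<bullet> [f1] \<rhd> sinv \<delta>1) \<bullet> sinv (kap [f1, L1.l]) \<lhd> x1"

definition ogood :: "('m, 'c) sdatum \<Rightarrow> bool" where
  "ogood = (\<lambda>(x1, x2, a, b). \<exists>\<alpha> \<delta>1 \<delta>2. iso \<alpha> \<and> dom \<alpha> = L1.k # x1 \<and> cod \<alpha> = L2.k # x2 \<and> x1 \<noteq> [] \<and> x2 \<noteq> []
     \<and> iso \<delta>1 \<and> dom \<delta>1 = p1 # L1.k # x1 \<and> cod \<delta>1 = L1.l # x1 \<and> [w1] \<rhd> \<delta>1 = L1.rK \<lhd> x1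
     \<and> iso \<delta>2 \<and> dom \<delta>2 = p2 # L2.k # x2 \<and> cod \<delta>2 = L2.l # x2 \<and> [w2] \<rhd> \<delta>2 = L2.rK \<lhd> x2
     \<and> a = oA x1 x2 \<alpha> \<and> b = oB x1 x2 \<alpha> \<delta>1 \<delta>2)"

lemma ogoodI:
  assumes "iso \<alpha>" "dom \<alpha> = L1.k # x1" "cod \<alpha> = L2.k # x2" "x1 \<noteq> []" "x2 \<noteq> []"
    "iso \<delta>1" "dom \<delta>1 = p1 # L1.k # x1" "cod \<delta>1 = L1.l # x1" "[w1] \<rhd> \<delta>1 = L1.rK \<lhd> x1"
    "iso \<delta>2" "dom \<delta>2 = p2 # L2.k # x2" "cod \<delta>2 = L2.l # x2" "[w2] \<rhd> \<delta>2 = L2.rK \<lhd> x2"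
    "a = oA x1 x2 \<alpha>" "b = oB x1 x2 \<alpha> \<delta>1 \<delta>2"
  shows "ogood (x1, x2, a, b)"
  unfolding ogood_def prod.case using assms by blast

text \<open>\<delta>1 and \<delta>2 are not part of the datum, but cancelling \<open>w1\<close> and
  \<open>w2\<close> determines them as germs, and cancelling \<open>\<one> P\<close> determines
  \<alpha>.\<close>

lemma ogood_good: "good gR1 gR2 ogood"
proof (rule goodI)
  note K = L1.gR_simps L2.gR_simps and B = L1.base L2.base facts
  fix x1 x2 a b assume "ogood (x1, x2, a, b)"
  then obtain \<alpha> \<delta>1 \<delta>2 where g: "iso \<alpha>" "dom \<alpha> = L1.k # x1" "cod \<alpha> = L2.k # x2" "x1 \<noteq> []" "x2 \<noteq> []"
    "iso \<delta>1" "dom \<delta>1 = p1 # L1.k # x1" "cod \<delta>1 = L1.l # x1"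
    "iso \<delta>2" "dom \<delta>2 = p2 # L2.k # x2" "cod \<delta>2 = L2.l # x2"
    and e: "[w1] \<rhd> \<delta>1 = L1.rK \<lhd> x1" "[w2] \<rhd> \<delta>2 = L2.rK \<lhd> x2" and ab: "a = oA x1 x2 \<alpha>" "b = oB x1 x2 \<alpha> \<delta>1 \<delta>2"
    unfolding ogood_def by blast
  have x: "pth x1" "pth x2" "src C L1.k = tg x1" "src C L2.k = tg x2" "sr x2 = sr x1"
    using valid_D[OF iso_valid[OF g(1)]] g(2-5) by auto
  note gg = g x
  show "dat gR1 gR2 (x1, x2, a, b)"
    unfolding dat_def ty_def prod.case K ab oA_def oB_def by (simp add: B gg)
  show "ogood (x1 @ h, x2 @ h, a \<lhd> h, b \<lhd> h)" if h: "pth h" "tg h = sr x1" for h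
  proof (rule ogoodI[of "\<alpha> \<lhd> h" _ _ "\<delta>1 \<lhd> h" "\<delta>2 \<lhd> h"])
    show "[w1] \<rhd> \<delta>1 \<lhd> h = L1.rK \<lhd> (x1 @ h)" "[w2] \<rhd> \<delta>2 \<lhd> h = L2.rK \<lhd> (x2 @ h)"
      using arg_cong[OF e(1), of "\<lambda>s. s \<lhd> h"] arg_cong[OF e(2), of "\<lambda>s. s \<lhd> h"] by simp_all
  qed (simp_all add: gg h B ab oA_def oB_def)
  show "ogood (dom t1, dom t2, [den gR2] \<rhd> sinv t2 \<bullet> a \<bullet> [den gR1] \<rhd> t1, [num gR2] \<rhd> sinv t2 \<bullet> b \<bullet> [num gR1] \<rhd> t1)"
    if t: "iso t1" "iso t2" "cod t1 = x1" "cod t2 = x2" for t1 t2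
  proof -
    note tt = valid_D[OF iso_valid[OF t(1)], unfolded t] valid_D[OF iso_valid[OF t(2)], unfolded t]
    have e1: "[w1] \<rhd> ([L1.l] \<rhd> sinv t1 \<bullet> \<delta>1 \<bullet> [p1, L1.k] \<rhd> t1) = [w1, L1.l] \<rhd> sinv t1 \<bullet> L1.rK \<lhd> x1 \<bullet> [w1, p1, L1.k] \<rhd> t1"
      "[w2] \<rhd> ([L2.l] \<rhd> sinv t2 \<bullet> \<delta>2 \<bullet> [p2, L2.k] \<rhd> t2) = [w2, L2.l] \<rhd> sinv t2 \<bullet> L2.rK \<lhd> x2 \<bullet> [w2, p2, L2.k] \<rhd> t2"
      unfolding e[symmetric] by simp_all
    show ?thesis
    proof (rule ogoodI[of "[L2.k] \<rhd> sinv t2 \<bullet> \<alpha> \<bullet> [L1.k] \<rhd> t1" _ _ "[L1.l] \<rhd> sinv t1 \<bullet> \<delta>1 \<bullet> [p1, L1.k] \<rhd> t1"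
        "[L2.l] \<rhd> sinv t2 \<bullet> \<delta>2 \<bullet> [p2, L2.k] \<rhd> t2"])
      show "[w1] \<rhd> ([L1.l] \<rhd> sinv t1 \<bullet> \<delta>1 \<bullet> [p1, L1.k] \<rhd> t1) = L1.rK \<lhd> dom t1"
        unfolding e1 by (simp add: t tt gg B slides cancels)
      show "[w2] \<rhd> ([L2.l] \<rhd> sinv t2 \<bullet> \<delta>2 \<bullet> [p2, L2.k] \<rhd> t2) = L2.rK \<lhd> dom t2"
        unfolding e1 by (simp add: t tt gg B slides cancels)
      show "[den gR2] \<rhd> sinv t2 \<bullet> a \<bullet> [den gR1] \<rhd> t1 = oA (dom t1) (dom t2) ([L2.k] \<rhd> sinv t2 \<bullet> \<alpha> \<bullet> [L1.k] \<rhd> t1)"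
        unfolding K ab oA_def by (simp add: t tt gg B slides)
      show "[num gR2] \<rhd> sinv t2 \<bullet> b \<bullet> [num gR1] \<rhd> t1 = oB (dom t1) (dom t2) ([L2.k] \<rhd> sinv t2 \<bullet> \<alpha> \<bullet> [L1.k] \<rhd> t1)
          ([L1.l] \<rhd> sinv t1 \<bullet> \<delta>1 \<bullet> [p1, L1.k] \<rhd> t1) ([L2.l] \<rhd> sinv t2 \<bullet> \<delta>2 \<bullet> [p2, L2.k] \<rhd> t2)"
        unfolding K ab oB_def by (simp add: t tt gg B slides cancels)
    qed (simp_all add: t tt gg B)
  qed
  fix a' b' assume "ogood (x1, x2, a', b')" and ea: "a' \<approx> a"
  then obtain \<alpha>' \<delta>1' \<delta>2' where g': "iso \<alpha>'" "dom \<alpha>' = L1.k # x1" "cod \<alpha>' = L2.k # x2"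
    "iso \<delta>1'" "dom \<delta>1' = p1 # L1.k # x1" "cod \<delta>1' = L1.l # x1"
    "iso \<delta>2'" "dom \<delta>2' = p2 # L2.k # x2" "cod \<delta>2' = L2.l # x2"
    and e': "[w1] \<rhd> \<delta>1' = L1.rK \<lhd> x1" "[w2] \<rhd> \<delta>2' = L2.rK \<lhd> x2" and ab': "a' = oA x1 x2 \<alpha>'" "b' = oB x1 x2 \<alpha>' \<delta>1' \<delta>2'"
    unfolding ogood_def by blast
  have "[\<one> P] \<rhd> \<alpha>' \<approx> [\<one> P] \<rhd> \<alpha>"
    by (rule germ_unsandwich[OF ea[unfolded ab ab' oA_def]]) (simp_all add: B gg g')
  then have ea': "\<alpha>' \<approx> \<alpha>" by (rule germ_cancel_lw) (simp_all add: B gg g')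
  have d1: "\<delta>1' \<approx> \<delta>1" by (rule germ_cancel_lw[of "[w1]"]; (unfold e e')?) (simp_all add: B gg g' germ_refl)
  have d2: "\<delta>2' \<approx> \<delta>2" by (rule germ_cancel_lw[of "[w2]"]; (unfold e e')?) (simp_all add: B gg g' germ_refl)
  have s1: "sinv \<delta>1' \<approx> sinv \<delta>1"
  proof -
    obtain z where z: "WP z" "tg z = sr (dom \<delta>1')" "\<delta>1' \<lhd> z = \<delta>1 \<lhd> z" using germ_E[OF d1] .
    have zz: "pth z" "tg z = sr x1" using z by (simp_all add: g' gg)
    have "sinv (\<delta>1' \<lhd> z) = sinv (\<delta>1 \<lhd> z)" unfolding z(3) ..
    then have "sinv \<delta>1' \<lhd> z = sinv \<delta>1 \<lhd> z" by (simp add: gg g' zz)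
    then show ?thesis by (intro germ_I[OF _ _ _ _ z(1)]) (simp_all add: gg g' zz)
  qed
  have "[f2] \<rhd> \<delta>2' \<bullet> Om \<lhd> (L2.k # x2) \<bullet> [f1, p1] \<rhd> \<alpha>' \<bullet> [f1] \<rhd> sinv \<delta>1' \<approx> [f2] \<rhd> \<delta>2 \<bullet> Om \<lhd> (L2.k # x2) \<bullet> [f1, p1] \<rhd> \<alpha> \<bullet> [f1] \<rhd> sinv \<delta>1"
    by (intro germ_vc germ_lw d2 s1 ea' germ_refl) (simp_all add: B gg g')
  then show "b' \<approx> b" unfolding ab ab' oB_def
    by (rule germ_sandwich) (simp_all add: B gg g')
qed

lemma ogood_ex: obtains x1 x2 a b where "ogood (x1, x2, a, b)" "WP (den gR1 # x1)" "iso b"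
proof -
  note B = L1.base L2.base facts
  obtain z x s where z0: "WP z" "tg z = sr [L1.k]" "iso s" "dom s = [L1.k] @ z" "cod s = [L2.k] @ x" "pth x" "tg x = sr [L2.k]" "sr x = sr z"
    by (rule bf3[of "[L2.k]" "[L1.k]"]) (use B in simp_all)
  note z = z0[simplified]
  have pz: "pth z" using z by simp
  obtain z1 \<delta>1 where d1: "WP z1" "tg z1 = sr (p1 # L1.k # z)" "valid \<delta>1" "dom \<delta>1 = (p1 # L1.k # z) @ z1" "cod \<delta>1 = (L1.l # z) @ z1"
    "(L1.rK \<lhd> z) \<lhd> z1 = [w1] \<rhd> \<delta>1" "iso (L1.rK \<lhd> z) \<Longrightarrow> iso \<delta>1"
    by (rule lift[of "[w1]" "p1 # L1.k # z" "L1.l # z" "L1.rK \<lhd> z"]) (simp_all add: B z pz)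
  have z1: "pth z1" "tg z1 = sr z" using d1(1,2) pz by simp_all
  obtain z2 \<delta>2 where d2: "WP z2" "tg z2 = sr (p2 # L2.k # x @ z1)" "valid \<delta>2" "dom \<delta>2 = (p2 # L2.k # x @ z1) @ z2" "cod \<delta>2 = (L2.l # x @ z1) @ z2"
    "(L2.rK \<lhd> (x @ z1)) \<lhd> z2 = [w2] \<rhd> \<delta>2" "iso (L2.rK \<lhd> (x @ z1)) \<Longrightarrow> iso \<delta>2"
    by (rule lift[of "[w2]" "p2 # L2.k # x @ z1" "L2.l # x @ z1" "L2.rK \<lhd> (x @ z1)"]) (simp_all add: B z pz z1)
  have z2: "pth z2" "tg z2 = sr z1" using d2(1,2) z1 by simp_all
  let ?Z = "z @ z1 @ z2" and ?X = "x @ z1 @ z2"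
  let ?a = "s \<lhd> (z1 @ z2)"
  have a: "iso ?a" "dom ?a = L1.k # ?Z" "cod ?a = L2.k # ?X" by (simp_all add: z pz z1 z2 B)
  have i: "iso \<delta>1" "iso \<delta>2" using d1(7) d2(7) by (simp_all add: B z pz z1)
  have dd: "iso (\<delta>1 \<lhd> z2)" "dom (\<delta>1 \<lhd> z2) = p1 # L1.k # ?Z" "cod (\<delta>1 \<lhd> z2) = L1.l # ?Z" "dom \<delta>2 = p2 # L2.k # ?X" "cod \<delta>2 = L2.l # ?X"
    using i d1(4,5) d2(4,5) by (simp_all add: z1 z2)
  have e: "[w1] \<rhd> \<delta>1 \<lhd> z2 = L1.rK \<lhd> ?Z" "[w2] \<rhd> \<delta>2 = L2.rK \<lhd> ?X"
    using arg_cong[OF d1(6), of "\<lambda>s. s \<lhd> z2"] d2(6) by simp_all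
  have ne: "?Z \<noteq> []" "?X \<noteq> []" using pz z by auto
  have og: "ogood (?Z, ?X, oA ?Z ?X ?a, oB ?Z ?X ?a (\<delta>1 \<lhd> z2) \<delta>2)"
    by (rule ogoodI[OF a ne dd(1-3) e(1) i(2) dd(4,5) e(2) refl refl])
  have w: "WP ?Z" using WP_append[OF z(1) WP_append[OF d1(1) d2(1)]] z1 z2 by simp
  have "WP [den gR1]" using L1.gR_simps L1.base by (simp add: BF2)
  then have "WP (den gR1 # ?Z)" using WP_append[OF _ w, of "[den gR1]"] L1.gR_simps B z pz by simp
  moreover have "iso (oB ?Z ?X ?a (\<delta>1 \<lhd> z2) \<delta>2)"
    unfolding oB_def using dd(2-5) a(2,3) by (simp add: B dd(1) i a(1) z pz z1 z2)
  ultimately show ?thesis using that og by blast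
qed

text \<open>\<open>ogood\<close> being a good set, every admissible choice spans the same class;
  \<open>SOME\<close> merely fixes one.\<close>

definition Omega where
  "Omega = (let (x1, x2, a, b) = (SOME d. ogood d \<and> WP (den gR1 # fst d) \<and> iso (snd (snd (snd d)))) in cls gR1 gR2 (x1, x2, a, b))"

lemma parO: "par gR1 gR2"
  unfolding par_def cmpf(5,6)[OF L1.compg] cmpf(5,6)[OF L2.compg]
  using cmpf(4)[OF L1.compg] cmpf(4)[OF L2.compg] facts
  by (simp add: L1.R_def L2.R_def L1.gg_def L2.gg_def frac_src_def frac_tgt_def)

lemma Omega:
  shows cell_Omega: "cell gR1 gR2 Omega" and holds_Omega: "ogood D \<Longrightarrow> holds Omega D" and inv_Omega: "Omega \<in> inv_cells Fr gR1 gR2"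
proof -
  define d where "d = (SOME d. ogood d \<and> WP (den gR1 # fst d) \<and> iso (snd (snd (snd d))))"
  obtain x1 x2 a b where d: "d = (x1, x2, a, b)" by (cases d)
  have "\<exists>d. ogood d \<and> WP (den gR1 # fst d) \<and> iso (snd (snd (snd d)))"
  proof -
    obtain x1 x2 a b where "ogood (x1, x2, a, b)" "WP (den gR1 # x1)" "iso b" using ogood_ex .
    then have "ogood (x1, x2, a, b) \<and> WP (den gR1 # fst (x1, x2, a, b)) \<and> iso (snd (snd (snd (x1, x2, a, b))))" by simp
    then show ?thesis by blast
  qed
  from someI_ex[OF this] have h: "ogood (x1, x2, a, b)" "WP (den gR1 # x1)" "iso b" by (simp_all add: d flip: d_def)
  have O: "Omega = cls gR1 gR2 (x1, x2, a, b)" by (simp add: Omega_def d flip: d_def)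
  note c = cls_good[OF parO ogood_good h(1,2), folded O]
  show "cell gR1 gR2 Omega" "ogood D \<Longrightarrow> holds Omega D" by (rule c(1)) (rule c(2))
  show "Omega \<in> inv_cells Fr gR1 gR2" by (rule inverseI[OF c(1) c(2)[OF h(1)] h(3,2)])
qed

text \<open>In the coordinates of the legs, whiskering by \<open>T\<close> turns
  \<open>Omega\<close> into \<omega> restricted along \<open>num T # X\<close>: the cells
  \<open>q1\<close> and \<open>q2\<close> of the legs play the part of \<delta>1 and \<delta>2 and
  are absorbed by the coordinates.\<close>

lemma holds_Omega_whisk:
  assumes T: "L1.ok T"
    and l1: "L1.legs T X N1 A1 \<eta>1 \<tau>1 \<delta>1 q1" and l2: "L2.legs T X N2 A2 \<eta>2 \<tau>2 \<delta>2 q2"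
  shows "cell (cmpf gR1 T) (cmpf gR2 T) (whrF Omega T)"
    "holds (whrF Omega T)
       (A1, A2, sinv (L2.DA T A2 \<tau>2) \<bullet> L1.DA T A1 \<tau>1, sinv (L2.BA T A2 \<tau>2 q2) \<bullet> Om \<lhd> (num T # X) \<bullet> L1.BA T A1 \<tau>1 q1)"
proof -
  have T2: "L2.ok T" using T by (simp add: L1.ok_def L2.ok_def)
  note B = L1.base L2.base facts and t1 = L1.Tbase[OF T] and t2 = L2.Tbase(6-38)[OF T2]
  note d1 = L1.legs_D(1-22)[OF T l1] and d2 = L2.legs_D(1-22)[OF T2 l2]
  note e1 = L1.ee[OF T l1] and e2 = L2.ee[OF T2 l2]
  define \<alpha> where "\<alpha> = sinv (L2.ee T A2 \<tau>2) \<bullet> L1.ee T A1 \<tau>1"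
  define \<epsilon> where "\<epsilon> = sinv \<tau>2 \<bullet> \<tau>1"
  have a: "iso \<alpha>" "dom \<alpha> = L1.k # L1.c T # A1" "cod \<alpha> = L2.k # L2.c T # A2" by (simp_all add: \<alpha>_def e1 e2)
  have ep: "iso \<epsilon>" "dom \<epsilon> = L1.m T # A1" "cod \<epsilon> = L2.m T # A2" by (simp_all add: \<epsilon>_def d1 d2)
  have "ogood (L1.c T # A1, L2.c T # A2, oA (L1.c T # A1) (L2.c T # A2) \<alpha>, oB (L1.c T # A1) (L2.c T # A2) \<alpha> q1 q2)"
    by (rule ogoodI[OF a _ _ d1(14-16) L1.legs_D(24)[OF T l1] d2(14-16) L2.legs_D(24)[OF T2 l2] refl refl]) simp_all
  then have H: "holds Omega (L1.c T # A1, L2.c T # A2, oA (L1.c T # A1) (L2.c T # A2) \<alpha>, oB (L1.c T # A1) (L2.c T # A2) \<alpha> q1 q2)"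
    by (rule holds_Omega)
  have A: "oA (L1.c T # A1) (L2.c T # A2) \<alpha>
     = pr (num T) (\<one> P \<cdot> L2.k) \<lhd> A2 \<bullet> [num T] \<rhd> \<epsilon> \<bullet> sinv (pr (num T) (\<one> P \<cdot> L1.k)) \<lhd> A1"
  proof -
    have P1: "P = tg (dom \<alpha>)" by (simp add: a B)
    have lu1: "lu [L1.k, L1.c T] \<lhd> A1 = lu (L1.k # L1.c T # A1)" using lu_rw[of "[L1.k, L1.c T]" A1] by (simp add: d1 t1 B)
    have lu2: "lu [L2.k, L2.c T] \<lhd> A2 = lu (L2.k # L2.c T # A2)" using lu_rw[of "[L2.k, L2.c T]" A2] by (simp add: d2 t2 B)
    have s2: "sinv (lu (L2.k # L2.c T # A2)) = sinv (lu [L2.k, L2.c T]) \<lhd> A2" unfolding lu2[symmetric] by (simp add: d2 t2 B)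
    have "[\<one> P] \<rhd> \<alpha> = sinv (lu [L2.k, L2.c T]) \<lhd> A2 \<bullet> \<alpha> \<bullet> lu [L1.k, L1.c T] \<lhd> A1"
      unfolding lu_conj[OF iso_valid[OF a(1)] P1] a(2,3) lu1 s2 ..
    then show ?thesis
      unfolding oA_def by (simp add: \<alpha>_def \<epsilon>_def L1.ee_def[OF T] L2.ee_def[OF T2] L1.rM_def L2.rM_def d1 d2 t1 t2 B cancels)
  qed
  have k: "composable gR1 T" by (rule L1.compGR[OF T])
  show "cell (cmpf gR1 T) (cmpf gR2 T) (whrF Omega T)" by (rule cell_hcomp_right[OF cell_Omega k])
  have "holds (whrF Omega T) (A1, A2,
           kap [den T, L2.m T] \<lhd> A2 \<bullet> [den T] \<rhd> \<epsilon> \<bullet> sinv (kap [den T, L1.m T]) \<lhd> A1,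
           kap [f2 \<cdot> L2.l, L2.c T] \<lhd> A2 \<bullet> oB (L1.c T # A1) (L2.c T # A2) \<alpha> q1 q2 \<bullet> sinv (kap [f1 \<cdot> L1.l, L1.c T]) \<lhd> A1)"
    using holds_hcomp_right(2)[OF cell_Omega k, unfolded L1.gR_simps L2.gR_simps, folded L1.m_def[of T] L2.m_def[of T] L1.c_def[of T] L2.c_def[of T],
      OF ep d1(4) d2(4) H[unfolded A]] .
  moreover have "kap [den T, L2.m T] \<lhd> A2 \<bullet> [den T] \<rhd> \<epsilon> \<bullet> sinv (kap [den T, L1.m T]) \<lhd> A1 = sinv (L2.DA T A2 \<tau>2) \<bullet> L1.DA T A1 \<tau>1"
    by (simp add: L1.DA_def[OF T] L2.DA_def[OF T2] \<epsilon>_def d1 d2 t1 t2)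
  moreover have "kap [f2 \<cdot> L2.l, L2.c T] \<lhd> A2 \<bullet> oB (L1.c T # A1) (L2.c T # A2) \<alpha> q1 q2 \<bullet> sinv (kap [f1 \<cdot> L1.l, L1.c T]) \<lhd> A1
     = sinv (L2.BA T A2 \<tau>2 q2) \<bullet> Om \<lhd> (num T # X) \<bullet> L1.BA T A1 \<tau>1 q1"
    by (simp add: L1.BA_def[OF T] L2.BA_def[OF T2] oB_def L1.K2_def L2.K2_def \<alpha>_def e1 e2 d1 d2 t1 t2 B slides cancels)
  ultimately show "holds (whrF Omega T)
       (A1, A2, sinv (L2.DA T A2 \<tau>2) \<bullet> L1.DA T A1 \<tau>1, sinv (L2.BA T A2 \<tau>2 q2) \<bullet> Om \<lhd> (num T # X) \<bullet> L1.BA T A1 \<tau>1 q1)" by simp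
qed

end

context leg
begin

text \<open>Coordinates for 2-morphisms into \<open>R \<circ> T\<close>, and with
  \<open>\<Gamma>dat\<close> between two such composites: the numerator part starts with
  \<open>w\<close>, and \<phi> or \<gamma> is what remains when \<open>w\<close> is stripped
  off.\<close>

definition \<Lambda>dat where
  "\<Lambda>dat S T Y X \<alpha> \<phi> = (pv (num S) w # Y, X, jj T \<lhd> X \<bullet> \<alpha>, KK T \<lhd> X \<bullet> [w] \<rhd> \<phi> \<bullet> pr (num S) w \<lhd> Y)"

definition \<Gamma>dat where
  "\<Gamma>dat T T' X X' \<alpha> \<gamma> = (X, X', jj T' \<lhd> X' \<bullet> \<alpha> \<bullet> sinv (jj T) \<lhd> X, KK T' \<lhd> X' \<bullet> [w] \<rhd> \<gamma> \<bullet> sinv (KK T) \<lhd> X)"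

text \<open>An invertible 2-morphism can be prescribed by one invertible value over a member of
  \<open>W\<close>; this provides the 2-morphisms demanded by condition A1.\<close>

lemma inv_cell_into:
  assumes T: "ok T" and k: "composable gg S" and P: "par S (cmpf R T)"
    and a: "iso \<alpha>" "dom \<alpha> = den S # pv (num S) w # Y" "cod \<alpha> = den T # X"
    and ph: "iso \<phi>" "dom \<phi> = pf (num S) w # Y" "cod \<phi> = p # num T # X"
    and Y: "Y \<noteq> []" "X \<noteq> []" and WY: "WP (den S # pv (num S) w # Y)"
  obtains \<Lambda> where "\<Lambda> \<in> inv_cells Fr S (cmpf R T)" "holds \<Lambda> (\<Lambda>dat S T Y X \<alpha> \<phi>)"
proof -
  note B = Tbase[OF T] base
  note sc = composable_D[OF k, simplified]
  note s = sc choice[OF sc(3) base(1) sc(9)[symmetric]]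
  note va = valid_D[OF iso_valid[OF a(1)], unfolded a]
  have y: "pth Y" "pth X" "tg Y = src C (pv (num S) w)" "tg X = src C (num T)" "sr Y = sr X"
    using va Y Tbase(4)[OF T] by auto
  have D: "dat S (cmpf R T) (\<Lambda>dat S T Y X \<alpha> \<phi>)"
    unfolding dat_def ty_def \<Lambda>dat_def prod.case RT_simps[OF T] by (simp add: a ph y Y s(1-9) s(11-18) B)
  note c = cls[OF P D[unfolded \<Lambda>dat_def] WY]
  have i: "iso (KK T \<lhd> X \<bullet> [w] \<rhd> \<phi> \<bullet> pr (num S) w \<lhd> Y)" by (simp add: ph y Y s(1-9) s(11-18) B)
  show ?thesis by (rule that[OF inverseI[OF c i WY]]) (simp add: \<Lambda>dat_def c(2))
qed

lemma \<Lambda>dat_res: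
  assumes T: "ok T" and k: "composable gg S"
    and "holds \<Lambda> (\<Lambda>dat S T Y X \<alpha> \<phi>)" "cell S (cmpf R T) \<Lambda>" "pth h" "tg h = sr Y" "Y \<noteq> []"
  shows "holds \<Lambda> (\<Lambda>dat S T (Y @ h) (X @ h) (\<alpha> \<lhd> h) (\<phi> \<lhd> h))"
  using holds_res[OF assms(4) assms(3)[unfolded \<Lambda>dat_def], of h] assms(5-7) by (simp add: \<Lambda>dat_def)

text \<open>The coordinate changes at \<open>gg \<circ> (R \<circ> T)\<close> occur in one factor
  and inverted in the other, and cancel.\<close>

lemma holds_assoc_lwhisk:
  assumes T: "ok T" and c: "cell S (cmpf R T) \<Lambda>" and k: "composable gg S" and L: "legs T X N A \<eta> \<tau> \<delta> q"
    and h: "holds \<Lambda> (\<Lambda>dat S T Y X \<alpha> \<phi>)"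
    and a: "iso \<alpha>" "dom \<alpha> = den S # pv (num S) w # Y" "cod \<alpha> = den T # X"
    and \<phi>: "valid \<phi>" "dom \<phi> = pf (num S) w # Y" "cod \<phi> = p # num T # X" "Y \<noteq> []"
  shows "cell (cmpf gg S) (cmpf (cmpf gg R) T) (vcF (ascF gg R T) (whlF gg \<Lambda>))"
    "holds (vcF (ascF gg R T) (whlF gg \<Lambda>)) (Y, A,
     sinv (DA T A \<tau>) \<bullet> \<alpha> \<bullet> sinv (kap [den S, pv (num S) w]) \<lhd> Y, sinv (BA T A \<tau> q) \<bullet> [f] \<rhd> \<phi> \<bullet> sinv (kap [f, pf (num S) w]) \<lhd> Y)"
proof -
  note C1 = cell_hcomp_left[OF c k] and H1 = holds_lwhisk_legs[OF T c k L h[unfolded \<Lambda>dat_def] a \<phi>]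
  note A = holds_assoc_legs[OF T L]
  note d = legs_D(1-22)[OF T L] and B = Tbase[OF T] base and q = conj_iso[OF T L]
  note sc = composable_D[OF k, simplified]
  note s = sc choice[OF sc(3) base(1) sc(9)[symmetric]]
  show "cell (cmpf gg S) (cmpf (cmpf gg R) T) (vcF (ascF gg R T) (whlF gg \<Lambda>))"
    by (rule cell_vcomp[OF C1 A(1)])
  have y: "pth Y" "tg Y = src C (pv (num S) w)" "tg Y = src C (pf (num S) w)"
    using valid_D(1,6)[OF iso_valid[OF a(1)], unfolded a] valid_D(1,6)[OF \<phi>(1), unfolded \<phi>] \<phi>(4) by auto
  have e: "(sinv (DA T A \<tau>) \<bullet> DN T N \<eta>) \<bullet> sinv (DN T N \<eta>) \<bullet> \<alpha> \<bullet> sinv (kap [den S, pv (num S) w]) \<lhd> Y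
     = sinv (DA T A \<tau>) \<bullet> \<alpha> \<bullet> sinv (kap [den S, pv (num S) w]) \<lhd> Y"
    "(sinv (BA T A \<tau> q) \<bullet> BN T N \<delta>) \<bullet> sinv (BN T N \<delta>) \<bullet> [f] \<rhd> \<phi> \<bullet> sinv (kap [f, pf (num S) w]) \<lhd> Y
     = sinv (BA T A \<tau> q) \<bullet> [f] \<rhd> \<phi> \<bullet> sinv (kap [f, pf (num S) w]) \<lhd> Y"
    by (simp_all add: q a \<phi> y s(1-9) s(11-18) base cancels)
  show "holds (vcF (ascF gg R T) (whlF gg \<Lambda>)) (Y, A,
     sinv (DA T A \<tau>) \<bullet> \<alpha> \<bullet> sinv (kap [den S, pv (num S) w]) \<lhd> Y, sinv (BA T A \<tau> q) \<bullet> [f] \<rhd> \<phi> \<bullet> sinv (kap [f, pf (num S) w]) \<lhd> Y)"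
    using holds_vcomp(2)[OF C1 A(1) H1 A(2)] unfolding e .
qed

context
  fixes T T' assumes T: "ok T" "ok T'"
begin

lemma \<Gamma>dat_res:
  assumes c: "cell (cmpf R T) (cmpf R T') \<Gamma>" and h: "holds \<Gamma> (\<Gamma>dat T T' X X' \<alpha> \<gamma>)" and z: "pth h" "tg h = sr X"
  shows "holds \<Gamma> (\<Gamma>dat T T' (X @ h) (X' @ h) (\<alpha> \<lhd> h) (\<gamma> \<lhd> h))"
  using holds_res[OF c h[unfolded \<Gamma>dat_def] z] by (simp add: \<Gamma>dat_def)

text \<open>Three refinements: one for a value at the given test, one to make it invertible, one to
  lift it through \<open>w\<close>.\<close>

lemma inv_cell_lift:
  assumes I: "\<Gamma> \<in> inv_cells Fr (cmpf R T) (cmpf R T')"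
    and a: "iso \<alpha>" "dom \<alpha> = den T # X" "cod \<alpha> = den T' # X'" "X \<noteq> []" "X' \<noteq> []"
  obtains z \<gamma> where "WP z" "tg z = sr X" "iso \<gamma>" "dom \<gamma> = p # num T # X @ z" "cod \<gamma> = p # num T' # X' @ z"
    "holds \<Gamma> (\<Gamma>dat T T' (X @ z) (X' @ z) (\<alpha> \<lhd> z) \<gamma>)"
proof -
  note B = Tbase[OF T(1)] Tbase[OF T(2)] base
  obtain \<Delta> where I': "inverse (cmpf R T) (cmpf R T') \<Gamma> \<Delta>" using I inv_cells_Fr by blast
  then have c: "cell (cmpf R T) (cmpf R T') \<Gamma>" by (simp add: inverse_def)
  have x: "pth X" "pth X'" "tg X = src C (num T)" "tg X' = src C (num T')" "sr X' = sr X"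
    using valid_D[OF iso_valid[OF a(1)], unfolded a] a(4,5) Tbase(4)[OF T(1)] Tbase(4)[OF T(2)] by auto
  let ?a = "jj T' \<lhd> X' \<bullet> \<alpha> \<bullet> sinv (jj T) \<lhd> X"
  have ia: "iso ?a" "dom ?a = den (cmpf R T) # X" "cod ?a = den (cmpf R T') # X'"
    unfolding RT_simps[OF T(1)] RT_simps[OF T(2)] by (simp_all add: a x B)
  obtain z1 b where z1: "WP z1" "tg z1 = sr X" "holds \<Gamma> (X @ z1, X' @ z1, ?a \<lhd> z1, b)" using holds_ex[OF c ia x(1,2)] .
  obtain z2 where z2: "WP z2" "tg z2 = sr (X @ z1)" "iso (b \<lhd> z2)" using holds_inverse_ex[OF I' z1(3)] by blast
  have p: "pth z1" "pth z2" "tg z2 = sr z1" using z1 z2 by simp_all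
  have H: "holds \<Gamma> (X @ z1 @ z2, X' @ z1 @ z2, ?a \<lhd> z1 \<lhd> z2, b \<lhd> z2)" using holds_res[OF c z1(3) p(2) z2(2)] by simp
  note dd = dat_D[OF holds_dat[OF c H]]
  have db: "dom (b \<lhd> z2) = ((w \<cdot> p) \<cdot> num T) # X @ z1 @ z2" "cod (b \<lhd> z2) = ((w \<cdot> p) \<cdot> num T') # X' @ z1 @ z2"
    using dd by (simp_all add: RT_simps[OF T(1)] RT_simps[OF T(2)])
  let ?s = "sinv (KK T') \<lhd> (X' @ z1 @ z2) \<bullet> b \<lhd> z2 \<bullet> KK T \<lhd> (X @ z1 @ z2)"
  have s: "iso ?s" "dom ?s = [w] @ p # num T # X @ z1 @ z2" "cod ?s = [w] @ p # num T' # X' @ z1 @ z2"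
    by (simp_all add: z2 db x p z1 B)
  obtain z3 \<gamma> where z3: "WP z3" "tg z3 = sr (p # num T # X @ z1 @ z2)" "valid \<gamma>" "dom \<gamma> = (p # num T # X @ z1 @ z2) @ z3" "cod \<gamma> = (p # num T' # X' @ z1 @ z2) @ z3"
    "?s \<lhd> z3 = [w] \<rhd> \<gamma>" "iso ?s \<Longrightarrow> iso \<gamma>"
    by (rule lift[OF _ _ _ iso_valid[OF s(1)] s(2,3)]) (simp_all add: x p z1 B)
  have p3: "pth z3" "tg z3 = sr z2" using z3(1,2) p by simp_all
  show ?thesis
  proof (rule that[of "z1 @ z2 @ z3" \<gamma>])
    show "WP (z1 @ z2 @ z3)" using WP_append[OF z1(1) WP_append[OF z2(1) z3(1)]] p p3 by simp
    show "tg (z1 @ z2 @ z3) = sr X" using z1 p by simp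
    show "iso \<gamma>" by (rule z3(7)[OF s(1)])
    show "dom \<gamma> = p # num T # X @ z1 @ z2 @ z3" "cod \<gamma> = p # num T' # X' @ z1 @ z2 @ z3" using z3(4,5) by simp_all
    have H3: "holds \<Gamma> (X @ z1 @ z2 @ z3, X' @ z1 @ z2 @ z3, ?a \<lhd> (z1 @ z2 @ z3), b \<lhd> (z2 @ z3))"
      using holds_res[OF c H p3(1)] p3(2) p by simp
    have "b \<lhd> (z2 @ z3) = (KK T' \<lhd> (X' @ z1 @ z2) \<bullet> ?s \<bullet> sinv (KK T) \<lhd> (X @ z1 @ z2)) \<lhd> z3"
      by (simp add: z2 db x p p3 z1 B cancels)
    also have "\<dots> = KK T' \<lhd> (X' @ z1 @ z2 @ z3) \<bullet> (?s \<lhd> z3) \<bullet> sinv (KK T) \<lhd> (X @ z1 @ z2 @ z3)" by simp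
    finally have "b \<lhd> (z2 @ z3) = KK T' \<lhd> (X' @ z1 @ z2 @ z3) \<bullet> [w] \<rhd> \<gamma> \<bullet> sinv (KK T) \<lhd> (X @ z1 @ z2 @ z3)" unfolding z3(6) .
    then show "holds \<Gamma> (\<Gamma>dat T T' (X @ z1 @ z2 @ z3) (X' @ z1 @ z2 @ z3) (\<alpha> \<lhd> (z1 @ z2 @ z3)) \<gamma>)"
      using H3 by (simp add: \<Gamma>dat_def)
  qed
qed

text \<open>The choice for \<open>num T\<close> against the identity denominator of \<open>R\<close>
  consists of unitors, and by the triangle they match those in \<open>jj\<close>. What is left is
  whiskering by the numerator of \<open>R\<close>.\<close>

lemma holds_R_whisk:
  assumes c: "cell T T' \<Gamma>" and h: "holds \<Gamma> (y, y', \<alpha>, \<gamma>)"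
  shows "cell (cmpf R T) (cmpf R T') (whlF R \<Gamma>)"
    "holds (whlF R \<Gamma>) (\<Gamma>dat T T' y y' \<alpha> ([p] \<rhd> \<gamma>))"
proof -
  note B = Tbase[OF T(1)] Tbase[OF T(2)] base
  note k = compR[OF T(1)]
  note d = dat_D[OF holds_dat[OF c h]]
  show "cell (cmpf R T) (cmpf R T') (whlF R \<Gamma>)" by (rule cell_hcomp_left[OF c k])
  have P1: "P = tg (dom \<gamma>)" using d B by simp
  note r = triangle_scell[of y "num T"] triangle_scell[of y' "num T'"] triangle_scell[of y "den T"] triangle_scell[of y' "den T'"]
  note l1 = lu_rw[of "[num T]" y] lu_rw[of "[num T']" y']
  have r': "ru (num T) \<lhd> y = [num T] \<rhd> lu y" "ru (num T') \<lhd> y' = [num T'] \<rhd> lu y'"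
    "ru (den T) \<lhd> y = [den T] \<rhd> lu y" "ru (den T') \<lhd> y' = [den T'] \<rhd> lu y'"
    "lu [num T] \<lhd> y = lu (num T # y)" "lu [num T'] \<lhd> y' = lu (num T' # y')"
    using r l1 by (simp_all add: d B(1-5) B(39-43))
  have sr': "sinv (ru (den T)) \<lhd> y = [den T] \<rhd> sinv (lu y)" "sinv (ru (den T')) \<lhd> y' = [den T'] \<rhd> sinv (lu y')"
    "sinv (ru (num T')) \<lhd> y' = [num T'] \<rhd> sinv (lu y')" "sinv (lu [num T]) \<lhd> y = sinv (lu (num T # y))"
    using arg_cong[OF r'(3), of sinv] arg_cong[OF r'(4), of sinv] arg_cong[OF r'(2), of sinv] arg_cong[OF r'(5), of sinv] by (simp_all add: d B(1-5) B(39-43))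
  from holds_iso[OF c h, of "lu y" "lu y'"]
  have H: "holds \<Gamma> (\<one> (src C (num T)) # y, \<one> (src C (num T')) # y', [den T'] \<rhd> sinv (lu y') \<bullet> \<alpha> \<bullet> [den T] \<rhd> lu y,
     [num T'] \<rhd> sinv (lu y') \<bullet> \<gamma> \<bullet> [num T] \<rhd> lu y)"
    by (simp add: d B(1-5) B(39-43))
  have E: "[num T'] \<rhd> sinv (lu y') \<bullet> \<gamma> \<bullet> [num T] \<rhd> lu y
    = sinv (pr (num T') (\<one> P)) \<lhd> y' \<bullet> [\<one> P] \<rhd> \<gamma> \<bullet> pr (num T) (\<one> P) \<lhd> y"
    unfolding lu_conj[OF d(5) P1] pT[OF T(1)] pT[OF T(2)] by (simp add: r' sr' d B(1-5) B(39-43) cancels)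
  have ne: "y \<noteq> []" "y' \<noteq> []" using d(8,9) by auto
  have H2: "holds (whlF R \<Gamma>) (y, y',
     kap [den T', \<one> (src C (num T'))] \<lhd> y' \<bullet> ([den T'] \<rhd> sinv (lu y') \<bullet> \<alpha> \<bullet> [den T] \<rhd> lu y) \<bullet> sinv (kap [den T, \<one> (src C (num T))]) \<lhd> y,
     kap [w \<cdot> p, num T'] \<lhd> y' \<bullet> [w \<cdot> p] \<rhd> \<gamma> \<bullet> sinv (kap [w \<cdot> p, num T]) \<lhd> y)"
    by (rule holds_hcomp_left(2)[OF c k, unfolded dn pT[OF T(1)] pT[OF T(2)], OF d(5-7) ne H[unfolded E pT[OF T(1)] pT[OF T(2)]]])
  have E1: "kap [den T', \<one> (src C (num T'))] \<lhd> y' \<bullet> ([den T'] \<rhd> sinv (lu y') \<bullet> \<alpha> \<bullet> [den T] \<rhd> lu y) \<bullet> sinv (kap [den T, \<one> (src C (num T))]) \<lhd> y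
    = jj T' \<lhd> y' \<bullet> \<alpha> \<bullet> sinv (jj T) \<lhd> y"
    by (simp add: jj_def d B(1-5) B(39-43) r' sr')
  have E2: "kap [w \<cdot> p, num T'] \<lhd> y' \<bullet> [w \<cdot> p] \<rhd> \<gamma> \<bullet> sinv (kap [w \<cdot> p, num T]) \<lhd> y
    = KK T' \<lhd> y' \<bullet> [w] \<rhd> ([p] \<rhd> \<gamma>) \<bullet> sinv (KK T) \<lhd> y"
    by (simp add: KK_def d B(1-5) B(39-43) base slides cancels)
  show "holds (whlF R \<Gamma>) (\<Gamma>dat T T' y y' \<alpha> ([p] \<rhd> \<gamma>))"
    using H2 unfolding E1 E2 \<Gamma>dat_def .
qed

end

end

context fraction_choices
begin

lemma inv_cells_representative:
  assumes "\<Lambda> \<in> inv_cells Fr F1 F2"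
  obtains x1 x2 \<alpha> \<beta> where "holds \<Lambda> (x1, x2, \<alpha>, \<beta>)" "iso \<beta>" "WP (den F1 # x1)"
proof -
  obtain \<Delta> where I: "inverse F1 F2 \<Lambda> \<Delta>" using assms inv_cells_Fr by blast
  then have c: "cell F1 F2 \<Lambda>" by (simp add: inverse_def)
  obtain d0 where d0: "d0 \<in> snd (snd \<Lambda>)" using cell_data(1)[OF c] by blast
  obtain x1 x2 \<alpha> \<beta> where D0: "sd F1 F2 d0 = (x1, x2, \<alpha>, \<beta>)" by (cases "sd F1 F2 d0")
  have h: "holds \<Lambda> (x1, x2, \<alpha>, \<beta>)" using holds_sd[OF c d0] by (simp add: D0)
  have W0: "WP (den F1 # x1)" using wdat_sd[OF cell_par[OF c] cell_data(2)[OF c d0]] by (simp add: D0 wdat_def)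
  obtain z where z: "WP z" "tg z = sr x1" "iso (\<beta> \<lhd> z)" using holds_inverse_ex[OF I h] by blast
  have x: "pth x1" using dat_D(8)[OF holds_dat[OF c h]] .
  have "holds \<Lambda> (x1 @ z, x2 @ z, \<alpha> \<lhd> z, \<beta> \<lhd> z)" by (rule holds_res[OF c h]) (use z in simp_all)
  moreover have "WP (den F1 # x1 @ z)" using WP_append[OF W0 z(1)] z x by (cases "x1 = []") simp_all
  ultimately show ?thesis using that z(3) by blast
qed

end

context leg
begin

lemma par_R:
  assumes "ok T" shows "composable gg S \<Longrightarrow> frac_src C S = frac_src C T \<Longrightarrow> par S (cmpf R T)"
    "frac_src C (cmpf R T) = frac_src C T" "frac_tgt C (cmpf R T) = tgt C w" "cmpf R T \<in> frac_Mor C W"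
proof -
  note k = cmpf(4-6)[OF compR[OF assms]]
  have r: "frac_tgt C R = tgt C w" using base by (simp add: R_def frac_tgt_def)
  show "frac_src C (cmpf R T) = frac_src C T" "frac_tgt C (cmpf R T) = tgt C w" "cmpf R T \<in> frac_Mor C W" using k r by simp_all
  show "par S (cmpf R T)" if "composable gg S" "frac_src C S = frac_src C T"
    using that k r by (simp add: par_def composable_def) (simp add: gg_def frac_src_def)
qed

text \<open>The associator has an invertible value over a member of \<open>W\<close>, so
  \<open>vinv\<close> yields an actual inverse, with the inverse values.\<close>

lemma associator_inverse:
  assumes T: "ok T" and L: "legs T X N A \<eta> \<tau> \<delta> q" and X: "WP (den T # X)"
  shows "cell (cmpf (cmpf gg R) T) (cmpf gg (cmpf R T)) (vinv Fr (ascF gg R T))"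
    "holds (vinv Fr (ascF gg R T)) (A, N, sinv (DN T N \<eta>) \<bullet> DA T A \<tau>, sinv (BN T N \<delta>) \<bullet> BA T A \<tau> q)"
proof -
  note H = holds_assoc_legs[OF T L] and q = conj_iso[OF T L]
  have W0: "WP (den (cmpf gg (cmpf R T)) # N)" using WP_iso[OF q(1)] q X by simp
  have i: "iso (sinv (BA T A \<tau> q) \<bullet> BN T N \<delta>)" by (simp add: q)
  have I: "inverse (cmpf gg (cmpf R T)) (cmpf (cmpf gg R) T) (ascF gg R T) (vinv Fr (ascF gg R T))"
    by (rule vinv_Fr[OF inverseI[OF H i W0]])
  then show "cell (cmpf (cmpf gg R) T) (cmpf gg (cmpf R T)) (vinv Fr (ascF gg R T))" by (simp add: inverse_def)
  show "holds (vinv Fr (ascF gg R T)) (A, N, sinv (DN T N \<eta>) \<bullet> DA T A \<tau>, sinv (BN T N \<delta>) \<bullet> BA T A \<tau> q)"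
    using holds_inverse[OF I H(2) i] by (simp add: q)
qed

end

context two_legs
begin

lemma ok2: "L1.ok T \<Longrightarrow> L2.ok T" by (simp add: L1.ok_def L2.ok_def)

text \<open>The legs for the second index require a further restriction, along which those for the
  first can be restricted.\<close>

lemma legs_both:
  assumes T: "L1.ok T" and X: "pth X" "tg X = src C (num T)"
  obtains z N1 A1 \<eta>1 \<tau>1 \<delta>1 q1 N2 A2 \<eta>2 \<tau>2 \<delta>2 q2 where "WP z" "tg z = sr X"
    "L1.legs T (X @ z) N1 A1 \<eta>1 \<tau>1 \<delta>1 q1" "L2.legs T (X @ z) N2 A2 \<eta>2 \<tau>2 \<delta>2 q2"
proof -
  obtain z N A \<eta> \<tau> \<delta> q where 1: "WP z" "tg z = sr X" "L1.legs T (X @ z) N A \<eta> \<tau> \<delta> q" using L1.legs_ex[OF T X] .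
  have p: "pth z" using 1 by simp
  have X1: "pth (X @ z)" "tg (X @ z) = src C (num T)" using X 1(2) p by simp_all
  obtain z' N2 A2 \<eta>2 \<tau>2 \<delta>2 q2 where 2: "WP z'" "tg z' = sr (X @ z)" "L2.legs T ((X @ z) @ z') N2 A2 \<eta>2 \<tau>2 \<delta>2 q2"
    using L2.legs_ex[OF ok2[OF T] X1] .
  have p': "pth z'" "tg z' = sr z" using 2(1,2) p by simp_all
  show ?thesis
  proof (rule that[of "z @ z'"])
    show "WP (z @ z')" by (rule WP_append[OF 1(1) 2(1)]) (simp add: p')
    show "tg (z @ z') = sr X" using 1(2) p by simp
    show "L1.legs T (X @ z @ z') (N @ z') (A @ z') (\<eta> \<lhd> z') (\<tau> \<lhd> z') (\<delta> \<lhd> z') (q \<lhd> z')"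
      using L1.legs_res[OF T 1(3) p'(1) 2(2)] by simp
    show "L2.legs T (X @ z @ z') N2 A2 \<eta>2 \<tau>2 \<delta>2 q2" using 2(3) by simp
  qed
qed

lemma fractions_A1:
  assumes S: "composable L1.gg S1" "composable L2.gg S2" "frac_src C S2 = frac_src C S1"
    and \<Lambda>: "\<Lambda> \<in> inv_cells Fr (cmpf L1.gg S1) (cmpf L2.gg S2)"
  obtains T \<Lambda>1 \<Lambda>2 where "L1.ok T" "frac_src C T = frac_src C S1"
    "\<Lambda>1 \<in> inv_cells Fr S1 (cmpf L1.R T)" "\<Lambda>2 \<in> inv_cells Fr S2 (cmpf L2.R T)"
    "vcF (whrF Omega T) (vcF (ascF L1.gg L1.R T) (whlF L1.gg \<Lambda>1))
      = vcF (ascF L2.gg L2.R T) (vcF (whlF L2.gg \<Lambda>2) \<Lambda>)"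
proof -
  note B = L1.base L2.base facts
  note sc1 = composable_D[OF S(1), unfolded L1.dn] and sc2 = composable_D[OF S(2), unfolded L2.dn]
  define d1 d2 s1 s2 where dd: "d1 = pv (num S1) w1" "d2 = pv (num S2) w2" "s1 = pf (num S1) w1" "s2 = pf (num S2) w2"
  note ch1 = choice[OF sc1(3) ww(1) sc1(9)[symmetric], folded dd] and ch2 = choice[OF sc2(3) ww(3) sc2(9)[symmetric], folded dd]
  note K = cmpf(2,3)[OF S(1), unfolded L1.dn, folded dd] cmpf(2,3)[OF S(2), unfolded L2.dn, folded dd]
  have c: "cell (cmpf L1.gg S1) (cmpf L2.gg S2) \<Lambda>" by (rule inv_cells_cell[OF \<Lambda>])
  obtain x1 x2 a b where h: "holds \<Lambda> (x1, x2, a, b)" "iso b" "WP (den (cmpf L1.gg S1) # x1)" using inv_cells_representative[OF \<Lambda>] .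
  note da = dat_D[OF holds_dat[OF c h(1)], unfolded K]
  have m: "d1 \<in> Mor C" "d2 \<in> Mor C" "s1 \<in> Mor C" "s2 \<in> Mor C" "den S1 \<in> Mor C" "den S2 \<in> Mor C"
    "src C (den S1) = tgt C d1" "src C (den S2) = tgt C d2" "src C s1 = src C d1" "src C s2 = src C d2" "tgt C s1 = src C f1" "tgt C s2 = src C f2"
    using ch1 ch2 sc1 sc2 ww by simp_all
  have x: "pth x1" "pth x2" "x1 \<noteq> []" "x2 \<noteq> []" "tg x1 = src C d1" "tg x2 = src C d2" "sr x2 = sr x1"
    using da m by auto
  \<comment> \<open>The value of \<Lambda> with composed morphisms spelled out. Its numerator part
    \<open>L\<close> is an invertible square over \<open>f1\<close> and \<open>f2\<close>, to which
    \<open>A1\<close> applies.\<close>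
  define \<alpha>0 where "\<alpha>0 = sinv (kap [den S2, d2]) \<lhd> x2 \<bullet> a \<bullet> kap [den S1, d1] \<lhd> x1"
  define L where "L = sinv (kap [f2, s2]) \<lhd> x2 \<bullet> b \<bullet> kap [f1, s1] \<lhd> x1"
  have a0: "iso \<alpha>0" "dom \<alpha>0 = den S1 # d1 # x1" "cod \<alpha>0 = den S2 # d2 # x2" by (simp_all add: \<alpha>0_def da(1-4) m x)
  have l0: "iso L" "dom L = f1 # s1 # x1" "cod L = f2 # s2 # x2" by (simp_all add: L_def da(5-7) h(2) m x B)
  have ps: "pth (s1 # x1)" "pth (s2 # x2)" by (simp_all add: m x)
  obtain s \<phi>1 \<phi>2 where s: "s \<in> Mor C" "tgt C s = P" "src C s = sr (s1 # x1)" and \<phi>: "iso \<phi>1" "dom \<phi>1 = s1 # x1" "cod \<phi>1 = [p1, s]"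
    "iso \<phi>2" "dom \<phi>2 = s2 # x2" "cod \<phi>2 = [p2, s]" and eq: "Om \<lhd> [s] \<bullet> [f1] \<rhd> \<phi>1 = [f2] \<rhd> \<phi>2 \<bullet> L"
    using A1[OF ps l0] .
  have ss: "src C s = sr x1" using s(3) x by simp
  \<comment> \<open>The denominator of \<open>T\<close> is that of \<open>S1\<close> continued along
    the test of the representative, which lies in \<open>W\<close>; its numerator is the factor
    \<open>s\<close> just found.\<close>
  define e where "e = ev (den S1 # d1 # x1)"
  define T where "T = (sr x1, e, s)"
  have W1: "WP (den S1 # d1 # x1)" using WP_iso[of "kap [den S1, d1] \<lhd> x1"] h(3) by (simp add: K m x)
  have W2: "WP (den S2 # d2 # x2)" using WP_iso[OF a0(1)] W1 a0 by simp
  have e: "e \<in> W" "e \<in> Mor C" "src C e = sr x1" "tgt C e = tgt C (den S1)" using W1 m x by (simp_all add: e_def WP_def)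
  have T: "L1.ok T" using e s ss by (simp add: L1.ok_def T_def frac_Mor_def frac_tgt_def)
  note T2 = ok2[OF T]
  have dT: "den T = e" "num T = s" by (simp_all add: T_def)
  have fs: "frac_src C T = frac_src C S1" using e(4) by (cases S1) (simp add: T_def frac_src_def)
  define \<alpha>1 where "\<alpha>1 = kap (den S1 # d1 # x1)"
  \<comment> \<open>\<alpha>0 identifies the continued denominators of \<open>S1\<close> and
    \<open>S2\<close>, so one \<open>T\<close> serves both legs.\<close>
  define \<alpha>2 where "\<alpha>2 = \<alpha>1 \<bullet> sinv \<alpha>0"
  have a1: "iso \<alpha>1" "dom \<alpha>1 = den S1 # d1 # x1" "cod \<alpha>1 = [e]" by (simp_all add: \<alpha>1_def e_def m x)
  have a2: "iso \<alpha>2" "dom \<alpha>2 = den S2 # d2 # x2" "cod \<alpha>2 = [e]" by (simp_all add: \<alpha>2_def a1 a0)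
  \<comment> \<open>Tests are nonempty paths, so \<open>T\<close> is tested on an identity.\<close>
  define X where "X = [\<one> (sr x1)]"
  have pX: "pth X" "tg X = sr x1" "sr X = sr x1" "X \<noteq> []" "WP X" using x by (simp_all add: X_def BF1)
  have aX: "iso (\<alpha>1 \<lhd> X)" "dom (\<alpha>1 \<lhd> X) = den S1 # d1 # x1 @ X" "cod (\<alpha>1 \<lhd> X) = den T # X"
    "iso (\<alpha>2 \<lhd> X)" "dom (\<alpha>2 \<lhd> X) = den S2 # d2 # x2 @ X" "cod (\<alpha>2 \<lhd> X) = den T # X"
    "iso (\<phi>1 \<lhd> X)" "dom (\<phi>1 \<lhd> X) = s1 # x1 @ X" "cod (\<phi>1 \<lhd> X) = p1 # num T # X"
    "iso (\<phi>2 \<lhd> X)" "dom (\<phi>2 \<lhd> X) = s2 # x2 @ X" "cod (\<phi>2 \<lhd> X) = p2 # num T # X"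
    by (simp_all add: a1 a2 \<phi> dT x pX)
  have WX: "WP (den S1 # d1 # x1 @ X)" "WP (den S2 # d2 # x2 @ X)"
    using WP_append[OF W1 pX(5)] WP_append[OF W2 pX(5)] by (simp_all add: x pX)
  have ne: "x1 @ X \<noteq> []" "x2 @ X \<noteq> []" using x by simp_all
  have P1: "par S1 (cmpf L1.R T)" by (rule L1.par_R(1)[OF T S(1)]) (simp add: fs)
  have P2: "par S2 (cmpf L2.R T)" by (rule L2.par_R(1)[OF T2 S(2)]) (simp add: fs S)
  obtain \<Lambda>1 where \<Lambda>1: "\<Lambda>1 \<in> inv_cells Fr S1 (cmpf L1.R T)" "holds \<Lambda>1 (L1.\<Lambda>dat S1 T (x1 @ X) X (\<alpha>1 \<lhd> X) (\<phi>1 \<lhd> X))"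
    by (rule L1.inv_cell_into[OF T S(1) P1, folded dd, OF aX(1-3,7-9) ne(1) pX(4) WX(1)])
  obtain \<Lambda>2 where \<Lambda>2: "\<Lambda>2 \<in> inv_cells Fr S2 (cmpf L2.R T)" "holds \<Lambda>2 (L2.\<Lambda>dat S2 T (x2 @ X) X (\<alpha>2 \<lhd> X) (\<phi>2 \<lhd> X))"
    by (rule L2.inv_cell_into[OF T2 S(2) P2, folded dd, OF aX(4-6,10-12) ne(2) pX(4) WX(2)])
  note c1 = inv_cells_cell[OF \<Lambda>1(1)] and c2 = inv_cells_cell[OF \<Lambda>2(1)]
  have tX: "tg X = src C (num T)" by (simp add: pX dT ss)
  obtain z N1 A1 \<eta>1 \<tau>1 \<delta>1 q1 N2 A2 \<eta>2 \<tau>2 \<delta>2 q2 where z: "WP z" "tg z = sr X"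
    and l1: "L1.legs T (X @ z) N1 A1 \<eta>1 \<tau>1 \<delta>1 q1" and l2: "L2.legs T (X @ z) N2 A2 \<eta>2 \<tau>2 \<delta>2 q2" using legs_both[OF T pX(1) tX] .
  have pz: "pth z" "tg z = sr x1" using z pX by simp_all
  have rz: "tg z = sr (x1 @ X)" "tg z = sr (x2 @ X)" using pz x pX by simp_all
  note h1 = L1.\<Lambda>dat_res[OF T S(1) \<Lambda>1(2) c1 pz(1) rz(1) ne(1)] and h2 = L2.\<Lambda>dat_res[OF T2 S(2) \<Lambda>2(2) c2 pz(1) rz(2) ne(2)]
  have aXz: "iso (\<alpha>1 \<lhd> X \<lhd> z)" "dom (\<alpha>1 \<lhd> X \<lhd> z) = den S1 # d1 # (x1 @ X) @ z" "cod (\<alpha>1 \<lhd> X \<lhd> z) = den T # X @ z"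
    "iso (\<alpha>2 \<lhd> X \<lhd> z)" "dom (\<alpha>2 \<lhd> X \<lhd> z) = den S2 # d2 # (x2 @ X) @ z" "cod (\<alpha>2 \<lhd> X \<lhd> z) = den T # X @ z"
    "valid (\<phi>1 \<lhd> X \<lhd> z)" "dom (\<phi>1 \<lhd> X \<lhd> z) = s1 # (x1 @ X) @ z" "cod (\<phi>1 \<lhd> X \<lhd> z) = p1 # num T # X @ z"
    "valid (\<phi>2 \<lhd> X \<lhd> z)" "dom (\<phi>2 \<lhd> X \<lhd> z) = s2 # (x2 @ X) @ z" "cod (\<phi>2 \<lhd> X \<lhd> z) = p2 # num T # X @ z"
    by (simp_all add: a1 a2 \<phi> dT x pX pz)
  have ne': "(x1 @ X) @ z \<noteq> []" "(x2 @ X) @ z \<noteq> []" using x by simp_all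
  note M1 = L1.holds_assoc_lwhisk[OF T c1 S(1) l1 h1, folded dd, OF aXz(1-3,7-9) ne'(1)]
  note M2 = L2.holds_lwhisk_legs[OF T2 c2 S(2) l2 h2[unfolded L2.\<Lambda>dat_def], folded dd, OF aXz(4-6,10-12) ne'(2)]
  note C2 = cell_hcomp_left[OF c2 S(2)] and A2' = L2.holds_assoc_legs[OF T2 l2]
  note O = holds_Omega_whisk[OF T l1 l2]
  have hz: "holds \<Lambda> ((x1 @ X) @ z, (x2 @ X) @ z, a \<lhd> (X @ z), b \<lhd> (X @ z))"
    using holds_res[OF c h(1), of "X @ z"] x pX pz by simp
  note LH = holds_vcomp[OF M1(1) O(1)] and RH1 = holds_vcomp[OF c C2]
  note RH = holds_vcomp[OF RH1(1) A2'(1)]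
  note lh = LH(2)[OF M1(2) O(2)] and rh = RH(2)[OF RH1(2)[OF hz M2] A2'(2)]
  note q1' = L1.conj_iso[OF T l1] and q2' = L2.conj_iso[OF T2 l2]
  \<comment> \<open>Both sides of the required equation are evaluated at one test. \<open>Ea\<close>
    and \<open>Eb\<close> match their denominators and numerators, \<open>Eb\<close> being the
    equation supplied by \<open>A1\<close>.\<close>
  have Ea: "\<alpha>2 \<bullet> sinv (kap [den S2, d2]) \<lhd> x2 \<bullet> a = \<alpha>1 \<bullet> sinv (kap [den S1, d1]) \<lhd> x1"
    by (simp add: \<alpha>2_def \<alpha>0_def a1 da(1-4) m x cancels)
  have Eb: "[f2] \<rhd> \<phi>2 \<bullet> sinv (kap [f2, s2]) \<lhd> x2 \<bullet> b = Om \<lhd> [s] \<bullet> [f1] \<rhd> \<phi>1 \<bullet> sinv (kap [f1, s1]) \<lhd> x1"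
  proof -
    have "Om \<lhd> [s] \<bullet> [f1] \<rhd> \<phi>1 \<bullet> sinv (kap [f1, s1]) \<lhd> x1 = (Om \<lhd> [s] \<bullet> [f1] \<rhd> \<phi>1) \<bullet> sinv (kap [f1, s1]) \<lhd> x1" by simp
    also have "\<dots> = [f2] \<rhd> \<phi>2 \<bullet> sinv (kap [f2, s2]) \<lhd> x2 \<bullet> b" unfolding eq L_def by (simp add: \<phi> da(5-7) h(2) m x B cancels)
    finally show ?thesis by simp
  qed
  have Fa: "(sinv (L2.DA T A2 \<tau>2) \<bullet> L1.DA T A1 \<tau>1) \<bullet> (sinv (L1.DA T A1 \<tau>1) \<bullet> \<alpha>1 \<lhd> X \<lhd> z \<bullet> sinv (kap [den S1, d1]) \<lhd> ((x1 @ X) @ z))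
    = (sinv (L2.DA T A2 \<tau>2) \<bullet> L2.DN T N2 \<eta>2) \<bullet> (sinv (L2.DN T N2 \<eta>2) \<bullet> \<alpha>2 \<lhd> X \<lhd> z \<bullet> sinv (kap [den S2, d2]) \<lhd> ((x2 @ X) @ z)) \<bullet> a \<lhd> (X @ z)" (is "?l = ?r")
  proof -
    have "?l = sinv (L2.DA T A2 \<tau>2) \<bullet> (\<alpha>1 \<bullet> sinv (kap [den S1, d1]) \<lhd> x1) \<lhd> (X @ z)" by (simp add: q1' q2' a1 m x pX pz dT)
    also have "\<dots> = ?r" unfolding Ea[symmetric] by (simp add: q1' q2' a2 da(1-4) m x pX pz dT)
    finally show ?thesis .
  qed
  have Fb: "(sinv (L2.BA T A2 \<tau>2 q2) \<bullet> Om \<lhd> (num T # X @ z) \<bullet> L1.BA T A1 \<tau>1 q1) \<bullet> (sinv (L1.BA T A1 \<tau>1 q1) \<bullet> [f1] \<rhd> (\<phi>1 \<lhd> X \<lhd> z) \<bullet> sinv (kap [f1, s1]) \<lhd> ((x1 @ X) @ z))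
    = (sinv (L2.BA T A2 \<tau>2 q2) \<bullet> L2.BN T N2 \<delta>2) \<bullet> (sinv (L2.BN T N2 \<delta>2) \<bullet> [f2] \<rhd> (\<phi>2 \<lhd> X \<lhd> z) \<bullet> sinv (kap [f2, s2]) \<lhd> ((x2 @ X) @ z)) \<bullet> b \<lhd> (X @ z)" (is "?l = ?r")
  proof -
    have "?l = sinv (L2.BA T A2 \<tau>2 q2) \<bullet> (Om \<lhd> [s] \<bullet> [f1] \<rhd> \<phi>1 \<bullet> sinv (kap [f1, s1]) \<lhd> x1) \<lhd> (X @ z)" by (simp add: q1' q2' \<phi> m x pX pz dT s(1,2) ss B)
    also have "\<dots> = ?r" unfolding Eb[symmetric] by (simp add: q1' q2' \<phi> da(5-7) m x pX pz dT s(1,2) ss B)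
    finally show ?thesis .
  qed
  have "WP (den (cmpf L1.gg S1) # x1 @ X)" using WP_append[OF h(3) pX(5)] by (simp add: x pX)
  from WP_append[OF this z(1)] have WW: "WP (den (cmpf L1.gg S1) # (x1 @ X) @ z)" by (simp add: x pX pz)
  show ?thesis
    by (rule that[OF T fs \<Lambda>1(1) \<Lambda>2(1) holds_eq[OF LH(1) RH(1) lh rh[folded Fa Fb] WW]])
qed

text \<open>A single test on which \<Gamma>1 and \<Gamma>2 both have values lifted through
  \<open>w1\<close> and \<open>w2\<close> and on which all four legs exist, so that the hypothesis
  of condition A2 can be evaluated.\<close>

lemma test_cells:
  assumes T: "L1.ok T" "L1.ok T'" "frac_src C T' = frac_src C T"
    and \<Gamma>: "\<Gamma>1 \<in> inv_cells Fr (cmpf L1.R T) (cmpf L1.R T')" "\<Gamma>2 \<in> inv_cells Fr (cmpf L2.R T) (cmpf L2.R T')"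
  obtains X X' \<alpha> \<gamma>1 \<gamma>2 N1 A1 \<eta>1 \<tau>1 \<delta>1 q1 N2 A2 \<eta>2 \<tau>2 \<delta>2 q2 N1' A1' \<eta>1' \<tau>1' \<delta>1' q1' N2' A2' \<eta>2' \<tau>2' \<delta>2' q2'
  where "WP (den T # X)" "WP (den T' # X')" "iso \<alpha>" "dom \<alpha> = den T # X" "cod \<alpha> = den T' # X'"
    "iso \<gamma>1" "dom \<gamma>1 = p1 # num T # X" "cod \<gamma>1 = p1 # num T' # X'"
    "iso \<gamma>2" "dom \<gamma>2 = p2 # num T # X" "cod \<gamma>2 = p2 # num T' # X'"
    "holds \<Gamma>1 (L1.\<Gamma>dat T T' X X' \<alpha> \<gamma>1)" "holds \<Gamma>2 (L2.\<Gamma>dat T T' X X' \<alpha> \<gamma>2)"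
    "L1.legs T X N1 A1 \<eta>1 \<tau>1 \<delta>1 q1" "L2.legs T X N2 A2 \<eta>2 \<tau>2 \<delta>2 q2"
    "L1.legs T' X' N1' A1' \<eta>1' \<tau>1' \<delta>1' q1'" "L2.legs T' X' N2' A2' \<eta>2' \<tau>2' \<delta>2' q2'"
proof -
  note B = L1.Tbase(1-5)[OF T(1)] L1.Tbase(1-5)[OF T(2)] and T2 = ok2[OF T(1)] ok2[OF T(2)]
  note c = inv_cells_cell[OF \<Gamma>(1)] inv_cells_cell[OF \<Gamma>(2)]
  have tt: "tgt C (den T') = tgt C (den T)" using T(3) by (cases T; cases T') (simp add: frac_src_def)
  obtain z x \<alpha> where z0: "WP z" "tg z = sr [den T]" "iso \<alpha>" "dom \<alpha> = [den T] @ z" "cod \<alpha> = [den T'] @ x" "pth x" "tg x = sr [den T']" "sr x = sr z"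
    by (rule bf3[of "[den T']" "[den T]"]) (use B tt in simp_all)
  have z: "pth z" "tg z = src C (den T)" "z \<noteq> []" "x \<noteq> []" "tg x = src C (den T')" using z0 by auto
  have d0: "dom \<alpha> = den T # z" "cod \<alpha> = den T' # x" using z0(4,5) by simp_all
  obtain y1 \<gamma>1 where y1: "WP y1" "tg y1 = sr z" "iso \<gamma>1" "dom \<gamma>1 = p1 # num T # z @ y1" "cod \<gamma>1 = p1 # num T' # x @ y1"
    "holds \<Gamma>1 (L1.\<Gamma>dat T T' (z @ y1) (x @ y1) (\<alpha> \<lhd> y1) \<gamma>1)"
    using L1.inv_cell_lift[OF T(1,2) \<Gamma>(1) z0(3) d0 z(3,4)] .
  have py1: "pth y1" using y1 by simp
  have d1: "iso (\<alpha> \<lhd> y1)" "dom (\<alpha> \<lhd> y1) = den T # z @ y1" "cod (\<alpha> \<lhd> y1) = den T' # x @ y1" "z @ y1 \<noteq> []" "x @ y1 \<noteq> []"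
    using z0 y1(2) py1 z by simp_all
  obtain y2 \<gamma>2 where y2: "WP y2" "tg y2 = sr (z @ y1)" "iso \<gamma>2" "dom \<gamma>2 = p2 # num T # (z @ y1) @ y2" "cod \<gamma>2 = p2 # num T' # (x @ y1) @ y2"
    "holds \<Gamma>2 (L2.\<Gamma>dat T T' ((z @ y1) @ y2) ((x @ y1) @ y2) (\<alpha> \<lhd> y1 \<lhd> y2) \<gamma>2)"
    using L2.inv_cell_lift[OF T2 \<Gamma>(2) d1] .
  have py2: "pth y2" "tg y2 = sr y1" using y2(1,2) py1 by simp_all
  let ?X = "z @ y1 @ y2" and ?X' = "x @ y1 @ y2"
  have X: "pth ?X" "tg ?X = src C (num T)" "pth ?X'" "tg ?X' = src C (num T')" "sr ?X = sr y2" "sr ?X' = sr y2"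
    using z0(6,8) z py1 py2 y1(2) B by simp_all
  obtain y3 N1 A1 \<eta>1 \<tau>1 \<delta>1 q1 N2 A2 \<eta>2 \<tau>2 \<delta>2 q2 where y3: "WP y3" "tg y3 = sr ?X"
    "L1.legs T (?X @ y3) N1 A1 \<eta>1 \<tau>1 \<delta>1 q1" "L2.legs T (?X @ y3) N2 A2 \<eta>2 \<tau>2 \<delta>2 q2" using legs_both[OF T(1) X(1,2)] .
  have py3: "pth y3" "tg y3 = sr y2" using y3(1,2) X by simp_all
  have X3: "pth (?X' @ y3)" "tg (?X' @ y3) = src C (num T')" using z0(6,8) z py1 py2 py3 y1(2) B by simp_all
  obtain y4 N1' A1' \<eta>1' \<tau>1' \<delta>1' q1' N2' A2' \<eta>2' \<tau>2' \<delta>2' q2' where y4: "WP y4" "tg y4 = sr (?X' @ y3)"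
    "L1.legs T' ((?X' @ y3) @ y4) N1' A1' \<eta>1' \<tau>1' \<delta>1' q1'" "L2.legs T' ((?X' @ y3) @ y4) N2' A2' \<eta>2' \<tau>2' \<delta>2' q2'" using legs_both[OF T(2) X3] .
  have py4: "pth y4" "tg y4 = sr y3" using y4(1,2) X3 py3 by simp_all
  let ?Y = "z @ y1 @ y2 @ y3 @ y4" and ?Y' = "x @ y1 @ y2 @ y3 @ y4"
  have r4: "tg y4 = sr (?X @ y3)" using py4 py3 X by simp
  have r34: "pth (y3 @ y4)" "tg (y3 @ y4) = sr ((z @ y1) @ y2)" "pth (y2 @ y3 @ y4)" "tg (y2 @ y3 @ y4) = sr (z @ y1)"
    using py2 py3 py4 py1 by simp_all
  have ly: "WP (y2 @ y3 @ y4)" using WP_append[OF y2(1) WP_append[OF y3(1) y4(1)]] py2 py3 py4 by simp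
  have WY: "WP ?Y" using WP_append[OF z0(1) WP_append[OF y1(1) ly]] py1 py2 y1(2) by simp
  let ?a = "\<alpha> \<lhd> (y1 @ y2 @ y3 @ y4)"
  have a: "iso ?a" "dom ?a = den T # ?Y" "cod ?a = den T' # ?Y'"
    using z0 d0 py1 py2 py3 py4 y1(2) z by simp_all
  have WT: "WP (den T # ?Y)" using WP_append[of "[den T]" ?Y] WY B z by simp
  then have WT': "WP (den T' # ?Y')" using WP_iso[OF a(1)] a by simp
  note m1 = L1.legs_res[OF T(1) y3(3) py4(1) r4] and m2 = L2.legs_res[OF T2(1) y3(4) py4(1) r4]
  note g1 = L1.\<Gamma>dat_res[OF T(1,2) c(1) y1(6) r34(3,4)] and g2 = L2.\<Gamma>dat_res[OF T2 c(2) y2(6) r34(1,2)]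
  have i: "iso (\<gamma>1 \<lhd> (y2 @ y3 @ y4))" "dom (\<gamma>1 \<lhd> (y2 @ y3 @ y4)) = p1 # num T # ?Y" "cod (\<gamma>1 \<lhd> (y2 @ y3 @ y4)) = p1 # num T' # ?Y'"
    "iso (\<gamma>2 \<lhd> (y3 @ y4))" "dom (\<gamma>2 \<lhd> (y3 @ y4)) = p2 # num T # ?Y" "cod (\<gamma>2 \<lhd> (y3 @ y4)) = p2 # num T' # ?Y'"
    using y1(3-5) y2(3-5) py1 py2 py3 py4 z by simp_all
  show ?thesis
    by (rule that[OF WT WT' a i g1[unfolded rw_rw append_assoc] g2[unfolded rw_rw append_assoc] m1[unfolded append_assoc] m2[unfolded append_assoc]
      y4(3,4)[unfolded append_assoc]])
qed

lemma fractions_A2: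
  assumes T: "L1.ok T" "L1.ok T'" "frac_src C T' = frac_src C T"
    and \<Gamma>: "\<Gamma>1 \<in> inv_cells Fr (cmpf L1.R T) (cmpf L1.R T')" "\<Gamma>2 \<in> inv_cells Fr (cmpf L2.R T) (cmpf L2.R T')"
    and eq: "vcF (vinv Fr (ascF L2.gg L2.R T')) (vcF (whrF Omega T')
         (vcF (ascF L1.gg L1.R T') (whlF L1.gg \<Gamma>1)))
      = vcF (whlF L2.gg \<Gamma>2) (vcF (vinv Fr (ascF L2.gg L2.R T))
         (vcF (whrF Omega T) (ascF L1.gg L1.R T)))"
  shows "\<exists>!\<Gamma>. \<Gamma> \<in> inv_cells Fr T T' \<and> whlF L1.R \<Gamma> = \<Gamma>1 \<and> whlF L2.R \<Gamma> = \<Gamma>2"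
proof -
  note T2 = ok2[OF T(1)] ok2[OF T(2)]
  note B = L1.base L2.base facts L1.Tbase(1-5)[OF T(1)] L1.Tbase(1-5)[OF T(2)]
  note c = inv_cells_cell[OF \<Gamma>(1)] inv_cells_cell[OF \<Gamma>(2)]
  obtain X X' \<alpha> \<gamma>1 \<gamma>2 N1 A1 \<eta>1 \<tau>1 \<delta>1 q1 N2 A2 \<eta>2 \<tau>2 \<delta>2 q2 N1' A1' \<eta>1' \<tau>1' \<delta>1' q1' N2' A2' \<eta>2' \<tau>2' \<delta>2' q2'
  where X: "WP (den T # X)" "WP (den T' # X')" and a: "iso \<alpha>" "dom \<alpha> = den T # X" "cod \<alpha> = den T' # X'"
    and g: "iso \<gamma>1" "dom \<gamma>1 = p1 # num T # X" "cod \<gamma>1 = p1 # num T' # X'"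
    "iso \<gamma>2" "dom \<gamma>2 = p2 # num T # X" "cod \<gamma>2 = p2 # num T' # X'"
    and h: "holds \<Gamma>1 (L1.\<Gamma>dat T T' X X' \<alpha> \<gamma>1)" "holds \<Gamma>2 (L2.\<Gamma>dat T T' X X' \<alpha> \<gamma>2)"
    and l: "L1.legs T X N1 A1 \<eta>1 \<tau>1 \<delta>1 q1" "L2.legs T X N2 A2 \<eta>2 \<tau>2 \<delta>2 q2"
    and l': "L1.legs T' X' N1' A1' \<eta>1' \<tau>1' \<delta>1' q1'" "L2.legs T' X' N2' A2' \<eta>2' \<tau>2' \<delta>2' q2'"
    using test_cells[OF T \<Gamma>] .
  note x = L1.legs_D(1,2)[OF T(1) l(1)] L1.legs_D(1,2)[OF T(2) l'(1)]
  have x0: "X \<noteq> []" "X' \<noteq> []" "sr X' = sr X" "tgt C (den T') = tgt C (den T)"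
    using valid_D[OF iso_valid[OF a(1)], unfolded a] x by auto
  note q = L1.conj_iso[OF T(1) l(1)] L2.conj_iso[OF T2(1) l(2)] L1.conj_iso[OF T(2) l'(1)] L2.conj_iso[OF T2(2) l'(2)]
  note M1 = L1.holds_lwhisk_legs2[OF T(1,2) c(1) l(1) l'(1) h(1)[unfolded L1.\<Gamma>dat_def] a iso_valid[OF g(1)] g(2,3)]
  note M2 = L2.holds_lwhisk_legs2[OF T2 c(2) l(2) l'(2) h(2)[unfolded L2.\<Gamma>dat_def] a iso_valid[OF g(4)] g(5,6)]
  note C1 = cell_hcomp_left[OF c(1) L1.compRT[OF T(1)]] and C2 = cell_hcomp_left[OF c(2) L2.compRT[OF T2(1)]]
  note O = holds_Omega_whisk[OF T(1) l] and O' = holds_Omega_whisk[OF T(2) l']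
  note A1 = L1.holds_assoc_legs[OF T(1) l(1)] and A1' = L1.holds_assoc_legs[OF T(2) l'(1)]
  note V = L2.associator_inverse[OF T2(1) l(2) X(1)] and V' = L2.associator_inverse[OF T2(2) l'(2) X(2)]
  note s1 = holds_vcomp[OF C1 A1'(1)]
  note s2 = holds_vcomp[OF s1(1) O'(1)]
  note s3 = holds_vcomp[OF s2(1) V'(1)]
  note lhs = s3(2)[OF s2(2)[OF s1(2)[OF M1 A1'(2)] O'(2)] V'(2)]
  note r1 = holds_vcomp[OF A1(1) O(1)]
  note r2 = holds_vcomp[OF r1(1) V(1)]
  note r3 = holds_vcomp[OF r2(1) C2]
  note rhs = r3(2)[OF r2(2)[OF r1(2)[OF A1(2) O(2)] V(2)] M2]
  let ?l = "Om \<lhd> (num T' # X') \<bullet> [f1] \<rhd> \<gamma>1" and ?r = "[f2] \<rhd> \<gamma>2 \<bullet> Om \<lhd> (num T # X)"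
  have LH: "holds (vcF (whlF L2.gg \<Gamma>2) (vcF (vinv Fr (ascF L2.gg L2.R T))
         (vcF (whrF Omega T) (ascF L1.gg L1.R T))))
     (N1, N2', sinv (L2.DN T' N2' \<eta>2') \<bullet> \<alpha> \<bullet> L1.DN T N1 \<eta>1, sinv (L2.BN T' N2' \<delta>2') \<bullet> ?l \<bullet> L1.BN T N1 \<delta>1)"
    using lhs unfolding eq by (simp add: q a g x x0 B cancels)
  have RH: "holds (vcF (whlF L2.gg \<Gamma>2) (vcF (vinv Fr (ascF L2.gg L2.R T))
         (vcF (whrF Omega T) (ascF L1.gg L1.R T))))
     (N1, N2', sinv (L2.DN T' N2' \<eta>2') \<bullet> \<alpha> \<bullet> L1.DN T N1 \<eta>1, sinv (L2.BN T' N2' \<delta>2') \<bullet> ?r \<bullet> L1.BN T N1 \<delta>1)"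
    using rhs by (simp add: q a g x x0 B cancels)
  have ia: "iso (sinv (L2.DN T' N2' \<eta>2') \<bullet> \<alpha> \<bullet> L1.DN T N1 \<eta>1)" by (simp add: q a)
  have gl: "sinv (L2.BN T' N2' \<delta>2') \<bullet> ?l \<bullet> L1.BN T N1 \<delta>1 \<approx> sinv (L2.BN T' N2' \<delta>2') \<bullet> ?r \<bullet> L1.BN T N1 \<delta>1"
    by (rule holds_unique[OF r3(1) RH LH germ_refl[THEN iffD2, OF iso_valid[OF ia]]])
  \<comment> \<open>The hypothesis, evaluated on both sides, is the compatibility of \<gamma>1 and
    \<gamma>2 with \<omega>, but only as germs; the restriction along \<open>z\<close> makes it the
    equation that \<open>A2\<close> requires.\<close>
  have "?l \<approx> ?r" by (rule germ_unsandwich[OF gl]) (simp_all add: q g x x0 B)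
  then obtain z where z: "WP z" "tg z = sr (dom ?l)" "?l \<lhd> z = ?r \<lhd> z" by (rule germ_E)
  have pz: "pth z" "tg z = sr X" using z(1,2) x0 x by (simp_all add: g B)
  let ?X = "X @ z" and ?X' = "X' @ z"
  have e: "Om \<lhd> (num T' # ?X') \<bullet> [f1] \<rhd> (\<gamma>1 \<lhd> z) = [f2] \<rhd> (\<gamma>2 \<lhd> z) \<bullet> Om \<lhd> (num T # ?X)" using z(3) by simp
  have gz: "iso (\<gamma>1 \<lhd> z)" "dom (\<gamma>1 \<lhd> z) = p1 # num T # ?X" "cod (\<gamma>1 \<lhd> z) = p1 # num T' # ?X'"
    "iso (\<gamma>2 \<lhd> z)" "dom (\<gamma>2 \<lhd> z) = p2 # num T # ?X" "cod (\<gamma>2 \<lhd> z) = p2 # num T' # ?X'"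
    "iso (\<alpha> \<lhd> z)" "dom (\<alpha> \<lhd> z) = den T # ?X" "cod (\<alpha> \<lhd> z) = den T' # ?X'"
    by (simp_all add: g a x x0 pz)
  have t: "pth (num T # ?X)" "pth (num T' # ?X')" "tg (num T # ?X) = P" "tg (num T' # ?X') = P" "sr (num T' # ?X') = sr (num T # ?X)"
    using x x0 pz B by simp_all
  obtain \<gamma> where \<gamma>: "iso \<gamma>" "dom \<gamma> = num T # ?X" "cod \<gamma> = num T' # ?X'" "[p1] \<rhd> \<gamma> = \<gamma>1 \<lhd> z" "[p2] \<rhd> \<gamma> = \<gamma>2 \<lhd> z"
    using A2[OF t gz(1-6) e] .
  have D: "dat T T' (?X, ?X', \<alpha> \<lhd> z, \<gamma>)"
    unfolding dat_def ty_def prod.case by (simp add: gz(7-9) \<gamma>(1-3) x x0 pz B)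
  have P: "par T T'" using T by (simp add: par_def L1.ok_def)
  have W0: "WP (den T # ?X)" using WP_append[OF X(1) z(1)] x0 pz by simp
  define \<Gamma> where "\<Gamma> = cls T T' (?X, ?X', \<alpha> \<lhd> z, \<gamma>)"
  note cl = cls[OF P D W0, folded \<Gamma>_def]
  have I: "\<Gamma> \<in> inv_cells Fr T T'" by (rule inverseI[OF cl \<gamma>(1) W0])
  note R1 = L1.holds_R_whisk[OF T(1,2) cl] and R2 = L2.holds_R_whisk[OF T2 cl]
  note h1 = L1.\<Gamma>dat_res[OF T(1,2) c(1) h(1) pz] and h2 = L2.\<Gamma>dat_res[OF T2 c(2) h(2) pz]
  have W1: "WP (den (cmpf L1.R T) # ?X)" "WP (den (cmpf L2.R T) # ?X)"
    unfolding L1.RT_simps[OF T(1)] L2.RT_simps[OF T2(1)]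
    using WP_iso[of "L1.jj T \<lhd> ?X"] W0 L1.Tbase[OF T(1)] x x0 pz by simp_all
  have E1: "whlF L1.R \<Gamma> = \<Gamma>1"
    by (rule holds_eq[OF R1(1) c(1) R1(2)[unfolded L1.\<Gamma>dat_def] h1[unfolded L1.\<Gamma>dat_def \<gamma>(4)[symmetric]] W1(1)])
  have E2: "whlF L2.R \<Gamma> = \<Gamma>2"
    by (rule holds_eq[OF R2(1) c(2) R2(2)[unfolded L2.\<Gamma>dat_def] h2[unfolded L2.\<Gamma>dat_def \<gamma>(5)[symmetric]] W1(2)])
  have U: "\<Delta> = \<Gamma>" if \<Delta>: "\<Delta> \<in> inv_cells Fr T T'" "whlF L1.R \<Delta> = \<Gamma>1" "whlF L2.R \<Delta> = \<Gamma>2" for \<Delta>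
  proof -
    obtain \<Delta>' where I': "inverse T T' \<Delta> \<Delta>'" using \<Delta>(1) inv_cells_Fr by blast
    have cD: "cell T T' \<Delta>" by (rule inv_cells_cell[OF \<Delta>(1)])
    have pX: "pth ?X" "pth ?X'" using x x0 pz by simp_all
    \<comment> \<open>For uniqueness, \<Delta> is evaluated over the same denominators as \<Gamma>,
      and its value is made invertible because \<open>A2_unique\<close> compares invertible
      2-cells.\<close>
    obtain y1 d0 where y1: "WP y1" "tg y1 = sr ?X" "holds \<Delta> (?X @ y1, ?X' @ y1, \<alpha> \<lhd> z \<lhd> y1, d0)" using holds_ex[OF cD gz(7-9) pX] .
    obtain y2 where y2: "WP y2" "tg y2 = sr (?X @ y1)" "iso (d0 \<lhd> y2)" using holds_inverse_ex[OF I' y1(3)] by blast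
    define y where "y = y1 @ y2"
    define d where "d = d0 \<lhd> y2"
    have p1: "pth y1" "pth y2" "tg y1 = sr z" "tg y2 = sr y1" using y1(1,2) y2(1,2) pz by simp_all
    have y: "WP y" "pth y" "tg y = sr z" "tg y = sr ?X" using WP_append[OF y1(1) y2(1)] p1 pz by (simp_all add: y_def)
    have hD: "holds \<Delta> (?X @ y, ?X' @ y, \<alpha> \<lhd> z \<lhd> y, d)" using holds_res[OF cD y1(3) p1(2) y2(2)] by (simp add: y_def d_def)
    note dd = dat_D[OF holds_dat[OF cD hD]]
    have hG: "holds \<Gamma> (?X @ y, ?X' @ y, \<alpha> \<lhd> z \<lhd> y, \<gamma> \<lhd> y)" by (rule holds_res[OF cl y(2,4)])
    have id: "iso d" using y2(3) by (simp add: d_def)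
    have gy: "iso (\<gamma> \<lhd> y)" "dom (\<gamma> \<lhd> y) = num T # ?X @ y" "cod (\<gamma> \<lhd> y) = num T' # ?X' @ y"
      using \<gamma>(1-3) y x x0 pz by simp_all
    note Z = x x0 pz y dd(2-7) gy id
    note k = L1.Tbase(24-29)[OF T(1)] L1.Tbase(24-29)[OF T(2)] L2.Tbase(24-29)[OF T2(1)] L2.Tbase(24-29)[OF T2(2)]
    note n1 = L1.holds_R_whisk[OF T(1,2) cD hD, unfolded \<Delta>(2) L1.\<Gamma>dat_def] L1.holds_R_whisk(2)[OF T(1,2) cl(1) hG, unfolded E1 L1.\<Gamma>dat_def]
    note n2 = L2.holds_R_whisk[OF T2 cD hD, unfolded \<Delta>(3) L2.\<Gamma>dat_def] L2.holds_R_whisk(2)[OF T2 cl(1) hG, unfolded E2 L2.\<Gamma>dat_def]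
    have i1: "valid (L1.jj T' \<lhd> (?X' @ y) \<bullet> \<alpha> \<lhd> z \<lhd> y \<bullet> sinv (L1.jj T) \<lhd> (?X @ y))"
      "valid (L2.jj T' \<lhd> (?X' @ y) \<bullet> \<alpha> \<lhd> z \<lhd> y \<bullet> sinv (L2.jj T) \<lhd> (?X @ y))"
      using dat_D(2)[OF holds_dat[OF n1(1,2)]] dat_D(2)[OF holds_dat[OF n2(1,2)]] by simp_all
    note u1 = holds_unique[OF n1(1) n1(3,2) germ_refl[THEN iffD2, OF i1(1)]] and u2 = holds_unique[OF n2(1) n2(3,2) germ_refl[THEN iffD2, OF i1(2)]]
    \<comment> \<open>Whiskering by the first projection applies \<open>w1\<close> after
      \<open>p1\<close> to both values. \<open>w1\<close> cancels as a member of \<open>W\<close>,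
      but \<open>p1\<close> and \<open>p2\<close> need not lie in \<open>W\<close>; they are removed
      jointly, by uniqueness in the weak fiber product of \<open>C\<close>.\<close>
    have w1: "[w1] \<rhd> ([p1] \<rhd> d) \<approx> [w1] \<rhd> ([p1] \<rhd> \<gamma> \<lhd> y)"
      by (rule germ_unsandwich[OF u1]) (simp_all add: Z k B)
    have g1: "[p1] \<rhd> d \<approx> [p1] \<rhd> \<gamma> \<lhd> y"
      by (rule germ_cancel_lw[OF w1]) (simp_all add: Z B)
    have w2: "[w2] \<rhd> ([p2] \<rhd> d) \<approx> [w2] \<rhd> ([p2] \<rhd> \<gamma> \<lhd> y)"
      by (rule germ_unsandwich[OF u2]) (simp_all add: Z k B)
    have g2: "[p2] \<rhd> d \<approx> [p2] \<rhd> \<gamma> \<lhd> y"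
      by (rule germ_cancel_lw[OF w2]) (simp_all add: Z B)
    obtain v where v: "WP v" "tg v = sr (dom ([p1] \<rhd> d))" "([p1] \<rhd> d) \<lhd> v = ([p1] \<rhd> \<gamma> \<lhd> y) \<lhd> v" "([p2] \<rhd> d) \<lhd> v = ([p2] \<rhd> \<gamma> \<lhd> y) \<lhd> v"
      by (rule germ_exact2[OF g1 g2]) (simp_all add: Z B)
    have pv: "pth v" "tg v = sr y" "tg v = sr (?X @ y)" using v(1,2) y by (simp_all add: Z B)
    have "d \<lhd> v = \<gamma> \<lhd> y \<lhd> v"
      by (rule A2_unique) (use v(3,4) in \<open>simp_all add: Z pv B del: rw_rw\<close>)
    then have H: "holds \<Delta> ((?X @ y) @ v, (?X' @ y) @ v, \<alpha> \<lhd> z \<lhd> y \<lhd> v, \<gamma> \<lhd> y \<lhd> v)"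
      using holds_res[OF cD hD pv(1,3)] by simp
    have "WP (den T # ?X @ y)" using WP_append[OF W0 y(1)] y(4) x0 by simp
    from WP_append[OF this v(1)] have "WP (den T # (?X @ y) @ v)" using pv x0 y by simp
    then show "\<Delta> = \<Gamma>" by (rule holds_eq[OF cD cl(1) H holds_res[OF cl(1) hG pv(1,3)]])
  qed
  show ?thesis using I E1 E2 U by blast
qed

end

context two_legs
begin

theorem weak_fiber_product_fractions: "weak_fiber_product Fr L1.gg L2.gg P L1.R L2.R Omega"
proof -
  note B = L1.base L2.base facts
  have gg: "L1.gg \<in> frac_Mor C W" "L2.gg \<in> frac_Mor C W" "frac_src C L1.gg = tgt C w1" "frac_src C L2.gg = tgt C w2"
    "frac_tgt C L1.gg = tgt C f1" "frac_tgt C L2.gg = tgt C f2"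
    using L1.frac_mor L2.frac_mor by (simp_all add: L1.gg_def L2.gg_def frac_src_def frac_tgt_def)
  have R: "L1.R \<in> frac_Mor C W" "L2.R \<in> frac_Mor C W" "frac_src C L1.R = P" "frac_src C L2.R = P"
    "frac_tgt C L1.R = tgt C w1" "frac_tgt C L2.R = tgt C w2"
    using L1.frac_mor L2.frac_mor B by (simp_all add: L1.R_def L2.R_def frac_src_def frac_tgt_def)
  have A1: "\<exists>s\<in>hom Fr X P. \<exists>\<Lambda>1\<in>inv_cells Fr s1 (cmpf L1.R s). \<exists>\<Lambda>2\<in>inv_cells Fr s2 (cmpf L2.R s).
      vcF (whrF Omega s) (vcF (ascF L1.gg L1.R s) (whlF L1.gg \<Lambda>1))
      = vcF (ascF L2.gg L2.R s) (vcF (whlF L2.gg \<Lambda>2) \<Lambda>)"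
    if s: "s1 \<in> hom Fr X (frac_src C L1.gg)" "s2 \<in> hom Fr X (frac_src C L2.gg)" "\<Lambda> \<in> inv_cells Fr (cmpf L1.gg s1) (cmpf L2.gg s2)" for X s1 s2 \<Lambda>
  proof -
    have k: "composable L1.gg s1" "composable L2.gg s2" "frac_src C s2 = frac_src C s1" and X: "frac_src C s1 = X"
      using s(1,2) gg by (simp_all add: hom_def composable_def)
    obtain T \<Lambda>1 \<Lambda>2 where t: "L1.ok T" "frac_src C T = frac_src C s1"
    "\<Lambda>1 \<in> inv_cells Fr s1 (cmpf L1.R T)" "\<Lambda>2 \<in> inv_cells Fr s2 (cmpf L2.R T)"
    "vcF (whrF Omega T) (vcF (ascF L1.gg L1.R T) (whlF L1.gg \<Lambda>1))
      = vcF (ascF L2.gg L2.R T) (vcF (whlF L2.gg \<Lambda>2) \<Lambda>)"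
      using fractions_A1[OF k s(3)] .
    have "T \<in> hom Fr X P" using t(1,2) X by (simp add: hom_def L1.ok_def)
    then show ?thesis using t(3-5) by blast
  qed
  have A2: "\<exists>!\<Gamma>. \<Gamma> \<in> inv_cells Fr t t' \<and> whlF L1.R \<Gamma> = \<Gamma>1 \<and> whlF L2.R \<Gamma> = \<Gamma>2"
    if t: "t \<in> hom Fr X P" "t' \<in> hom Fr X P" "\<Gamma>1 \<in> inv_cells Fr (cmpf L1.R t) (cmpf L1.R t')" "\<Gamma>2 \<in> inv_cells Fr (cmpf L2.R t) (cmpf L2.R t')"
    and eq: "vcF (vinv Fr (ascF L2.gg L2.R t')) (vcF (whrF Omega t')
         (vcF (ascF L1.gg L1.R t') (whlF L1.gg \<Gamma>1)))
      = vcF (whlF L2.gg \<Gamma>2) (vcF (vinv Fr (ascF L2.gg L2.R t))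
         (vcF (whrF Omega t) (ascF L1.gg L1.R t)))" for X t t' \<Gamma>1 \<Gamma>2
  proof -
    have o: "L1.ok t" "L1.ok t'" "frac_src C t' = frac_src C t" using t(1,2) by (simp_all add: hom_def L1.ok_def)
    show ?thesis by (rule fractions_A2[OF o t(3,4) eq])
  qed
  have base: "L1.gg \<in> frac_Mor C W" "L2.gg \<in> frac_Mor C W" "frac_tgt C L1.gg = frac_tgt C L2.gg" "P \<in> Ob C"
    "L1.R \<in> hom Fr P (frac_src C L1.gg)" "L2.R \<in> hom Fr P (frac_src C L2.gg)" "Omega \<in> inv_cells Fr gR1 gR2"
    using gg R facts inv_Omega by (simp_all add: hom_def)
  show ?thesis
    unfolding weak_fiber_product_def Fr_simps
    by (intro conjI ballI impI; (rule A1 A2)?; (assumption | rule base)?)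
qed

end

theorem corollary0p3:
  fixes \<C> :: "('o, 'm, 'c) bicat" (structure)
    and W :: "'m set"
    and ch :: "('o, 'm, 'c) choices"
  assumes "bicategory \<C>"
    and "BF \<C> W"
    and "set_of_choices \<C> W ch"
  shows
    "(\<forall>A \<in> Ob \<C>. \<forall>B1 \<in> Ob \<C>. \<forall>B2 \<in> Ob \<C>. \<forall>C \<in> Ob \<C>.
      \<forall>f1 \<in> hom \<C> B1 A. \<forall>f2 \<in> hom \<C> B2 A.
      \<forall>p1 \<in> hom \<C> C B1. \<forall>p2 \<in> hom \<C> C B2. \<forall>\<omega> \<in> inv_cells \<C> (f1 \<cdot> p1) (f2 \<cdot> p2).
      weak_fiber_product \<C> f1 f2 C p1 p2 \<omega> \<longrightarrow>
      (\<forall>D \<in> Ob \<C>.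
         (\<forall>q1 \<in> hom \<C> D B1. \<forall>q2 \<in> hom \<C> D B2. \<forall>l \<in> inv_cells \<C> (f1 \<cdot> q1) (f2 \<cdot> q2).
            \<exists>E \<in> Ob \<C>. \<exists>v \<in> hom \<C> E D. \<exists>q \<in> hom \<C> E C.
            \<exists>l1 \<in> inv_cells \<C> (q1 \<cdot> v) (p1 \<cdot> q). \<exists>l2 \<in> inv_cells \<C> (q2 \<cdot> v) (p2 \<cdot> q).
              v \<in> W
              \<and> vinv \<C> (\<theta> f2 p2 q) \<odot> (\<omega> \<star> \<iota> q) \<odot> \<theta> f1 p1 q \<odot> (\<iota> f1 \<star> l1)
                = (\<iota> f2 \<star> l2) \<odot> vinv \<C> (\<theta> f2 q2 v) \<odot> (l \<star> \<iota> v) \<odot> \<theta> f1 q1 v)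
       \<and> (\<forall>t \<in> hom \<C> D C. \<forall>t' \<in> hom \<C> D C.
          \<forall>\<gamma>1 \<in> inv_cells \<C> (p1 \<cdot> t) (p1 \<cdot> t'). \<forall>\<gamma>2 \<in> inv_cells \<C> (p2 \<cdot> t) (p2 \<cdot> t').
            vinv \<C> (\<theta> f2 p2 t') \<odot> (\<omega> \<star> \<iota> t') \<odot> \<theta> f1 p1 t' \<odot> (\<iota> f1 \<star> \<gamma>1)
              = (\<iota> f2 \<star> \<gamma>2) \<odot> vinv \<C> (\<theta> f2 p2 t) \<odot> (\<omega> \<star> \<iota> t) \<odot> \<theta> f1 p1 t \<longrightarrow>
            (\<exists>F \<in> Ob \<C>. \<exists>u \<in> hom \<C> F D. \<exists>\<gamma> \<in> inv_cells \<C> (t \<cdot> u) (t' \<cdot> u).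
               u \<in> W
               \<and> \<theta> p1 t' u \<odot> (\<iota> p1 \<star> \<gamma>) = (\<gamma>1 \<star> \<iota> u) \<odot> \<theta> p1 t u
               \<and> \<theta> p2 t' u \<odot> (\<iota> p2 \<star> \<gamma>) = (\<gamma>2 \<star> \<iota> u) \<odot> \<theta> p2 t u))
       \<and> (\<forall>t \<in> hom \<C> D C. \<forall>t' \<in> hom \<C> D C.
          \<forall>\<gamma>1 \<in> inv_cells \<C> (p1 \<cdot> t) (p1 \<cdot> t'). \<forall>\<gamma>2 \<in> inv_cells \<C> (p2 \<cdot> t) (p2 \<cdot> t').
          \<forall>F \<in> Ob \<C>. \<forall>u \<in> hom \<C> F D. \<forall>\<gamma> \<in> inv_cells \<C> (t \<cdot> u) (t' \<cdot> u).
          \<forall>F' \<in> Ob \<C>. \<forall>u' \<in> hom \<C> F' D. \<forall>\<gamma>' \<in> inv_cells \<C> (t \<cdot> u') (t' \<cdot> u').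
            vinv \<C> (\<theta> f2 p2 t') \<odot> (\<omega> \<star> \<iota> t') \<odot> \<theta> f1 p1 t' \<odot> (\<iota> f1 \<star> \<gamma>1)
              = (\<iota> f2 \<star> \<gamma>2) \<odot> vinv \<C> (\<theta> f2 p2 t) \<odot> (\<omega> \<star> \<iota> t) \<odot> \<theta> f1 p1 t
            \<and> u \<in> W
            \<and> \<theta> p1 t' u \<odot> (\<iota> p1 \<star> \<gamma>) = (\<gamma>1 \<star> \<iota> u) \<odot> \<theta> p1 t u
            \<and> \<theta> p2 t' u \<odot> (\<iota> p2 \<star> \<gamma>) = (\<gamma>2 \<star> \<iota> u) \<odot> \<theta> p2 t u
            \<and> u' \<in> W
            \<and> \<theta> p1 t' u' \<odot> (\<iota> p1 \<star> \<gamma>') = (\<gamma>1 \<star> \<iota> u') \<odot> \<theta> p1 t u'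
            \<and> \<theta> p2 t' u' \<odot> (\<iota> p2 \<star> \<gamma>') = (\<gamma>2 \<star> \<iota> u') \<odot> \<theta> p2 t u' \<longrightarrow>
            (\<exists>G \<in> Ob \<C>. \<exists>z \<in> hom \<C> G F. \<exists>z' \<in> hom \<C> G F'.
             \<exists>\<mu> \<in> inv_cells \<C> (u \<cdot> z) (u' \<cdot> z').
               z \<in> W
               \<and> \<theta> t' u' z' \<odot> (\<iota> t' \<star> \<mu>) \<odot> vinv \<C> (\<theta> t' u z) \<odot> (\<gamma> \<star> \<iota> z)
                 = (\<gamma>' \<star> \<iota> z') \<odot> \<theta> t u' z' \<odot> (\<iota> t \<star> \<mu>) \<odot> vinv \<C> (\<theta> t u z))))
      \<and> (\<forall>B1' \<in> Ob \<C>. \<forall>B2' \<in> Ob \<C>. \<forall>w1 \<in> hom \<C> B1 B1'. \<forall>w2 \<in> hom \<C> B2 B2'.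
           w1 \<in> W \<and> w2 \<in> W \<longrightarrow>
           (\<exists>P R1 R2 \<Omega>.
              weak_fiber_product (fractions \<C> W ch) (B1, w1, f1) (B2, w2, f2) P R1 R2 \<Omega>)))
     \<and> (closed_under_weak_fiber_products \<C>
          \<longrightarrow> closed_under_weak_fiber_products (fractions \<C> W ch))"
proof -
  have BF: "BF \<C> W" by fact
  interpret fraction_choices \<C> W ch by (intro fraction_choices.intro fraction_choices_axioms.intro BF) fact
  \<comment> \<open>Stated for arbitrary squares, since it is applied both to given fractions and,
    fraction by fraction, for closedness under weak fiber products.\<close>
  have frac: "weak_fiber_product (fractions \<C> W ch) (src \<C> w1, w1, f1) (src \<C> w2, w2, f2) C (C, \<one> C, w1 \<cdot> p1) (C, \<one> C, w2 \<cdot> p2)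
      (two_legs.Omega \<C> W f1 f2 C p1 p2 \<omega> ch w1 w2)"
    if "weak_fiber_product \<C> f1 f2 C p1 p2 \<omega>" "w1 \<in> W" "src \<C> w1 = src \<C> f1" "w2 \<in> W" "src \<C> w2 = src \<C> f2" for f1 f2 C p1 p2 \<omega> w1 w2
  proof -
    interpret two_legs \<C> W f1 f2 C p1 p2 \<omega> ch w1 w2 by unfold_locales (use that in auto)
    show ?thesis using weak_fiber_product_fractions unfolding L1.gg_def L2.gg_def L1.R_def L2.R_def .
  qed
  have closed: "closed_under_weak_fiber_products (fractions \<C> W ch)" if cl: "closed_under_weak_fiber_products \<C>"
    unfolding closed_under_weak_fiber_products_def Fr_simps
  proof (intro ballI impI)
    fix g1 g2 assume g: "g1 \<in> frac_Mor \<C> W" "g2 \<in> frac_Mor \<C> W" "frac_tgt \<C> g1 = frac_tgt \<C> g2"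
    obtain w1 f1 w2 f2 where e: "g1 = (src \<C> w1, w1, f1)" "g2 = (src \<C> w2, w2, f2)"
      and m: "w1 \<in> W" "w2 \<in> W" "f1 \<in> Mor \<C>" "f2 \<in> Mor \<C>" "src \<C> w1 = src \<C> f1" "src \<C> w2 = src \<C> f2" "tgt \<C> f1 = tgt \<C> f2"
      using g by (cases g1; cases g2) (auto simp: frac_Mor_def frac_tgt_def)
    obtain C p1 p2 \<omega> where "weak_fiber_product \<C> f1 f2 C p1 p2 \<omega>" using cl m unfolding closed_under_weak_fiber_products_def by blast
    from frac[OF this m(1,5,2,6)] show "\<exists>C r1 r2 \<Omega>. weak_fiber_product (fractions \<C> W ch) g1 g2 C r1 r2 \<Omega>" unfolding e by blast
  qed
  show ?thesis
  proof (intro conjI ballI impI, goal_cases)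
    case (1 A B1 B2 C f1 f2 p1 p2 \<omega> D q1 q2 l)
    interpret wfp \<C> W f1 f2 C p1 p2 \<omega> by (intro wfp.intro wfp_axioms.intro BF 1)
    from 1 show ?case by (intro part_a) (simp_all add: hom_def)
  next
    case (2 A B1 B2 C f1 f2 p1 p2 \<omega> D t t' \<gamma>1 \<gamma>2)
    interpret wfp \<C> W f1 f2 C p1 p2 \<omega> by (intro wfp.intro wfp_axioms.intro BF 2)
    from 2 show ?case by (intro part_b)
  next
    case (3 A B1 B2 C f1 f2 p1 p2 \<omega> D t t' \<gamma>1 \<gamma>2 F u \<gamma> F' u' \<gamma>')
    interpret wfp \<C> W f1 f2 C p1 p2 \<omega> by (intro wfp.intro wfp_axioms.intro BF 3)
    from 3 show ?case by (intro part_c[where D = D and ?\<gamma>1.0 = \<gamma>1 and ?\<gamma>2.0 = \<gamma>2]) blast+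
  next
    case (4 A B1 B2 C f1 f2 p1 p2 \<omega> B1' B2' w1 w2)
    then have "src \<C> w1 = src \<C> f1" "src \<C> w2 = src \<C> f2" "B1 = src \<C> w1" "B2 = src \<C> w2" by (simp_all add: hom_def)
    with frac[of f1 f2 C p1 p2 \<omega> w1 w2] 4 show ?case by blast
  next
    case 5
    then show ?case by (rule closed)
  qed
qed

end
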